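(* Let $\Gamma$ be a countable discrete group with left regular representation $\lambda$ on $\ell^2(\Gamma)$, and consider the compact quantum group $\mathbb{G}=(C^*_{\mathrm{red}}(\Gamma),\Delta_{\mathrm{red}})$, where $\Delta_{\mathrm{red}}$ is defined by $\Delta_{\mathrm{red}}\lambda_\gamma=\lambda_\gamma\otimes\lambda_\gamma$ for $\gamma\in\Gamma$. Then for all $n\in\mathbb{N}_0=\{0,1,2,\dots\}$ we have $H_n^{(2)}(\mathbb{G})=H_n^{(2)}(\Gamma)$, and in particular \[ \beta_n^{(2)}(\mathbb{G})=\beta_n^{(2)}(\Gamma)\quad\text{and}\quad c_n(\mathbb{G})=c_n(\Gamma). \]
   Context: Compact quantum groups. A compact quantum group (in the sense of Woronowicz) is a pair $\mathbb{G}=(A,\Delta)$ where $A$ is a unital $C^*$-algebra and $\Delta\colon A\to A\otimes A$ (minimal tensor product) is a unital $*$-homomorphism with $(\Delta\otimes\mathrm{id})\Delta=(\mathrm{id}\otimes\Delta)\Delta$ such that $\Delta(A)(1\otimes A)$ and $\Delta(A)(A\otimes 1)$ span dense subspaces of $A\otimes A$. It has a unique Haar state $h$, i.e. the state with $(h\otimes\mathrm{id})\Delta(a)=h(a)1=(\mathrm{id}\otimes h)\Delta(a)$. Let $A_0\subseteq A$ be the dense $*$-subalgebra spanned by matrix coefficients of irreducible unitary corepresentations; it is a Hopf $*$-algebra $(A_0,\Delta,S,\varepsilon)$ with antipode $S$ and counit $\varepsilon$, and $h$ is faithful on $A_0$. Let $\pi_h$ be the GNS-representation of $A$ on $L^2(A,h)$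 and $\mathscr{M}=\pi_h(A)''$. The $n$-th $L^2$-homology is $H_n^{(2)}(\mathbb{G})=\operatorname{Tor}_n^{A_0}(\mathscr{M},\mathbb{C})$, where $\mathbb{C}$ is a left $A_0$-module via $\varepsilon$ and $\mathscr{M}$ is a right $A_0$-module via $\pi_h$; it is a left $\mathscr{M}$-module. If $h$ is a trace (as it is for the $\mathbb{G}$ in the claim), then $h$ extends to a faithful normal tracial state on $\mathscr{M}$ and one sets $\beta_n^{(2)}(\mathbb{G})=\dim_{\mathscr{M}}H_n^{(2)}(\mathbb{G})$ and $c_n(\mathbb{G})=c(H_n^{(2)}(\mathbb{G}))$, with $\dim_{\mathscr{M}}$ and $c$ as below. Groups. For a countable discrete group $\Gamma$ with group von Neumann algebra $\mathscr{L}(\Gamma)=\lambda(\Gamma)''\subseteq B(\ell^2(\Gamma))$ and trace $\tau(x)=\langle x\delta_e\mid\delta_e\rangle$: $H_n^{(2)}(\Gamma)=\operatorname{Tor}_n^{\mathbb{C}\Gamma}(\mathscr{L}(\Gamma),\mathbb{C})$ ($\mathbb{C}$ the trivial module), a left $\mathscr{L}(\Gamma)$-module, $\beta_n^{(2)}(\Gamma)=\dim_{\mathscr{L}(\Gamma)}H_n^{(2)}(\Gamma)$ and $c_n(\Gamma)=c(H_n^{(2)}(\Gamma))$. For $\mathbb{G}=(C^*_{\mathrm{red}}(\Gamma),\Delta_{\mathrm{red}})$ the algebra $\mathscr{M}$ is naturally identified with $\mathscr{L}(\Gamma)$, and the equality of $L^2$-homology is understood as left $\mathscr{L}(\Gamma)$-modules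 under this identification. Dimension. For a finite von Neumann algebra $\mathscr{N}$ with faithful normal tracial state $\tau$: if $P\cong\mathscr{N}^kE$ is a finitely generated projective left module, $E\in M_k(\mathscr{N})$ a projection, then $\dim_{\mathscr{N}}P=\sum_i\tau(E_{ii})$; for an arbitrary left $\mathscr{N}$-module $Q$, $\dim_{\mathscr{N}}Q=\sup\{\dim_{\mathscr{N}}P\mid P\subseteq Q \text{ finitely generated projective submodule}\}\in[0,\infty]$ (Lück). Capacity (Lück, Reich, Schick). If $Q$ is a finitely presented zero-dimensional left $\mathscr{N}$-module, choose a presentation $\mathscr{N}^k\to\mathscr{N}^l\to Q\to 0$ given by right multiplication by a matrix $B$, and put $F(\lambda)=(\mathrm{tr}\otimes\tau)(\chi_{[0,\lambda^2]}(B^*B))$ with the unnormalized matrix trace. The Novikov–Shubin invariant is $\alpha(Q)=\liminf_{\lambda\searrow0}\frac{\log(F(\lambda)-F(0))}{\log\lambda}\in[0,\infty]$ if $F(\lambda)>F(0)$ for all $\lambda>0$, and $\alpha(Q)=\infty^+$ otherwise. The capacity is $c(Q)=1/\alpha(Q)\in\{0^-\}\cup[0,\infty]$ with $1/\infty^+=0^-$, $1/\infty=0$, $1/0=\infty$, and $0^-<0$. A module is measurable if it is a quotient of a finitely presented zero-dimensional module; for measurable $Q$, $c(Q)=\inf\{c(L)\mid L\text{ finitely presented zero-dimensional with quotient }Q\}$; for arbitrary $Q$, $c(Q)=\sup\{c(N)\mid N\subseteq Q\text{ measurable submodule}\}$. These definitions are consistent. *)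

theory Defs
  imports "HOL-Analysis.Analysis" "HOL-Algebra.Module" "HOL-Algebra.AbelCoset"
    "HOL-Algebra.Generated_Groups" "HOL-Algebra.Free_Abelian_Groups" "HOL-Library.Option_ord"
begin

section \<open>Hilbert spaces and bounded operators\<close>

text \<open>Complex Hilbert spaces are handled with explicit carriers; inner products are linear in
  the first argument.\<close>

record 'v hilbert = "'v partial_object" +
  hadd :: "'v \<Rightarrow> 'v \<Rightarrow> 'v"
  hzero :: 'v
  hscale :: "complex \<Rightarrow> 'v \<Rightarrow> 'v"
  hip :: "'v \<Rightarrow> 'v \<Rightarrow> complex"

definition hnorm :: "('v, 'z) hilbert_scheme \<Rightarrow> 'v \<Rightarrow> real" where
  "hnorm H v = sqrt (Re (hip H v v))"

definition ell2 :: "'x set \<Rightarrow> ('x \<Rightarrow> complex) hilbert" where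
  "ell2 X = \<lparr>
     carrier = {f. (\<forall>x. x \<notin> X \<longrightarrow> f x = 0) \<and> (\<lambda>x. (cmod (f x))\<^sup>2) summable_on X},
     hadd = (\<lambda>f g x. f x + g x),
     hzero = (\<lambda>x. 0),
     hscale = (\<lambda>c f x. c * f x),
     hip = (\<lambda>f g. \<Sum>\<^sub>\<infinity>x\<in>X. f x * cnj (g x))\<rparr>"

type_synonym 'v op = "'v \<Rightarrow> 'v"

text \<open>The algebra of bounded operators, as a complex algebra in the record format of
  \<open>HOL-Algebra\<close>. Operators are extensional functions on the carrier. A unital subalgebra with
  underlying set \<open>S\<close> is the record \<open>(BH H)\<lparr>carrier := S\<rparr>\<close>.\<close>

definition bounded_ops :: "'v hilbert \<Rightarrow> 'v op set" where
  "bounded_ops H = {T \<in> carrier H \<rightarrow>\<^sub>E carrier H.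
     (\<forall>v\<in>carrier H. \<forall>w\<in>carrier H. T (hadd H v w) = hadd H (T v) (T w)) \<and>
     (\<forall>c. \<forall>v\<in>carrier H. T (hscale H c v) = hscale H c (T v)) \<and>
     (\<exists>C. \<forall>v\<in>carrier H. hnorm H (T v) \<le> C * hnorm H v)}"

definition BH :: "'v hilbert \<Rightarrow> (complex, 'v op) module" where
  "BH H = \<lparr>
     carrier = bounded_ops H,
     monoid.mult = compose (carrier H),
     monoid.one = (\<lambda>v\<in>carrier H. v),
     ring.zero = (\<lambda>v\<in>carrier H. hzero H),
     ring.add = (\<lambda>S T. \<lambda>v\<in>carrier H. hadd H (S v) (T v)),
     smult = (\<lambda>c T. \<lambda>v\<in>carrier H. hscale H c (T v))\<rparr>"

definition op_norm :: "'v hilbert \<Rightarrow> 'v op \<Rightarrow> real" where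
  "op_norm H T = (SUP v\<in>{v \<in> carrier H. hnorm H v \<le> 1}. hnorm H (T v))"

definition adjoint_op :: "'v hilbert \<Rightarrow> 'v op \<Rightarrow> 'v op" where
  "adjoint_op H T = (THE S. S \<in> bounded_ops H \<and>
     (\<forall>v\<in>carrier H. \<forall>w\<in>carrier H. hip H (T v) w = hip H v (S w)))"

definition op_closure :: "'v hilbert \<Rightarrow> 'v op set \<Rightarrow> 'v op set" where
  "op_closure H S = {T \<in> bounded_ops H.
     \<forall>e>0. \<exists>R\<in>S. op_norm H (T \<oplus>\<^bsub>BH H\<^esub> (-1) \<odot>\<^bsub>BH H\<^esub> R) < e}"

definition commutant :: "'v hilbert \<Rightarrow> 'v op set \<Rightarrow> 'v op set" where
  "commutant H S = {T \<in> bounded_ops H. \<forall>R\<in>S. T \<otimes>\<^bsub>BH H\<^esub> R = R \<otimes>\<^bsub>BH H\<^esub> T}"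

inductive_set lin_span :: "(complex, 'a) module \<Rightarrow> 'a set \<Rightarrow> 'a set"
  for V :: "(complex, 'a) module" and S :: "'a set" where
  lin_span_zero: "\<zero>\<^bsub>V\<^esub> \<in> lin_span V S"
| lin_span_incl: "a \<in> S \<Longrightarrow> a \<in> lin_span V S"
| lin_span_add: "a \<in> lin_span V S \<Longrightarrow> b \<in> lin_span V S \<Longrightarrow> a \<oplus>\<^bsub>V\<^esub> b \<in> lin_span V S"
| lin_span_smult: "a \<in> lin_span V S \<Longrightarrow> c \<odot>\<^bsub>V\<^esub> a \<in> lin_span V S"

definition linear_on :: "(complex, 'a) module \<Rightarrow> (complex, 'b) module \<Rightarrow> 'a set \<Rightarrow> ('a \<Rightarrow> 'b) \<Rightarrow> bool"
  where "linear_on V W S L \<longleftrightarrow>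
     (\<forall>a\<in>S. L a \<in> carrier W) \<and>
     (\<forall>a\<in>S. \<forall>b\<in>S. L (a \<oplus>\<^bsub>V\<^esub> b) = L a \<oplus>\<^bsub>W\<^esub> L b) \<and>
     (\<forall>c. \<forall>a\<in>S. L (c \<odot>\<^bsub>V\<^esub> a) = c \<odot>\<^bsub>W\<^esub> L a)"

definition hilbert_iso :: "'v hilbert \<Rightarrow> 'w hilbert \<Rightarrow> ('v \<Rightarrow> 'w) \<Rightarrow> bool" where
  "hilbert_iso H K U \<longleftrightarrow> bij_betw U (carrier H) (carrier K) \<and>
     (\<forall>v\<in>carrier H. \<forall>w\<in>carrier H. U (hadd H v w) = hadd K (U v) (U w)) \<and>
     (\<forall>c. \<forall>v\<in>carrier H. U (hscale H c v) = hscale K c (U v)) \<and>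
     (\<forall>v\<in>carrier H. \<forall>w\<in>carrier H. hip K (U v) (U w) = hip H v w)"

definition conj_op :: "'v hilbert \<Rightarrow> 'w hilbert \<Rightarrow> ('v \<Rightarrow> 'w) \<Rightarrow> 'v op \<Rightarrow> 'w op" where
  "conj_op H K U T = (\<lambda>w\<in>carrier K. U (T (inv_into (carrier H) U w)))"

section \<open>C*-algebras and minimal tensor products\<close>

text \<open>C*-algebras are represented concretely, as norm-closed unital *-subalgebras of the bounded
  operators on some \<open>\<ell>\<^sup>2(X)\<close>; every Hilbert space is of this form. The minimal (spatial)
  tensor product is then the norm closure of the algebraic one inside the bounded operators on
  \<open>\<ell>\<^sup>2(X \<times> Y)\<close>, which is the Hilbert space tensor product of \<open>\<ell>\<^sup>2(X)\<close> and
  \<open>\<ell>\<^sup>2(Y)\<close>.\<close>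

definition cstar_algebra :: "'v hilbert \<Rightarrow> 'v op set \<Rightarrow> bool" where
  "cstar_algebra H A \<longleftrightarrow> A \<subseteq> bounded_ops H \<and> \<one>\<^bsub>BH H\<^esub> \<in> A \<and>
     (\<forall>S\<in>A. \<forall>T\<in>A. S \<oplus>\<^bsub>BH H\<^esub> T \<in> A \<and> S \<otimes>\<^bsub>BH H\<^esub> T \<in> A) \<and>
     (\<forall>c. \<forall>T\<in>A. c \<odot>\<^bsub>BH H\<^esub> T \<in> A) \<and>
     (\<forall>T\<in>A. adjoint_op H T \<in> A) \<and>
     op_closure H A \<subseteq> A"

definition star_hom :: "'v hilbert \<Rightarrow> 'v op set \<Rightarrow> 'w hilbert \<Rightarrow> 'w op set \<Rightarrow> ('v op \<Rightarrow> 'w op) \<Rightarrow> bool"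
  where "star_hom H A K B \<phi> \<longleftrightarrow> \<phi> \<in> A \<rightarrow>\<^sub>E B \<and> linear_on (BH H) (BH K) A \<phi> \<and>
     (\<forall>S\<in>A. \<forall>T\<in>A. \<phi> (S \<otimes>\<^bsub>BH H\<^esub> T) = \<phi> S \<otimes>\<^bsub>BH K\<^esub> \<phi> T) \<and>
     (\<forall>T\<in>A. \<phi> (adjoint_op H T) = adjoint_op K (\<phi> T)) \<and>
     \<phi> \<one>\<^bsub>BH H\<^esub> = \<one>\<^bsub>BH K\<^esub>"

definition op_tensor :: "'x set \<Rightarrow> 'y set \<Rightarrow> ('x \<Rightarrow> complex) op \<Rightarrow> ('y \<Rightarrow> complex) op
    \<Rightarrow> ('x \<times> 'y \<Rightarrow> complex) op" where
  "op_tensor X Y S T = (THE R. R \<in> bounded_ops (ell2 (X \<times> Y)) \<and>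
     (\<forall>f\<in>carrier (ell2 X). \<forall>g\<in>carrier (ell2 Y).
        R (\<lambda>(x, y). f x * g y) = (\<lambda>(x, y). S f x * T g y)))"

definition alg_tensor :: "'x set \<Rightarrow> ('x \<Rightarrow> complex) op set \<Rightarrow> 'y set \<Rightarrow> ('y \<Rightarrow> complex) op set
    \<Rightarrow> ('x \<times> 'y \<Rightarrow> complex) op set" where
  "alg_tensor X A Y B = lin_span (BH (ell2 (X \<times> Y))) {op_tensor X Y S T | S T. S \<in> A \<and> T \<in> B}"

definition min_tensor :: "'x set \<Rightarrow> ('x \<Rightarrow> complex) op set \<Rightarrow> 'y set \<Rightarrow> ('y \<Rightarrow> complex) op set
    \<Rightarrow> ('x \<times> 'y \<Rightarrow> complex) op set" where
  "min_tensor X A Y B = op_closure (ell2 (X \<times> Y)) (alg_tensor X A Y B)"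

text \<open>The identification of operators on \<open>(\<ell>\<^sup>2(X) \<otimes> \<ell>\<^sup>2(Y)) \<otimes> \<ell>\<^sup>2(Z)\<close> with operators
  on \<open>\<ell>\<^sup>2(X) \<otimes> (\<ell>\<^sup>2(Y) \<otimes> \<ell>\<^sup>2(Z))\<close>.\<close>

definition assoc_op :: "'x set \<Rightarrow> 'y set \<Rightarrow> 'z set \<Rightarrow> (('x \<times> 'y) \<times> 'z \<Rightarrow> complex) op
    \<Rightarrow> ('x \<times> ('y \<times> 'z) \<Rightarrow> complex) op" where
  "assoc_op X Y Z = conj_op (ell2 ((X \<times> Y) \<times> Z)) (ell2 (X \<times> (Y \<times> Z)))
     (\<lambda>F (x, (y, z)). F ((x, y), z))"

section \<open>Compact quantum groups\<close>

record 'x cqg =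
  qindex :: "'x set"
  qalg :: "('x \<Rightarrow> complex) op set"
  qcomult :: "('x \<Rightarrow> complex) op \<Rightarrow> ('x \<times> 'x \<Rightarrow> complex) op"

abbreviation qspace :: "'x cqg \<Rightarrow> ('x \<Rightarrow> complex) hilbert" where
  "qspace G \<equiv> ell2 (qindex G)"

abbreviation qtensor :: "'x cqg \<Rightarrow> ('x \<Rightarrow> complex) op \<Rightarrow> ('x \<Rightarrow> complex) op
    \<Rightarrow> ('x \<times> 'x \<Rightarrow> complex) op" where
  "qtensor G \<equiv> op_tensor (qindex G) (qindex G)"

abbreviation qspace2 :: "'x cqg \<Rightarrow> ('x \<times> 'x \<Rightarrow> complex) hilbert" where
  "qspace2 G \<equiv> ell2 (qindex G \<times> qindex G)"

abbreviation qalg2 :: "'x cqg \<Rightarrow> ('x \<times> 'x \<Rightarrow> complex) op set" where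
  "qalg2 G \<equiv> min_tensor (qindex G) (qalg G) (qindex G) (qalg G)"

text \<open>In the coassociativity condition, \<open>L\<close> and \<open>R\<close> are the (unique) *-homomorphisms
  \<open>\<Delta> \<otimes> id\<close> and \<open>id \<otimes> \<Delta>\<close> on the minimal tensor product.\<close>

definition coassociative :: "'x cqg \<Rightarrow> bool" where
  "coassociative G \<longleftrightarrow> (\<exists>L R.
     star_hom (qspace2 G) (qalg2 G) (ell2 ((qindex G \<times> qindex G) \<times> qindex G))
       (min_tensor (qindex G \<times> qindex G) (qalg2 G) (qindex G) (qalg G)) L \<and>
     star_hom (qspace2 G) (qalg2 G) (ell2 (qindex G \<times> (qindex G \<times> qindex G)))
       (min_tensor (qindex G) (qalg G) (qindex G \<times> qindex G) (qalg2 G)) R \<and>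
     (\<forall>a\<in>qalg G. \<forall>b\<in>qalg G.
        L (qtensor G a b) = op_tensor (qindex G \<times> qindex G) (qindex G) (qcomult G a) b \<and>
        R (qtensor G a b) = op_tensor (qindex G) (qindex G \<times> qindex G) a (qcomult G b)) \<and>
     (\<forall>a\<in>qalg G. assoc_op (qindex G) (qindex G) (qindex G) (L (qcomult G a)) = R (qcomult G a)))"

definition compact_quantum_group :: "'x cqg \<Rightarrow> bool" where
  "compact_quantum_group G \<longleftrightarrow>
     cstar_algebra (qspace G) (qalg G) \<and>
     star_hom (qspace G) (qalg G) (qspace2 G) (qalg2 G) (qcomult G) \<and>
     coassociative G \<and>
     op_closure (qspace2 G) (lin_span (BH (qspace2 G))
       {qcomult G a \<otimes>\<^bsub>BH (qspace2 G)\<^esub> qtensor G \<one>\<^bsub>BH (qspace G)\<^esub> b | a b. a \<in> qalg G \<and> b \<in> qalg G})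
       = qalg2 G \<and>
     op_closure (qspace2 G) (lin_span (BH (qspace2 G))
       {qcomult G a \<otimes>\<^bsub>BH (qspace2 G)\<^esub> qtensor G b \<one>\<^bsub>BH (qspace G)\<^esub> | a b. a \<in> qalg G \<and> b \<in> qalg G})
       = qalg2 G"

definition cstar_state :: "'v hilbert \<Rightarrow> 'v op set \<Rightarrow> ('v op \<Rightarrow> complex) \<Rightarrow> bool" where
  "cstar_state H A h \<longleftrightarrow> h \<in> extensional A \<and>
     (\<forall>a\<in>A. \<forall>b\<in>A. h (a \<oplus>\<^bsub>BH H\<^esub> b) = h a + h b) \<and>
     (\<forall>c. \<forall>a\<in>A. h (c \<odot>\<^bsub>BH H\<^esub> a) = c * h a) \<and>
     (\<forall>a\<in>A. h (adjoint_op H a \<otimes>\<^bsub>BH H\<^esub> a) \<in> \<real> \<and> 0 \<le> Re (h (adjoint_op H a \<otimes>\<^bsub>BH H\<^esub> a))) \<and>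
     (\<forall>a\<in>A. cmod (h a) \<le> op_norm H a) \<and>
     h \<one>\<^bsub>BH H\<^esub> = 1"

text \<open>\<open>L\<close> and \<open>R\<close> are the slice maps \<open>h \<otimes> id\<close> and \<open>id \<otimes> h\<close>, i.e. the (unique) bounded
  linear extensions from the algebraic tensor product.\<close>

definition haar_state_on :: "'x cqg \<Rightarrow> (('x \<Rightarrow> complex) op \<Rightarrow> complex) \<Rightarrow> bool" where
  "haar_state_on G h \<longleftrightarrow> cstar_state (qspace G) (qalg G) h \<and>
     (\<exists>L R C.
        linear_on (BH (qspace2 G)) (BH (qspace G)) (qalg2 G) L \<and>
        linear_on (BH (qspace2 G)) (BH (qspace G)) (qalg2 G) R \<and>
        (\<forall>x\<in>qalg2 G. op_norm (qspace G) (L x) \<le> C * op_norm (qspace2 G) x \<and>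
           op_norm (qspace G) (R x) \<le> C * op_norm (qspace2 G) x) \<and>
        (\<forall>a\<in>qalg G. \<forall>b\<in>qalg G.
           L (qtensor G a b) = h a \<odot>\<^bsub>BH (qspace G)\<^esub> b \<and>
           R (qtensor G a b) = h b \<odot>\<^bsub>BH (qspace G)\<^esub> a) \<and>
        (\<forall>a\<in>qalg G.
           L (qcomult G a) = h a \<odot>\<^bsub>BH (qspace G)\<^esub> \<one>\<^bsub>BH (qspace G)\<^esub> \<and>
           R (qcomult G a) = h a \<odot>\<^bsub>BH (qspace G)\<^esub> \<one>\<^bsub>BH (qspace G)\<^esub>))"

definition haar_state :: "'x cqg \<Rightarrow> ('x \<Rightarrow> complex) op \<Rightarrow> complex" where
  "haar_state G = (THE h. haar_state_on G h)"

definition unitary_corep :: "'x cqg \<Rightarrow> nat \<Rightarrow> (nat \<Rightarrow> nat \<Rightarrow> ('x \<Rightarrow> complex) op) \<Rightarrow> bool" where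
  "unitary_corep G n u \<longleftrightarrow> 0 < n \<and> (\<forall>i<n. \<forall>j<n. u i j \<in> qalg G \<and>
     qcomult G (u i j) = (\<Oplus>\<^bsub>BH (qspace2 G)\<^esub>k\<in>{..<n}. qtensor G (u i k) (u k j)) \<and>
     (\<Oplus>\<^bsub>BH (qspace G)\<^esub>k\<in>{..<n}. adjoint_op (qspace G) (u k i) \<otimes>\<^bsub>BH (qspace G)\<^esub> u k j)
       = (if i = j then \<one>\<^bsub>BH (qspace G)\<^esub> else \<zero>\<^bsub>BH (qspace G)\<^esub>) \<and>
     (\<Oplus>\<^bsub>BH (qspace G)\<^esub>k\<in>{..<n}. u i k \<otimes>\<^bsub>BH (qspace G)\<^esub> adjoint_op (qspace G) (u j k))
       = (if i = j then \<one>\<^bsub>BH (qspace G)\<^esub> else \<zero>\<^bsub>BH (qspace G)\<^esub>))"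

text \<open>Irreducible: every self-intertwiner \<open>T \<in> M\<^sub>n(\<complex>)\<close> is scalar.\<close>

definition irreducible_corep :: "'x cqg \<Rightarrow> nat \<Rightarrow> (nat \<Rightarrow> nat \<Rightarrow> ('x \<Rightarrow> complex) op) \<Rightarrow> bool" where
  "irreducible_corep G n u \<longleftrightarrow> (\<forall>T :: nat \<Rightarrow> nat \<Rightarrow> complex.
     (\<forall>i<n. \<forall>j<n. (\<Oplus>\<^bsub>BH (qspace G)\<^esub>k\<in>{..<n}. T i k \<odot>\<^bsub>BH (qspace G)\<^esub> u k j)
        = (\<Oplus>\<^bsub>BH (qspace G)\<^esub>k\<in>{..<n}. T k j \<odot>\<^bsub>BH (qspace G)\<^esub> u i k)) \<longrightarrow>
     (\<exists>c. \<forall>i<n. \<forall>j<n. T i j = (if i = j then c else 0)))"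

definition hopf_alg :: "'x cqg \<Rightarrow> ('x \<Rightarrow> complex) op set" where
  "hopf_alg G = lin_span (BH (qspace G))
     {u i j | n u i j. unitary_corep G n u \<and> irreducible_corep G n u \<and> i < n \<and> j < n}"

definition hopf_ring :: "'x cqg \<Rightarrow> (complex, ('x \<Rightarrow> complex) op) module" where
  "hopf_ring G = (BH (qspace G))\<lparr>carrier := hopf_alg G\<rparr>"

definition counit_on :: "'x cqg \<Rightarrow> (('x \<Rightarrow> complex) op \<Rightarrow> complex) \<Rightarrow> bool" where
  "counit_on G e \<longleftrightarrow> e \<in> extensional (hopf_alg G) \<and>
     (\<forall>a\<in>hopf_alg G. \<forall>b\<in>hopf_alg G. e (a \<oplus>\<^bsub>BH (qspace G)\<^esub> b) = e a + e b \<and>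
        e (a \<otimes>\<^bsub>BH (qspace G)\<^esub> b) = e a * e b) \<and>
     (\<forall>c. \<forall>a\<in>hopf_alg G. e (c \<odot>\<^bsub>BH (qspace G)\<^esub> a) = c * e a) \<and>
     e \<one>\<^bsub>BH (qspace G)\<^esub> = 1 \<and>
     (\<exists>L R. let T = alg_tensor (qindex G) (hopf_alg G) (qindex G) (hopf_alg G) in
        linear_on (BH (qspace2 G)) (BH (qspace G)) T L \<and>
        linear_on (BH (qspace2 G)) (BH (qspace G)) T R \<and>
        (\<forall>a\<in>hopf_alg G. \<forall>b\<in>hopf_alg G.
           L (qtensor G a b) = e a \<odot>\<^bsub>BH (qspace G)\<^esub> b \<and>
           R (qtensor G a b) = e b \<odot>\<^bsub>BH (qspace G)\<^esub> a) \<and>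
        (\<forall>a\<in>hopf_alg G. L (qcomult G a) = a \<and> R (qcomult G a) = a))"

definition counit :: "'x cqg \<Rightarrow> ('x \<Rightarrow> complex) op \<Rightarrow> complex" where
  "counit G = (THE e. counit_on G e)"

section \<open>The GNS construction\<close>

text \<open>The GNS space is the completion of \<open>A\<close> with respect to \<open>\<langle>a, b\<rangle> = h(b\<^sup>* a)\<close>: its
  elements are the classes of Cauchy sequences in \<open>A\<close> modulo null sequences.\<close>

definition gns_dist :: "'v hilbert \<Rightarrow> ('v op \<Rightarrow> complex) \<Rightarrow> 'v op \<Rightarrow> 'v op \<Rightarrow> real" where
  "gns_dist H h a b = (let d = a \<oplus>\<^bsub>BH H\<^esub> (-1) \<odot>\<^bsub>BH H\<^esub> b in
     sqrt (Re (h (adjoint_op H d \<otimes>\<^bsub>BH H\<^esub> d))))"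

definition gns_cauchy :: "'v hilbert \<Rightarrow> 'v op set \<Rightarrow> ('v op \<Rightarrow> complex) \<Rightarrow> (nat \<Rightarrow> 'v op) set" where
  "gns_cauchy H A h = {s. (\<forall>n. s n \<in> A) \<and>
     (\<forall>e>0. \<exists>N. \<forall>m\<ge>N. \<forall>n\<ge>N. gns_dist H h (s m) (s n) < e)}"

definition gns_class :: "'v hilbert \<Rightarrow> 'v op set \<Rightarrow> ('v op \<Rightarrow> complex) \<Rightarrow> (nat \<Rightarrow> 'v op)
    \<Rightarrow> (nat \<Rightarrow> 'v op) set" where
  "gns_class H A h s = {t \<in> gns_cauchy H A h. (\<lambda>n. gns_dist H h (s n) (t n)) \<longlonglongrightarrow> 0}"

definition gns_space :: "'v hilbert \<Rightarrow> 'v op set \<Rightarrow> ('v op \<Rightarrow> complex)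
    \<Rightarrow> (nat \<Rightarrow> 'v op) set hilbert" where
  "gns_space H A h = \<lparr>
     carrier = gns_class H A h ` gns_cauchy H A h,
     hadd = (\<lambda>X Y. \<Union>s\<in>X. \<Union>t\<in>Y. gns_class H A h (\<lambda>n. s n \<oplus>\<^bsub>BH H\<^esub> t n)),
     hzero = gns_class H A h (\<lambda>n. \<zero>\<^bsub>BH H\<^esub>),
     hscale = (\<lambda>c X. \<Union>s\<in>X. gns_class H A h (\<lambda>n. c \<odot>\<^bsub>BH H\<^esub> s n)),
     hip = (\<lambda>X Y. THE z. \<forall>s\<in>X. \<forall>t\<in>Y.
        (\<lambda>n. h (adjoint_op H (t n) \<otimes>\<^bsub>BH H\<^esub> s n)) \<longlonglongrightarrow> z)\<rparr>"

definition gns_vec :: "'v hilbert \<Rightarrow> 'v op set \<Rightarrow> ('v op \<Rightarrow> complex) \<Rightarrow> 'v op \<Rightarrow> (nat \<Rightarrow> 'v op) set"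
  where "gns_vec H A h a = gns_class H A h (\<lambda>n. a)"

definition gns_rep :: "'v hilbert \<Rightarrow> 'v op set \<Rightarrow> ('v op \<Rightarrow> complex) \<Rightarrow> 'v op
    \<Rightarrow> (nat \<Rightarrow> 'v op) set op" where
  "gns_rep H A h a = (\<lambda>X\<in>carrier (gns_space H A h).
     \<Union>s\<in>X. gns_class H A h (\<lambda>n. a \<otimes>\<^bsub>BH H\<^esub> s n))"

section \<open>Von Neumann algebras with trace\<close>

record 'v traced_vna =
  vspace :: "'v hilbert"
  velems :: "'v op set"
  vtrace :: "'v op \<Rightarrow> complex"

definition vring :: "'v traced_vna \<Rightarrow> (complex, 'v op) module" where
  "vring N = (BH (vspace N))\<lparr>carrier := velems N\<rparr>"

text \<open>The normal extension of the Haar state to \<open>\<pi>\<^sub>h(A)''\<close> is the vector state of the cyclic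
  vector.\<close>

definition cqg_vna :: "'x cqg \<Rightarrow> (nat \<Rightarrow> ('x \<Rightarrow> complex) op) set traced_vna" where
  "cqg_vna G = (let h = haar_state G; K = gns_space (qspace G) (qalg G) h;
       \<xi> = gns_vec (qspace G) (qalg G) h \<one>\<^bsub>BH (qspace G)\<^esub> in
     \<lparr>vspace = K,
      velems = commutant K (commutant K (gns_rep (qspace G) (qalg G) h ` qalg G)),
      vtrace = (\<lambda>x. hip K (x \<xi>) \<xi>)\<rparr>)"

definition left_regular :: "('g, 'b) monoid_scheme \<Rightarrow> 'g \<Rightarrow> ('g \<Rightarrow> complex) op" where
  "left_regular \<Gamma> \<gamma> = (\<lambda>f\<in>carrier (ell2 (carrier \<Gamma>)).
     \<lambda>x. if x \<in> carrier \<Gamma> then f (inv\<^bsub>\<Gamma>\<^esub> \<gamma> \<otimes>\<^bsub>\<Gamma>\<^esub> x) else 0)"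

definition delta_one :: "('g, 'b) monoid_scheme \<Rightarrow> 'g \<Rightarrow> complex" where
  "delta_one \<Gamma> = (\<lambda>x. if x = \<one>\<^bsub>\<Gamma>\<^esub> then 1 else 0)"

definition group_vna :: "('g, 'b) monoid_scheme \<Rightarrow> ('g \<Rightarrow> complex) traced_vna" where
  "group_vna \<Gamma> = (let H = ell2 (carrier \<Gamma>) in
     \<lparr>vspace = H,
      velems = commutant H (commutant H (left_regular \<Gamma> ` carrier \<Gamma>)),
      vtrace = (\<lambda>x. hip H (x (delta_one \<Gamma>)) (delta_one \<Gamma>))\<rparr>)"

section \<open>Modules over noncommutative rings, tensor products and Tor\<close>

text \<open>The locale \<open>module\<close> of \<open>HOL-Algebra\<close> is restricted to commutative scalars; only its record
  type is used here, for left modules. The fields \<open>mult\<close> and \<open>one\<close> play no role.\<close>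

definition left_module_hom :: "('r, 'z) ring_scheme \<Rightarrow> ('r, 'm) module \<Rightarrow> ('r, 'n) module
    \<Rightarrow> ('m \<Rightarrow> 'n) \<Rightarrow> bool" where
  "left_module_hom R M N f \<longleftrightarrow> f \<in> carrier M \<rightarrow> carrier N \<and>
     (\<forall>x\<in>carrier M. \<forall>y\<in>carrier M. f (x \<oplus>\<^bsub>M\<^esub> y) = f x \<oplus>\<^bsub>N\<^esub> f y) \<and>
     (\<forall>r\<in>carrier R. \<forall>x\<in>carrier M. f (r \<odot>\<^bsub>M\<^esub> x) = r \<odot>\<^bsub>N\<^esub> f x)"

text \<open>Isomorphism of an \<open>R\<close>-module with an \<open>S\<close>-module along an identification \<open>\<Phi> : R \<rightarrow> S\<close> of the
  scalars.\<close>

definition left_module_iso_along :: "('r, 'z) ring_scheme \<Rightarrow> ('r \<Rightarrow> 's) \<Rightarrow> ('r, 'm) module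
    \<Rightarrow> ('s, 'n) module \<Rightarrow> ('m \<Rightarrow> 'n) \<Rightarrow> bool" where
  "left_module_iso_along R \<Phi> M N f \<longleftrightarrow> bij_betw f (carrier M) (carrier N) \<and>
     (\<forall>x\<in>carrier M. \<forall>y\<in>carrier M. f (x \<oplus>\<^bsub>M\<^esub> y) = f x \<oplus>\<^bsub>N\<^esub> f y) \<and>
     (\<forall>r\<in>carrier R. \<forall>x\<in>carrier M. f (r \<odot>\<^bsub>M\<^esub> x) = \<Phi> r \<odot>\<^bsub>N\<^esub> f x)"

definition quotient_module :: "('r, 'm) module \<Rightarrow> 'm set \<Rightarrow> ('r, 'm set) module" where
  "quotient_module M K = \<lparr>
     carrier = a_rcosets\<^bsub>M\<^esub> K,
     monoid.mult = undefined, monoid.one = undefined,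
     ring.zero = K,
     ring.add = set_add M,
     smult = (\<lambda>r X. \<Union>x\<in>X. K +>\<^bsub>M\<^esub> (r \<odot>\<^bsub>M\<^esub> x))\<rparr>"

definition free_module :: "('r, 'z) ring_scheme \<Rightarrow> 'i set \<Rightarrow> ('r, 'i \<Rightarrow> 'r) module" where
  "free_module R I = \<lparr>
     carrier = {f. (\<forall>i\<in>I. f i \<in> carrier R) \<and> (\<forall>i. i \<notin> I \<longrightarrow> f i = \<zero>\<^bsub>R\<^esub>) \<and> finite {i. f i \<noteq> \<zero>\<^bsub>R\<^esub>}},
     monoid.mult = undefined, monoid.one = undefined,
     ring.zero = (\<lambda>i. \<zero>\<^bsub>R\<^esub>),
     ring.add = (\<lambda>f g i. f i \<oplus>\<^bsub>R\<^esub> g i),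
     smult = (\<lambda>r f i. r \<otimes>\<^bsub>R\<^esub> f i)\<rparr>"

definition regular_module :: "('r, 'z) ring_scheme \<Rightarrow> ('r, 'r) module" where
  "regular_module R = \<lparr>carrier = carrier R, monoid.mult = undefined, monoid.one = undefined,
     ring.zero = \<zero>\<^bsub>R\<^esub>, ring.add = ring.add R, smult = monoid.mult R\<rparr>"

text \<open>\<open>\<complex>\<close> as a left module via a character \<open>e\<close> of the ring.\<close>

definition character_module :: "('r \<Rightarrow> complex) \<Rightarrow> ('r, complex) module" where
  "character_module e = \<lparr>carrier = UNIV, monoid.mult = undefined, monoid.one = undefined,
     ring.zero = 0, ring.add = (+), smult = (\<lambda>r z. e r * z)\<rparr>"

text \<open>Balanced tensor product \<open>M \<otimes>\<^sub>R P\<close> of an \<open>S\<close>-\<open>R\<close>-bimodule \<open>M\<close> (right action \<open>act\<close>) with a left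
  \<open>R\<close>-module \<open>P\<close>: the free abelian group on \<open>M \<times> P\<close> modulo the usual relations, as a left
  \<open>S\<close>-module.\<close>

definition tensor_relations :: "('r, 'z) ring_scheme \<Rightarrow> ('s, 'm) module \<Rightarrow> ('m \<Rightarrow> 'r \<Rightarrow> 'm)
    \<Rightarrow> ('r, 'p) module \<Rightarrow> ('m \<times> 'p \<Rightarrow>\<^sub>0 int) set" where
  "tensor_relations R M act P = generate (free_Abelian_group (carrier M \<times> carrier P))
     ({frag_of (m \<oplus>\<^bsub>M\<^esub> m', p) - frag_of (m, p) - frag_of (m', p) | m m' p.
         m \<in> carrier M \<and> m' \<in> carrier M \<and> p \<in> carrier P} \<union>
      {frag_of (m, p \<oplus>\<^bsub>P\<^esub> p') - frag_of (m, p) - frag_of (m, p') | m p p'.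
         m \<in> carrier M \<and> p \<in> carrier P \<and> p' \<in> carrier P} \<union>
      {frag_of (act m r, p) - frag_of (m, r \<odot>\<^bsub>P\<^esub> p) | m r p.
         m \<in> carrier M \<and> r \<in> carrier R \<and> p \<in> carrier P})"

definition tensor_module :: "('r, 'z) ring_scheme \<Rightarrow> ('s, 'm) module \<Rightarrow> ('m \<Rightarrow> 'r \<Rightarrow> 'm)
    \<Rightarrow> ('r, 'p) module \<Rightarrow> ('s, ('m \<times> 'p \<Rightarrow>\<^sub>0 int) set) module" where
  "tensor_module R M act P = (let F = free_Abelian_group (carrier M \<times> carrier P);
       K = tensor_relations R M act P in
     \<lparr>carrier = rcosets\<^bsub>F\<^esub> K,
      monoid.mult = undefined, monoid.one = undefined,
      ring.zero = K,
      ring.add = set_mult F,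
      smult = (\<lambda>s X. \<Union>c\<in>X. r_coset F K (frag_extend (\<lambda>(m, p). frag_of (s \<odot>\<^bsub>M\<^esub> m, p)) c))\<rparr>)"

definition tensor_map :: "('r, 'z) ring_scheme \<Rightarrow> ('s, 'm) module \<Rightarrow> ('m \<Rightarrow> 'r \<Rightarrow> 'm)
    \<Rightarrow> ('r, 'q) module \<Rightarrow> ('p \<Rightarrow> 'q) \<Rightarrow> ('m \<times> 'p \<Rightarrow>\<^sub>0 int) set \<Rightarrow> ('m \<times> 'q \<Rightarrow>\<^sub>0 int) set" where
  "tensor_map R M act Q f X = (\<Union>c\<in>X.
     r_coset (free_Abelian_group (carrier M \<times> carrier Q)) (tensor_relations R M act Q)
       (frag_extend (\<lambda>(m, p). frag_of (m, f p)) c))"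

text \<open>A free resolution \<open>\<dots> \<rightarrow> F\<^sub>1 \<rightarrow> F\<^sub>0 \<rightarrow> N \<rightarrow> 0\<close>, where \<open>F\<^sub>n\<close> is free on \<open>I n\<close> and
  \<open>d n : F\<^sub>n\<^sub>+\<^sub>1 \<rightarrow> F\<^sub>n\<close>.\<close>

definition free_resolution :: "('r, 'z) ring_scheme \<Rightarrow> ('r, 'n) module \<Rightarrow> (nat \<Rightarrow> 'i set)
    \<Rightarrow> (nat \<Rightarrow> ('i \<Rightarrow> 'r) \<Rightarrow> ('i \<Rightarrow> 'r)) \<Rightarrow> (('i \<Rightarrow> 'r) \<Rightarrow> 'n) \<Rightarrow> bool" where
  "free_resolution R N I d e \<longleftrightarrow>
     left_module_hom R (free_module R (I 0)) N e \<and>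
     (\<forall>n. left_module_hom R (free_module R (I (Suc n))) (free_module R (I n)) (d n)) \<and>
     e ` carrier (free_module R (I 0)) = carrier N \<and>
     d 0 ` carrier (free_module R (I 1)) = a_kernel (free_module R (I 0)) N e \<and>
     (\<forall>n. d (Suc n) ` carrier (free_module R (I (Suc (Suc n))))
        = a_kernel (free_module R (I (Suc n))) (free_module R (I n)) (d n))"

text \<open>Tor is computed from a chosen free resolution; the index type \<open>('r + 'n) list\<close> is infinite and
  at least as large as both \<open>R\<close> and \<open>N\<close>, hence large enough to index a free resolution of \<open>N\<close>.\<close>

definition chosen_resolution :: "('r, 'z) ring_scheme \<Rightarrow> ('r, 'n) module
    \<Rightarrow> (nat \<Rightarrow> ('r + 'n) list set) \<times>
       (nat \<Rightarrow> (('r + 'n) list \<Rightarrow> 'r) \<Rightarrow> (('r + 'n) list \<Rightarrow> 'r))" where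
  "chosen_resolution R N = (SOME (I, d). \<exists>e. free_resolution R N I d e)"

definition Tor :: "('r, 'z) ring_scheme \<Rightarrow> ('s, 'm) module \<Rightarrow> ('m \<Rightarrow> 'r \<Rightarrow> 'm) \<Rightarrow> ('r, 'n) module
    \<Rightarrow> nat \<Rightarrow> ('s, ('m \<times> (('r + 'n) list \<Rightarrow> 'r) \<Rightarrow>\<^sub>0 int) set set) module" where
  "Tor R M act N n = (case chosen_resolution R N of (I, d) \<Rightarrow>
     let C = (\<lambda>k. tensor_module R M act (free_module R (I k)));
         D = (\<lambda>k. tensor_map R M act (free_module R (I k)) (d k));
         Z = (case n of 0 \<Rightarrow> carrier (C 0) | Suc m \<Rightarrow> a_kernel (C (Suc m)) (C m) (D m))
     in quotient_module ((C n)\<lparr>carrier := Z\<rparr>) (D n ` carrier (C (Suc n))))"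

section \<open>Dimension and capacity\<close>

definition row_mult :: "('r, 'z) ring_scheme \<Rightarrow> nat \<Rightarrow> nat \<Rightarrow> (nat \<Rightarrow> nat \<Rightarrow> 'r) \<Rightarrow> (nat \<Rightarrow> 'r)
    \<Rightarrow> nat \<Rightarrow> 'r" where
  "row_mult R k l B x = (\<lambda>j. if j < l then (\<Oplus>\<^bsub>R\<^esub>i\<in>{..<k}. x i \<otimes>\<^bsub>R\<^esub> B i j) else \<zero>\<^bsub>R\<^esub>)"

definition matrix_over :: "('r, 'z) ring_scheme \<Rightarrow> nat \<Rightarrow> nat \<Rightarrow> (nat \<Rightarrow> nat \<Rightarrow> 'r) \<Rightarrow> bool" where
  "matrix_over R k l B \<longleftrightarrow> (\<forall>i<k. \<forall>j<l. B i j \<in> carrier R)"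

definition projection_matrix :: "'v hilbert \<Rightarrow> nat \<Rightarrow> (nat \<Rightarrow> nat \<Rightarrow> 'v op) \<Rightarrow> bool" where
  "projection_matrix H k E \<longleftrightarrow> matrix_over (BH H) k k E \<and>
     (\<forall>i<k. \<forall>j<k. (\<Oplus>\<^bsub>BH H\<^esub>m\<in>{..<k}. E i m \<otimes>\<^bsub>BH H\<^esub> E m j) = E i j \<and>
        adjoint_op H (E i j) = E j i)"

definition dim_vna :: "'v traced_vna \<Rightarrow> ('v op, 'm) module \<Rightarrow> ennreal" where
  "dim_vna N Q = Sup {ennreal (\<Sum>i<k. Re (vtrace N (E i i))) | k E P f.
     matrix_over (vring N) k k E \<and> projection_matrix (vspace N) k E \<and>
     submodule P (vring N) Q \<and>
     left_module_iso_along (vring N) id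
       ((free_module (vring N) {..<k})\<lparr>carrier :=
          row_mult (vring N) k k E ` carrier (free_module (vring N) {..<k})\<rparr>)
       (Q\<lparr>carrier := P\<rparr>) f}"

definition presented_module :: "'v traced_vna \<Rightarrow> nat \<Rightarrow> nat \<Rightarrow> (nat \<Rightarrow> nat \<Rightarrow> 'v op)
    \<Rightarrow> ('v op, (nat \<Rightarrow> 'v op) set) module" where
  "presented_module N k l B = quotient_module (free_module (vring N) {..<l})
     (row_mult (vring N) k l B ` carrier (free_module (vring N) {..<k}))"

definition gram_matrix :: "'v hilbert \<Rightarrow> nat \<Rightarrow> (nat \<Rightarrow> nat \<Rightarrow> 'v op) \<Rightarrow> nat \<Rightarrow> nat \<Rightarrow> 'v op" where
  "gram_matrix H k B i j = (\<Oplus>\<^bsub>BH H\<^esub>m\<in>{..<k}. adjoint_op H (B m i) \<otimes>\<^bsub>BH H\<^esub> B m j)"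

definition matrix_form :: "'v hilbert \<Rightarrow> nat \<Rightarrow> (nat \<Rightarrow> nat \<Rightarrow> 'v op) \<Rightarrow> (nat \<Rightarrow> 'v) \<Rightarrow> complex" where
  "matrix_form H l T v = (\<Sum>i<l. \<Sum>j<l. hip H (T i j (v j)) (v i))"

text \<open>\<open>P\<close> is the spectral measure of the self-adjoint \<open>l \<times> l\<close> operator matrix \<open>T\<close> acting on \<open>H\<^sup>l\<close>: a
  projection-valued Borel measure on the reals with \<open>P(\<real>) = 1\<close> and \<open>T = \<integral> t dP(t)\<close>, both
  expressed through the scalar measures \<open>S \<mapsto> \<langle>P(S)v, v\<rangle>\<close>.\<close>

definition spectral_measure :: "'v hilbert \<Rightarrow> nat \<Rightarrow> (nat \<Rightarrow> nat \<Rightarrow> 'v op)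
    \<Rightarrow> (real set \<Rightarrow> nat \<Rightarrow> nat \<Rightarrow> 'v op) \<Rightarrow> bool" where
  "spectral_measure H l T P \<longleftrightarrow>
     (\<forall>S\<in>sets borel. projection_matrix H l (P S)) \<and>
     (\<forall>v. (\<forall>i<l. v i \<in> carrier H) \<longrightarrow> (\<exists>\<mu> :: real measure.
        finite_measure \<mu> \<and> sets \<mu> = sets borel \<and>
        (\<forall>S\<in>sets borel. matrix_form H l (P S) v = of_real (measure \<mu> S)) \<and>
        measure \<mu> UNIV = (\<Sum>i<l. (hnorm H (v i))\<^sup>2) \<and>
        integrable \<mu> (\<lambda>t. t) \<and>
        matrix_form H l T v = of_real (\<integral>t. t \<partial>\<mu>)))"

text \<open>Values of the Novikov--Shubin invariant lie in \<open>[0,\<infinity>] \<union> {\<infinity>\<^sup>+}\<close>, capacities in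
  \<open>{0\<^sup>-} \<union> [0,\<infinity>]\<close>. Both are encoded as \<open>ennreal option\<close>, with \<open>None\<close> standing for \<open>\<infinity>\<^sup>+\<close> and
  for \<open>0\<^sup>-\<close> respectively; in the order on \<open>option\<close>, \<open>None\<close> is the least element, as required for
  capacities. The order is not used for Novikov--Shubin invariants.\<close>

definition ns_exponent :: "(real \<Rightarrow> real) \<Rightarrow> ennreal option" where
  "ns_exponent F = (if \<forall>x>0. F x > F 0
     then Some (e2ennreal (Liminf (at_right 0) (\<lambda>x. ereal (ln (F x - F 0) / ln x))))
     else None)"

text \<open>The spectral measure \<open>P\<close> of \<open>B\<^sup>*B\<close> is unique on Borel sets, so the value does not depend
  on \<open>P\<close>.\<close>

definition novikov_shubin :: "'v traced_vna \<Rightarrow> nat \<Rightarrow> nat \<Rightarrow> (nat \<Rightarrow> nat \<Rightarrow> 'v op) \<Rightarrow> ennreal option"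
  where "novikov_shubin N k l B = (THE \<alpha>. \<exists>P.
     spectral_measure (vspace N) l (gram_matrix (vspace N) k B) P \<and>
     \<alpha> = ns_exponent (\<lambda>x. \<Sum>i<l. Re (vtrace N (P {0..x\<^sup>2} i i))))"

definition presented_capacity :: "'v traced_vna \<Rightarrow> nat \<Rightarrow> nat \<Rightarrow> (nat \<Rightarrow> nat \<Rightarrow> 'v op) \<Rightarrow> ennreal option"
  where "presented_capacity N k l B = map_option inverse (novikov_shubin N k l B)"

text \<open>Up to isomorphism, the finitely presented modules are the \<open>presented_module N k l B\<close>. The
  relation below says that such a module is zero-dimensional and has \<open>Q\<close> as a quotient.\<close>

definition zero_dim_cover :: "'v traced_vna \<Rightarrow> ('v op, 'm) module \<Rightarrow> nat \<Rightarrow> nat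
    \<Rightarrow> (nat \<Rightarrow> nat \<Rightarrow> 'v op) \<Rightarrow> bool" where
  "zero_dim_cover N Q k l B \<longleftrightarrow> matrix_over (vring N) k l B \<and>
     dim_vna N (presented_module N k l B) = 0 \<and>
     (\<exists>f. left_module_hom (vring N) (presented_module N k l B) Q f \<and>
        f ` carrier (presented_module N k l B) = carrier Q)"

definition measurable_module :: "'v traced_vna \<Rightarrow> ('v op, 'm) module \<Rightarrow> bool" where
  "measurable_module N Q \<longleftrightarrow> (\<exists>k l B. zero_dim_cover N Q k l B)"

definition measurable_capacity :: "'v traced_vna \<Rightarrow> ('v op, 'm) module \<Rightarrow> ennreal option" where
  "measurable_capacity N Q = Inf {presented_capacity N k l B | k l B. zero_dim_cover N Q k l B}"

definition capacity :: "'v traced_vna \<Rightarrow> ('v op, 'm) module \<Rightarrow> ennreal option" where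
  "capacity N Q = Sup {measurable_capacity N (Q\<lparr>carrier := P\<rparr>) | P.
     submodule P (vring N) Q \<and> measurable_module N (Q\<lparr>carrier := P\<rparr>)}"

section \<open>\<open>L\<^sup>2\<close>-invariants of compact quantum groups\<close>

definition cqg_L2_homology :: "'x cqg \<Rightarrow> nat \<Rightarrow>
    ((nat \<Rightarrow> ('x \<Rightarrow> complex) op) set op,
     ((nat \<Rightarrow> ('x \<Rightarrow> complex) op) set op \<times>
      ((('x \<Rightarrow> complex) op + complex) list \<Rightarrow> ('x \<Rightarrow> complex) op) \<Rightarrow>\<^sub>0 int) set set) module" where
  "cqg_L2_homology G n = Tor (hopf_ring G) (regular_module (vring (cqg_vna G)))
     (\<lambda>x a. x \<otimes>\<^bsub>vring (cqg_vna G)\<^esub> gns_rep (qspace G) (qalg G) (haar_state G) a)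
     (character_module (counit G)) n"

definition cqg_L2_betti :: "'x cqg \<Rightarrow> nat \<Rightarrow> ennreal" where
  "cqg_L2_betti G n = dim_vna (cqg_vna G) (cqg_L2_homology G n)"

definition cqg_capacity :: "'x cqg \<Rightarrow> nat \<Rightarrow> ennreal option" where
  "cqg_capacity G n = capacity (cqg_vna G) (cqg_L2_homology G n)"

section \<open>\<open>L\<^sup>2\<close>-invariants of discrete groups\<close>

definition group_ring :: "('g, 'b) monoid_scheme \<Rightarrow> ('g \<Rightarrow> complex) ring" where
  "group_ring \<Gamma> = \<lparr>
     carrier = {f. finite {x. f x \<noteq> 0} \<and> {x. f x \<noteq> 0} \<subseteq> carrier \<Gamma>},
     monoid.mult = (\<lambda>f g x. if x \<in> carrier \<Gamma>
        then \<Sum>y\<in>{y. f y \<noteq> 0}. f y * g (inv\<^bsub>\<Gamma>\<^esub> y \<otimes>\<^bsub>\<Gamma>\<^esub> x) else 0),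
     monoid.one = delta_one \<Gamma>,
     ring.zero = (\<lambda>x. 0),
     ring.add = (\<lambda>f g x. f x + g x)\<rparr>"

definition group_ring_rep :: "('g, 'b) monoid_scheme \<Rightarrow> ('g \<Rightarrow> complex) \<Rightarrow> ('g \<Rightarrow> complex) op" where
  "group_ring_rep \<Gamma> f = (let B = BH (ell2 (carrier \<Gamma>)) in
     (\<Oplus>\<^bsub>B\<^esub>x\<in>{x. f x \<noteq> 0}. f x \<odot>\<^bsub>B\<^esub> left_regular \<Gamma> x))"

definition group_L2_homology :: "('g, 'b) monoid_scheme \<Rightarrow> nat \<Rightarrow>
    (('g \<Rightarrow> complex) op,
     (('g \<Rightarrow> complex) op \<times> ((('g \<Rightarrow> complex) + complex) list \<Rightarrow> ('g \<Rightarrow> complex)) \<Rightarrow>\<^sub>0 int) set set) module"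
  where
  "group_L2_homology \<Gamma> n = Tor (group_ring \<Gamma>) (regular_module (vring (group_vna \<Gamma>)))
     (\<lambda>x f. x \<otimes>\<^bsub>vring (group_vna \<Gamma>)\<^esub> group_ring_rep \<Gamma> f)
     (character_module (\<lambda>f. \<Sum>x\<in>{x. f x \<noteq> 0}. f x)) n"

definition group_L2_betti :: "('g, 'b) monoid_scheme \<Rightarrow> nat \<Rightarrow> ennreal" where
  "group_L2_betti \<Gamma> n = dim_vna (group_vna \<Gamma>) (group_L2_homology \<Gamma> n)"

definition group_capacity :: "('g, 'b) monoid_scheme \<Rightarrow> nat \<Rightarrow> ennreal option" where
  "group_capacity \<Gamma> n = capacity (group_vna \<Gamma>) (group_L2_homology \<Gamma> n)"

section \<open>The reduced group C*-algebra as a compact quantum group\<close>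

definition reduced_alg :: "('g, 'b) monoid_scheme \<Rightarrow> ('g \<Rightarrow> complex) op set" where
  "reduced_alg \<Gamma> = (let H = ell2 (carrier \<Gamma>) in
     op_closure H (lin_span (BH H) (left_regular \<Gamma> ` carrier \<Gamma>)))"

definition reduced_comult :: "('g, 'b) monoid_scheme \<Rightarrow> ('g \<Rightarrow> complex) op
    \<Rightarrow> ('g \<times> 'g \<Rightarrow> complex) op" where
  "reduced_comult \<Gamma> = (THE \<Delta>.
     star_hom (ell2 (carrier \<Gamma>)) (reduced_alg \<Gamma>) (ell2 (carrier \<Gamma> \<times> carrier \<Gamma>))
       (min_tensor (carrier \<Gamma>) (reduced_alg \<Gamma>) (carrier \<Gamma>) (reduced_alg \<Gamma>)) \<Delta> \<and>
     (\<forall>\<gamma>\<in>carrier \<Gamma>. \<Delta> (left_regular \<Gamma> \<gamma>)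
        = op_tensor (carrier \<Gamma>) (carrier \<Gamma>) (left_regular \<Gamma> \<gamma>) (left_regular \<Gamma> \<gamma>)))"

definition reduced_cqg :: "('g, 'b) monoid_scheme \<Rightarrow> 'g cqg" where
  "reduced_cqg \<Gamma> = \<lparr>qindex = carrier \<Gamma>, qalg = reduced_alg \<Gamma>, qcomult = reduced_comult \<Gamma>\<rparr>"

text \<open>The unitary \<open>U : \<ell>\<^sup>2(\<Gamma>) \<rightarrow> L\<^sup>2(A, h)\<close> with \<open>U(a \<delta>\<^sub>e) = \<Lambda>\<^sub>h(a)\<close>; the natural
  identification of \<open>\<L>(\<Gamma>)\<close> with \<open>\<pi>\<^sub>h(A)''\<close> is conjugation by \<open>U\<close>.\<close>

definition gns_identification :: "('g, 'b) monoid_scheme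
    \<Rightarrow> (('g \<Rightarrow> complex) \<Rightarrow> (nat \<Rightarrow> ('g \<Rightarrow> complex) op) set) \<Rightarrow> bool" where
  "gns_identification \<Gamma> U \<longleftrightarrow>
     hilbert_iso (vspace (group_vna \<Gamma>)) (vspace (cqg_vna (reduced_cqg \<Gamma>))) U \<and>
     (\<forall>a\<in>reduced_alg \<Gamma>. U (a (delta_one \<Gamma>))
        = gns_vec (ell2 (carrier \<Gamma>)) (reduced_alg \<Gamma>) (haar_state (reduced_cqg \<Gamma>)) a)"

definition natural_map :: "('g, 'b) monoid_scheme
    \<Rightarrow> (('g \<Rightarrow> complex) \<Rightarrow> (nat \<Rightarrow> ('g \<Rightarrow> complex) op) set)
    \<Rightarrow> ('g \<Rightarrow> complex) op \<Rightarrow> (nat \<Rightarrow> ('g \<Rightarrow> complex) op) set op" where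
  "natural_map \<Gamma> U = conj_op (vspace (group_vna \<Gamma>)) (vspace (cqg_vna (reduced_cqg \<Gamma>))) U"

end

theory Submission
 imports Defs "HOL-Algebra.QuotRing" "HOL-Algebra.Subrings"
begin

text \<open>The Haar state is \<open>h(a) = \<langle>a \<delta>\<^sub>e, \<delta>\<^sub>e\<rangle>\<close>, so \<open>\<Lambda>\<^sub>h(a) \<mapsto> a \<delta>\<^sub>e\<close> identifies its GNS space with \<open>\<ell>\<^sup>2(\<Gamma>)\<close>, and conjugation by this
 unitary matches the two von Neumann algebras and their traces. If \<open>u\<close> is a finite-dimensional corepresentation, then
 \<open>\<Delta>(u\<^sub>i\<^sub>j) = \<Sum>\<^sub>k u\<^sub>i\<^sub>k \<otimes> u\<^sub>k\<^sub>j\<close> says that the matrices of coefficients of \<open>u\<close> at the elements of \<open>\<Gamma>\<close> are orthogonal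
 idempotents; only finitely many of them are non-zero, whence the Hopf *-algebra is \<open>\<complex>\<Gamma>\<close>, with the augmentation
 as counit. The two Tor modules have the same input up to these identifications. They are computed from different
 free resolutions, which are homotopy equivalent.\<close>

text \<open>Nearly every object is fixed by a definite description or by a choice: adjoints, tensor
  products of operators, the comultiplication, the Haar state, the counit, the resolution behind
  Tor. The descriptions named here require existence and uniqueness. Existence is cheap once there
  is a formula valid for all bounded operators, such as an amplification or a compression.
  Uniqueness comes from matrix entries, or from density and continuity; since *-homomorphisms are
  not assumed bounded, the comultiplication needs automatic contractivity.

  The second obstacle is that the two sides live in different types. The two chosen resolutions are
  over different rings, have unrelated index sets and are not images of each other, so the
  comparison theorem is proved for maps that are semilinear along a ring homomorphism. Dimension and
  capacity are then transported along isomorphisms of scalars and modules. All hypotheses of that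
  transport are symmetric, so one inequality, used in both directions, gives equality.\<close>

abbreviation "ip X \<equiv> hip (ell2 X)"
abbreviation l2 :: "'x set \<Rightarrow> ('x \<Rightarrow> complex) set" where "l2 X \<equiv> carrier (ell2 X)"

section \<open>Square-summable functions\<close>

definition l2norm :: "'x set \<Rightarrow> ('x \<Rightarrow> complex) \<Rightarrow> real" where
 "l2norm X f = sqrt (\<Sum>\<^sub>\<infinity>x\<in>X. (cmod (f x))\<^sup>2)"

definition delta :: "'x \<Rightarrow> 'x \<Rightarrow> complex" where
 "delta x = (\<lambda>y. if y = x then 1 else 0)"

lemma ell2_simps [simp]:
 "hadd (ell2 X) = (\<lambda>f g x. f x + g x)" "hzero (ell2 X) = (\<lambda>x. 0)"
 "hscale (ell2 X) = (\<lambda>c f x. c * f x)"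
 by (auto simp: ell2_def)

lemma ell2_hip: "ip X f g = (\<Sum>\<^sub>\<infinity>x\<in>X. f x * cnj (g x))"
 by (simp add: ell2_def)

lemma l2_iff: "f \<in> l2 X \<longleftrightarrow> (\<forall>x. x \<notin> X \<longrightarrow> f x = 0) \<and> (\<lambda>x. (cmod (f x))\<^sup>2) summable_on X"
 by (auto simp: ell2_def)

lemma l2_outside: "f \<in> l2 X \<Longrightarrow> x \<notin> X \<Longrightarrow> f x = 0"
 by (auto simp: l2_iff)

lemma l2norm_nonneg [simp]: "0 \<le> l2norm X f"
 by (simp add: l2norm_def infsum_nonneg)

lemma hip_self: "ip X f f = of_real ((l2norm X f)\<^sup>2)"
proof -
 have "(\<Sum>\<^sub>\<infinity>x\<in>X. f x * cnj (f x)) = (\<Sum>\<^sub>\<infinity>x\<in>X. complex_of_real ((cmod (f x))\<^sup>2))"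
  by (simp only: complex_norm_square)
 also have "\<dots> = complex_of_real (\<Sum>\<^sub>\<infinity>x\<in>X. (cmod (f x))\<^sup>2)"
  by (intro infsum_bounded_linear_strong bounded_linear_of_real
    summable_on_bounded_linear_iff[OF bounded_linear_of_real bounded_linear_Re]) simp
 finally show ?thesis by (simp add: l2norm_def infsum_nonneg ell2_hip)
qed

lemma hnorm_ell2 [simp]: "hnorm (ell2 X) f = l2norm X f"
 using hip_self[of X f] by (simp add: hnorm_def)

lemma l2_finite_le:
 assumes "f \<in> l2 X" "finite F" "F \<subseteq> X"
 shows "L2_set (\<lambda>x. cmod (f x)) F \<le> l2norm X f"
 unfolding L2_set_def l2norm_def
 using assms by (intro real_sqrt_le_mono finite_sum_le_infsum) (auto simp: l2_iff)

text \<open>One bound on all finite partial norms gives membership and the norm bound together.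
  Sums, limits, tensors, adjoints, amplifications and compressions all enter the space this way, so
  each of them needs only a finite estimate.\<close>

lemma l2I:
 assumes "\<And>x. x \<notin> X \<Longrightarrow> f x = 0"
  and b: "\<And>F. finite F \<Longrightarrow> F \<subseteq> X \<Longrightarrow> L2_set (\<lambda>x. cmod (f x)) F \<le> C"
 shows "f \<in> l2 X" "l2norm X f \<le> C"
proof -
 have C: "0 \<le> C" using b[of "{}"] by simp
 have *: "(\<Sum>x\<in>F. (cmod (f x))\<^sup>2) \<le> C\<^sup>2" if "finite F" "F \<subseteq> X" for F
  using b[OF that] C unfolding L2_set_def by (meson real_sqrt_le_iff real_sqrt_unique sqrt_le_D)
 show "f \<in> l2 X"
  unfolding l2_iff using assms(1) by (auto intro!: nonneg_bdd_above_summable_on bdd_aboveI2 *)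
 hence "(\<Sum>\<^sub>\<infinity>x\<in>X. (cmod (f x))\<^sup>2) \<le> C\<^sup>2"
  by (intro infsum_le_finite_sums *) (auto simp: l2_iff)
 thus "l2norm X f \<le> C"
  using C by (simp add: l2norm_def real_le_lsqrt)
qed

lemma l2_coord_le: "f \<in> l2 X \<Longrightarrow> cmod (f x) \<le> l2norm X f"
proof (cases "x \<in> X")
 case True assume "f \<in> l2 X"
 from l2_finite_le[OF this, of "{x}"] True show ?thesis by simp
qed (simp add: l2_outside)

lemma l2_norm_le0: "f \<in> l2 X \<Longrightarrow> l2norm X f \<le> 0 \<Longrightarrow> f = (\<lambda>x. 0)"
 by (rule ext) (metis l2_coord_le norm_le_zero_iff order_trans)

lemma l2_zero [simp]: "(\<lambda>x. 0) \<in> l2 X" by (simp add: l2_iff)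
lemma l2norm_zero [simp]: "l2norm X (\<lambda>x. 0) = 0" by (simp add: l2norm_def)

lemma l2_add:
 assumes "f \<in> l2 X" "g \<in> l2 X"
 shows "(\<lambda>x. f x + g x) \<in> l2 X" "l2norm X (\<lambda>x. f x + g x) \<le> l2norm X f + l2norm X g"
proof -
 have "L2_set (\<lambda>x. cmod (f x + g x)) F \<le> l2norm X f + l2norm X g" if "finite F" "F \<subseteq> X" for F
 proof -
  have "L2_set (\<lambda>x. cmod (f x + g x)) F \<le> L2_set (\<lambda>x. cmod (f x) + cmod (g x)) F"
   by (intro L2_set_mono norm_triangle_ineq) auto
  also have "\<dots> \<le> L2_set (\<lambda>x. cmod (f x)) F + L2_set (\<lambda>x. cmod (g x)) F"
   by (rule L2_set_triangle_ineq)
  also have "\<dots> \<le> l2norm X f + l2norm X g"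
   using assms that by (intro add_mono l2_finite_le)
  finally show ?thesis .
 qed
 thus "(\<lambda>x. f x + g x) \<in> l2 X" "l2norm X (\<lambda>x. f x + g x) \<le> l2norm X f + l2norm X g"
  using assms l2I[of X "\<lambda>x. f x + g x"] by (auto simp: l2_outside)
qed

lemma l2norm_scale: "l2norm X (\<lambda>x. c * f x) = cmod c * l2norm X f"
 by (simp add: l2norm_def norm_mult power_mult_distrib infsum_cmult_right' real_sqrt_mult)

lemma l2_scale: "f \<in> l2 X \<Longrightarrow> (\<lambda>x. c * f x) \<in> l2 X"
 by (auto simp: l2_iff norm_mult power_mult_distrib intro!: summable_on_cmult_right)

lemma l2_diff:
 assumes "f \<in> l2 X" "g \<in> l2 X"
 shows "(\<lambda>x. f x - g x) \<in> l2 X" "l2norm X (\<lambda>x. f x - g x) \<le> l2norm X f + l2norm X g"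
 using l2_add[OF assms(1) l2_scale[OF assms(2), of "-1"]] by (simp_all add: l2norm_scale[of X "-1" g, simplified])

lemma l2norm_minus_commute: "l2norm X (\<lambda>x. f x - g x) = l2norm X (\<lambda>x. g x - f x)"
 by (simp add: l2norm_def norm_minus_commute)

lemma l2_triangle3:
 assumes "f \<in> l2 X" "g \<in> l2 X" "h \<in> l2 X"
 shows "l2norm X (\<lambda>x. f x - h x) \<le> l2norm X (\<lambda>x. f x - g x) + l2norm X (\<lambda>x. g x - h x)"
 using l2_add(2)[OF l2_diff(1)[OF assms(1,2)] l2_diff(1)[OF assms(2,3)]] by simp

lemma l2_triangle_diff:
 assumes "f \<in> l2 X" "g \<in> l2 X"
 shows "l2norm X f \<le> l2norm X (\<lambda>x. f x - g x) + l2norm X g"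
 using l2_add(2)[OF l2_diff(1)[OF assms] assms(2)] by simp

lemma l2_finite_support:
 assumes "finite F" "F \<subseteq> X" "\<And>x. x \<notin> F \<Longrightarrow> f x = 0"
 shows "f \<in> l2 X" "l2norm X f = L2_set (\<lambda>x. cmod (f x)) F"
proof -
 show "f \<in> l2 X" unfolding l2_iff
  using assms summable_on_cong_neutral[of X F "\<lambda>x. (cmod (f x))\<^sup>2" "\<lambda>x. (cmod (f x))\<^sup>2"]
  by auto
 have "(\<Sum>\<^sub>\<infinity>x\<in>X. (cmod (f x))\<^sup>2) = (\<Sum>\<^sub>\<infinity>x\<in>F. (cmod (f x))\<^sup>2)"
  using assms by (intro infsum_cong_neutral) auto
 thus "l2norm X f = L2_set (\<lambda>x. cmod (f x)) F"
  using assms by (simp add: l2norm_def L2_set_def)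
qed

lemma delta_l2 [simp]: "x \<in> X \<Longrightarrow> delta x \<in> l2 X"
 by (rule l2_finite_support[of "{x}"]) (auto simp: delta_def)

lemma l2norm_delta [simp]: "x \<in> X \<Longrightarrow> l2norm X (delta x) = 1"
 by (subst l2_finite_support[of "{x}"]) (auto simp: delta_def)

lemma l2_sum:
 assumes "\<And>i. i \<in> I \<Longrightarrow> f i \<in> l2 X" shows "(\<lambda>x. \<Sum>i\<in>I. f i x) \<in> l2 X"
 using assms by (induction I rule: infinite_finite_induct) (auto intro: l2_add)

text \<open>Truncation replaces density arguments. The sum of squares is approximated within e^2
  because the norm of the tail is a square root.\<close>

lemma l2_approx:
 assumes "f \<in> l2 X" "e > 0"
 obtains F where "finite F" "F \<subseteq> X" "l2norm X (\<lambda>x. f x - (if x \<in> F then f x else 0)) \<le> e"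
proof -
 let ?g = "\<lambda>x. (cmod (f x))\<^sup>2"
 have s: "?g summable_on X" using assms by (simp add: l2_iff)
 obtain F where F: "finite F" "F \<subseteq> X" "dist (sum ?g F) (infsum ?g X) \<le> e\<^sup>2"
  using infsum_finite_approximation[OF s, of "e\<^sup>2"] assms by auto
 have "infsum ?g (X - F) = infsum ?g X - infsum ?g F"
  using F s by (intro infsum_Diff) auto
 hence "infsum ?g (X - F) \<le> e\<^sup>2" using F by (simp add: dist_real_def)
 moreover have "(\<Sum>\<^sub>\<infinity>x\<in>X. (cmod (f x - (if x \<in> F then f x else 0)))\<^sup>2) = infsum ?g (X - F)"
  by (rule infsum_cong_neutral) auto
 ultimately have "l2norm X (\<lambda>x. f x - (if x \<in> F then f x else 0)) \<le> e"
  using assms by (simp add: l2norm_def real_le_lsqrt)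
 with F that show ?thesis by blast
qed

lemma L2_set_tendsto:
 assumes "\<And>x. x \<in> F \<Longrightarrow> (\<lambda>n. s n x) \<longlonglongrightarrow> (g x :: complex)"
 shows "(\<lambda>n. L2_set (\<lambda>x. cmod (s n x)) F) \<longlonglongrightarrow> L2_set (\<lambda>x. cmod (g x)) F"
 unfolding L2_set_def using assms
 by (intro tendsto_intros)

text \<open>Fatou's lemma for counting measure: each finite partial norm is continuous under
  coordinatewise convergence, so the bound survives on every finite set.\<close>

lemma l2_limit:
 assumes s: "\<And>n. s n \<in> l2 X" and b: "\<And>n. n \<ge> N \<Longrightarrow> l2norm X (s n) \<le> C"
  and lim: "\<And>x. x \<in> X \<Longrightarrow> (\<lambda>n. s n x) \<longlonglongrightarrow> g x" and 0: "\<And>x. x \<notin> X \<Longrightarrow> g x = 0"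
 shows "g \<in> l2 X" "l2norm X g \<le> C"
proof -
 have "L2_set (\<lambda>x. cmod (g x)) F \<le> C" if F: "finite F" "F \<subseteq> X" for F
 proof (rule tendsto_upperbound)
  show "(\<lambda>n. L2_set (\<lambda>x. cmod (s n x)) F) \<longlonglongrightarrow> L2_set (\<lambda>x. cmod (g x)) F"
   using F lim by (intro L2_set_tendsto) auto
  show "\<forall>\<^sub>F n in sequentially. L2_set (\<lambda>x. cmod (s n x)) F \<le> C"
   using eventually_ge_at_top[of N]
   by eventually_elim (use b l2_finite_le[OF s F] in \<open>meson order_trans\<close>)
 qed simp
 thus "g \<in> l2 X" "l2norm X g \<le> C" using l2I[of X g] 0 by auto
qed

text \<open>The limit is formed coordinatewise, and \<open>l2_limit\<close> applied to s n - s m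
  with m tending to infinity bounds the distance. The last conclusion turns a Cauchy bound into a
  rate of convergence; the Neumann series needs the rate to get an estimate in operator norm from a
  pointwise limit.\<close>

lemma l2_complete:
 fixes s :: "nat \<Rightarrow> 'x \<Rightarrow> complex"
 assumes s: "\<And>n. s n \<in> l2 X"
  and c: "\<And>e. e > 0 \<Longrightarrow> \<exists>N. \<forall>m\<ge>N. \<forall>n\<ge>N. l2norm X (\<lambda>x. s m x - s n x) \<le> e"
 obtains g where "g \<in> l2 X" "\<And>x. (\<lambda>n. s n x) \<longlonglongrightarrow> g x"
  "\<And>N e. (\<And>m n. m \<ge> N \<Longrightarrow> n \<ge> N \<Longrightarrow> l2norm X (\<lambda>x. s m x - s n x) \<le> e) \<Longrightarrow>
    (\<And>n. n \<ge> N \<Longrightarrow> l2norm X (\<lambda>x. s n x - g x) \<le> e)"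
proof -
 have "Cauchy (\<lambda>n. s n x)" for x
 proof (rule metric_CauchyI)
  fix e :: real assume "e > 0"
  then obtain N where N: "\<And>m n. m \<ge> N \<Longrightarrow> n \<ge> N \<Longrightarrow> l2norm X (\<lambda>x. s m x - s n x) \<le> e / 2"
   using c[of "e/2"] by auto
  have "dist (s m x) (s n x) < e" if "m \<ge> N" "n \<ge> N" for m n
   using l2_coord_le[OF l2_diff(1)[OF s[of m] s[of n]], where x=x] N[OF that] \<open>e > 0\<close> by (simp add: dist_norm)
  thus "\<exists>N. \<forall>m\<ge>N. \<forall>n\<ge>N. dist (s m x) (s n x) < e" by blast
 qed
 hence "\<forall>x. \<exists>l. (\<lambda>n. s n x) \<longlonglongrightarrow> l"
  by (simp add: Cauchy_convergent_iff convergent_def)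
 from choice[OF this] obtain g where g: "\<And>x. (\<lambda>n. s n x) \<longlonglongrightarrow> g x" by blast
 have g0: "g x = 0" if "x \<notin> X" for x
  using LIMSEQ_unique[OF g[of x], of 0] l2_outside[OF s that] by simp
 have *: "(\<lambda>x. s n x - g x) \<in> l2 X \<and> l2norm X (\<lambda>x. s n x - g x) \<le> e"
  if "\<And>m n. m \<ge> N \<Longrightarrow> n \<ge> N \<Longrightarrow> l2norm X (\<lambda>x. s m x - s n x) \<le> e" "n \<ge> N" for N e n
 proof -
  note l = l2_limit[where s="\<lambda>m x. s n x - s m x" and g="\<lambda>x. s n x - g x" and C=e and N=N and X=X]
  have "\<And>m. m \<ge> N \<Longrightarrow> l2norm X (\<lambda>x. s n x - s m x) \<le> e" using that by blast
  moreover have "\<And>x. (\<lambda>m. s n x - s m x) \<longlonglongrightarrow> s n x - g x" by (intro tendsto_intros g)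
  moreover have "\<And>x. x \<notin> X \<Longrightarrow> s n x - g x = 0" using g0 l2_outside[OF s] by simp
  ultimately show ?thesis using l[OF l2_diff(1)[OF s s]] by blast
 qed
 obtain N where N: "\<And>m n. m \<ge> N \<Longrightarrow> n \<ge> N \<Longrightarrow> l2norm X (\<lambda>x. s m x - s n x) \<le> 1"
  using c[of 1] by auto
 have "g \<in> l2 X"
  using l2_diff(1)[OF s[of N] conjunct1[OF *[where N=N and n=N and e=1]]] N by simp
 thus thesis by (rule that[OF _ g]) (use * in blast)
qed

lemma hip_summable:
 assumes "f \<in> l2 X" "g \<in> l2 X"
 shows "(\<lambda>x. cmod (f x * cnj (g x))) summable_on X"
proof (rule Infinite_Sum.abs_summable_product)
 show "(\<lambda>x. cmod (f x * f x)) summable_on X" "(\<lambda>x. cmod (cnj (g x) * cnj (g x))) summable_on X"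
  using assms by (simp_all add: l2_iff norm_mult power2_eq_square)
qed

lemma hip_bound:
 assumes "f \<in> l2 X" "g \<in> l2 X"
 shows "cmod (ip X f g) \<le> l2norm X f * l2norm X g"
proof -
 have "cmod (ip X f g) \<le> (\<Sum>\<^sub>\<infinity>x\<in>X. cmod (f x * cnj (g x)))"
  unfolding ell2_hip by (rule norm_infsum_bound[OF hip_summable[OF assms]])
 also have "\<dots> \<le> l2norm X f * l2norm X g"
 proof (rule infsum_le_finite_sums)
  fix F assume F: "finite F" "F \<subseteq> X"
  have "(\<Sum>x\<in>F. cmod (f x * cnj (g x))) \<le> L2_set (\<lambda>x. cmod (f x)) F * L2_set (\<lambda>x. cmod (g x)) F"
   using L2_set_mult_ineq[of "\<lambda>x. cmod (f x)" "\<lambda>x. cmod (g x)" F] by (simp add: norm_mult)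
  also have "\<dots> \<le> l2norm X f * l2norm X g"
   using F assms by (intro mult_mono l2_finite_le) auto
  finally show "(\<Sum>x\<in>F. cmod (f x * cnj (g x))) \<le> l2norm X f * l2norm X g" .
 qed (use hip_summable[OF assms] in auto)
 finally show ?thesis .
qed

lemma hip_add_left:
 assumes "f \<in> l2 X" "f' \<in> l2 X" "g \<in> l2 X"
 shows "ip X (\<lambda>x. f x + f' x) g = ip X f g + ip X f' g"
proof -
 have "(\<lambda>x. f x * cnj (g x)) summable_on X" "(\<lambda>x. f' x * cnj (g x)) summable_on X"
  by (rule abs_summable_summable, rule hip_summable[OF _ assms(3)], rule assms)+
 from infsum_add[OF this] show ?thesis by (simp add: distrib_right ell2_hip)
qed

lemma hip_scale_left: "ip X (\<lambda>x. c * f x) g = c * ip X f g"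
 by (simp add: mult.assoc infsum_cmult_right' ell2_hip)

lemma hip_zero_left [simp]: "ip X (\<lambda>x. 0) g = 0"
 by (simp add: ell2_hip)

lemma hip_cnj: "ip X g f = cnj (ip X f g)"
 by (simp flip: infsum_cnj add: mult.commute ell2_hip)

lemma hip_diff_left:
 assumes "f \<in> l2 X" "f' \<in> l2 X" "g \<in> l2 X"
 shows "ip X (\<lambda>x. f x - f' x) g = ip X f g - ip X f' g"
 using hip_add_left[OF assms(1) l2_scale[OF assms(2), of "-1"] assms(3)] hip_scale_left[of X "-1" f' g] by simp

lemma hip_diff_right:
 assumes "f \<in> l2 X" "f' \<in> l2 X" "g \<in> l2 X"
 shows "ip X g (\<lambda>x. f x - f' x) = ip X g f - ip X g f'"
 using hip_diff_left[OF assms] hip_cnj by (metis complex_cnj_diff)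

lemma hip_finite_support:
 assumes "finite F" "F \<subseteq> X" "\<And>x. x \<in> X - F \<Longrightarrow> f x = 0 \<or> g x = 0"
 shows "ip X f g = (\<Sum>x\<in>F. f x * cnj (g x))"
proof -
 have "(\<Sum>\<^sub>\<infinity>x\<in>X. f x * cnj (g x)) = (\<Sum>\<^sub>\<infinity>x\<in>F. f x * cnj (g x))"
  using assms by (intro infsum_cong_neutral) auto
 thus ?thesis using assms by (simp add: ell2_hip)
qed

lemma hip_delta_right: "x \<in> X \<Longrightarrow> ip X f (delta x) = f x"
 by (subst hip_finite_support[of "{x}"]) (auto simp: delta_def)

lemma hip_delta_left: "x \<in> X \<Longrightarrow> ip X (delta x) f = cnj (f x)"
 by (subst hip_finite_support[of "{x}"]) (auto simp: delta_def)

text \<open>A finite subset of X \<times> Y lies in the product of its two projections, and over a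
  product the sum of squares factorises.\<close>

lemma l2_tensor:
 assumes "f \<in> l2 X" "g \<in> l2 Y"
 shows "(\<lambda>(x, y). f x * g y) \<in> l2 (X \<times> Y)" "l2norm (X \<times> Y) (\<lambda>(x, y). f x * g y) \<le> l2norm X f * l2norm Y g"
proof -
 let ?h = "\<lambda>(x, y). f x * g y"
 have b: "L2_set (\<lambda>z. cmod (?h z)) F \<le> l2norm X f * l2norm Y g" if F: "finite F" "F \<subseteq> X \<times> Y" for F
 proof -
  have fin: "finite (fst ` F)" "finite (snd ` F)" "fst ` F \<subseteq> X" "snd ` F \<subseteq> Y" using F by auto
  have "(\<Sum>z\<in>F. (cmod (?h z))\<^sup>2) \<le> (\<Sum>z\<in>fst ` F \<times> snd ` F. (cmod (?h z))\<^sup>2)"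
   using fin by (intro sum_mono2) (auto simp: rev_image_eqI)
  also have "\<dots> = (\<Sum>x\<in>fst ` F. (cmod (f x))\<^sup>2) * (\<Sum>y\<in>snd ` F. (cmod (g y))\<^sup>2)"
   by (simp add: sum_product sum.cartesian_product norm_mult power_mult_distrib split_def)
  finally have "L2_set (\<lambda>z. cmod (?h z)) F \<le> L2_set (\<lambda>x. cmod (f x)) (fst ` F) * L2_set (\<lambda>x. cmod (g x)) (snd ` F)"
   by (simp add: L2_set_def real_sqrt_mult[symmetric])
  also have "\<dots> \<le> l2norm X f * l2norm Y g"
   using fin assms by (intro mult_mono l2_finite_le) auto
  finally show ?thesis .
 qed
 have z: "?h p = 0" if "p \<notin> X \<times> Y" for p using that assms by (cases p) (auto simp: l2_outside)
 show "?h \<in> l2 (X \<times> Y)" "l2norm (X \<times> Y) ?h \<le> l2norm X f * l2norm Y g"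
  using l2I[OF z b] by blast+
qed

section \<open>Bounded operators and matrix entries\<close>

abbreviation "adj X \<equiv> adjoint_op (ell2 X)"
abbreviation "bh X \<equiv> BH (ell2 X)"
abbreviation bop :: "'x set \<Rightarrow> ('x \<Rightarrow> complex) op set" where "bop X \<equiv> bounded_ops (ell2 X)"

lemma bop_iff: "T \<in> bop X \<longleftrightarrow> T \<in> extensional (l2 X) \<and> (\<forall>v\<in>l2 X. T v \<in> l2 X) \<and>
  (\<forall>v\<in>l2 X. \<forall>w\<in>l2 X. T (\<lambda>x. v x + w x) = (\<lambda>x. T v x + T w x)) \<and>
  (\<forall>c. \<forall>v\<in>l2 X. T (\<lambda>x. c * v x) = (\<lambda>x. c * T v x)) \<and>
  (\<exists>C\<ge>0. \<forall>v\<in>l2 X. l2norm X (T v) \<le> C * l2norm X v)" (is "?l = ?r")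
proof -
 have "(\<exists>C\<ge>0. \<forall>v\<in>l2 X. l2norm X (T v) \<le> C * l2norm X v) = (\<exists>C. \<forall>v\<in>l2 X. l2norm X (T v) \<le> C * l2norm X v)"
 proof
  assume "\<exists>C. \<forall>v\<in>l2 X. l2norm X (T v) \<le> C * l2norm X v"
  then obtain C where C: "\<And>v. v \<in> l2 X \<Longrightarrow> l2norm X (T v) \<le> C * l2norm X v" by blast
  have "l2norm X (T v) \<le> max C 0 * l2norm X v" if "v \<in> l2 X" for v
   using C[OF that] mult_right_mono[of C "max C 0" "l2norm X v"] by simp
  thus "\<exists>C\<ge>0. \<forall>v\<in>l2 X. l2norm X (T v) \<le> C * l2norm X v"
   by (intro exI[of _ "max C 0"]) auto
 qed blast
 thus ?thesis by (auto simp: bounded_ops_def PiE_def Pi_def)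
qed

lemma bopI:
 assumes "T \<in> extensional (l2 X)" "\<And>v. v \<in> l2 X \<Longrightarrow> T v \<in> l2 X"
  "\<And>v w x. v \<in> l2 X \<Longrightarrow> w \<in> l2 X \<Longrightarrow> T (\<lambda>x. v x + w x) x = T v x + T w x"
  "\<And>c v x. v \<in> l2 X \<Longrightarrow> T (\<lambda>x. c * v x) x = c * T v x"
  "0 \<le> C" "\<And>v. v \<in> l2 X \<Longrightarrow> l2norm X (T v) \<le> C * l2norm X v"
 shows "T \<in> bop X"
 unfolding bop_iff fun_eq_iff using assms by blast

lemma bop_ext: "T \<in> bop X \<Longrightarrow> T \<in> extensional (l2 X)"
 and bop_in [intro]: "T \<in> bop X \<Longrightarrow> v \<in> l2 X \<Longrightarrow> T v \<in> l2 X"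
 and bop_add: "T \<in> bop X \<Longrightarrow> v \<in> l2 X \<Longrightarrow> w \<in> l2 X \<Longrightarrow> T (\<lambda>x. v x + w x) = (\<lambda>x. T v x + T w x)"
 and bop_scale: "T \<in> bop X \<Longrightarrow> v \<in> l2 X \<Longrightarrow> T (\<lambda>x. c * v x) = (\<lambda>x. c * T v x)"
 by (auto simp: bop_iff)

lemma bop_bound: assumes "T \<in> bop X"
 obtains C where "0 \<le> C" "\<And>v. v \<in> l2 X \<Longrightarrow> l2norm X (T v) \<le> C * l2norm X v"
 using assms by (auto simp: bop_iff)

lemma bop_zero: "T \<in> bop X \<Longrightarrow> T (\<lambda>x. 0) = (\<lambda>x. 0)"
 using bop_scale[of T X "\<lambda>x. 0" 0] by simp

lemma bop_diff: "T \<in> bop X \<Longrightarrow> v \<in> l2 X \<Longrightarrow> w \<in> l2 X \<Longrightarrow> T (\<lambda>x. v x - w x) = (\<lambda>x. T v x - T w x)"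
 using bop_add[of T X v "\<lambda>x. (-1) * w x"] bop_scale[of T X w "-1"] l2_scale[of w X "-1"] by simp

lemma bop_outside: "T \<in> bop X \<Longrightarrow> v \<in> l2 X \<Longrightarrow> x \<notin> X \<Longrightarrow> T v x = 0"
 using l2_outside bop_in by metis

lemma bop_sum:
 assumes "T \<in> bop X" "\<And>i. i \<in> I \<Longrightarrow> f i \<in> l2 X"
 shows "T (\<lambda>x. \<Sum>i\<in>I. f i x) = (\<lambda>x. \<Sum>i\<in>I. T (f i) x)"
 using assms(2) by (induction I rule: infinite_finite_induct)
  (auto simp: bop_zero[OF assms(1)] bop_add[OF assms(1)] l2_sum)

lemma bop_finite_support:
 assumes "T \<in> bop X" "finite F" "F \<subseteq> X" "\<And>x. x \<notin> F \<Longrightarrow> f x = 0"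
 shows "T f = (\<lambda>y. \<Sum>x\<in>F. f x * T (delta x) y)"
proof -
 have "f = (\<lambda>y. \<Sum>x\<in>F. f x * delta x y)"
  using assms by (auto simp: delta_def if_distrib[of "\<lambda>x. _ * x"] sum.delta' cong: if_cong)
 hence "T f = T (\<lambda>y. \<Sum>x\<in>F. f x * delta x y)" by simp
 also have "\<dots> = (\<lambda>y. \<Sum>x\<in>F. T (\<lambda>y. f x * delta x y) y)"
  using assms by (intro bop_sum l2_scale) auto
 also have "\<dots> = (\<lambda>y. \<Sum>x\<in>F. f x * T (delta x) y)"
  using assms by (intro ext sum.cong refl) (subst bop_scale[OF assms(1)], auto)
 finally show ?thesis .
qed

text \<open>Linearity settles finitely supported vectors. A truncation error of e / (C + 1) grows by
  a factor of at most C under T; the added 1 keeps the quotient defined when C = 0.\<close>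

lemma bop_zeroI:
 assumes T: "T \<in> bop X" and z: "\<And>x y. x \<in> X \<Longrightarrow> y \<in> X \<Longrightarrow> T (delta x) y = 0" and v: "v \<in> l2 X"
 shows "T v = (\<lambda>x. 0)"
proof (rule l2_norm_le0[OF bop_in[OF T v]], rule field_le_epsilon)
 fix e :: real assume e: "e > 0"
 obtain C where C: "0 \<le> C" "\<And>v. v \<in> l2 X \<Longrightarrow> l2norm X (T v) \<le> C * l2norm X v"
  using bop_bound[OF T] by blast
 obtain F where F: "finite F" "F \<subseteq> X" "l2norm X (\<lambda>x. v x - (if x \<in> F then v x else 0)) \<le> e / (C + 1)"
  using l2_approx[OF v, of "e / (C + 1)"] e C by auto
 let ?g = "\<lambda>x. if x \<in> F then v x else 0"
 have g: "?g \<in> l2 X" by (rule l2_finite_support[of F]) (use F in auto)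
 have "T ?g = (\<lambda>y. \<Sum>x\<in>F. ?g x * T (delta x) y)"
  by (rule bop_finite_support[OF T F(1,2)]) simp
 also have "\<dots> = (\<lambda>y. 0)"
 proof
  fix y show "(\<Sum>x\<in>F. ?g x * T (delta x) y) = 0"
   using z F bop_outside[OF T delta_l2, of _ y] by (cases "y \<in> X") (auto intro!: sum.neutral)
 qed
 finally have "T (\<lambda>x. v x - ?g x) = T v" by (subst bop_diff[OF T v g]) simp
 hence "l2norm X (T v) \<le> C * (e / (C + 1))"
  using C(2)[OF l2_diff(1)[OF v g]] mult_left_mono[OF F(3) C(1)] by simp
 also have "\<dots> \<le> e" using e C by (simp add: field_simps)
 finally show "l2norm X (T v) \<le> 0 + e" by simp
qed

subsection \<open>The algebra of bounded operators\<close>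

lemma BH_carrier [simp]: "carrier (BH H) = bounded_ops H"
 by (simp add: BH_def)

lemma BH_apply [simp]:
 assumes "v \<in> l2 X"
 shows "(S \<oplus>\<^bsub>bh X\<^esub> T) v = (\<lambda>x. S v x + T v x)"
  "(S \<otimes>\<^bsub>bh X\<^esub> T) v = S (T v)"
  "(c \<odot>\<^bsub>bh X\<^esub> T) v = (\<lambda>x. c * T v x)"
  "\<zero>\<^bsub>bh X\<^esub> v = (\<lambda>x. 0)" "\<one>\<^bsub>bh X\<^esub> v = v"
 using assms by (auto simp: BH_def compose_def)

lemma BH_ext [simp]:
 "S \<oplus>\<^bsub>bh X\<^esub> T \<in> extensional (l2 X)" "S \<otimes>\<^bsub>bh X\<^esub> T \<in> extensional (l2 X)"
 "c \<odot>\<^bsub>bh X\<^esub> T \<in> extensional (l2 X)" "\<zero>\<^bsub>bh X\<^esub> \<in> extensional (l2 X)"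
 "\<one>\<^bsub>bh X\<^esub> \<in> extensional (l2 X)"
 by (auto simp: BH_def compose_def)

lemma bop_eq: "S \<in> extensional (l2 X) \<Longrightarrow> T \<in> extensional (l2 X) \<Longrightarrow>
  (\<And>v x. v \<in> l2 X \<Longrightarrow> S v x = T v x) \<Longrightarrow> S = T"
 by (rule extensionalityI[of _ "l2 X"]) auto

lemma BH_add_closed [simp]:
 assumes S: "S \<in> bop X" and T: "T \<in> bop X" shows "S \<oplus>\<^bsub>bh X\<^esub> T \<in> bop X"
proof -
 obtain C where C: "0 \<le> C" "\<And>v. v \<in> l2 X \<Longrightarrow> l2norm X (S v) \<le> C * l2norm X v"
  using bop_bound[OF S] by blast
 obtain D where D: "0 \<le> D" "\<And>v. v \<in> l2 X \<Longrightarrow> l2norm X (T v) \<le> D * l2norm X v"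
  using bop_bound[OF T] by blast
 show ?thesis
 proof (rule bopI[where C="C + D"])
  fix v assume v: "v \<in> l2 X"
  show "l2norm X ((S \<oplus>\<^bsub>bh X\<^esub> T) v) \<le> (C + D) * l2norm X v"
   using l2_add(2)[OF bop_in[OF S v] bop_in[OF T v]] C(2)[OF v] D(2)[OF v] v
   by (simp add: algebra_simps)
 qed (use S T C D in \<open>auto simp: l2_add l2_scale bop_add bop_scale algebra_simps bop_in\<close>)
qed

lemma BH_mult_closed [simp]:
 assumes S: "S \<in> bop X" and T: "T \<in> bop X" shows "S \<otimes>\<^bsub>bh X\<^esub> T \<in> bop X"
proof -
 obtain C where C: "0 \<le> C" "\<And>v. v \<in> l2 X \<Longrightarrow> l2norm X (S v) \<le> C * l2norm X v"
  using bop_bound[OF S] by blast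
 obtain D where D: "0 \<le> D" "\<And>v. v \<in> l2 X \<Longrightarrow> l2norm X (T v) \<le> D * l2norm X v"
  using bop_bound[OF T] by blast
 show ?thesis
 proof (rule bopI[where C="C * D"])
  fix v assume v: "v \<in> l2 X"
  show "l2norm X ((S \<otimes>\<^bsub>bh X\<^esub> T) v) \<le> (C * D) * l2norm X v"
   using C(2)[OF bop_in[OF T v]] mult_left_mono[OF D(2)[OF v] C(1)] v
   by (simp add: algebra_simps)
 qed (use S T C D in \<open>auto simp: l2_add l2_scale bop_add bop_scale algebra_simps bop_in\<close>)
qed

lemma BH_smult_closed [simp]:
 assumes T: "T \<in> bop X" shows "c \<odot>\<^bsub>bh X\<^esub> T \<in> bop X"
proof -
 obtain D where D: "0 \<le> D" "\<And>v. v \<in> l2 X \<Longrightarrow> l2norm X (T v) \<le> D * l2norm X v"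
  using bop_bound[OF T] by blast
 show ?thesis
 proof (rule bopI[where C="cmod c * D"])
  fix v assume v: "v \<in> l2 X"
  show "l2norm X ((c \<odot>\<^bsub>bh X\<^esub> T) v) \<le> (cmod c * D) * l2norm X v"
   using mult_left_mono[OF D(2)[OF v], of "cmod c"] v by (simp add: l2norm_scale algebra_simps)
 qed (use T D in \<open>auto simp: l2_add l2_scale bop_add bop_scale algebra_simps bop_in\<close>)
qed

lemma BH_zero_closed [simp]: "\<zero>\<^bsub>bh X\<^esub> \<in> bop X"
 by (rule bopI[where C=0]) (auto simp: l2_add l2_scale)

lemma BH_one_closed [simp]: "\<one>\<^bsub>bh X\<^esub> \<in> bop X"
 by (rule bopI[where C=1]) (auto simp: l2_add l2_scale)

lemma ring_BH: "ring (bh X)"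
proof (rule ringI)
 show "abelian_group (bh X)"
 proof (rule abelian_groupI)
  fix T assume "T \<in> carrier (bh X)"
  thus "\<exists>S\<in>carrier (bh X). S \<oplus>\<^bsub>bh X\<^esub> T = \<zero>\<^bsub>bh X\<^esub>"
   by (intro bexI[of _ "(-1) \<odot>\<^bsub>bh X\<^esub> T"]) (auto intro!: bop_eq[of _ X])
 qed (auto intro!: bop_eq[of _ X] simp: bop_ext)
 show "Group.monoid (bh X)"
  by unfold_locales (auto intro!: bop_eq[of _ X] simp: bop_ext bop_in)
qed (auto intro!: bop_eq[of _ X] simp: bop_ext bop_in bop_add)

lemma abelian_group_BH: "abelian_group (bh X)"
 using ring_BH ring.is_abelian_group by blast

lemma BH_uminus: "T \<in> bop X \<Longrightarrow> \<ominus>\<^bsub>bh X\<^esub> T = (-1) \<odot>\<^bsub>bh X\<^esub> T"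
proof -
 assume T: "T \<in> bop X"
 have "(-1) \<odot>\<^bsub>bh X\<^esub> T \<oplus>\<^bsub>bh X\<^esub> T = \<zero>\<^bsub>bh X\<^esub>"
  using T by (auto intro!: bop_eq[of _ X])
 thus ?thesis
  using abelian_group.minus_equality[OF abelian_group_BH[of X]] T by auto
qed

lemma BH_finsum:
 assumes "finite I" "\<And>i. i \<in> I \<Longrightarrow> T i \<in> bop X"
 shows "(\<Oplus>\<^bsub>bh X\<^esub>i\<in>I. T i) \<in> bop X"
  and "v \<in> l2 X \<Longrightarrow> (\<Oplus>\<^bsub>bh X\<^esub>i\<in>I. T i) v = (\<lambda>x. \<Sum>i\<in>I. T i v x)"
proof -
 interpret abelian_group "bh X" by (rule abelian_group_BH)
 show "(\<Oplus>\<^bsub>bh X\<^esub>i\<in>I. T i) \<in> bop X"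
  using finsum_closed[of T I] assms(2) by auto
 show "(\<Oplus>\<^bsub>bh X\<^esub>i\<in>I. T i) v = (\<lambda>x. \<Sum>i\<in>I. T i v x)" if "v \<in> l2 X"
  using assms that by (induction I) (auto simp: finsum_insert Pi_iff)
qed

text \<open>An operator is determined by its matrix. Identities between adjoints, tensors,
  amplifications and compressions are mostly reduced to entries by this rule.\<close>

lemma bop_eqI:
 assumes S: "S \<in> bop X" and T: "T \<in> bop X"
  and e: "\<And>x y. x \<in> X \<Longrightarrow> y \<in> X \<Longrightarrow> S (delta x) y = T (delta x) y"
 shows "S = T"
proof (rule bop_eq)
 fix v x assume v: "v \<in> l2 X"
 let ?D = "S \<oplus>\<^bsub>bh X\<^esub> ((-1) \<odot>\<^bsub>bh X\<^esub> T)"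
 have "?D v = (\<lambda>x. 0)" by (rule bop_zeroI[OF _ _ v, of _]) (use S T e in auto)
 thus "S v x = T v x" using v by (auto dest: fun_cong[of _ _ x])
qed (use assms in \<open>auto simp: bop_ext\<close>)

subsection \<open>Adjoints\<close>

text \<open>The adjoint is written down instead of being obtained from a representation theorem: the
  coordinate of S w at y has to be the inner product of w with T (delta y). What needs proof is that
  these coordinates are square summable; the defining identity then holds for finitely supported v
  and extends by truncation.\<close>

lemma adjoint_exists:
 assumes T: "T \<in> bop X"
 shows "\<exists>S\<in>bop X. \<forall>v\<in>l2 X. \<forall>w\<in>l2 X. ip X (T v) w = ip X v (S w)"
proof -
 let ?ip = "ip X"
 obtain C where C: "0 \<le> C" "\<And>v. v \<in> l2 X \<Longrightarrow> l2norm X (T v) \<le> C * l2norm X v"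
  using bop_bound[OF T] by blast
 define S where "S = (\<lambda>w\<in>l2 X. \<lambda>y. if y \<in> X then ?ip w (T (delta y)) else 0)"
 have Sext: "S \<in> extensional (l2 X)" unfolding S_def by (rule restrict_extensional)
 have Sd: "S w y = ?ip w (T (delta y))" if "w \<in> l2 X" "y \<in> X" for w y
  using that by (simp add: S_def)
 have fin: "?ip (T g) w = (\<Sum>y\<in>F. g y * cnj (S w y))"
  if w: "w \<in> l2 X" and F: "finite F" "F \<subseteq> X" and g: "\<And>x. x \<notin> F \<Longrightarrow> g x = 0" for g w F
 proof -
  have "?ip (\<lambda>y. \<Sum>x\<in>G. g x * T (delta x) y) w = (\<Sum>y\<in>G. g y * cnj (S w y))"
   if "finite G" "G \<subseteq> X" for G
   using that
  proof (induction G)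
   case (insert a G)
   have "?ip (\<lambda>y. \<Sum>x\<in>insert a G. g x * T (delta x) y) w =
     ?ip (\<lambda>y. g a * T (delta a) y + (\<Sum>x\<in>G. g x * T (delta x) y)) w"
    using insert by simp
   also have "\<dots> = ?ip (\<lambda>y. g a * T (delta a) y) w + ?ip (\<lambda>y. \<Sum>x\<in>G. g x * T (delta x) y) w"
   proof (rule hip_add_left[OF l2_scale l2_sum w])
    show "T (delta a) \<in> l2 X" using insert.prems T by auto
    show "(\<lambda>y. g x * T (delta x) y) \<in> l2 X" if "x \<in> G" for x
     using insert.prems that by (intro l2_scale bop_in[OF T] delta_l2) auto
   qed
   also have "?ip (\<lambda>y. g a * T (delta a) y) w = g a * cnj (S w a)"
    using insert.prems w hip_cnj[of X "T (delta a)" w] by (simp add: Sd hip_scale_left)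
   finally show ?case using insert by simp
  qed simp
  thus ?thesis using bop_finite_support[OF T F g] F by simp
 qed
 have S1: "S w \<in> l2 X" "l2norm X (S w) \<le> C * l2norm X w" if w: "w \<in> l2 X" for w
 proof -
  have "L2_set (\<lambda>y. cmod (S w y)) F \<le> C * l2norm X w" if F: "finite F" "F \<subseteq> X" for F
  proof -
   let ?g = "\<lambda>y. if y \<in> F then S w y else 0" and ?L = "L2_set (\<lambda>y. cmod (S w y)) F"
   have g: "?g \<in> l2 X" "l2norm X ?g = ?L"
    using l2_finite_support[OF F, of ?g] by (auto intro: L2_set_cong)
   \<comment> \<open>Pairing w with T applied to the truncation \<open>?g\<close> of S w itself
     yields L^2 \<le> C L ||w||, where L is the norm of \<open>?g\<close>. Cancelling L is only
     possible for L > 0; the case L = 0 is trivial since C \<ge> 0.\<close>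
   have "of_real (?L\<^sup>2) = (\<Sum>y\<in>F. ?g y * cnj (S w y))"
    by (simp add: L2_set_def sum_nonneg flip: complex_norm_square)
   also have "\<dots> = ?ip (T ?g) w" by (rule fin[symmetric]) (use w F in auto)
   finally have "?L\<^sup>2 = cmod (?ip (T ?g) w)"
    by (metis abs_power2 norm_of_real)
   also have "\<dots> \<le> l2norm X (T ?g) * l2norm X w"
    using g w T by (intro hip_bound) auto
   also have "\<dots> \<le> (C * ?L) * l2norm X w"
    using C(2)[OF g(1)] g(2) by (intro mult_right_mono) auto
   finally have "?L * ?L \<le> ?L * (C * l2norm X w)" by (simp add: power2_eq_square mult_ac)
   hence "?L = 0 \<or> ?L \<le> C * l2norm X w"
    using L2_set_nonneg[of "\<lambda>y. cmod (S w y)" F] mult_le_cancel_left_pos[of ?L ?L "C * l2norm X w"]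
    by (cases "?L > 0") (auto simp: not_less intro: order.antisym)
   thus ?thesis using C(1) by (metis l2norm_nonneg mult_nonneg_nonneg)
  qed
  thus "S w \<in> l2 X" "l2norm X (S w) \<le> C * l2norm X w"
   using l2I[of X "S w" "C * l2norm X w"] w by (auto simp: S_def)
 qed
 have S: "S \<in> bop X"
 proof (rule bopI[OF Sext S1(1) _ _ C(1) S1(2)])
  fix v w x assume vw: "v \<in> l2 X" "w \<in> l2 X"
  show "S (\<lambda>x. v x + w x) x = S v x + S w x"
   using vw l2_add[OF vw] T hip_add_left[OF vw] by (simp add: S_def bop_in)
 next
  fix c v x assume v: "v \<in> l2 X"
  show "S (\<lambda>x. c * v x) x = c * S v x"
   using v l2_scale[OF v, of c] by (simp add: S_def hip_scale_left)
 qed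
 moreover have "?ip (T v) w = ?ip v (S w)" if v: "v \<in> l2 X" and w: "w \<in> l2 X" for v w
 proof -
  \<comment> \<open>Replacing v by a truncation changes the two inner products by at most the
    truncation error times the first two summands; the 1 makes K positive, so that e / K makes
    sense.\<close>
  define K where "K = C * l2norm X w + l2norm X (S w) + 1"
  have K: "K > 0" using C by (auto simp: K_def intro!: add_nonneg_pos)
  have "cmod (?ip (T v) w - ?ip v (S w)) \<le> 0"
  proof (rule field_le_epsilon)
   fix e :: real assume e: "e > 0"
   obtain F where F: "finite F" "F \<subseteq> X" "l2norm X (\<lambda>x. v x - (if x \<in> F then v x else 0)) \<le> e / K"
    using l2_approx[OF v, of "e / K"] e K by auto
   let ?g = "\<lambda>x. if x \<in> F then v x else 0" and ?d = "\<lambda>x. v x - (if x \<in> F then v x else 0)"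
   have g: "?g \<in> l2 X" by (rule l2_finite_support[of F]) (use F in auto)
   have d: "?d \<in> l2 X" by (rule l2_diff[OF v g])
   have "?ip (T ?g) w = ?ip ?g (S w)"
    by (subst fin[OF w F(1,2)], simp, subst hip_finite_support[OF F(1,2)]) auto
   moreover have "?ip (T v) w = ?ip (T ?g) w + ?ip (T ?d) w"
    using hip_diff_left[OF bop_in[OF T v] bop_in[OF T g] w] bop_diff[OF T v g] by simp
   moreover have "?ip v (S w) = ?ip ?g (S w) + ?ip ?d (S w)"
    using hip_diff_left[OF v g S1(1)[OF w]] by simp
   ultimately have "cmod (?ip (T v) w - ?ip v (S w)) = cmod (?ip (T ?d) w - ?ip ?d (S w))"
    by simp
   also have "\<dots> \<le> cmod (?ip (T ?d) w) + cmod (?ip ?d (S w))" by (rule norm_triangle_ineq4)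
   also have "\<dots> \<le> l2norm X (T ?d) * l2norm X w + l2norm X ?d * l2norm X (S w)"
    using T d w S1 by (intro add_mono hip_bound) auto
   also have "\<dots> \<le> C * l2norm X ?d * l2norm X w + l2norm X ?d * l2norm X (S w)"
    using C(2)[OF d] by (intro add_mono mult_right_mono) auto
   also have "\<dots> \<le> l2norm X ?d * K" by (simp add: K_def algebra_simps)
   also have "\<dots> \<le> e / K * K" using F(3) K by (intro mult_right_mono) auto
   finally show "cmod (?ip (T v) w - ?ip v (S w)) \<le> 0 + e" using K by simp
  qed
  thus ?thesis by simp
 qed
 ultimately show ?thesis by blast
qed

lemma adjoint_unique:
 assumes "S \<in> bop X" "S' \<in> bop X"
  "\<And>v w. v \<in> l2 X \<Longrightarrow> w \<in> l2 X \<Longrightarrow> ip X v (S w) = ip X v (S' w)"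
 shows "S = S'"
proof (rule bop_eqI[OF assms(1,2)])
 fix x y assume "x \<in> X" "y \<in> X"
 thus "S (delta x) y = S' (delta x) y"
  using assms(3)[of "delta y" "delta x"] by (simp add: hip_delta_left)
qed

lemma adjoint_op_bop [simp]: "T \<in> bop X \<Longrightarrow> adj X T \<in> bop X"
 and adjoint_op_hip: "T \<in> bop X \<Longrightarrow> v \<in> l2 X \<Longrightarrow> w \<in> l2 X \<Longrightarrow>
  ip X (T v) w = ip X v (adj X T w)"
proof -
 have *: "\<exists>!S. S \<in> bop X \<and> (\<forall>v\<in>l2 X. \<forall>w\<in>l2 X. ip X (T v) w = ip X v (S w))"
  if T: "T \<in> bop X"
  using adjoint_exists[OF T] adjoint_unique[of _ X] by (metis (no_types, lifting))
 show "T \<in> bop X \<Longrightarrow> adj X T \<in> bop X"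
  "T \<in> bop X \<Longrightarrow> v \<in> l2 X \<Longrightarrow> w \<in> l2 X \<Longrightarrow> ip X (T v) w = ip X v (adj X T w)"
  unfolding adjoint_op_def using theI'[OF *] by blast+
qed

lemma adjoint_entry:
 assumes "T \<in> bop X" "x \<in> X" "y \<in> X"
 shows "adj X T (delta x) y = cnj (T (delta y) x)"
 using adjoint_op_hip[OF assms(1) delta_l2[OF assms(3)] delta_l2[OF assms(2)]] assms
 by (metis hip_delta_left hip_delta_right complex_cnj_cnj)

lemma adjoint_eqI:
 assumes "S \<in> bop X" "T \<in> bop X" "\<And>x y. x \<in> X \<Longrightarrow> y \<in> X \<Longrightarrow> S (delta x) y = cnj (T (delta y) x)"
 shows "adj X T = S"
 using assms by (intro bop_eqI) (auto simp: adjoint_entry)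

lemma adjoint_add:
 assumes "S \<in> bop X" "T \<in> bop X"
 shows "adj X (S \<oplus>\<^bsub>bh X\<^esub> T) = adj X S \<oplus>\<^bsub>bh X\<^esub> adj X T"
 using assms by (intro adjoint_eqI) (auto simp: adjoint_entry)

lemma adjoint_smult:
 assumes "T \<in> bop X"
 shows "adj X (c \<odot>\<^bsub>bh X\<^esub> T) = cnj c \<odot>\<^bsub>bh X\<^esub> adj X T"
 using assms by (intro adjoint_eqI) (auto simp: adjoint_entry)

lemma adjoint_zero: "adj X \<zero>\<^bsub>bh X\<^esub> = \<zero>\<^bsub>bh X\<^esub>"
 by (intro adjoint_eqI) auto

lemma adjoint_adjoint: "T \<in> bop X \<Longrightarrow> adj X (adj X T) = T"
 by (intro adjoint_eqI) (auto simp: adjoint_entry)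

lemma adjoint_bound:
 assumes T: "T \<in> bop X" and C: "\<And>v. v \<in> l2 X \<Longrightarrow> l2norm X (T v) \<le> C * l2norm X v" and w: "w \<in> l2 X"
 shows "l2norm X (adj X T w) \<le> C * l2norm X w"
proof -
 let ?s = "adj X T w"
 have s: "?s \<in> l2 X" by (rule bop_in[OF adjoint_op_bop[OF T] w])
 have "(l2norm X ?s)\<^sup>2 = cmod (ip X ?s ?s)" by (simp add: hip_self norm_power)
 also have "ip X ?s ?s = ip X (T ?s) w" by (rule adjoint_op_hip[OF T s w, symmetric])
 also have "cmod \<dots> \<le> l2norm X (T ?s) * l2norm X w" by (rule hip_bound[OF bop_in[OF T s] w])
 also have "\<dots> \<le> C * l2norm X ?s * l2norm X w" using C[OF s] by (rule mult_right_mono) simp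
 finally have *: "l2norm X ?s * l2norm X ?s \<le> l2norm X ?s * (C * l2norm X w)"
  by (simp add: power2_eq_square mult_ac)
 show ?thesis
 proof (cases "l2norm X ?s = 0")
  case True thus ?thesis using C[OF w] l2norm_nonneg[of X "T w"] by linarith
 next
  case False thus ?thesis using * l2norm_nonneg[of X ?s] by (simp add: mult_le_cancel_left)
 qed
qed

section \<open>Operator bounds, norm closures and continuous linear maps\<close>

definition op_le :: "'x set \<Rightarrow> ('x \<Rightarrow> complex) op \<Rightarrow> real \<Rightarrow> bool" where
 "op_le X T C \<longleftrightarrow> (\<forall>v\<in>l2 X. l2norm X (T v) \<le> C * l2norm X v)"

abbreviation op_diff :: "'x set \<Rightarrow> ('x \<Rightarrow> complex) op \<Rightarrow> ('x \<Rightarrow> complex) op \<Rightarrow> ('x \<Rightarrow> complex) op" where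
 "op_diff X S T \<equiv> S \<oplus>\<^bsub>bh X\<^esub> (-1) \<odot>\<^bsub>bh X\<^esub> T"

lemma op_leD: "op_le X T C \<Longrightarrow> v \<in> l2 X \<Longrightarrow> l2norm X (T v) \<le> C * l2norm X v"
 by (simp add: op_le_def)

lemma op_le_mono: "op_le X T C \<Longrightarrow> C \<le> D \<Longrightarrow> op_le X T D"
 unfolding op_le_def by (meson l2norm_nonneg mult_right_mono order_trans)

lemma op_le_exists: "T \<in> bop X \<Longrightarrow> \<exists>C>0. op_le X T C"
proof -
 assume T: "T \<in> bop X"
 obtain C where "0 \<le> C" "op_le X T C"
  using bop_bound[OF T] unfolding op_le_def by (metis (no_types, lifting))
 thus ?thesis using op_le_mono[of X T C "C + 1"] by (intro exI[of _ "C + 1"]) auto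
qed

lemma op_norm_set: "{v \<in> carrier (ell2 X). hnorm (ell2 X) v \<le> 1} = {v \<in> l2 X. l2norm X v \<le> 1}"
 by simp

lemma op_norm_bdd:
 assumes "T \<in> bop X"
 shows "bdd_above ((\<lambda>v. l2norm X (T v)) ` {v \<in> l2 X. l2norm X v \<le> 1})"
proof -
 obtain C where C: "0 \<le> C" "\<And>v. v \<in> l2 X \<Longrightarrow> l2norm X (T v) \<le> C * l2norm X v"
  using bop_bound[OF assms] by blast
 show ?thesis
 proof (rule bdd_aboveI2)
  fix v assume "v \<in> {v \<in> l2 X. l2norm X v \<le> 1}"
  thus "l2norm X (T v) \<le> C" using C(2)[of v] mult_left_mono[of "l2norm X v" 1 C] C(1) by auto
 qed
qed

lemma op_norm_nonneg: "T \<in> bop X \<Longrightarrow> 0 \<le> op_norm (ell2 X) T"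
 unfolding op_norm_def op_norm_set hnorm_ell2
 by (rule cSUP_upper2[OF op_norm_bdd, of _ _ "\<lambda>x. 0"]) auto

lemma op_le_op_norm:
 assumes T: "T \<in> bop X" shows "op_le X T (op_norm (ell2 X) T)"
 unfolding op_le_def
proof
 fix v assume v: "v \<in> l2 X"
 show "l2norm X (T v) \<le> op_norm (ell2 X) T * l2norm X v"
 proof (cases "l2norm X v = 0")
  case True
  hence "v = (\<lambda>x. 0)" using l2_norm_le0[OF v] by simp
  thus ?thesis by (simp add: bop_zero[OF T])
 next
  case False
  hence p: "l2norm X v > 0" using l2norm_nonneg[of X v] by linarith
  define c where "c = complex_of_real (1 / l2norm X v)"
  have c: "cmod c = 1 / l2norm X v" using p by (simp add: c_def norm_divide)
  have "l2norm X (T (\<lambda>x. c * v x)) \<le> op_norm (ell2 X) T"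
   unfolding op_norm_def op_norm_set hnorm_ell2
   by (rule cSUP_upper[OF _ op_norm_bdd[OF T]]) (use v p in \<open>auto simp: l2_scale l2norm_scale c\<close>)
  thus ?thesis using p by (simp add: bop_scale[OF T v] l2norm_scale c field_simps)
 qed
qed

lemma op_norm_le: "0 \<le> C \<Longrightarrow> op_le X T C \<Longrightarrow> op_norm (ell2 X) T \<le> C"
 unfolding op_norm_def op_norm_set hnorm_ell2
proof (rule cSUP_least)
 show "{v \<in> l2 X. l2norm X v \<le> 1} \<noteq> {}" using l2_zero l2norm_zero by fastforce
 fix v assume "0 \<le> C" "op_le X T C" "v \<in> {v \<in> l2 X. l2norm X v \<le> 1}"
 thus "l2norm X (T v) \<le> C"
  using op_leD[of X T C v] mult_left_mono[of "l2norm X v" 1 C] by auto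
qed

lemma op_le_add:
 assumes "S \<in> bop X" "T \<in> bop X" "op_le X S C" "op_le X T D"
 shows "op_le X (S \<oplus>\<^bsub>bh X\<^esub> T) (C + D)"
 unfolding op_le_def
proof
 fix v assume v: "v \<in> l2 X"
 show "l2norm X ((S \<oplus>\<^bsub>bh X\<^esub> T) v) \<le> (C + D) * l2norm X v"
  using l2_add(2)[OF bop_in[OF assms(1) v] bop_in[OF assms(2) v]] op_leD[OF assms(3) v] op_leD[OF assms(4) v] v
  by (simp add: distrib_right)
qed

lemma op_le_mult:
 assumes "S \<in> bop X" "T \<in> bop X" "op_le X S C" "op_le X T D" "0 \<le> C"
 shows "op_le X (S \<otimes>\<^bsub>bh X\<^esub> T) (C * D)"
 unfolding op_le_def
proof
 fix v assume v: "v \<in> l2 X"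
 show "l2norm X ((S \<otimes>\<^bsub>bh X\<^esub> T) v) \<le> (C * D) * l2norm X v"
  using op_leD[OF assms(3) bop_in[OF assms(2) v]] mult_left_mono[OF op_leD[OF assms(4) v] assms(5)] v
  by (simp add: mult.assoc)
qed

lemma op_le_smult: "op_le X T C \<Longrightarrow> op_le X (c \<odot>\<^bsub>bh X\<^esub> T) (cmod c * C)"
 unfolding op_le_def by (auto simp: l2norm_scale mult.assoc intro!: mult_left_mono)

lemma op_le_diff:
 assumes "S \<in> bop X" "T \<in> bop X" "op_le X S C" "op_le X T D"
 shows "op_le X (op_diff X S T) (C + D)"
 using op_le_add[OF assms(1) _ assms(3) op_le_smult[OF assms(4), of "-1"]] assms by simp

lemma op_le_adjoint: "T \<in> bop X \<Longrightarrow> op_le X T C \<Longrightarrow> op_le X (adj X T) C"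
 unfolding op_le_def using adjoint_bound by blast

lemma op_le_one: "op_le X \<one>\<^bsub>bh X\<^esub> 1"
 by (simp add: op_le_def)

lemma op_le_zeroD:
 assumes T: "T \<in> bop X" and "\<And>e. e > 0 \<Longrightarrow> op_le X T e"
 shows "T = \<zero>\<^bsub>bh X\<^esub>"
proof (rule bop_eq[of _ X])
 fix v x assume v: "v \<in> l2 X"
 have "T v = (\<lambda>x. 0)"
 proof (rule l2_norm_le0[OF bop_in[OF T v]], rule field_le_epsilon)
  fix e :: real assume e: "e > 0"
  have p: "l2norm X v + 1 > 0" using l2norm_nonneg[of X v] by linarith
  have "l2norm X (T v) \<le> e / (l2norm X v + 1) * l2norm X v"
   by (rule op_leD[OF assms(2) v]) (use e p in simp)
  also have "\<dots> \<le> e" using e p by (simp add: field_simps)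
  finally show "l2norm X (T v) \<le> 0 + e" by simp
 qed
 thus "T v x = \<zero>\<^bsub>bh X\<^esub> v x" using v by simp
qed (use T in \<open>auto simp: bop_ext\<close>)

lemma op_diff_eq0:
 assumes "S \<in> bop X" "T \<in> bop X" "op_diff X S T = \<zero>\<^bsub>bh X\<^esub>"
 shows "S = T"
proof (rule bop_eq)
 fix v x assume "v \<in> l2 X"
 thus "S v x = T v x" using fun_cong[OF fun_cong[OF assms(3), of v], of x] by simp
qed (use assms in \<open>auto simp: bop_ext\<close>)

text \<open>From here on, distances are expressed by \<open>op_le\<close>, an upper bound rather
  than a supremum, so that estimates add and multiply without first bounding the set under the
  supremum. Passing from \<le> back to < costs half of e.\<close>

lemma op_closure_iff:
 assumes "S \<subseteq> bop X"
 shows "T \<in> op_closure (ell2 X) S \<longleftrightarrow> T \<in> bop X \<and> (\<forall>e>0. \<exists>R\<in>S. op_le X (op_diff X T R) e)"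
proof -
 have "(\<forall>e>0. \<exists>R\<in>S. op_norm (ell2 X) (op_diff X T R) < e) \<longleftrightarrow> (\<forall>e>0. \<exists>R\<in>S. op_le X (op_diff X T R) e)"
  if T: "T \<in> bop X"
 proof (intro iffI allI impI)
  fix e :: real assume "\<forall>e>0. \<exists>R\<in>S. op_norm (ell2 X) (op_diff X T R) < e" "e > 0"
  then obtain R where R: "R \<in> S" "op_norm (ell2 X) (op_diff X T R) < e" by blast
  have "op_diff X T R \<in> bop X" using R(1) assms T by auto
  from op_le_mono[OF op_le_op_norm[OF this], of e] have "op_le X (op_diff X T R) e" using R by simp
  thus "\<exists>R\<in>S. op_le X (op_diff X T R) e" using R by blast
 next
  fix e :: real assume "\<forall>e>0. \<exists>R\<in>S. op_le X (op_diff X T R) e" "e > 0"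
  then obtain R where R: "R \<in> S" "op_le X (op_diff X T R) (e / 2)" using half_gt_zero by blast
  hence "op_norm (ell2 X) (op_diff X T R) < e" using op_norm_le[OF _ R(2)] \<open>e > 0\<close> by simp
  thus "\<exists>R\<in>S. op_norm (ell2 X) (op_diff X T R) < e" using R by blast
 qed
 thus ?thesis by (auto simp: op_closure_def)
qed

lemma op_closure_bop: "op_closure (ell2 X) S \<subseteq> bop X"
 by (auto simp: op_closure_def)

lemma op_closure_incl:
 assumes "S \<subseteq> bop X" shows "S \<subseteq> op_closure (ell2 X) S"
proof
 fix T assume T: "T \<in> S"
 have "op_le X (op_diff X T T) e" if "e > 0" for e
  using that by (auto simp: op_le_def)
 thus "T \<in> op_closure (ell2 X) S" using T assms by (auto simp: op_closure_iff)
qed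

definition op_space :: "'x set \<Rightarrow> ('x \<Rightarrow> complex) op set \<Rightarrow> bool" where
 "op_space X A \<longleftrightarrow> A \<subseteq> bop X \<and> \<zero>\<^bsub>bh X\<^esub> \<in> A \<and> (\<forall>S\<in>A. \<forall>T\<in>A. S \<oplus>\<^bsub>bh X\<^esub> T \<in> A) \<and>
   (\<forall>c. \<forall>T\<in>A. c \<odot>\<^bsub>bh X\<^esub> T \<in> A)"

definition op_alg :: "'x set \<Rightarrow> ('x \<Rightarrow> complex) op set \<Rightarrow> bool" where
 "op_alg X A \<longleftrightarrow> op_space X A \<and> \<one>\<^bsub>bh X\<^esub> \<in> A \<and> (\<forall>S\<in>A. \<forall>T\<in>A. S \<otimes>\<^bsub>bh X\<^esub> T \<in> A)"

text \<open>Continuity is recorded on A alone because a *-homomorphism is given only on its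
  C*-algebra. The bound is in terms of \<open>op_le\<close>, with one constant for all T in
  A.\<close>

definition bounded_on :: "'x set \<Rightarrow> 'y set \<Rightarrow> ('x \<Rightarrow> complex) op set \<Rightarrow> (('x \<Rightarrow> complex) op \<Rightarrow> ('y \<Rightarrow> complex) op) \<Rightarrow> bool" where
 "bounded_on X Y A \<phi> \<longleftrightarrow> linear_on (bh X) (bh Y) A \<phi> \<and>
   (\<exists>C\<ge>0. \<forall>T\<in>A. \<forall>e\<ge>0. op_le X T e \<longrightarrow> op_le Y (\<phi> T) (C * e))"

lemma op_spaceD:
 assumes "op_space X A"
 shows "T \<in> A \<Longrightarrow> T \<in> bop X" "\<zero>\<^bsub>bh X\<^esub> \<in> A" "S \<in> A \<Longrightarrow> T \<in> A \<Longrightarrow> S \<oplus>\<^bsub>bh X\<^esub> T \<in> A"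
  "T \<in> A \<Longrightarrow> c \<odot>\<^bsub>bh X\<^esub> T \<in> A" "S \<in> A \<Longrightarrow> T \<in> A \<Longrightarrow> op_diff X S T \<in> A"
 using assms by (auto simp: op_space_def)

lemma op_space_bop: "op_space X (bop X)" by (auto simp: op_space_def)

lemma bounded_on_diff:
 assumes "linear_on (bh X) (bh Y) A \<phi>" "op_space X A" "S \<in> A" "T \<in> A"
 shows "\<phi> (op_diff X S T) = op_diff Y (\<phi> S) (\<phi> T)"
 using assms op_spaceD(4)[OF assms(2) assms(4)] by (simp add: linear_on_def)

lemma bounded_on_closure:
 assumes \<phi>: "bounded_on X Y A \<phi>" and A: "op_space X A" and S: "S \<subseteq> A" "\<phi> ` S \<subseteq> S'" "S' \<subseteq> bop Y"
  and T: "T \<in> A" "T \<in> op_closure (ell2 X) S"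
 shows "\<phi> T \<in> op_closure (ell2 Y) S'"
proof -
 have SX: "S \<subseteq> bop X" using S A by (auto simp: op_space_def)
 have lin: "linear_on (bh X) (bh Y) A \<phi>" using \<phi> by (simp add: bounded_on_def)
 obtain C where C: "C \<ge> 0" "\<And>T e. T \<in> A \<Longrightarrow> e \<ge> 0 \<Longrightarrow> op_le X T e \<Longrightarrow> op_le Y (\<phi> T) (C * e)"
  using \<phi> unfolding bounded_on_def by blast
 have "\<exists>R\<in>S'. op_le Y (op_diff Y (\<phi> T) R) e" if e: "e > 0" for e
 proof -
  have p: "e / (C + 1) > 0" using e C by simp
  then obtain R where R: "R \<in> S" "op_le X (op_diff X T R) (e / (C + 1))"
   using T(2) by (auto simp: op_closure_iff[OF SX])
  have RA: "R \<in> A" using R S by blast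
  have "op_le Y (\<phi> (op_diff X T R)) (C * (e / (C + 1)))"
   using p by (intro C(2) op_spaceD(5)[OF A] T RA R) auto
  hence "op_le Y (op_diff Y (\<phi> T) (\<phi> R)) (C * (e / (C + 1)))"
   unfolding bounded_on_diff[OF lin A T(1) RA] .
  hence "op_le Y (op_diff Y (\<phi> T) (\<phi> R)) e"
   by (rule op_le_mono) (use e C in \<open>simp add: field_simps\<close>)
  thus ?thesis using R S by blast
 qed
 moreover have "\<phi> T \<in> bop Y" using lin T by (simp add: linear_on_def)
 ultimately show ?thesis by (simp add: op_closure_iff[OF S(3)])
qed

lemma op_closure_zero: "op_closure (ell2 X) {\<zero>\<^bsub>bh X\<^esub>} = {\<zero>\<^bsub>bh X\<^esub>}"
proof (rule subset_antisym; rule subsetI)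
 fix T assume "T \<in> op_closure (ell2 X) {\<zero>\<^bsub>bh X\<^esub>}"
 hence T: "T \<in> bop X" "\<And>e. e > 0 \<Longrightarrow> op_le X (op_diff X T \<zero>\<^bsub>bh X\<^esub>) e"
  using op_closure_iff[of "{\<zero>\<^bsub>bh X\<^esub>}" X T] by auto
 have "op_diff X T \<zero>\<^bsub>bh X\<^esub> = \<zero>\<^bsub>bh X\<^esub>"
  using T by (intro op_le_zeroD) auto
 thus "T \<in> {\<zero>\<^bsub>bh X\<^esub>}" using op_diff_eq0[OF T(1) BH_zero_closed] by simp
qed (use op_closure_incl[of "{\<zero>\<^bsub>bh X\<^esub>}" X] in auto)

text \<open>The difference of the two maps is again bounded and sends S into {0}, which is norm
  closed.\<close>

lemma bounded_on_eq:
 assumes \<phi>: "bounded_on X Y A \<phi>" and \<psi>: "bounded_on X Y A \<psi>" and A: "op_space X A" and S: "S \<subseteq> A"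
  and eq: "\<And>T. T \<in> S \<Longrightarrow> \<phi> T = \<psi> T" and T: "T \<in> A" "T \<in> op_closure (ell2 X) S"
 shows "\<phi> T = \<psi> T"
proof -
 let ?d = "\<lambda>T. op_diff Y (\<phi> T) (\<psi> T)"
 have SX: "S \<subseteq> bop X" using S A by (auto simp: op_space_def)
 have l: "linear_on (bh X) (bh Y) A \<phi>" "linear_on (bh X) (bh Y) A \<psi>"
  using \<phi> \<psi> by (auto simp: bounded_on_def)
 obtain C where C: "C \<ge> 0" "\<And>T e. T \<in> A \<Longrightarrow> e \<ge> 0 \<Longrightarrow> op_le X T e \<Longrightarrow> op_le Y (\<phi> T) (C * e)"
  using \<phi> unfolding bounded_on_def by blast
 obtain D where D: "D \<ge> 0" "\<And>T e. T \<in> A \<Longrightarrow> e \<ge> 0 \<Longrightarrow> op_le X T e \<Longrightarrow> op_le Y (\<psi> T) (D * e)"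
  using \<psi> unfolding bounded_on_def by blast
 have bd: "\<phi> T \<in> bop Y" "\<psi> T \<in> bop Y" if "T \<in> A" for T using l that by (auto simp: linear_on_def)
 have lin: "linear_on (bh X) (bh Y) A ?d"
  using l bd unfolding linear_on_def
  by (auto intro!: bop_eq[of _ Y] simp: algebra_simps)
 have "bounded_on X Y A ?d"
  unfolding bounded_on_def
 proof (intro conjI exI[of _ "C + D"] ballI allI impI lin)
  fix T and e :: real assume "T \<in> A" "0 \<le> e" "op_le X T e"
  thus "op_le Y (?d T) ((C + D) * e)"
   unfolding distrib_right by (intro op_le_diff bd C D)
 qed (use C D in auto)
 hence "?d T \<in> op_closure (ell2 Y) {\<zero>\<^bsub>bh Y\<^esub>}"
 proof (rule bounded_on_closure[OF _ A S _ _ T])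
  show "?d ` S \<subseteq> {\<zero>\<^bsub>bh Y\<^esub>}"
  proof (rule image_subsetI)
   fix T assume "T \<in> S"
   thus "?d T \<in> {\<zero>\<^bsub>bh Y\<^esub>}" using eq[of T] by (auto intro!: bop_eq[of _ Y])
  qed
 qed auto
 hence "?d T = \<zero>\<^bsub>bh Y\<^esub>" by (simp add: op_closure_zero)
 thus ?thesis by (rule op_diff_eq0[OF bd(1)[OF T(1)] bd(2)[OF T(1)]])
qed

lemma op_closure_mono: "S \<subseteq> S' \<Longrightarrow> op_closure (ell2 X) S \<subseteq> op_closure (ell2 X) S'"
 by (fastforce simp: op_closure_def)

lemma op_closure_closure:
 assumes S: "S \<subseteq> bop X"
 shows "op_closure (ell2 X) (op_closure (ell2 X) S) = op_closure (ell2 X) S"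
proof
 show "op_closure (ell2 X) (op_closure (ell2 X) S) \<subseteq> op_closure (ell2 X) S"
 proof
  fix T assume T: "T \<in> op_closure (ell2 X) (op_closure (ell2 X) S)"
  hence TX: "T \<in> bop X" using op_closure_bop by blast
  have "\<exists>R\<in>S. op_le X (op_diff X T R) e" if e: "e > 0" for e
  proof -
   obtain Q where Q: "Q \<in> op_closure (ell2 X) S" "op_le X (op_diff X T Q) (e/2)"
    using T half_gt_zero[OF e] unfolding op_closure_iff[OF op_closure_bop] by blast
   then obtain R where R: "R \<in> S" "op_le X (op_diff X Q R) (e/2)"
    using half_gt_zero[OF e] unfolding op_closure_iff[OF S] by blast
   have QR: "Q \<in> bop X" "R \<in> bop X" using Q R S op_closure_bop by blast+
   have "op_diff X T R = op_diff X T Q \<oplus>\<^bsub>bh X\<^esub> op_diff X Q R"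
    by (rule bop_eq[of _ X]) auto
   hence "op_le X (op_diff X T R) (e/2 + e/2)"
    using op_le_add[OF _ _ Q(2) R(2)] TX QR by simp
   thus ?thesis using R by auto
  qed
  thus "T \<in> op_closure (ell2 X) S" using TX by (simp add: op_closure_iff[OF S])
 qed
qed (rule op_closure_incl[OF op_closure_bop])

lemma op_closure_space:
 assumes A: "op_space X A" shows "op_space X (op_closure (ell2 X) A)"
proof -
 let ?A = "op_closure (ell2 X) A"
 have AX: "A \<subseteq> bop X" using A by (auto simp: op_space_def)
 have 1: "S \<oplus>\<^bsub>bh X\<^esub> T \<in> ?A" if ST: "S \<in> ?A" "T \<in> ?A" for S T
 proof -
  have SX: "S \<in> bop X" "T \<in> bop X" using ST op_closure_bop by blast+
  have "\<exists>R\<in>A. op_le X (op_diff X (S \<oplus>\<^bsub>bh X\<^esub> T) R) e" if e: "e > 0" for e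
  proof -
   obtain P where P: "P \<in> A" "op_le X (op_diff X S P) (e/2)"
    using ST(1) half_gt_zero[OF e] unfolding op_closure_iff[OF AX] by blast
   obtain Q where Q: "Q \<in> A" "op_le X (op_diff X T Q) (e/2)"
    using ST(2) half_gt_zero[OF e] unfolding op_closure_iff[OF AX] by blast
   have PQ: "P \<in> bop X" "Q \<in> bop X" using P Q AX by blast+
   have "op_diff X (S \<oplus>\<^bsub>bh X\<^esub> T) (P \<oplus>\<^bsub>bh X\<^esub> Q) = op_diff X S P \<oplus>\<^bsub>bh X\<^esub> op_diff X T Q"
    by (rule bop_eq[of _ X]) auto
   hence "op_le X (op_diff X (S \<oplus>\<^bsub>bh X\<^esub> T) (P \<oplus>\<^bsub>bh X\<^esub> Q)) (e/2 + e/2)"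
    using op_le_add[OF _ _ P(2) Q(2)] SX PQ by simp
   thus ?thesis using op_spaceD(3)[OF A P(1) Q(1)] by auto
  qed
  thus ?thesis using SX by (simp add: op_closure_iff[OF AX])
 qed
 have 2: "c \<odot>\<^bsub>bh X\<^esub> T \<in> ?A" if T: "T \<in> ?A" for c T
 proof (rule bounded_on_closure[OF _ op_space_bop AX _ AX _ T])
  show "bounded_on X X (bop X) (\<lambda>T. c \<odot>\<^bsub>bh X\<^esub> T)"
   unfolding bounded_on_def linear_on_def
   by (auto intro!: bop_eq[of _ X] exI[of _ "cmod c"] op_le_smult simp: algebra_simps)
  show "(\<odot>\<^bsub>bh X\<^esub>) c ` A \<subseteq> A" using op_spaceD(4)[OF A] by blast
  show "T \<in> bop X" using T op_closure_bop by blast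
 qed
 show ?thesis
  unfolding op_space_def using 1 2 op_closure_incl[OF AX] op_closure_bop op_spaceD(2)[OF A] by blast
qed

lemma bounded_on_lmult:
 assumes S: "S \<in> bop X" shows "bounded_on X X (bop X) (\<lambda>T. S \<otimes>\<^bsub>bh X\<^esub> T)"
proof -
 obtain C where C: "C > 0" "op_le X S C" using op_le_exists[OF S] by blast
 show ?thesis
  unfolding bounded_on_def linear_on_def
 proof (intro conjI exI[of _ C] ballI allI impI)
  fix T and e :: real assume "T \<in> bop X" "op_le X T e"
  thus "op_le X (S \<otimes>\<^bsub>bh X\<^esub> T) (C * e)" using op_le_mult[OF S _ C(2)] C by auto
 qed (use S C in \<open>auto intro!: bop_eq[of _ X] simp: bop_add bop_scale bop_in\<close>)
qed

lemma bounded_on_rmult: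
 assumes S: "S \<in> bop X" shows "bounded_on X X (bop X) (\<lambda>T. T \<otimes>\<^bsub>bh X\<^esub> S)"
proof -
 obtain C where C: "C > 0" "op_le X S C" using op_le_exists[OF S] by blast
 show ?thesis
  unfolding bounded_on_def linear_on_def
 proof (intro conjI exI[of _ C] ballI allI impI)
  fix T and e :: real assume "T \<in> bop X" "op_le X T e" "0 \<le> e"
  thus "op_le X (T \<otimes>\<^bsub>bh X\<^esub> S) (C * e)"
   using op_le_mult[OF _ S _ C(2), of T e] by (simp add: mult.commute)
 qed (use S C in \<open>auto intro!: bop_eq[of _ X] simp: bop_in\<close>)
qed

text \<open>Multiplication is continuous in each factor separately: first the right factor runs
  through the closure with the left one in A, then the left factor does. The second step lands in a
  double closure.\<close>

lemma op_closure_mult: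
 assumes A: "op_alg X A" and ST: "S \<in> op_closure (ell2 X) A" "T \<in> op_closure (ell2 X) A"
 shows "S \<otimes>\<^bsub>bh X\<^esub> T \<in> op_closure (ell2 X) A"
proof -
 have AX: "A \<subseteq> bop X" using A by (auto simp: op_alg_def op_space_def)
 have SX: "S \<in> bop X" "T \<in> bop X" using ST op_closure_bop by blast+
 have 1: "P \<otimes>\<^bsub>bh X\<^esub> T \<in> op_closure (ell2 X) A" if P: "P \<in> A" for P
  using P A AX SX by (intro bounded_on_closure[OF bounded_on_lmult op_space_bop AX _ AX _ ST(2)])
   (auto simp: op_alg_def)
 have "S \<otimes>\<^bsub>bh X\<^esub> T \<in> op_closure (ell2 X) (op_closure (ell2 X) A)"
  using 1 SX by (intro bounded_on_closure[OF bounded_on_rmult op_space_bop AX _ op_closure_bop _ ST(1)]) auto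
 thus ?thesis by (simp add: op_closure_closure[OF AX])
qed

lemma op_closure_alg: "op_alg X A \<Longrightarrow> op_alg X (op_closure (ell2 X) A)"
 using op_closure_mult[of X A] op_closure_space[of X A] op_closure_incl[of A X]
 by (auto simp: op_alg_def op_space_def)

lemma op_closure_adjoint:
 assumes S: "S \<subseteq> bop X" "\<And>T. T \<in> S \<Longrightarrow> adj X T \<in> S" and T: "T \<in> op_closure (ell2 X) S"
 shows "adj X T \<in> op_closure (ell2 X) S"
proof -
 have TX: "T \<in> bop X" using T op_closure_bop by blast
 have "\<exists>R\<in>S. op_le X (op_diff X (adj X T) R) e" if e: "e > 0" for e
 proof -
  obtain R where R: "R \<in> S" "op_le X (op_diff X T R) e"
   using T e unfolding op_closure_iff[OF S(1)] by blast
  have RX: "R \<in> bop X" using R S by blast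
  have "adj X (op_diff X T R) = op_diff X (adj X T) (adj X R)"
   using TX RX by (simp add: adjoint_add adjoint_smult)
  hence "op_le X (op_diff X (adj X T) (adj X R)) e"
   using op_le_adjoint[OF _ R(2)] TX RX by simp
  thus ?thesis using S(2)[OF R(1)] by blast
 qed
 thus ?thesis using TX by (simp add: op_closure_iff[OF S(1)])
qed

subsection \<open>Linear spans\<close>

lemma lin_span_space: "S \<subseteq> bop X \<Longrightarrow> op_space X (lin_span (bh X) S)"
proof -
 assume S: "S \<subseteq> bop X"
 have "T \<in> bop X" if "T \<in> lin_span (bh X) S" for T
  using that by induction (use S in auto)
 thus ?thesis unfolding op_space_def by (auto intro: lin_span.intros)
qed

lemma lin_span_least: "op_space X A \<Longrightarrow> S \<subseteq> A \<Longrightarrow> lin_span (bh X) S \<subseteq> A"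
proof
 fix T assume A: "op_space X A" "S \<subseteq> A" and "T \<in> lin_span (bh X) S"
 from this(3) show "T \<in> A" by induction (use A in \<open>auto simp: op_space_def\<close>)
qed

lemma lin_span_incl': "S \<subseteq> lin_span V S"
 by (auto intro: lin_span.intros)

lemma linear_on_eq_span:
 assumes "linear_on (bh X) (bh Y) (lin_span (bh X) S) \<phi>"
  "linear_on (bh X) (bh Y) (lin_span (bh X) S) \<psi>"
  "\<And>T. T \<in> S \<Longrightarrow> \<phi> T = \<psi> T" and S: "S \<subseteq> bop X" and T: "T \<in> lin_span (bh X) S"
 shows "\<phi> T = \<psi> T"
 using T
proof induction
 case lin_span_zero
 \<comment> \<open>\<open>linear_on\<close> says nothing about zero; its image is found from
   homogeneity at the scalar 0.\<close>
 have z: "0 \<odot>\<^bsub>bh X\<^esub> \<zero>\<^bsub>bh X\<^esub> = \<zero>\<^bsub>bh X\<^esub>" by (rule bop_eq[of _ X]) auto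
 have "g \<zero>\<^bsub>bh X\<^esub> = \<zero>\<^bsub>bh Y\<^esub>" if "linear_on (bh X) (bh Y) (lin_span (bh X) S) g" for g
 proof -
  have "g (0 \<odot>\<^bsub>bh X\<^esub> \<zero>\<^bsub>bh X\<^esub>) = 0 \<odot>\<^bsub>bh Y\<^esub> g \<zero>\<^bsub>bh X\<^esub>"
   using that lin_span.lin_span_zero unfolding linear_on_def by blast
  also have "\<dots> = \<zero>\<^bsub>bh Y\<^esub>" by (rule bop_eq[of _ Y]) auto
  finally show ?thesis by (simp only: z)
 qed
 from this[OF assms(1)] this[OF assms(2)] show ?case by simp
qed (use assms in \<open>auto simp: linear_on_def\<close>)

lemma lin_span_alg:
 assumes S: "S \<subseteq> bop X" and 1: "\<one>\<^bsub>bh X\<^esub> \<in> lin_span (bh X) S"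
  and m: "\<And>a b. a \<in> S \<Longrightarrow> b \<in> S \<Longrightarrow> a \<otimes>\<^bsub>bh X\<^esub> b \<in> lin_span (bh X) S"
 shows "op_alg X (lin_span (bh X) S)"
proof -
 let ?L = "lin_span (bh X) S"
 have L: "op_space X ?L" by (rule lin_span_space[OF S])
 have mem: "T \<in> bop X" if "T \<in> ?L" for T using L that by (auto simp: op_space_def)
 have z: "\<zero>\<^bsub>bh X\<^esub> \<otimes>\<^bsub>bh X\<^esub> a = \<zero>\<^bsub>bh X\<^esub>" "a \<otimes>\<^bsub>bh X\<^esub> \<zero>\<^bsub>bh X\<^esub> = \<zero>\<^bsub>bh X\<^esub>"
  if "a \<in> bop X" for a
  using that by (auto intro!: bop_eq[of _ X] simp: bop_in bop_zero)
 have ad: "(a \<oplus>\<^bsub>bh X\<^esub> b) \<otimes>\<^bsub>bh X\<^esub> c = a \<otimes>\<^bsub>bh X\<^esub> c \<oplus>\<^bsub>bh X\<^esub> b \<otimes>\<^bsub>bh X\<^esub> c"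
   "c \<otimes>\<^bsub>bh X\<^esub> (a \<oplus>\<^bsub>bh X\<^esub> b) = c \<otimes>\<^bsub>bh X\<^esub> a \<oplus>\<^bsub>bh X\<^esub> c \<otimes>\<^bsub>bh X\<^esub> b"
   "(s \<odot>\<^bsub>bh X\<^esub> b) \<otimes>\<^bsub>bh X\<^esub> c = s \<odot>\<^bsub>bh X\<^esub> (b \<otimes>\<^bsub>bh X\<^esub> c)"
   "c \<otimes>\<^bsub>bh X\<^esub> (s \<odot>\<^bsub>bh X\<^esub> b) = s \<odot>\<^bsub>bh X\<^esub> (c \<otimes>\<^bsub>bh X\<^esub> b)"
  if "a \<in> bop X" "b \<in> bop X" "c \<in> bop X" for a b c s
  using that by (auto intro!: bop_eq[of _ X] simp: bop_in bop_add bop_scale)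
 have 2: "a \<otimes>\<^bsub>bh X\<^esub> b \<in> ?L" if a: "a \<in> ?L" and b: "b \<in> S" for a b
  using a
 proof induction
  case lin_span_zero
  have "b \<in> bop X" using b S by blast
  thus ?case by (simp add: z lin_span.lin_span_zero)
 next
  case (lin_span_add c d)
  thus ?case using b S mem by (subst ad) (auto intro: lin_span.intros)
 next
  case (lin_span_smult c d)
  thus ?case using b S mem by (subst ad) (auto intro: lin_span.intros)
 qed (use b m in auto)
 have "a \<otimes>\<^bsub>bh X\<^esub> b \<in> ?L" if a: "a \<in> ?L" and b: "b \<in> ?L" for a b
  using b
 proof induction
  case lin_span_zero
  have "a \<in> bop X" using a mem by blast
  thus ?case by (simp add: z lin_span.lin_span_zero)
 next
  case (lin_span_add c d)
  thus ?case using a mem by (subst ad) (auto intro: lin_span.intros)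
 next
  case (lin_span_smult c d)
  thus ?case using a mem by (subst ad) (auto intro: lin_span.intros)
 qed (use a 2 in auto)
 thus ?thesis using L 1 by (auto simp: op_alg_def)
qed

subsection \<open>Automatic contractivity of *-homomorphisms\<close>

text \<open>The partial sum 1 + c + ... + c^(n-1) of the geometric series, in Horner form. With c on
  the right, the (n+1)-st sum sends v to the n-th sum at c v, plus v, which is the identity that the
  limit inherits.\<close>

primrec neumann_sum :: "'x set \<Rightarrow> ('x \<Rightarrow> complex) op \<Rightarrow> nat \<Rightarrow> ('x \<Rightarrow> complex) op" where
 "neumann_sum X c 0 = \<zero>\<^bsub>bh X\<^esub>"
| "neumann_sum X c (Suc n) = (neumann_sum X c n \<otimes>\<^bsub>bh X\<^esub> c) \<oplus>\<^bsub>bh X\<^esub> \<one>\<^bsub>bh X\<^esub>"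

lemma cstar_algebra_alg:
 assumes "cstar_algebra (ell2 X) A" shows "op_alg X A"
proof -
 have A: "A \<subseteq> bop X" "\<one>\<^bsub>bh X\<^esub> \<in> A" "\<And>c T. T \<in> A \<Longrightarrow> c \<odot>\<^bsub>bh X\<^esub> T \<in> A"
  using assms by (auto simp: cstar_algebra_def)
 have "\<zero>\<^bsub>bh X\<^esub> = 0 \<odot>\<^bsub>bh X\<^esub> \<one>\<^bsub>bh X\<^esub>" by (rule bop_eq[of _ X]) auto
 hence "\<zero>\<^bsub>bh X\<^esub> \<in> A" using A by simp
 thus ?thesis using assms by (auto simp: cstar_algebra_def op_alg_def op_space_def)
qed

text \<open>The limit of the series is formed vector by vector. The geometric rate is uniform on the
  unit ball, so the partial sums also converge in norm; as A is norm closed, the limit stays in A.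
  This last point matters, since the inverse is later mapped by a *-homomorphism that is defined on
  A only.\<close>

lemma neumann_inverse:
 assumes A: "cstar_algebra (ell2 X) A" and c: "c \<in> A" "op_le X c q" and q: "0 \<le> q" "q < 1"
 shows "\<exists>d\<in>A. d \<otimes>\<^bsub>bh X\<^esub> (op_diff X \<one>\<^bsub>bh X\<^esub> c) = \<one>\<^bsub>bh X\<^esub>"
proof -
 have alg: "op_alg X A" by (rule cstar_algebra_alg[OF A])
 have AX: "A \<subseteq> bop X" using A by (simp add: cstar_algebra_def)
 have cX: "c \<in> bop X" using c AX by blast
 let ?p = "neumann_sum X c" and ?K = "1 / (1 - q)"
 have K: "?K > 0" using q by simp
 have pA: "?p n \<in> A" for n by (induction n) (use alg c in \<open>auto simp: op_alg_def op_space_def\<close>)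
 have pX: "?p n \<in> bop X" for n using pA AX by blast
 have ps: "?p (Suc n) v = (\<lambda>x. ?p n (c v) x + v x)" if "v \<in> l2 X" for n v
  using that by simp
 \<comment> \<open>\<open>?K\<close> is the sum of the scalar series, characterised by K q + 1 = K,
   hence the same bound serves for every partial sum.\<close>
 have ple: "op_le X (?p n) ?K" for n
 proof (induction n)
  case 0 thus ?case using K by (simp add: op_le_def)
 next
  case (Suc n)
  have "op_le X (?p (Suc n)) (?K * q + 1)"
   unfolding neumann_sum.simps
   using K by (intro op_le_add op_le_mult op_le_one Suc c(2) BH_mult_closed BH_one_closed pX cX) auto
  moreover have "?K * q + 1 = ?K" using q by (simp add: field_simps)
  ultimately show ?case by metis
 qed
 have it: "(c ^^ n) v \<in> l2 X \<and> l2norm X ((c ^^ n) v) \<le> q ^ n * l2norm X v" if v: "v \<in> l2 X" for n v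
 proof (induction n)
  case (Suc n)
  thus ?case
   using bop_in[OF cX, of "(c ^^ n) v"] op_leD[OF c(2), of "(c ^^ n) v"]
    mult_left_mono[of "l2norm X ((c ^^ n) v)" "q ^ n * l2norm X v" q] q by (auto simp: mult.assoc)
 qed (use v in simp)
 \<comment> \<open>The difference of two partial sums is a partial sum applied to a power of c,
   which has norm at most K q^n.\<close>
 have padd: "?p (n + k) v = (\<lambda>x. ?p k ((c ^^ n) v) x + ?p n v x)" if "v \<in> l2 X" for n k v
  using that
 proof (induction n arbitrary: v)
  case (Suc n)
  have "?p (Suc n + k) v = (\<lambda>x. ?p (n + k) (c v) x + v x)" using ps[OF Suc.prems, of "n + k"] by simp
  also have "\<dots> = (\<lambda>x. ?p k ((c ^^ n) (c v)) x + ?p n (c v) x + v x)"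
   by (simp add: Suc.IH[OF bop_in[OF cX Suc.prems]])
  also have "\<dots> = (\<lambda>x. ?p k ((c ^^ Suc n) v) x + ?p (Suc n) v x)"
   by (simp only: ps[OF Suc.prems] funpow_Suc_right o_apply add.assoc)
  finally show ?case .
 qed simp
 have near: "l2norm X (\<lambda>x. ?p m v x - ?p N v x) \<le> ?K * q ^ N * l2norm X v" if v: "v \<in> l2 X" and "m \<ge> N" for v m N
 proof -
  obtain k where m: "m = N + k" using \<open>m \<ge> N\<close> le_Suc_ex by blast
  have "(\<lambda>x. ?p m v x - ?p N v x) = ?p k ((c ^^ N) v)" unfolding m padd[OF v] by simp
  hence "l2norm X (\<lambda>x. ?p m v x - ?p N v x) \<le> ?K * l2norm X ((c ^^ N) v)"
   using op_leD[OF ple, of "(c ^^ N) v" k] it[OF v] by simp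
  also have "\<dots> \<le> ?K * (q ^ N * l2norm X v)" using it[OF v, of N] K by (intro mult_left_mono) auto
  finally show ?thesis by (simp only: mult.assoc)
 qed
 \<comment> \<open>Both sums are compared with the N-th one; this is the origin of the factor
   2.\<close>
 have near2: "l2norm X (\<lambda>x. ?p m v x - ?p n v x) \<le> 2 * (?K * q ^ N) * l2norm X v"
  if v: "v \<in> l2 X" and "m \<ge> N" "n \<ge> N" for v m n N
  using l2_triangle3[OF bop_in[OF pX[of m] v] bop_in[OF pX[of N] v] bop_in[OF pX[of n] v]]
   near[OF v \<open>m \<ge> N\<close>] near[OF v \<open>n \<ge> N\<close>] l2norm_minus_commute[of X "?p n v" "?p N v"] by linarith
 have small: "\<exists>N. 2 * (?K * q ^ N) * B < e" if "e > 0" "B \<ge> 0" for e B :: real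
 proof -
  have "(\<lambda>N. 2 * (?K * q ^ N) * B) \<longlonglongrightarrow> 2 * (?K * 0) * B"
   using q by (intro tendsto_intros LIMSEQ_power_zero) auto
  hence "\<forall>\<^sub>F N in sequentially. 2 * (?K * q ^ N) * B < e"
   using that by (intro order_tendstoD(2)[of _ "2 * (?K * 0) * B"]) auto
  thus ?thesis by (auto simp: eventually_sequentially)
 qed
 have lim: "\<exists>g\<in>l2 X. (\<forall>x. (\<lambda>n. ?p n v x) \<longlonglongrightarrow> g x) \<and>
   (\<forall>N n. n \<ge> N \<longrightarrow> l2norm X (\<lambda>x. ?p n v x - g x) \<le> 2 * (?K * q ^ N) * l2norm X v)" if v: "v \<in> l2 X" for v
 proof (rule l2_complete[of "\<lambda>n. ?p n v" X])
  show "?p n v \<in> l2 X" for n by (rule bop_in[OF pX v])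
  fix e :: real assume "e > 0"
  then obtain N where "2 * (?K * q ^ N) * l2norm X v < e" using small[of e "l2norm X v"] by auto
  thus "\<exists>N. \<forall>m\<ge>N. \<forall>n\<ge>N. l2norm X (\<lambda>x. ?p m v x - ?p n v x) \<le> e"
   using near2[OF v, of N] by (intro exI[of _ N]) fastforce
 next
  fix g assume g: "g \<in> l2 X" "\<And>x. (\<lambda>n. ?p n v x) \<longlonglongrightarrow> g x"
   "\<And>N e n. (\<And>m n. m \<ge> N \<Longrightarrow> n \<ge> N \<Longrightarrow> l2norm X (\<lambda>x. ?p m v x - ?p n v x) \<le> e) \<Longrightarrow> n \<ge> N \<Longrightarrow>
     l2norm X (\<lambda>x. ?p n v x - g x) \<le> e"
  show ?thesis
  proof (intro bexI[OF _ g(1)] conjI allI impI g(2))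
   fix N n assume "N \<le> (n::nat)"
   thus "l2norm X (\<lambda>x. ?p n v x - g x) \<le> 2 * (?K * q ^ N) * l2norm X v"
    by (intro g(3)[of N] near2[OF v]) auto
  qed
 qed
 \<comment> \<open>The limit vectors are chosen one at a time; linearity of the resulting map
   follows afterwards from uniqueness of limits.\<close>
 define d0 where "d0 v = (SOME g. g \<in> l2 X \<and> (\<forall>x. (\<lambda>n. ?p n v x) \<longlonglongrightarrow> g x) \<and>
   (\<forall>N n. n \<ge> N \<longrightarrow> l2norm X (\<lambda>x. ?p n v x - g x) \<le> 2 * (?K * q ^ N) * l2norm X v))" for v
 have d0': "d0 v \<in> l2 X \<and> (\<forall>x. (\<lambda>n. ?p n v x) \<longlonglongrightarrow> d0 v x) \<and>
   (\<forall>N n. n \<ge> N \<longrightarrow> l2norm X (\<lambda>x. ?p n v x - d0 v x) \<le> 2 * (?K * q ^ N) * l2norm X v)" if "v \<in> l2 X" for v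
  unfolding d0_def by (rule someI_ex[OF lim[OF that, unfolded Bex_def]])
 have d0: "\<And>v. v \<in> l2 X \<Longrightarrow> d0 v \<in> l2 X" "\<And>v x. v \<in> l2 X \<Longrightarrow> (\<lambda>n. ?p n v x) \<longlonglongrightarrow> d0 v x"
  "\<And>v n. v \<in> l2 X \<Longrightarrow> l2norm X (\<lambda>x. ?p n v x - d0 v x) \<le> 2 * (?K * q ^ n) * l2norm X v"
  using d0' by blast+
 define d where "d = restrict d0 (l2 X)"
 have d: "d \<in> bop X"
 proof (rule bopI[where C="?K"])
  show "d \<in> extensional (l2 X)" unfolding d_def by (rule restrict_extensional)
  show "d v \<in> l2 X" if "v \<in> l2 X" for v using that d0 by (simp add: d_def)
  show "d (\<lambda>x. v x + w x) x = d v x + d w x" if vw: "v \<in> l2 X" "w \<in> l2 X" for v w x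
  proof -
   have "(\<lambda>n. ?p n (\<lambda>x. v x + w x) x) \<longlonglongrightarrow> d0 v x + d0 w x"
    using tendsto_add[OF d0(2)[OF vw(1)] d0(2)[OF vw(2)], of x x] by (simp add: bop_add[OF pX vw])
   from LIMSEQ_unique[OF this d0(2)[OF l2_add(1)[OF vw]]] show ?thesis
    using vw l2_add(1)[OF vw] by (simp add: d_def)
  qed
  show "d (\<lambda>x. k * v x) x = k * d v x" if v: "v \<in> l2 X" for k v x
  proof -
   have "(\<lambda>n. ?p n (\<lambda>x. k * v x) x) \<longlonglongrightarrow> k * d0 v x"
    using tendsto_mult[OF tendsto_const d0(2)[OF v], of k x] by (simp add: bop_scale[OF pX v])
   from LIMSEQ_unique[OF this d0(2)[OF l2_scale[OF v]]] show ?thesis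
    using v l2_scale[OF v] by (simp add: d_def)
  qed
  show "l2norm X (d v) \<le> ?K * l2norm X v" if v: "v \<in> l2 X" for v
  proof (rule l2_limit(2)[where s="\<lambda>n. ?p n v" and N=0])
   show "(\<lambda>n. ?p n v x) \<longlonglongrightarrow> d v x" for x using d0(2)[OF v] v by (simp add: d_def)
   show "d v x = 0" if "x \<notin> X" for x using l2_outside[OF d0(1)[OF v] that] v by (simp add: d_def)
  qed (use op_leD[OF ple v] bop_in[OF pX v] in auto)
 qed (use K in simp)
 have "d \<in> op_closure (ell2 X) A"
  unfolding op_closure_iff[OF AX]
 proof (intro conjI allI impI d)
  fix e :: real assume "e > 0"
  then obtain n where n: "2 * (?K * q ^ n) * 1 < e" using small[of e 1] by auto
  have "op_le X (op_diff X d (?p n)) (2 * (?K * q ^ n))"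
   unfolding op_le_def
  proof
   fix v assume v: "v \<in> l2 X"
   show "l2norm X (op_diff X d (?p n) v) \<le> 2 * (?K * q ^ n) * l2norm X v"
    using d0(3)[OF v, of n] v l2norm_minus_commute[of X "?p n v" "d0 v"] by (simp add: d_def)
  qed
  hence "op_le X (op_diff X d (?p n)) e" using n by (elim op_le_mono) simp
  thus "\<exists>R\<in>A. op_le X (op_diff X d R) e" using pA by blast
 qed
 hence dA: "d \<in> A" using A by (auto simp: cstar_algebra_def)
 have "d \<otimes>\<^bsub>bh X\<^esub> (op_diff X \<one>\<^bsub>bh X\<^esub> c) = \<one>\<^bsub>bh X\<^esub>"
 proof (rule bop_eq[of _ X])
  fix v x assume v: "v \<in> l2 X"
  have cv: "c v \<in> l2 X" by (rule bop_in[OF cX v])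
  \<comment> \<open>The limit of p_n v - p_n (c v) is computed in two ways. By the Horner step p_n
    (c v) = p_(n+1) v - v, so it is v; by convergence it is d v - d (c v).\<close>
  have "(\<lambda>n. ?p n v x - (?p (Suc n) v x - v x)) \<longlonglongrightarrow> d0 v x - (d0 v x - v x)"
   by (intro tendsto_intros d0(2)[OF v] LIMSEQ_Suc[OF d0(2)[OF v]])
  moreover have "(\<lambda>n. ?p n v x - (?p (Suc n) v x - v x)) = (\<lambda>n. ?p n v x - ?p n (c v) x)"
   unfolding ps[OF v] by simp
  ultimately have "(\<lambda>n. ?p n v x - ?p n (c v) x) \<longlonglongrightarrow> v x" by simp
  moreover have "(\<lambda>n. ?p n v x - ?p n (c v) x) \<longlonglongrightarrow> d0 v x - d0 (c v) x"
   by (intro tendsto_intros d0(2) v cv)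
  ultimately have "d v x - d (c v) x = v x"
   using LIMSEQ_unique v cv by (fastforce simp: d_def)
  thus "(d \<otimes>\<^bsub>bh X\<^esub> (op_diff X \<one>\<^bsub>bh X\<^esub> c)) v x = \<one>\<^bsub>bh X\<^esub> v x"
   using v cv by (simp add: bop_diff[OF d v cv])
 qed auto
 thus ?thesis using dA by blast
qed

lemma l2norm_diff_sq:
 assumes "f \<in> l2 X" "g \<in> l2 X"
 shows "(l2norm X (\<lambda>x. f x - g x))\<^sup>2 = (l2norm X f)\<^sup>2 - 2 * Re (ip X f g) + (l2norm X g)\<^sup>2"
proof -
 let ?ip = "ip X"
 have "?ip (\<lambda>x. f x - g x) (\<lambda>x. f x - g x) = ?ip f f - ?ip g f - ?ip f g + ?ip g g"
  using hip_diff_left[OF assms l2_diff(1)[OF assms]] hip_diff_right[OF assms(1,2) assms(1)]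
   hip_diff_right[OF assms(1,2) assms(2)] by simp
 hence "Re (?ip (\<lambda>x. f x - g x) (\<lambda>x. f x - g x)) = Re (?ip f f) - Re (?ip g f) - Re (?ip f g) + Re (?ip g g)"
  by simp
 moreover have "Re (?ip g f) = Re (?ip f g)" by (subst hip_cnj) simp
 ultimately show ?thesis by (simp add: hip_self del: of_real_power)
qed

text \<open>If \<open>M = \<parallel>\<phi>(a)\<parallel>\<close> exceeded \<open>\<parallel>a\<parallel>\<close>, then \<open>M\<^sup>2 - a\<^sup>*a\<close> would have a left inverse in \<open>A\<close> (Neumann series),
 so \<open>M\<^sup>2 - \<phi>(a)\<^sup>*\<phi>(a)\<close> would be bounded below, which contradicts the choice of \<open>M\<close>.\<close>

lemma star_hom_contractive:
 assumes A: "cstar_algebra (ell2 X) A" and \<phi>: "star_hom (ell2 X) A (ell2 Y) B \<phi>" and B: "B \<subseteq> bop Y"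
  and a: "a \<in> A" "op_le X a C" "0 \<le> C"
 shows "op_le Y (\<phi> a) C"
proof -
 have alg: "op_alg X A" by (rule cstar_algebra_alg[OF A])
 have AX: "\<And>T. T \<in> A \<Longrightarrow> T \<in> bop X" using A by (auto simp: cstar_algebra_def)
 have \<phi>B: "\<phi> T \<in> bop Y" if "T \<in> A" for T using \<phi> B that by (auto simp: star_hom_def)
 have sp: "op_space X A" using alg by (simp add: op_alg_def)
 have lin: "linear_on (bh X) (bh Y) A \<phi>" using \<phi> by (simp add: star_hom_def)
 define T where "T = \<phi> a"
 define M where "M = op_norm (ell2 Y) T"
 have T: "T \<in> bop Y" using \<phi>B a by (simp add: T_def)
 have M0: "M \<ge> 0" by (simp add: M_def op_norm_nonneg T)
 have MT: "op_le Y T M" by (simp add: M_def op_le_op_norm T)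
 have "M \<le> C"
 proof (rule ccontr)
  assume "\<not> M \<le> C"
  hence MC: "C < M" "M > 0" using a by auto
  let ?as = "adj X a" and ?Ts = "adj Y T"
  let ?b = "?as \<otimes>\<^bsub>bh X\<^esub> a"
  define c where "c = of_real (1 / M\<^sup>2) \<odot>\<^bsub>bh X\<^esub> ?b"
  have asA: "?as \<in> A" using A a by (simp add: cstar_algebra_def)
  have bA: "?b \<in> A" using alg asA a by (simp add: op_alg_def)
  have cA: "c \<in> A" using op_spaceD(4)[OF sp bA] by (simp add: c_def)
  have "op_le X ?b (C * C)" using a AX by (intro op_le_mult op_le_adjoint) auto
  from op_le_smult[OF this, of "of_real (1 / M\<^sup>2)"]
  have "op_le X c (cmod (of_real (1 / M\<^sup>2)) * (C * C))" by (simp add: c_def)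
  hence cle: "op_le X c ((C / M)\<^sup>2)" by (simp add: power_divide power2_eq_square norm_divide norm_mult)
  have "(C / M)\<^sup>2 < 1" using MC a by (simp add: power_less_one_iff abs_square_less_1)
  from neumann_inverse[OF A cA cle _ this]
  obtain d where d: "d \<in> A" "d \<otimes>\<^bsub>bh X\<^esub> (op_diff X \<one>\<^bsub>bh X\<^esub> c) = \<one>\<^bsub>bh X\<^esub>" by auto
  have oneA: "\<one>\<^bsub>bh X\<^esub> \<in> A" using alg by (simp add: op_alg_def)
  have "\<phi> d \<otimes>\<^bsub>bh Y\<^esub> \<phi> (op_diff X \<one>\<^bsub>bh X\<^esub> c) = \<one>\<^bsub>bh Y\<^esub>"
   using \<phi> d op_spaceD(5)[OF sp oneA cA] unfolding star_hom_def by metis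
  moreover have "\<phi> (op_diff X \<one>\<^bsub>bh X\<^esub> c) = op_diff Y \<one>\<^bsub>bh Y\<^esub> (\<phi> c)"
   using bounded_on_diff[OF lin sp oneA cA] \<phi> by (simp add: star_hom_def)
  moreover have "\<phi> c = of_real (1 / M\<^sup>2) \<odot>\<^bsub>bh Y\<^esub> (?Ts \<otimes>\<^bsub>bh Y\<^esub> T)"
   using lin bA asA a \<phi> unfolding c_def T_def linear_on_def star_hom_def by simp
  ultimately have inv: "\<phi> d \<otimes>\<^bsub>bh Y\<^esub> op_diff Y \<one>\<^bsub>bh Y\<^esub>
    (of_real (1 / M\<^sup>2) \<odot>\<^bsub>bh Y\<^esub> (?Ts \<otimes>\<^bsub>bh Y\<^esub> T)) = \<one>\<^bsub>bh Y\<^esub>" by simp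
  obtain D0 where D0: "D0 > 0" "op_le Y (\<phi> d) D0" using op_le_exists[OF \<phi>B[OF d(1)]] by blast
  \<comment> \<open>D is only an upper bound for the norm of the image of the left inverse.
    Enlarging it to at least 1 makes 1 - 1 / D^2 non-negative, so that its square root can be
    taken.\<close>
  define D where "D = max D0 1"
  have D: "D \<ge> 1" "op_le Y (\<phi> d) D" using op_le_mono[OF D0(2)] by (auto simp: D_def)
  \<comment> \<open>Write w - T*T w / M^2 for the vector that \<phi>(d) sends back to w. Its squared
    norm is at most ||w||^2 - ||T w||^2 / M^2: the cross term contributes -2 ||T w||^2 / M^2, and
    ||T*|| \<le> M bounds the quadratic term by ||T w||^2 / M^2. Multiplying by D^2 and solving for
    ||T w||^2 improves the bound on T strictly below M.\<close>
  have key: "(l2norm Y (T w))\<^sup>2 \<le> M\<^sup>2 * (1 - 1 / D\<^sup>2) * (l2norm Y w)\<^sup>2" if w: "w \<in> l2 Y" for w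
  proof -
   let ?u = "?Ts (T w)" and ?m = "complex_of_real (1 / M\<^sup>2)"
   have Tw: "T w \<in> l2 Y" by (rule bop_in[OF T w])
   have u: "?u \<in> l2 Y" by (rule bop_in[OF adjoint_op_bop[OF T] Tw])
   let ?mu = "\<lambda>x. ?m * ?u x"
   have mu: "?mu \<in> l2 Y" by (rule l2_scale[OF u])
   have r: "(\<lambda>x. w x - ?mu x) \<in> l2 Y" by (rule l2_diff(1)[OF w mu])
   have "\<phi> d (\<lambda>x. w x - ?mu x) = w" using fun_cong[OF inv, of w] w by simp
   hence "l2norm Y w \<le> D * l2norm Y (\<lambda>x. w x - ?mu x)" using op_leD[OF D(2) r] by simp
   hence "(l2norm Y w)\<^sup>2 \<le> (D * l2norm Y (\<lambda>x. w x - ?mu x))\<^sup>2" by (intro power_mono) auto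
   hence 1: "(l2norm Y w)\<^sup>2 \<le> D\<^sup>2 * (l2norm Y (\<lambda>x. w x - ?mu x))\<^sup>2" by (simp add: power_mult_distrib)
   have "ip Y w ?mu = cnj (?m * ip Y ?u w)"
    by (subst hip_cnj) (simp only: hip_scale_left)
   moreover have "ip Y ?u w = of_real ((l2norm Y (T w))\<^sup>2)"
   proof -
    have "ip Y w ?u = of_real ((l2norm Y (T w))\<^sup>2)"
     using adjoint_op_hip[OF T w Tw] hip_self[of Y "T w"] by simp
    thus ?thesis by (subst hip_cnj) (simp only: complex_cnj_complex_of_real)
   qed
   ultimately have 2: "Re (ip Y w ?mu) = (l2norm Y (T w))\<^sup>2 / M\<^sup>2"
    by (simp del: of_real_power of_real_divide of_real_mult add: of_real_mult[symmetric])
   have "l2norm Y ?u \<le> M * l2norm Y (T w)"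
    by (rule op_leD[OF op_le_adjoint[OF T MT] Tw])
   hence "(l2norm Y ?u)\<^sup>2 \<le> M\<^sup>2 * (l2norm Y (T w))\<^sup>2"
    using power_mono[of "l2norm Y ?u" "M * l2norm Y (T w)" 2] by (simp add: power_mult_distrib)
   hence "(l2norm Y ?mu)\<^sup>2 \<le> (l2norm Y (T w))\<^sup>2 / M\<^sup>2"
   proof -
    assume *: "(l2norm Y ?u)\<^sup>2 \<le> M\<^sup>2 * (l2norm Y (T w))\<^sup>2"
    have "l2norm Y ?mu = l2norm Y ?u / M\<^sup>2"
     using l2norm_scale[of Y ?m ?u] by (simp add: norm_divide norm_power)
    hence "(l2norm Y ?mu)\<^sup>2 = (l2norm Y ?u)\<^sup>2 / (M\<^sup>2 * M\<^sup>2)"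
     by (simp add: power_divide power2_eq_square)
    also have "\<dots> \<le> M\<^sup>2 * (l2norm Y (T w))\<^sup>2 / (M\<^sup>2 * M\<^sup>2)"
     by (rule divide_right_mono[OF *]) simp
    finally show ?thesis using MC by (simp add: power2_eq_square)
   qed
   hence "(l2norm Y (\<lambda>x. w x - ?mu x))\<^sup>2 \<le> (l2norm Y w)\<^sup>2 - (l2norm Y (T w))\<^sup>2 / M\<^sup>2"
    using l2norm_diff_sq[OF w mu] 2 by simp
   from order_trans[OF 1 mult_left_mono[OF this, of "D\<^sup>2"]]
   have "(l2norm Y w)\<^sup>2 \<le> D\<^sup>2 * ((l2norm Y w)\<^sup>2 - (l2norm Y (T w))\<^sup>2 / M\<^sup>2)" by simp
   thus ?thesis using MC D by (simp add: field_simps)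
  qed
  let ?E = "M * sqrt (1 - 1 / D\<^sup>2)"
  have D1: "1 - 1 / D\<^sup>2 \<ge> 0" "1 - 1 / D\<^sup>2 < 1" using D by (auto simp: field_simps)
  have "op_le Y T ?E"
   unfolding op_le_def
  proof
   fix w assume "w \<in> l2 Y"
   from real_sqrt_le_mono[OF key[OF this]] show "l2norm Y (T w) \<le> ?E * l2norm Y w"
    using M0 by (simp add: real_sqrt_mult)
  qed
  hence "M \<le> ?E" unfolding M_def[symmetric] using M0 D1 op_norm_le[of ?E Y T] by (simp add: M_def)
  moreover have "?E < M * 1" using MC D1 by (intro mult_strict_left_mono) auto
  ultimately show False by simp
 qed
 thus ?thesis using MT op_le_mono by (simp add: T_def)
qed

subsection \<open>Amplifications\<close>

text \<open>A bijection \<open>y \<mapsto> (p y, q y)\<close> from \<open>Y\<close> to \<open>X \<times> Z\<close> with inverse \<open>j\<close> turns an operator \<open>T\<close> on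
 \<open>\<ell>\<^sup>2(X)\<close> into the operator \<open>T \<otimes> 1\<close> on \<open>\<ell>\<^sup>2(Y)\<close>. Tensor products with the identity, the comultiplication
 of a group C*-algebra and the maps \<open>\<Delta> \<otimes> id\<close> and \<open>id \<otimes> \<Delta>\<close> are all of this form.\<close>

locale reindex =
 fixes X :: "'x set" and Y :: "'y set" and Z :: "'z set" and p :: "'y \<Rightarrow> 'x" and q :: "'y \<Rightarrow> 'z"
  and j :: "'x \<Rightarrow> 'z \<Rightarrow> 'y"
 assumes p [simp]: "y \<in> Y \<Longrightarrow> p y \<in> X" and q [simp]: "y \<in> Y \<Longrightarrow> q y \<in> Z"
  and j [simp]: "x \<in> X \<Longrightarrow> z \<in> Z \<Longrightarrow> j x z \<in> Y"
  and pj [simp]: "x \<in> X \<Longrightarrow> z \<in> Z \<Longrightarrow> p (j x z) = x"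
  and qj [simp]: "x \<in> X \<Longrightarrow> z \<in> Z \<Longrightarrow> q (j x z) = z"
  and jpq [simp]: "y \<in> Y \<Longrightarrow> j (p y) (q y) = y"
begin

definition slice :: "('y \<Rightarrow> complex) \<Rightarrow> 'z \<Rightarrow> 'x \<Rightarrow> complex" where
 "slice F z = (\<lambda>x. if x \<in> X then F (j x z) else 0)"

definition amp :: "('x \<Rightarrow> complex) op \<Rightarrow> ('y \<Rightarrow> complex) op" where
 "amp T = (\<lambda>F\<in>l2 Y. \<lambda>y. if y \<in> Y then T (slice F (q y)) (p y) else 0)"

lemma inj_j: "z \<in> Z \<Longrightarrow> inj_on (\<lambda>x. j x z) X"
 by (rule inj_on_inverseI[of _ p]) simp

text \<open>For distinct z the points j x z form disjoint fibres of q, so the slices of F use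
  disjoint parts of its sum of squares. Taking K empty gives membership of the slices without any
  choice of K.\<close>

lemma slice_sum:
 assumes F: "F \<in> l2 Y" and K: "finite K" "K \<subseteq> Z"
 shows "\<And>z. z \<in> Z \<Longrightarrow> slice F z \<in> l2 X" "(\<Sum>z\<in>K. (l2norm X (slice F z))\<^sup>2) \<le> (l2norm Y F)\<^sup>2"
proof -
 let ?g = "\<lambda>y. (cmod (F y))\<^sup>2" and ?B = "\<lambda>z. (\<lambda>x. j x z) ` X"
 have s: "?g summable_on Y" using F by (simp add: l2_iff)
 have sB: "?g summable_on ?B z" if "z \<in> Z" for z
  by (rule summable_on_subset_banach[OF s]) (use that in auto)
 have sl: "slice F z \<in> l2 X \<and> (l2norm X (slice F z))\<^sup>2 = infsum ?g (?B z)" if z: "z \<in> Z" for z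
 proof -
  have "(?g \<circ> (\<lambda>x. j x z)) summable_on X"
   using sB[OF z] by (simp add: summable_on_reindex[OF inj_j[OF z]])
  moreover have "(\<lambda>x. (cmod (slice F z x))\<^sup>2) summable_on X \<longleftrightarrow> (?g \<circ> (\<lambda>x. j x z)) summable_on X"
   by (rule summable_on_cong) (simp add: slice_def)
  moreover have "(\<Sum>\<^sub>\<infinity>x\<in>X. (cmod (slice F z x))\<^sup>2) = infsum (?g \<circ> (\<lambda>x. j x z)) X"
   by (rule infsum_cong) (simp add: slice_def)
  ultimately show ?thesis
   by (simp add: l2_iff l2norm_def infsum_nonneg infsum_reindex[OF inj_j[OF z]]) (simp add: slice_def)
 qed
 thus "\<And>z. z \<in> Z \<Longrightarrow> slice F z \<in> l2 X" by blast
 have "(\<Sum>z\<in>K. (l2norm X (slice F z))\<^sup>2) = (\<Sum>z\<in>K. infsum ?g (?B z))"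
  using sl K by (intro sum.cong) auto
 also have "\<dots> = infsum ?g (\<Union>z\<in>K. ?B z)"
 proof (rule sum_infsum[OF K(1)])
  show "?g summable_on ?B z" if "z \<in> K" for z using sB that K by blast
  show "?B z \<inter> ?B z' = {}" if "z \<in> K" "z' \<in> K" "z \<noteq> z'" for z z'
  proof -
   have "q (j x z) \<noteq> q (j x' z')" if "x \<in> X" "x' \<in> X" for x x'
    using that \<open>z \<in> K\<close> \<open>z' \<in> K\<close> \<open>z \<noteq> z'\<close> K by (simp add: subset_iff)
   thus ?thesis by fastforce
  qed
 qed
 also have "\<dots> \<le> infsum ?g Y"
  using K by (intro infsum_mono2 s summable_on_subset_banach[OF s]) auto
 also have "\<dots> = (l2norm Y F)\<^sup>2" by (simp add: l2norm_def infsum_nonneg)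
 finally show "(\<Sum>z\<in>K. (l2norm X (slice F z))\<^sup>2) \<le> (l2norm Y F)\<^sup>2" .
qed

lemmas slice_l2 [simp] = slice_sum(1)[OF _ finite.emptyI empty_subsetI]

lemma amp_apply: "F \<in> l2 Y \<Longrightarrow> y \<in> Y \<Longrightarrow> amp T F y = T (slice F (q y)) (p y)"
 and amp_outside: "F \<in> l2 Y \<Longrightarrow> y \<notin> Y \<Longrightarrow> amp T F y = 0"
 and amp_ext [simp]: "amp T \<in> extensional (l2 Y)"
 by (simp_all add: amp_def)

text \<open>A finite set of points is enlarged to a rectangle in the coordinates q and p. On a
  rectangle the sum splits into slices, T acts on each slice with the same constant, and
  \<open>slice_sum\<close> adds them up.\<close>

lemma amp_l2:
 assumes T: "T \<in> bop X" "op_le X T C" "0 \<le> C" and F: "F \<in> l2 Y"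
 shows "amp T F \<in> l2 Y" "l2norm Y (amp T F) \<le> C * l2norm Y F"
proof -
 have "L2_set (\<lambda>y. cmod (amp T F y)) G \<le> C * l2norm Y F" if G: "finite G" "G \<subseteq> Y" for G
 proof -
  let ?h = "\<lambda>z x. (cmod (T (slice F z) x))\<^sup>2"
  have pG: "finite (p ` G)" "finite (q ` G)" "p ` G \<subseteq> X" "q ` G \<subseteq> Z" using G by auto
  have inj: "inj_on (\<lambda>y. (q y, p y)) G"
   using jpq G by (intro inj_on_inverseI[of _ "\<lambda>(z, x). j x z"]) auto
  have "(\<Sum>y\<in>G. (cmod (amp T F y))\<^sup>2) = (\<Sum>y\<in>G. ?h (q y) (p y))"
   using G F by (intro sum.cong) (auto simp: amp_apply)
  also have "\<dots> = (\<Sum>(z, x)\<in>(\<lambda>y. (q y, p y)) ` G. ?h z x)"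
   by (simp add: sum.reindex[OF inj])
  also have "\<dots> \<le> (\<Sum>(z, x)\<in>q ` G \<times> p ` G. ?h z x)"
   using pG by (intro sum_mono2) auto
  also have "\<dots> = (\<Sum>z\<in>q ` G. \<Sum>x\<in>p ` G. ?h z x)" by (simp add: sum.cartesian_product)
  also have "\<dots> \<le> (\<Sum>z\<in>q ` G. (l2norm X (T (slice F z)))\<^sup>2)"
  proof (rule sum_mono)
   fix z assume "z \<in> q ` G"
   hence "slice F z \<in> l2 X" using F pG by auto
   hence "L2_set (\<lambda>x. cmod (T (slice F z) x)) (p ` G) \<le> l2norm X (T (slice F z))"
    using pG by (intro l2_finite_le bop_in[OF T(1)])
   hence "(L2_set (\<lambda>x. cmod (T (slice F z) x)) (p ` G))\<^sup>2 \<le> (l2norm X (T (slice F z)))\<^sup>2"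
    by (intro power_mono) auto
   thus "(\<Sum>x\<in>p ` G. ?h z x) \<le> (l2norm X (T (slice F z)))\<^sup>2"
    by (simp add: L2_set_def sum_nonneg)
  qed
  also have "\<dots> \<le> (\<Sum>z\<in>q ` G. C\<^sup>2 * (l2norm X (slice F z))\<^sup>2)"
  proof (rule sum_mono)
   fix z assume "z \<in> q ` G"
   hence "slice F z \<in> l2 X" using F pG by auto
   thus "(l2norm X (T (slice F z)))\<^sup>2 \<le> C\<^sup>2 * (l2norm X (slice F z))\<^sup>2"
    using power_mono[OF op_leD[OF T(2)], of "slice F z" 2] by (simp add: power_mult_distrib)
  qed
  also have "\<dots> \<le> C\<^sup>2 * (l2norm Y F)\<^sup>2"
   using slice_sum(2)[OF F pG(2,4)] by (simp add: mult_left_mono flip: sum_distrib_left)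
  finally have "(\<Sum>y\<in>G. (cmod (amp T F y))\<^sup>2) \<le> (C * l2norm Y F)\<^sup>2"
   by (simp add: power_mult_distrib)
  thus ?thesis using T(3) by (simp add: L2_set_def real_le_lsqrt sum_nonneg)
 qed
 thus "amp T F \<in> l2 Y" "l2norm Y (amp T F) \<le> C * l2norm Y F"
  using l2I[of Y "amp T F" "C * l2norm Y F"] F by (auto simp: amp_outside)
qed

lemma slice_add: "slice (\<lambda>y. F y + G y) z = (\<lambda>x. slice F z x + slice G z x)"
 and slice_scale: "slice (\<lambda>y. c * F y) z = (\<lambda>x. c * slice F z x)"
 by (auto simp: slice_def)

lemma amp_bop [simp]:
 assumes T: "T \<in> bop X" shows "amp T \<in> bop Y"
proof -
 obtain C where C: "C > 0" "op_le X T C" using op_le_exists[OF T] by blast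
 show ?thesis
 proof (rule bopI[where C=C])
  fix F G y assume FG: "F \<in> l2 Y" "G \<in> l2 Y"
  show "amp T (\<lambda>y. F y + G y) y = amp T F y + amp T G y"
   using FG l2_add(1)[OF FG] by (cases "y \<in> Y") (simp_all add: amp_apply amp_outside slice_add bop_add[OF T])
 next
  fix c F y assume F: "F \<in> l2 Y"
  show "amp T (\<lambda>y. c * F y) y = c * amp T F y"
   using F l2_scale[OF F, of c] by (cases "y \<in> Y") (simp_all add: amp_apply amp_outside slice_scale bop_scale[OF T])
 qed (use C amp_l2[OF T C(2)] in auto)
qed

lemma amp_le: "T \<in> bop X \<Longrightarrow> op_le X T C \<Longrightarrow> 0 \<le> C \<Longrightarrow> op_le Y (amp T) C"
 using amp_l2(2) by (auto simp: op_le_def)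

lemma amp_add: "amp (S \<oplus>\<^bsub>bh X\<^esub> T) = amp S \<oplus>\<^bsub>bh Y\<^esub> amp T"
proof (rule bop_eq)
 fix F y assume "F \<in> l2 Y"
 thus "amp (S \<oplus>\<^bsub>bh X\<^esub> T) F y = (amp S \<oplus>\<^bsub>bh Y\<^esub> amp T) F y"
  by (cases "y \<in> Y") (simp_all add: amp_apply amp_outside)
qed auto

lemma amp_smult: "amp (c \<odot>\<^bsub>bh X\<^esub> T) = c \<odot>\<^bsub>bh Y\<^esub> amp T"
proof (rule bop_eq)
 fix F y assume "F \<in> l2 Y"
 thus "amp (c \<odot>\<^bsub>bh X\<^esub> T) F y = (c \<odot>\<^bsub>bh Y\<^esub> amp T) F y"
  by (cases "y \<in> Y") (simp_all add: amp_apply amp_outside)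
qed auto

lemma slice_amp: "T \<in> bop X \<Longrightarrow> F \<in> l2 Y \<Longrightarrow> z \<in> Z \<Longrightarrow> slice (amp T F) z = T (slice F z)"
 by (auto simp: slice_def[of "amp T F"] amp_apply bop_outside)

lemma amp_mult:
 assumes "S \<in> bop X" "T \<in> bop X"
 shows "amp (S \<otimes>\<^bsub>bh X\<^esub> T) = amp S \<otimes>\<^bsub>bh Y\<^esub> amp T"
proof (rule bop_eq)
 fix F y assume F: "F \<in> l2 Y"
 show "amp (S \<otimes>\<^bsub>bh X\<^esub> T) F y = (amp S \<otimes>\<^bsub>bh Y\<^esub> amp T) F y"
  using assms F bop_in[OF amp_bop F, of T]
  by (cases "y \<in> Y") (simp_all add: amp_apply amp_outside slice_amp)
qed auto

lemma amp_one: "amp \<one>\<^bsub>bh X\<^esub> = \<one>\<^bsub>bh Y\<^esub>"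
proof (rule bop_eq)
 fix F y assume F: "F \<in> l2 Y"
 thus "amp \<one>\<^bsub>bh X\<^esub> F y = \<one>\<^bsub>bh Y\<^esub> F y"
  by (cases "y \<in> Y") (simp_all add: amp_apply amp_outside l2_outside, simp add: slice_def)
qed auto

text \<open>The matrix of T \<otimes> 1: block diagonal, with a copy of T in each fibre. Identities
  between composed amplifications become comparisons of which labels must agree.\<close>

lemma amp_entry:
 assumes T: "T \<in> bop X" and y: "y \<in> Y" "y' \<in> Y"
 shows "amp T (delta y) y' = (if q y = q y' then T (delta (p y)) (p y') else 0)"
proof -
 have "slice (delta y) (q y') = (if q y = q y' then delta (p y) else (\<lambda>x. 0))"
 proof
  fix x
  have "j x (q y') = y \<longleftrightarrow> q y = q y' \<and> x = p y" if "x \<in> X"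
   using that y by (metis jpq pj q qj)
  thus "slice (delta y) (q y') x = (if q y = q y' then delta (p y) else (\<lambda>x. 0)) x"
   using y by (auto simp: slice_def delta_def)
 qed
 thus ?thesis using y by (simp add: amp_apply bop_zero[OF T])
qed

lemma amp_adjoint: "T \<in> bop X \<Longrightarrow> adj Y (amp T) = amp (adj X T)"
 by (intro adjoint_eqI) (auto simp: amp_entry adjoint_entry)

lemma bounded_on_amp: "A \<subseteq> bop X \<Longrightarrow> bounded_on X Y A amp"
 unfolding bounded_on_def linear_on_def
 by (auto intro!: exI[of _ 1] amp_le simp: amp_add amp_smult)

end

lemma (in reindex) star_hom_amp:
 assumes A: "op_alg X A" "\<And>T. T \<in> A \<Longrightarrow> adj X T \<in> A" and B: "amp ` A \<subseteq> B"
 shows "star_hom (ell2 X) A (ell2 Y) B (restrict amp A)"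
proof -
 have AX: "\<And>T. T \<in> A \<Longrightarrow> T \<in> bop X" using A by (auto simp: op_alg_def op_space_def)
 show ?thesis unfolding star_hom_def linear_on_def
  using A B by (auto simp: AX amp_add amp_smult amp_mult amp_one amp_adjoint op_alg_def op_space_def)
qed

subsection \<open>Tensor products of operators\<close>

text \<open>The two standard legs: this amplification is S \<otimes> 1 and the next one is 1
  \<otimes> T.\<close>

interpretation left_leg: reindex X "X \<times> Y" Y fst snd Pair for X :: "'x set" and Y :: "'y set"
 by unfold_locales auto

interpretation right_leg: reindex Y "X \<times> Y" X snd fst "\<lambda>y x. (x, y)" for X :: "'x set" and Y :: "'y set"
 by unfold_locales auto

abbreviation "left_amp X Y \<equiv> left_leg.amp X Y"
abbreviation "right_amp X Y \<equiv> right_leg.amp Y X"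

lemma delta_pair: "delta (x, y) = (\<lambda>(x', y'). delta x x' * delta y y')"
 by (auto simp: delta_def)

text \<open>The product of S \<otimes> 1 and 1 \<otimes> T witnesses the definite description. It is
  the only candidate because basis vectors of the product are elementary tensors, on which all
  candidates agree.\<close>

lemma op_tensor_eq:
 assumes S: "S \<in> bop X" and T: "T \<in> bop Y"
 shows "op_tensor X Y S T = left_amp X Y S \<otimes>\<^bsub>bh (X \<times> Y)\<^esub> right_amp X Y T"
  (is "_ = ?R")
proof -
 have R: "?R \<in> bop (X \<times> Y)" using S T by simp
 have app: "?R (\<lambda>(x, y). f x * g y) = (\<lambda>(x, y). S f x * T g y)" if f: "f \<in> l2 X" and g: "g \<in> l2 Y" for f g
 proof
  fix z
  have fg: "(\<lambda>(x, y). f x * g y) \<in> l2 (X \<times> Y)" and fTg: "(\<lambda>(x, y). f x * T g y) \<in> l2 (X \<times> Y)"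
   using f g bop_in[OF T g] by (auto intro: l2_tensor)
  have "right_amp X Y T (\<lambda>(x, y). f x * g y) w = (\<lambda>(x, y). f x * T g y) w" for w
  proof (cases "w \<in> X \<times> Y")
   case True
   have "right_leg.slice Y (\<lambda>(x, y). f x * g y) (fst w) = (\<lambda>y. f (fst w) * g y)"
    using g by (auto simp: right_leg.slice_def l2_outside)
   thus ?thesis using True fg bop_scale[OF T g] by (simp add: right_leg.amp_apply split_def)
  next
   case False
   thus ?thesis using l2_outside[OF fTg False] by (simp add: right_leg.amp_outside[OF fg])
  qed
  hence 1: "right_amp X Y T (\<lambda>(x, y). f x * g y) = (\<lambda>(x, y). f x * T g y)" by blast
  show "?R (\<lambda>(x, y). f x * g y) z = (\<lambda>(x, y). S f x * T g y) z"
  proof (cases "z \<in> X \<times> Y")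
   case True
   have "left_leg.slice X (\<lambda>(x, y). f x * T g y) (snd z) = (\<lambda>x. T g (snd z) * f x)"
    using f by (auto simp: left_leg.slice_def l2_outside)
   thus ?thesis using True fg fTg bop_scale[OF S f]
    by (simp add: 1[unfolded split_def] left_leg.amp_apply split_def)
  next
   case False
   have "(\<lambda>(x, y). S f x * T g y) \<in> l2 (X \<times> Y)" by (rule l2_tensor(1)[OF bop_in[OF S f] bop_in[OF T g]])
   from l2_outside[OF this False] show ?thesis using fg fTg False by (simp add: 1 left_leg.amp_outside)
  qed
 qed
 show ?thesis
  unfolding op_tensor_def
 proof (rule the_equality)
  show "?R \<in> bop (X \<times> Y) \<and> (\<forall>f\<in>l2 X. \<forall>g\<in>l2 Y. ?R (\<lambda>(x, y). f x * g y) = (\<lambda>(x, y). S f x * T g y))"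
   using R app by blast
  fix Q assume Q: "Q \<in> bop (X \<times> Y) \<and> (\<forall>f\<in>l2 X. \<forall>g\<in>l2 Y. Q (\<lambda>(x, y). f x * g y) = (\<lambda>(x, y). S f x * T g y))"
  show "Q = ?R"
  proof (rule bop_eqI[OF conjunct1[OF Q] R])
   fix z z' assume "z \<in> X \<times> Y"
   then obtain x y where z: "z = (x, y)" "x \<in> X" "y \<in> Y" by blast
   show "Q (delta z) z' = ?R (delta z) z'"
    using Q app[of "delta x" "delta y"] z unfolding z(1) delta_pair by simp
  qed
 qed
qed

lemma op_tensor_bop [simp]: "S \<in> bop X \<Longrightarrow> T \<in> bop Y \<Longrightarrow> op_tensor X Y S T \<in> bop (X \<times> Y)"
 by (simp add: op_tensor_eq)

lemma op_tensor_apply: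
 assumes S: "S \<in> bop X" and T: "T \<in> bop Y" and F: "F \<in> l2 (X \<times> Y)" and xy: "x \<in> X" "y \<in> Y"
 shows "op_tensor X Y S T F (x, y) = S (\<lambda>x'. if x' \<in> X then T (\<lambda>y'. if y' \<in> Y then F (x', y') else 0) y else 0) x"
proof -
 have R: "right_amp X Y T F \<in> l2 (X \<times> Y)" by (rule bop_in[OF right_leg.amp_bop[OF T] F])
 have "left_leg.slice X (right_amp X Y T F) y
   = (\<lambda>x'. if x' \<in> X then T (\<lambda>y'. if y' \<in> Y then F (x', y') else 0) y else 0)"
  using F xy by (auto simp: left_leg.slice_def right_leg.slice_def right_leg.amp_apply)
 thus ?thesis using R F xy by (simp add: op_tensor_eq[OF S T] left_leg.amp_apply)
qed

lemma op_tensor_tensor: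
 assumes S: "S \<in> bop X" and T: "T \<in> bop Y" and f: "f \<in> l2 X" and g: "g \<in> l2 Y" and xy: "x \<in> X" "y \<in> Y"
 shows "op_tensor X Y S T (\<lambda>(x, y). f x * g y) (x, y) = S f x * T g y"
proof -
 have *: "(\<lambda>y'. if y' \<in> Y then f x' * g y' else 0) = (\<lambda>y'. f x' * g y')" for x'
  using l2_outside[OF g] by auto
 have "(\<lambda>x'. if x' \<in> X then f x' * T g y else 0) = (\<lambda>x'. T g y * f x')"
  using l2_outside[OF f] by auto
 thus ?thesis using l2_tensor(1)[OF f g] xy
  by (simp add: op_tensor_apply[OF S T] * bop_scale[OF T g] bop_scale[OF S f] cong: if_cong)
qed

lemma op_tensor_entry:
 assumes "S \<in> bop X" "T \<in> bop Y" "x \<in> X" "y \<in> Y" "x' \<in> X" "y' \<in> Y"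
 shows "op_tensor X Y S T (delta (x, y)) (x', y') = S (delta x) x' * T (delta y) y'"
 unfolding delta_pair using assms by (subst op_tensor_tensor) auto

lemma op_tensor_eqI:
 assumes "R \<in> bop (X \<times> Y)" "S \<in> bop X" "T \<in> bop Y"
  "\<And>x y x' y'. x \<in> X \<Longrightarrow> y \<in> Y \<Longrightarrow> x' \<in> X \<Longrightarrow> y' \<in> Y \<Longrightarrow> R (delta (x, y)) (x', y') = S (delta x) x' * T (delta y) y'"
 shows "op_tensor X Y S T = R"
 using assms by (intro bop_eqI[of _ "X \<times> Y"]) (auto simp: op_tensor_entry)

lemma op_tensor_mult:
 assumes "S \<in> bop X" "T \<in> bop Y" "S' \<in> bop X" "T' \<in> bop Y"
 shows "op_tensor X Y S T \<otimes>\<^bsub>bh (X \<times> Y)\<^esub> op_tensor X Y S' T'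
  = op_tensor X Y (S \<otimes>\<^bsub>bh X\<^esub> S') (T \<otimes>\<^bsub>bh Y\<^esub> T')"
proof (rule op_tensor_eqI[symmetric])
 fix x y x' y' assume xy: "x \<in> X" "y \<in> Y" "x' \<in> X" "y' \<in> Y"
 have "op_tensor X Y S' T' (delta (x, y)) = (\<lambda>(a, b). S' (delta x) a * T' (delta y) b)"
 proof
  fix z show "op_tensor X Y S' T' (delta (x, y)) z = (\<lambda>(a, b). S' (delta x) a * T' (delta y) b) z"
  proof (cases "z \<in> X \<times> Y")
   case True thus ?thesis using assms xy by (auto simp: op_tensor_entry)
  next
   case False
   have "(\<lambda>(a, b). S' (delta x) a * T' (delta y) b) \<in> l2 (X \<times> Y)"
    by (rule l2_tensor(1)[OF bop_in[OF assms(3) delta_l2[OF xy(1)]] bop_in[OF assms(4) delta_l2[OF xy(2)]]])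
   thus ?thesis using False bop_outside[of "op_tensor X Y S' T'" "X \<times> Y" "delta (x, y)" z] assms xy
    by (simp add: l2_outside)
  qed
 qed
 thus "(op_tensor X Y S T \<otimes>\<^bsub>bh (X \<times> Y)\<^esub> op_tensor X Y S' T') (delta (x, y)) (x', y') =
    (S \<otimes>\<^bsub>bh X\<^esub> S') (delta x) x' * (T \<otimes>\<^bsub>bh Y\<^esub> T') (delta y) y'"
  using assms xy by (simp add: op_tensor_tensor bop_in)
qed (use assms in auto)

lemma op_tensor_one: "op_tensor X Y \<one>\<^bsub>bh X\<^esub> \<one>\<^bsub>bh Y\<^esub> = \<one>\<^bsub>bh (X \<times> Y)\<^esub>"
 by (rule op_tensor_eqI) (simp_all, simp add: delta_def)

lemma op_tensor_adjoint:
 "S \<in> bop X \<Longrightarrow> T \<in> bop Y \<Longrightarrow>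
  adj (X \<times> Y) (op_tensor X Y S T) = op_tensor X Y (adj X S) (adj Y T)"
 by (rule adjoint_eqI) (auto simp: op_tensor_entry adjoint_entry)

lemma bounded_on_tensor_left:
 assumes T: "T \<in> bop Y" shows "bounded_on X (X \<times> Y) (bop X) (\<lambda>S. op_tensor X Y S T)"
proof -
 obtain C where C: "C > 0" "op_le (X \<times> Y) (right_amp X Y T) C"
  using op_le_exists[OF right_leg.amp_bop[OF T]] by blast
 show ?thesis
  unfolding bounded_on_def linear_on_def
 proof (intro conjI exI[of _ C] ballI allI impI)
  fix S and e :: real assume "S \<in> bop X" "op_le X S e" "0 \<le> e"
  thus "op_le (X \<times> Y) (op_tensor X Y S T) (C * e)"
   using op_le_mult[OF left_leg.amp_bop right_leg.amp_bop[OF T] left_leg.amp_le C(2), of S e]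
   by (simp add: op_tensor_eq T mult.commute)
 qed (use T C in \<open>auto intro!: op_tensor_eqI simp: op_tensor_entry algebra_simps\<close>)
qed

lemma bounded_on_tensor_right:
 assumes S: "S \<in> bop X" shows "bounded_on Y (X \<times> Y) (bop Y) (\<lambda>T. op_tensor X Y S T)"
proof -
 obtain C where C: "C > 0" "op_le (X \<times> Y) (left_amp X Y S) C"
  using op_le_exists[OF left_leg.amp_bop[OF S]] by blast
 show ?thesis
  unfolding bounded_on_def linear_on_def
 proof (intro conjI exI[of _ C] ballI allI impI)
  fix T and e :: real assume "T \<in> bop Y" "op_le Y T e" "0 \<le> e"
  thus "op_le (X \<times> Y) (op_tensor X Y S T) (C * e)"
   using op_le_mult[OF left_leg.amp_bop[OF S] right_leg.amp_bop C(2) right_leg.amp_le, of T e] C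
   by (simp add: op_tensor_eq S)
 qed (use S C in \<open>auto intro!: op_tensor_eqI simp: op_tensor_entry algebra_simps\<close>)
qed

lemma linear_on_span_image:
 assumes lin: "linear_on (bh X) (bh Y) A \<phi>" and A: "op_space X A" "S \<subseteq> A"
  and S': "\<phi> ` S \<subseteq> S'" "op_space Y S'"
 shows "\<phi> ` lin_span (bh X) S \<subseteq> S'"
proof (rule image_subsetI)
 fix T assume "T \<in> lin_span (bh X) S"
 hence "T \<in> A \<and> \<phi> T \<in> S'"
 proof induction
  case lin_span_zero
  have z: "0 \<odot>\<^bsub>bh X\<^esub> \<zero>\<^bsub>bh X\<^esub> = \<zero>\<^bsub>bh X\<^esub>" by (rule bop_eq[of _ X]) auto
  have zA: "\<zero>\<^bsub>bh X\<^esub> \<in> A" by (rule op_spaceD(2)[OF A(1)])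
  have "\<phi> (0 \<odot>\<^bsub>bh X\<^esub> \<zero>\<^bsub>bh X\<^esub>) = 0 \<odot>\<^bsub>bh Y\<^esub> \<phi> \<zero>\<^bsub>bh X\<^esub>"
   using lin zA unfolding linear_on_def by blast
  also have "\<dots> = \<zero>\<^bsub>bh Y\<^esub>" by (rule bop_eq[of _ Y]) auto
  finally show ?case using op_spaceD(2)[OF S'(2)] zA by (simp only: z)
 qed (use lin A S' in \<open>auto simp: linear_on_def op_space_def\<close>)
 thus "\<phi> T \<in> S'" by blast
qed

lemma lin_span_adjoint:
 assumes S: "S \<subseteq> bop X" "\<And>T. T \<in> S \<Longrightarrow> adj X T \<in> S"
  and T: "T \<in> lin_span (bh X) S"
 shows "adj X T \<in> lin_span (bh X) S"
proof -
 have mem: "\<And>T. T \<in> lin_span (bh X) S \<Longrightarrow> T \<in> bop X"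
  using lin_span_space[OF S(1)] by (auto simp: op_space_def)
 show ?thesis using T
  by induction (auto simp: adjoint_zero adjoint_add adjoint_smult mem S(2) intro: lin_span.intros)
qed

lemma bounded_on_linear: "bounded_on X Y A \<phi> \<Longrightarrow> linear_on (bh X) (bh Y) A \<phi>"
 by (simp add: bounded_on_def)

subsection \<open>Minimal tensor products\<close>

lemma alg_tensor_gen: "A \<subseteq> bop X \<Longrightarrow> B \<subseteq> bop Y \<Longrightarrow> {op_tensor X Y S T | S T. S \<in> A \<and> T \<in> B} \<subseteq> bop (X \<times> Y)"
 by (auto intro!: op_tensor_bop)

lemma alg_tensor_space: "A \<subseteq> bop X \<Longrightarrow> B \<subseteq> bop Y \<Longrightarrow> op_space (X \<times> Y) (alg_tensor X A Y B)"
 unfolding alg_tensor_def by (rule lin_span_space[OF alg_tensor_gen])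

lemma alg_tensorI: "S \<in> A \<Longrightarrow> T \<in> B \<Longrightarrow> op_tensor X Y S T \<in> alg_tensor X A Y B"
 unfolding alg_tensor_def by (intro lin_span_incl) blast

lemma alg_tensor_bop: "A \<subseteq> bop X \<Longrightarrow> B \<subseteq> bop Y \<Longrightarrow> alg_tensor X A Y B \<subseteq> bop (X \<times> Y)"
 by (rule subsetI) (rule op_spaceD(1)[OF alg_tensor_space])

lemma op_alg_bop: "op_alg X A \<Longrightarrow> A \<subseteq> bop X" by (simp add: op_alg_def op_space_def)

lemma alg_tensor_alg:
 assumes A: "op_alg X A" and B: "op_alg Y B" shows "op_alg (X \<times> Y) (alg_tensor X A Y B)"
proof -
 note AB = op_alg_bop[OF A] op_alg_bop[OF B]
 show ?thesis unfolding alg_tensor_def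
 proof (rule lin_span_alg[OF alg_tensor_gen[OF AB]])
  show "\<one>\<^bsub>bh (X \<times> Y)\<^esub> \<in> lin_span (bh (X \<times> Y)) {op_tensor X Y S T |S T. S \<in> A \<and> T \<in> B}"
   using A B by (intro lin_span_incl) (auto simp: op_alg_def simp flip: op_tensor_one)
  fix a b assume "a \<in> {op_tensor X Y S T |S T. S \<in> A \<and> T \<in> B}" "b \<in> {op_tensor X Y S T |S T. S \<in> A \<and> T \<in> B}"
  then obtain S T S' T' where ab: "a = op_tensor X Y S T" "b = op_tensor X Y S' T'" "S \<in> A" "T \<in> B" "S' \<in> A" "T' \<in> B"
   by blast
  hence "a \<otimes>\<^bsub>bh (X \<times> Y)\<^esub> b = op_tensor X Y (S \<otimes>\<^bsub>bh X\<^esub> S') (T \<otimes>\<^bsub>bh Y\<^esub> T')"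
   using AB by (simp add: op_tensor_mult subsetD)
  moreover have "S \<otimes>\<^bsub>bh X\<^esub> S' \<in> A" "T \<otimes>\<^bsub>bh Y\<^esub> T' \<in> B" using A B ab by (auto simp: op_alg_def)
  ultimately show "a \<otimes>\<^bsub>bh (X \<times> Y)\<^esub> b \<in> lin_span (bh (X \<times> Y)) {op_tensor X Y S T |S T. S \<in> A \<and> T \<in> B}"
   by (intro lin_span_incl) blast
 qed
qed

lemma min_tensor_alg: "op_alg X A \<Longrightarrow> op_alg Y B \<Longrightarrow> op_alg (X \<times> Y) (min_tensor X A Y B)"
 unfolding min_tensor_def by (intro op_closure_alg alg_tensor_alg)

lemma alg_min_tensor: "A \<subseteq> bop X \<Longrightarrow> B \<subseteq> bop Y \<Longrightarrow> alg_tensor X A Y B \<subseteq> min_tensor X A Y B"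
 unfolding min_tensor_def by (intro op_closure_incl alg_tensor_bop)

lemma min_tensor_bop: "min_tensor X A Y B \<subseteq> bop (X \<times> Y)"
 by (simp add: min_tensor_def op_closure_bop)

lemma min_tensor_closed: "A \<subseteq> bop X \<Longrightarrow> B \<subseteq> bop Y \<Longrightarrow> op_closure (ell2 (X \<times> Y)) (min_tensor X A Y B) = min_tensor X A Y B"
 unfolding min_tensor_def by (intro op_closure_closure alg_tensor_bop)

lemma min_tensor_adjoint:
 assumes AB: "A \<subseteq> bop X" "B \<subseteq> bop Y"
  and adjs: "\<And>T. T \<in> A \<Longrightarrow> adj X T \<in> A" "\<And>T. T \<in> B \<Longrightarrow> adj Y T \<in> B"
  and T: "T \<in> min_tensor X A Y B"
 shows "adj (X \<times> Y) T \<in> min_tensor X A Y B"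
 unfolding min_tensor_def
proof (rule op_closure_adjoint[OF alg_tensor_bop[OF AB] _ T[unfolded min_tensor_def]])
 fix T assume T: "T \<in> alg_tensor X A Y B"
 show "adj (X \<times> Y) T \<in> alg_tensor X A Y B" unfolding alg_tensor_def
 proof (rule lin_span_adjoint[OF alg_tensor_gen[OF AB] _ T[unfolded alg_tensor_def]])
  fix T assume "T \<in> {op_tensor X Y S T |S T. S \<in> A \<and> T \<in> B}"
  then obtain S R where T: "T = op_tensor X Y S R" "S \<in> A" "R \<in> B" by blast
  hence "adj (X \<times> Y) T = op_tensor X Y (adj X S) (adj Y R)"
   using AB by (simp add: op_tensor_adjoint subsetD)
  thus "adj (X \<times> Y) T \<in> {op_tensor X Y S T |S T. S \<in> A \<and> T \<in> B}"
   using T adjs by blast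
 qed
qed

text \<open>Reassociation is a mere relabelling of coordinates, hence an amplification with a
  one-point second factor.\<close>

interpretation assoc: reindex "(X \<times> Y) \<times> Z" "X \<times> (Y \<times> Z)" "{()}"
 "\<lambda>(x, (y, z)). ((x, y), z)" "\<lambda>_. ()" "\<lambda>((x, y), z) _. (x, (y, z))"
 for X :: "'x set" and Y :: "'y set" and Z :: "'z set"
 by unfold_locales auto

lemma assoc_op_eq:
 fixes T :: "(('x \<times> 'y) \<times> 'z \<Rightarrow> complex) op"
 assumes T: "T \<in> bop ((X \<times> Y) \<times> Z)" shows "assoc_op X Y Z T = assoc.amp X Y Z T"
proof (rule bop_eq)
 let ?U = "\<lambda>(F :: ('x \<times> 'y) \<times> 'z \<Rightarrow> complex) (x, (y, z)). F ((x, y), z)"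
 show "assoc_op X Y Z T \<in> extensional (l2 (X \<times> (Y \<times> Z)))"
  unfolding assoc_op_def conj_op_def by (rule restrict_extensional)
 fix F w assume F: "F \<in> l2 (X \<times> (Y \<times> Z))"
 let ?S = "assoc.slice X Y Z F ()"
 have S: "?S \<in> l2 ((X \<times> Y) \<times> Z)" using F by simp
 have "?U ?S = F" using l2_outside[OF F] by (auto simp: assoc.slice_def)
 moreover
 have "inj_on ?U (l2 ((X \<times> Y) \<times> Z))"
 proof (rule inj_onI, rule ext)
  fix G H :: "('x \<times> 'y) \<times> 'z \<Rightarrow> complex" and u :: "('x \<times> 'y) \<times> 'z" assume eq: "?U G = ?U H"
  obtain x y z where "u = ((x, y), z)" by (metis prod.exhaust)
  thus "G u = H u" using fun_cong[OF eq, of "(x, (y, z))"] by simp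
 qed
 from inv_into_f_f[OF this S] have "inv_into (l2 ((X \<times> Y) \<times> Z)) ?U (?U ?S) = ?S" .
 ultimately have "inv_into (l2 ((X \<times> Y) \<times> Z)) ?U F = ?S" by (simp only:)
 hence "assoc_op X Y Z T F = ?U (T ?S)" using F by (simp add: assoc_op_def conj_op_def)
 hence "assoc_op X Y Z T F w = ?U (T ?S) w" by (rule fun_cong)
 also have "\<dots> = assoc.amp X Y Z T F w"
 proof (cases "w \<in> X \<times> (Y \<times> Z)")
  case True thus ?thesis using F by (auto simp: assoc.amp_apply)
 next
  case False
  hence "(case w of (x, (y, z)) \<Rightarrow> ((x, y), z)) \<notin> (X \<times> Y) \<times> Z" by (auto split: prod.splits)
  thus ?thesis using F False bop_outside[OF T S] by (auto simp: assoc.amp_outside split: prod.splits)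
 qed
 finally show "assoc_op X Y Z T F w = assoc.amp X Y Z T F w" .
qed auto

subsection \<open>The left regular representation\<close>

context group
begin

abbreviation "GxG \<equiv> carrier G \<times> carrier G"
abbreviation "HG \<equiv> ell2 (carrier G)"
abbreviation "HG2 \<equiv> ell2 GxG"
abbreviation "BG \<equiv> bh (carrier G)"
abbreviation "BG2 \<equiv> bh GxG"
abbreviation "adjG \<equiv> adjoint_op HG"
abbreviation "ipG \<equiv> hip HG"
abbreviation "l2G \<equiv> l2 (carrier G)"
abbreviation "bopG \<equiv> bop (carrier G)"
abbreviation "bopG2 \<equiv> bop GxG"
abbreviation "normG \<equiv> l2norm (carrier G)"
abbreviation "\<xi> \<equiv> delta \<one>"
abbreviation "lreg \<equiv> left_regular G"
abbreviation "gspan \<equiv> lin_span BG (left_regular G ` carrier G)"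
abbreviation "cred \<equiv> reduced_alg G"

lemma delta_one_eq: "delta_one G = delta \<one>"
 by (simp add: delta_one_def delta_def)

lemma lreg_apply: "v \<in> l2G \<Longrightarrow> lreg g v = (\<lambda>x. if x \<in> carrier G then v (inv g \<otimes> x) else 0)"
 by (simp add: left_regular_def)

lemma lreg_l2:
 assumes g: "g \<in> carrier G" and v: "v \<in> l2G"
 shows "lreg g v \<in> l2G" "normG (lreg g v) = normG v"
proof -
 let ?h = "\<lambda>x. (cmod (v x))\<^sup>2"
 have bij: "bij_betw (\<lambda>x. inv g \<otimes> x) (carrier G) (carrier G)"
  by (rule bij_betwI[where g="\<lambda>x. g \<otimes> x"]) (use g in \<open>auto simp flip: m_assoc\<close>)
 have "(\<lambda>x. ?h (inv g \<otimes> x)) summable_on carrier G"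
  using v summable_on_reindex_bij_betw[OF bij, of ?h] by (simp add: l2_iff)
 moreover have "(\<lambda>x. (cmod (lreg g v x))\<^sup>2) summable_on carrier G \<longleftrightarrow> (\<lambda>x. ?h (inv g \<otimes> x)) summable_on carrier G"
  using v by (intro summable_on_cong) (simp add: lreg_apply)
 ultimately show "lreg g v \<in> l2G" using v by (subst l2_iff) (simp add: lreg_apply)
 have "(\<Sum>\<^sub>\<infinity>x\<in>carrier G. (cmod (lreg g v x))\<^sup>2) = (\<Sum>\<^sub>\<infinity>x\<in>carrier G. ?h (inv g \<otimes> x))"
  using v by (intro infsum_cong) (simp add: lreg_apply)
 also have "\<dots> = infsum ?h (carrier G)" by (rule infsum_reindex_bij_betw[OF bij])
 finally show "normG (lreg g v) = normG v" by (simp add: l2norm_def)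
qed

lemma lreg_bop [simp]: assumes g: "g \<in> carrier G" shows "lreg g \<in> bopG"
proof (rule bopI[where C=1])
 show "lreg g \<in> extensional l2G" unfolding left_regular_def by (rule restrict_extensional)
 show "lreg g (\<lambda>x. v x + w x) x = lreg g v x + lreg g w x" if "v \<in> l2G" "w \<in> l2G" for v w x
  using that l2_add(1)[OF that] by (simp add: lreg_apply)
 show "lreg g (\<lambda>x. c * v x) x = c * lreg g v x" if "v \<in> l2G" for c v x
  using that l2_scale[OF that] by (simp add: lreg_apply)
qed (use lreg_l2[OF g] in auto)

lemma lreg_delta:
 assumes "g \<in> carrier G" "x \<in> carrier G" shows "lreg g (delta x) = delta (g \<otimes> x)"
proof
 fix y show "lreg g (delta x) y = delta (g \<otimes> x) y"
 proof (cases "y \<in> carrier G")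
  case True
  have "inv g \<otimes> y = x \<longleftrightarrow> y = g \<otimes> x"
   using assms True inv_solve_left'[of x g y] by auto
  thus ?thesis using assms True by (simp add: lreg_apply) (simp add: delta_def)
 next
  case False
  hence "y \<noteq> g \<otimes> x" using assms by auto
  thus ?thesis using assms False by (simp add: lreg_apply) (simp add: delta_def)
 qed
qed

lemma lreg_mult: "g \<in> carrier G \<Longrightarrow> h \<in> carrier G \<Longrightarrow> lreg g \<otimes>\<^bsub>BG\<^esub> lreg h = lreg (g \<otimes> h)"
 by (rule bop_eqI[of _ "carrier G"]) (auto simp: lreg_delta m_assoc)

lemma lreg_one: "lreg \<one> = \<one>\<^bsub>BG\<^esub>"
 by (rule bop_eqI[of _ "carrier G"]) (auto simp: lreg_delta)

lemma lreg_adjoint: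
 assumes g: "g \<in> carrier G" shows "adjG (lreg g) = lreg (inv g)"
proof (rule adjoint_eqI)
 fix x y assume "x \<in> carrier G" "y \<in> carrier G"
 moreover from this have "y = inv g \<otimes> x \<longleftrightarrow> x = g \<otimes> y" using g inv_solve_left by auto
 ultimately show "lreg (inv g) (delta x) y = cnj (lreg g (delta y) x)"
  using g by (simp add: lreg_delta) (simp add: delta_def)
qed (use g in auto)

lemma lreg_range: "lreg ` carrier G \<subseteq> bopG" by auto

section \<open>The group algebra and its norm closure\<close>

lemma gspan_alg: "op_alg (carrier G) gspan"
proof (rule lin_span_alg[OF lreg_range])
 show "\<one>\<^bsub>BG\<^esub> \<in> gspan" by (intro lin_span_incl) (auto simp flip: lreg_one)
qed (auto simp: lreg_mult intro: lin_span_incl)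

lemma gspan_bop: "gspan \<subseteq> bopG" by (rule op_alg_bop[OF gspan_alg])

lemma gspan_adjoint: "T \<in> gspan \<Longrightarrow> adjG T \<in> gspan"
 by (rule lin_span_adjoint[OF lreg_range]) (auto simp: lreg_adjoint)

lemma cred_eq: "cred = op_closure HG gspan"
 by (simp add: reduced_alg_def Let_def)

lemma cred_alg: "op_alg (carrier G) cred"
 unfolding cred_eq by (rule op_closure_alg[OF gspan_alg])

lemma cred_bop: "cred \<subseteq> bopG" by (rule op_alg_bop[OF cred_alg])

lemma cred_bopD [simp]: "T \<in> cred \<Longrightarrow> T \<in> bopG" using cred_bop by blast

lemma gspan_cred: "gspan \<subseteq> cred" unfolding cred_eq by (rule op_closure_incl[OF gspan_bop])

lemma lreg_cred [simp]: "g \<in> carrier G \<Longrightarrow> lreg g \<in> cred"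
 using gspan_cred by (auto intro: lin_span_incl)

lemma cred_adjoint: "T \<in> cred \<Longrightarrow> adjG T \<in> cred"
 unfolding cred_eq by (rule op_closure_adjoint[OF gspan_bop gspan_adjoint])

lemma cred_cstar: "cstar_algebra HG cred"
 using cred_alg cred_adjoint op_closure_closure[OF gspan_bop]
 by (auto simp: cstar_algebra_def op_alg_def op_space_def cred_eq)

lemma cred_mult: "S \<in> cred \<Longrightarrow> T \<in> cred \<Longrightarrow> S \<otimes>\<^bsub>BG\<^esub> T \<in> cred"
 using cred_alg by (simp add: op_alg_def)

text \<open>Elements of the reduced C*-algebra commute with right translations.\<close>

lemma cred_entry:
 assumes T: "T \<in> cred" and xy: "x \<in> carrier G" "y \<in> carrier G"
 shows "T (delta x) y = T \<xi> (y \<otimes> inv x)"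
proof -
 have gs: "T (delta x) y = T \<xi> (y \<otimes> inv x)" if "T \<in> gspan" for T
  using that
 proof induction
  case (lin_span_incl a)
  then obtain g where g: "g \<in> carrier G" "a = lreg g" by blast
  have "y = g \<otimes> x \<longleftrightarrow> y \<otimes> inv x = g" using g xy inv_solve_right[of g y x] by auto
  thus ?case using g xy by (simp add: lreg_delta) (simp add: delta_def)
 qed (use xy in auto)
 have TX: "T \<in> bopG" using T by simp
 have "cmod (T (delta x) y - T \<xi> (y \<otimes> inv x)) \<le> 0"
 proof (rule field_le_epsilon)
  fix e :: real assume "e > 0"
  hence "e / 2 > 0" by simp
  then obtain R where R: "R \<in> gspan" "op_le (carrier G) (op_diff (carrier G) T R) (e / 2)"
   using T unfolding cred_eq op_closure_iff[OF gspan_bop] by blast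
  have RX: "R \<in> bopG" using R gspan_bop by blast
  have "cmod (T (delta u) w - R (delta u) w) \<le> e / 2" if u: "u \<in> carrier G" for u w
  proof -
   have "cmod (op_diff (carrier G) T R (delta u) w) \<le> normG (op_diff (carrier G) T R (delta u))"
   proof (rule l2_coord_le)
    have "op_diff (carrier G) T R \<in> bopG" using TX RX by simp
    thus "op_diff (carrier G) T R (delta u) \<in> l2G" by (rule bop_in) (use u in simp)
   qed
   also have "\<dots> \<le> e / 2" using op_leD[OF R(2), of "delta u"] u by simp
   finally show ?thesis using u by simp
  qed
  note near = this
  have "T (delta x) y - T \<xi> (y \<otimes> inv x) =
    (T (delta x) y - R (delta x) y) - (T \<xi> (y \<otimes> inv x) - R \<xi> (y \<otimes> inv x))"
   using gs[OF R(1)] by simp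
  also have "cmod \<dots> \<le> e / 2 + e / 2"
   by (rule order_trans[OF norm_triangle_ineq4 add_mono[OF near[OF xy(1)] near[OF one_closed]]])
  finally show "cmod (T (delta x) y - T \<xi> (y \<otimes> inv x)) \<le> 0 + e" by simp
 qed
 thus ?thesis by simp
qed

text \<open>The vector at the unit is separating for the reduced algebra: by
  \<open>cred_entry\<close> every column of the matrix is a translate of the one at the
  unit.\<close>

lemma cred_eqI:
 assumes "S \<in> cred" "T \<in> cred" "\<And>x. x \<in> carrier G \<Longrightarrow> S \<xi> x = T \<xi> x"
 shows "S = T"
proof (rule bop_eqI[of _ "carrier G"])
 fix x y assume xy: "x \<in> carrier G" "y \<in> carrier G"
 show "S (delta x) y = T (delta x) y"
  unfolding cred_entry[OF assms(1) xy] cred_entry[OF assms(2) xy] using xy by (intro assms(3)) auto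
qed (use assms in auto)

end

context group
begin

subsection \<open>The comultiplication\<close>

lemma inv_mult_cancel: "x \<in> carrier G \<Longrightarrow> z \<in> carrier G \<Longrightarrow> inv x \<otimes> (x \<otimes> z) = z"
 "x \<in> carrier G \<Longrightarrow> z \<in> carrier G \<Longrightarrow> x \<otimes> (inv x \<otimes> z) = z"
 by (simp_all flip: m_assoc)

text \<open>The relabelling (r, z) \<mapsto> (r, r z) is the Kac-Takesaki unitary W, so
  \<open>com.amp T\<close> is W (T \<otimes> 1) W*. This gives the comultiplication at once on all
  bounded operators, multiplicative, *-preserving and norm decreasing, without an extension from the
  group algebra. The two following relabellings do the same in three variables and produce \<Delta>
  \<otimes> id and id \<otimes> \<Delta>.\<close>

sublocale com: reindex "carrier G" "GxG" "carrier G" fst "\<lambda>(s, t). inv s \<otimes> t" "\<lambda>r z. (r, r \<otimes> z)"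
 by unfold_locales (auto simp: inv_mult_cancel)

sublocale com_left: reindex "GxG" "GxG \<times> carrier G" "carrier G"
 "\<lambda>((s, t), u). (s, u)" "\<lambda>((s, t), u). inv s \<otimes> t" "\<lambda>(r, u) z. ((r, r \<otimes> z), u)"
 by unfold_locales (auto simp: inv_mult_cancel)

sublocale com_right: reindex "GxG" "carrier G \<times> GxG" "carrier G"
 "\<lambda>(s, (t, u)). (s, t)" "\<lambda>(s, (t, u)). inv t \<otimes> u" "\<lambda>(s, r) z. (s, (r, r \<otimes> z))"
 by unfold_locales (auto simp: inv_mult_cancel)

abbreviation "cred2 \<equiv> min_tensor (carrier G) (reduced_alg G) (carrier G) (reduced_alg G)"
abbreviation "otimes \<equiv> op_tensor (carrier G) (carrier G)"

lemma cred2_alg: "op_alg GxG cred2"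
 by (rule min_tensor_alg[OF cred_alg cred_alg])

lemma cred2_bop: "cred2 \<subseteq> bopG2" by (rule op_alg_bop[OF cred2_alg])

lemma cred2_bopD [simp]: "T \<in> cred2 \<Longrightarrow> T \<in> bopG2" using cred2_bop by blast

lemma cred2_space: "op_space GxG cred2" using cred2_alg by (simp add: op_alg_def)

lemma tensor_cred2: "S \<in> cred \<Longrightarrow> T \<in> cred \<Longrightarrow> otimes S T \<in> cred2"
 by (rule subsetD[OF alg_min_tensor[OF cred_bop cred_bop]]) (rule alg_tensorI)

lemma com_lreg: "g \<in> carrier G \<Longrightarrow> com.amp (lreg g) = otimes (lreg g) (lreg g)"
proof (rule op_tensor_eqI[symmetric])
 fix x y x' y' assume g: "g \<in> carrier G" and xy: "x \<in> carrier G" "y \<in> carrier G" "x' \<in> carrier G" "y' \<in> carrier G"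
 have "inv x \<otimes> y = inv (g \<otimes> x) \<otimes> y' \<longleftrightarrow> y' = g \<otimes> y"
 proof
  assume "inv x \<otimes> y = inv (g \<otimes> x) \<otimes> y'"
  hence "(g \<otimes> x) \<otimes> (inv x \<otimes> y) = y'" using g xy by (simp add: inv_mult_cancel)
  thus "y' = g \<otimes> y" using g xy by (simp add: m_assoc inv_mult_cancel)
 qed (use g xy in \<open>simp add: inv_mult_group m_assoc inv_mult_cancel\<close>)
 thus "com.amp (lreg g) (delta (x, y)) (x', y') = lreg g (delta x) x' * lreg g (delta y) y'"
  using g xy by (simp add: com.amp_entry lreg_delta) (auto simp: delta_def)
qed auto

lemma com_cred: "T \<in> cred \<Longrightarrow> com.amp T \<in> cred2"
proof -
 assume T: "T \<in> cred"
 have "com.amp ` gspan \<subseteq> alg_tensor (carrier G) cred (carrier G) cred"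
  by (rule linear_on_span_image[OF bounded_on_linear[OF com.bounded_on_amp[OF order_refl]] op_space_bop lreg_range _
     alg_tensor_space[OF cred_bop cred_bop]])
   (auto simp: com_lreg intro!: alg_tensorI)
 thus ?thesis
  unfolding min_tensor_def using T
  by (intro bounded_on_closure[OF com.bounded_on_amp[OF order_refl] op_space_bop gspan_bop _
     alg_tensor_bop[OF cred_bop cred_bop]])
   (auto simp: cred_eq[symmetric])
qed

definition comult :: "('a \<Rightarrow> complex) op \<Rightarrow> ('a \<times> 'a \<Rightarrow> complex) op" where
 "comult = restrict com.amp (reduced_alg G)"

lemma comult_apply [simp]: "T \<in> cred \<Longrightarrow> comult T = com.amp T"
 by (simp add: comult_def)

lemma comult_star_hom: "star_hom HG cred HG2 cred2 comult"
 unfolding comult_def by (rule com.star_hom_amp[OF cred_alg cred_adjoint]) (auto intro: com_cred)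

lemma star_hom_bounded_on:
 assumes "cstar_algebra (ell2 X) A" "star_hom (ell2 X) A (ell2 Y) B \<phi>" "B \<subseteq> bop Y"
 shows "bounded_on X Y A \<phi>"
 unfolding bounded_on_def using assms star_hom_contractive[OF assms]
 by (auto simp: star_hom_def intro!: exI[of _ 1])

text \<open>The competitors are arbitrary *-homomorphisms. They are contractive by
  \<open>star_hom_contractive\<close>, so agreement on the generators passes to the span and then to
  the closure; extensionality fixes the values elsewhere.\<close>

lemma reduced_comult_eq: "reduced_comult G = comult"
 unfolding reduced_comult_def
proof (rule the_equality, intro conjI ballI comult_star_hom)
 show "comult (lreg g) = otimes (lreg g) (lreg g)" if "g \<in> carrier G" for g
  using that by (simp add: com_lreg)
 fix \<phi> assume \<phi>: "star_hom HG cred HG2 cred2 \<phi> \<and>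
  (\<forall>g\<in>carrier G. \<phi> (lreg g) = otimes (lreg g) (lreg g))"
 note sp = conjunct1[OF cred_alg[unfolded op_alg_def]]
 note b\<phi> = star_hom_bounded_on[OF cred_cstar conjunct1[OF \<phi>] cred2_bop]
 note bc = star_hom_bounded_on[OF cred_cstar comult_star_hom cred2_bop]
 have l: "linear_on BG BG2 gspan \<psi>"
  if "bounded_on (carrier G) GxG cred \<psi>" for \<psi>
  using bounded_on_linear[OF that] gspan_cred unfolding linear_on_def by blast
 have gs: "\<phi> T = comult T" if "T \<in> gspan" for T
  using \<phi> by (intro linear_on_eq_span[OF l[OF b\<phi>] l[OF bc] _ lreg_range that]) (auto simp: com_lreg)
 have "\<phi> T = comult T" if "T \<in> cred" for T
  by (rule bounded_on_eq[OF b\<phi> bc sp gspan_cred gs that]) (use that in \<open>simp_all add: cred_eq\<close>)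
 thus "\<phi> = comult"
  using \<phi> comult_star_hom by (intro extensionalityI[of _ cred]) (auto simp: star_hom_def PiE_def)
qed

lemma reduced_cqg_simps [simp]:
 "qindex (reduced_cqg G) = carrier G" "qalg (reduced_cqg G) = cred" "qcomult (reduced_cqg G) = comult"
 by (simp_all add: reduced_cqg_def reduced_comult_eq)

lemma com_left_tensor:
 assumes "a \<in> bopG" "b \<in> bopG"
 shows "com_left.amp (otimes a b) = op_tensor GxG (carrier G) (com.amp a) b"
 using assms by (intro op_tensor_eqI[symmetric]) (auto simp: com_left.amp_entry com.amp_entry op_tensor_entry)

lemma com_right_tensor:
 assumes "a \<in> bopG" "b \<in> bopG"
 shows "com_right.amp (otimes a b) = op_tensor (carrier G) GxG a (com.amp b)"
 using assms by (intro op_tensor_eqI[symmetric]) (auto simp: com_right.amp_entry com.amp_entry op_tensor_entry)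

lemma cred2_adjoint: "T \<in> cred2 \<Longrightarrow> adjoint_op HG2 T \<in> cred2"
 by (rule min_tensor_adjoint[OF cred_bop cred_bop cred_adjoint cred_adjoint])

lemma min_tensor_image:
 assumes \<phi>: "bounded_on (X \<times> Y) W (bop (X \<times> Y)) \<phi>" and AB: "A \<subseteq> bop X" "B \<subseteq> bop Y"
  and gen: "\<And>a b. a \<in> A \<Longrightarrow> b \<in> B \<Longrightarrow> \<phi> (op_tensor X Y a b) \<in> K" and K: "op_space W K"
  and T: "T \<in> min_tensor X A Y B"
 shows "\<phi> T \<in> op_closure (ell2 W) K"
proof (rule bounded_on_closure[OF \<phi> op_space_bop alg_tensor_bop[OF AB]])
 show "\<phi> ` alg_tensor X A Y B \<subseteq> K" unfolding alg_tensor_def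
  by (rule linear_on_span_image[OF bounded_on_linear[OF \<phi>] op_space_bop alg_tensor_gen[OF AB] _ K])
   (use gen in auto)
 show "K \<subseteq> bop W" using K by (simp add: op_space_def)
qed (use T min_tensor_bop[of X A Y B] in \<open>auto simp: min_tensor_def\<close>)

lemma comult_coassociative: "coassociative (reduced_cqg G)"
proof -
 let ?L = "restrict com_left.amp cred2" and ?R = "restrict com_right.amp cred2"
 have L: "com_left.amp T \<in> min_tensor GxG cred2 (carrier G) cred" if "T \<in> cred2" for T
  unfolding min_tensor_def[of "GxG"]
  by (rule min_tensor_image[OF com_left.bounded_on_amp[OF order_refl] cred_bop cred_bop _
     alg_tensor_space[OF cred2_bop cred_bop] that])
   (auto simp: com_left_tensor intro: alg_tensorI com_cred)
 have R: "com_right.amp T \<in> min_tensor (carrier G) cred GxG cred2" if "T \<in> cred2" for T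
  unfolding min_tensor_def[of "carrier G" _ "GxG"]
  by (rule min_tensor_image[OF com_right.bounded_on_amp[OF order_refl] cred_bop cred_bop _
     alg_tensor_space[OF cred_bop cred2_bop] that])
   (auto simp: com_right_tensor intro: alg_tensorI com_cred)
 have eq: "assoc_op (carrier G) (carrier G) (carrier G) (com_left.amp (com.amp a)) = com_right.amp (com.amp a)"
  if a: "a \<in> cred" for a
 proof -
  have "assoc.amp (carrier G) (carrier G) (carrier G) (com_left.amp (com.amp a)) = com_right.amp (com.amp a)"
  proof (rule bop_eqI)
   fix x y assume "x \<in> carrier G \<times> GxG" "y \<in> carrier G \<times> GxG"
   then obtain s t u s' t' u' where xy: "x = (s, t, u)" "y = (s', t', u')" "s \<in> carrier G" "t \<in> carrier G"
    "u \<in> carrier G" "s' \<in> carrier G" "t' \<in> carrier G" "u' \<in> carrier G" by blast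
   \<comment> \<open>Both iterated comultiplications let a act on the first coordinate. The left one
     keeps inv s \<otimes> t and inv s \<otimes> u fixed, the right one inv s \<otimes> t and inv t
     \<otimes> u; either pair determines the other.\<close>
   have "inv s \<otimes> u = inv s' \<otimes> u' \<longleftrightarrow> inv t \<otimes> u = inv t' \<otimes> u'" if st: "inv s \<otimes> t = inv s' \<otimes> t'"
   proof -
    have "inv s \<otimes> u = (inv s \<otimes> t) \<otimes> (inv t \<otimes> u)" "inv s' \<otimes> u' = (inv s' \<otimes> t') \<otimes> (inv t' \<otimes> u')"
     using xy by (simp_all add: m_assoc inv_mult_cancel)
    thus ?thesis using xy st by simp
   qed
   thus "assoc.amp (carrier G) (carrier G) (carrier G) (com_left.amp (com.amp a)) (delta x) y
     = com_right.amp (com.amp a) (delta x) y"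
    using xy a by (simp add: assoc.amp_entry com_left.amp_entry com_right.amp_entry com.amp_entry)
  qed (use a in auto)
  thus ?thesis using a by (subst assoc_op_eq) auto
 qed
 show ?thesis
  unfolding coassociative_def
 proof (intro exI[of _ ?L] exI[of _ ?R] conjI ballI; unfold reduced_cqg_simps)
  show "star_hom HG2 cred2 (ell2 (GxG \<times> carrier G))
    (min_tensor GxG cred2 (carrier G) cred) ?L"
   by (rule com_left.star_hom_amp[OF cred2_alg cred2_adjoint]) (use L in auto)
  show "star_hom HG2 cred2 (ell2 (carrier G \<times> GxG))
    (min_tensor (carrier G) cred GxG cred2) ?R"
   by (rule com_right.star_hom_amp[OF cred2_alg cred2_adjoint]) (use R in auto)
 qed (simp_all add: tensor_cred2 com_left_tensor com_right_tensor com_cred eq)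
qed

text \<open>The extension from generators to elementary tensors goes one leg at a time, since S
  \<mapsto> S \<otimes> T and T \<mapsto> S \<otimes> T are bounded linear while the joint map is
  only bilinear.\<close>

lemma cred2_least:
 assumes K: "op_space GxG K" "op_closure HG2 K = K"
  and gen: "\<And>g h. g \<in> carrier G \<Longrightarrow> h \<in> carrier G \<Longrightarrow> otimes (lreg g) (lreg h) \<in> K"
 shows "cred2 \<subseteq> K"
proof -
 have KX: "K \<subseteq> bopG2" using K by (simp add: op_space_def)
 have ext: "\<phi> T \<in> K" if \<phi>: "bounded_on (carrier G) GxG bopG \<phi>"
  and g: "\<And>g. g \<in> carrier G \<Longrightarrow> \<phi> (lreg g) \<in> K" and T: "T \<in> cred" for \<phi> T
 proof -
  have "\<phi> ` gspan \<subseteq> K"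
   by (rule linear_on_span_image[OF bounded_on_linear[OF \<phi>] op_space_bop lreg_range _ K(1)]) (use g in auto)
  hence "\<phi> T \<in> op_closure HG2 K"
   using T by (intro bounded_on_closure[OF \<phi> op_space_bop gspan_bop _ KX]) (auto simp: cred_eq[symmetric])
  thus ?thesis using K by simp
 qed
 have 1: "otimes (lreg g) T \<in> K" if "g \<in> carrier G" "T \<in> cred" for g T
  by (rule ext[OF bounded_on_tensor_right _ that(2)]) (use gen that in auto)
 have 2: "otimes S T \<in> K" if "S \<in> cred" "T \<in> cred" for S T
  by (rule ext[OF bounded_on_tensor_left _ that(1)]) (use 1 that in auto)
 have "alg_tensor (carrier G) cred (carrier G) cred \<subseteq> K"
  unfolding alg_tensor_def by (rule lin_span_least[OF K(1)]) (use 2 in auto)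
 from op_closure_mono[OF this, of "GxG"] show ?thesis unfolding min_tensor_def K(2) .
qed

text \<open>A common form of the two density axioms: f a b is \<Delta>(a)(1 \<otimes> b) or
  \<Delta>(a)(b \<otimes> 1). By \<open>cred2_least\<close> it is enough that f reaches the tensors
  of two group elements exactly.\<close>

lemma cred2_density:
 assumes f: "\<And>a b. a \<in> cred \<Longrightarrow> b \<in> cred \<Longrightarrow> f a b \<in> cred2"
  and gen: "\<And>g h. g \<in> carrier G \<Longrightarrow> h \<in> carrier G \<Longrightarrow> \<exists>a\<in>cred. \<exists>b\<in>cred. f a b = otimes (lreg g) (lreg h)"
 shows "op_closure HG2 (lin_span BG2
   {f a b | a b. a \<in> cred \<and> b \<in> cred}) = cred2"
  (is "op_closure ?H (lin_span ?B ?S) = _")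
proof
 have S: "?S \<subseteq> cred2" using f by auto
 hence SX: "?S \<subseteq> bopG2" by (rule order_trans[OF _ cred2_bop])
 have "lin_span ?B ?S \<subseteq> cred2" by (rule lin_span_least[OF cred2_space S])
 from op_closure_mono[OF this, of "GxG"] show "op_closure ?H (lin_span ?B ?S) \<subseteq> cred2"
  by (simp only: min_tensor_closed[OF cred_bop cred_bop])
 note sp = lin_span_space[OF SX]
 have LX: "lin_span ?B ?S \<subseteq> bopG2" using sp by (simp add: op_space_def)
 show "cred2 \<subseteq> op_closure ?H (lin_span ?B ?S)"
 proof (rule cred2_least[OF op_closure_space[OF sp] op_closure_closure[OF LX]])
  fix g h assume "g \<in> carrier G" "h \<in> carrier G"
  then obtain a b where "a \<in> cred" "b \<in> cred" "f a b = otimes (lreg g) (lreg h)" using gen by blast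
  hence "otimes (lreg g) (lreg h) \<in> lin_span ?B ?S" by (metis (mono_tags, lifting) lin_span_incl mem_Collect_eq)
  thus "otimes (lreg g) (lreg h) \<in> op_closure ?H (lin_span ?B ?S)" using op_closure_incl[OF LX] by blast
 qed
qed

lemma cred_one: "\<one>\<^bsub>BG\<^esub> \<in> cred" using cred_alg by (simp add: op_alg_def)

lemma reduced_compact_quantum_group: "compact_quantum_group (reduced_cqg G)"
proof -
 let ?m = "(\<otimes>\<^bsub>BG2\<^esub>)"
 have m: "?m x y \<in> cred2" if "x \<in> cred2" "y \<in> cred2" for x y
  using cred2_alg that by (simp add: op_alg_def)
 have gen: "?m (comult (lreg g)) (otimes (lreg h) (lreg k)) = otimes (lreg (g \<otimes> h)) (lreg (g \<otimes> k))"
  if "g \<in> carrier G" "h \<in> carrier G" "k \<in> carrier G" for g h k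
  using that by (simp add: com_lreg op_tensor_mult lreg_mult)
 have "op_closure HG2 (lin_span BG2
   {?m (comult a) (otimes \<one>\<^bsub>BG\<^esub> b) | a b. a \<in> cred \<and> b \<in> cred}) = cred2"
 proof (rule cred2_density[of "\<lambda>a b. ?m (comult a) (otimes \<one>\<^bsub>BG\<^esub> b)"])
  fix g h assume gh: "g \<in> carrier G" "h \<in> carrier G"
  \<comment> \<open>Since \<Delta>(\<lambda>_g) = \<lambda>_g \<otimes> \<lambda>_g, the first leg
    is right already and b = \<lambda>_(inv g h) corrects the second.\<close>
  show "\<exists>a\<in>cred. \<exists>b\<in>cred. ?m (comult a) (otimes \<one>\<^bsub>BG\<^esub> b) = otimes (lreg g) (lreg h)"
   by (rule bexI[of _ "lreg g"], rule bexI[of _ "lreg (inv g \<otimes> h)"])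
    (use gh gen[of g \<one> "inv g \<otimes> h"] in \<open>auto simp: lreg_one inv_mult_cancel\<close>)
 qed (auto intro!: m com_cred tensor_cred2 cred_one)
 moreover have "op_closure HG2 (lin_span BG2
   {?m (comult a) (otimes b \<one>\<^bsub>BG\<^esub>) | a b. a \<in> cred \<and> b \<in> cred}) = cred2"
 proof (rule cred2_density[of "\<lambda>a b. ?m (comult a) (otimes b \<one>\<^bsub>BG\<^esub>)"])
  fix g h assume gh: "g \<in> carrier G" "h \<in> carrier G"
  \<comment> \<open>Here a is dictated by the second leg, and b corrects the first.\<close>
  show "\<exists>a\<in>cred. \<exists>b\<in>cred. ?m (comult a) (otimes b \<one>\<^bsub>BG\<^esub>) = otimes (lreg g) (lreg h)"
   by (rule bexI[of _ "lreg h"], rule bexI[of _ "lreg (inv h \<otimes> g)"])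
    (use gh gen[of h "inv h \<otimes> g" \<one>] in \<open>auto simp: lreg_one inv_mult_cancel\<close>)
 qed (auto intro!: m com_cred tensor_cred2 cred_one)
 ultimately show ?thesis
  unfolding compact_quantum_group_def reduced_cqg_simps
  using cred_cstar comult_star_hom comult_coassociative by blast
qed

end

subsection \<open>Compressions to coordinate subspaces\<close>

text \<open>The compression V*TV by the isometry V that sends the basis vector at x to the one at i
  x. For x \<mapsto> (e, x) and x \<mapsto> (x, e) it is the slice map \<omega> \<otimes> id or id
  \<otimes> \<omega> of the vector state \<omega> at the unit. It is contractive on all bounded
  operators, so the slice maps required of a Haar state need no extension argument.\<close>

locale embed =
 fixes X :: "'x set" and Y :: "'y set" and i :: "'x \<Rightarrow> 'y" and r :: "'y \<Rightarrow> 'x"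
 assumes i [simp]: "x \<in> X \<Longrightarrow> i x \<in> Y" and ri [simp]: "x \<in> X \<Longrightarrow> r (i x) = x"
begin

definition extend :: "('x \<Rightarrow> complex) \<Rightarrow> 'y \<Rightarrow> complex" where
 "extend f = (\<lambda>y. if r y \<in> X \<and> i (r y) = y then f (r y) else 0)"

definition compress :: "('y \<Rightarrow> complex) op \<Rightarrow> ('x \<Rightarrow> complex) op" where
 "compress T = (\<lambda>f\<in>l2 X. \<lambda>x. if x \<in> X then T (extend f) (i x) else 0)"

lemma extend_l2:
 assumes f: "f \<in> l2 X" shows "extend f \<in> l2 Y" "l2norm Y (extend f) \<le> l2norm X f"
proof -
 have z: "extend f y = 0" if "y \<notin> Y" for y using that i by (metis extend_def)
 have b: "L2_set (\<lambda>y. cmod (extend f y)) F \<le> l2norm X f" if F: "finite F" "F \<subseteq> Y" for F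
 proof -
  let ?F = "{y \<in> F. r y \<in> X \<and> i (r y) = y}"
  have inj: "inj_on r ?F" by (rule inj_on_inverseI[of _ i]) auto
  have "(\<Sum>y\<in>F. (cmod (extend f y))\<^sup>2) = (\<Sum>y\<in>?F. (cmod (f (r y)))\<^sup>2)"
   using F by (intro sum.mono_neutral_cong_right) (auto simp: extend_def)
  also have "\<dots> = (\<Sum>x\<in>r ` ?F. (cmod (f x))\<^sup>2)" by (simp add: sum.reindex[OF inj])
  finally have "L2_set (\<lambda>y. cmod (extend f y)) F = L2_set (\<lambda>x. cmod (f x)) (r ` ?F)"
   by (simp add: L2_set_def)
  also have "\<dots> \<le> l2norm X f" using F by (intro l2_finite_le[OF f]) auto
  finally show ?thesis .
 qed
 show "extend f \<in> l2 Y" "l2norm Y (extend f) \<le> l2norm X f" using l2I[OF z b] by blast+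
qed

lemma extend_delta: "x \<in> X \<Longrightarrow> extend (delta x) = delta (i x)"
 by (auto simp: extend_def delta_def)

lemma compress_l2:
 assumes T: "T \<in> bop Y" and f: "f \<in> l2 X"
 shows "compress T f \<in> l2 X" "l2norm X (compress T f) \<le> l2norm Y (T (extend f))"
proof -
 have z: "compress T f x = 0" if "x \<notin> X" for x using that f by (simp add: compress_def)
 have b: "L2_set (\<lambda>x. cmod (compress T f x)) F \<le> l2norm Y (T (extend f))" if F: "finite F" "F \<subseteq> X" for F
 proof -
  have inj: "inj_on i F" using F by (intro inj_on_inverseI[of _ r]) auto
  have "L2_set (\<lambda>x. cmod (compress T f x)) F = L2_set (\<lambda>y. cmod (T (extend f) y)) (i ` F)"
   unfolding L2_set_def sum.reindex[OF inj] using F f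
   by (intro arg_cong[where f=sqrt] sum.cong) (auto simp: compress_def)
  also have "\<dots> \<le> l2norm Y (T (extend f))"
   using F by (intro l2_finite_le[OF bop_in[OF T extend_l2(1)[OF f]]]) auto
  finally show ?thesis .
 qed
 show "compress T f \<in> l2 X" "l2norm X (compress T f) \<le> l2norm Y (T (extend f))" using l2I[OF z b] by blast+
qed

lemma compress_le: assumes T: "T \<in> bop Y" "op_le Y T C" "0 \<le> C" shows "op_le X (compress T) C"
 unfolding op_le_def
proof
 fix f assume f: "f \<in> l2 X"
 show "l2norm X (compress T f) \<le> C * l2norm X f"
  using compress_l2(2)[OF T(1) f] op_leD[OF T(2) extend_l2(1)[OF f]]
   mult_left_mono[OF extend_l2(2)[OF f] T(3)] by linarith
qed

lemma compress_bop [simp]: assumes T: "T \<in> bop Y" shows "compress T \<in> bop X"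
proof -
 obtain C where C: "C > 0" "op_le Y T C" using op_le_exists[OF T] by blast
 have e: "extend (\<lambda>x. f x + g x) = (\<lambda>y. extend f y + extend g y)" "extend (\<lambda>x. c * f x) = (\<lambda>y. c * extend f y)" for f g c
  by (auto simp: extend_def)
 show ?thesis
 proof (rule bopI[where C=C])
  show "compress T \<in> extensional (l2 X)" unfolding compress_def by (rule restrict_extensional)
  show "compress T (\<lambda>x. v x + w x) x = compress T v x + compress T w x" if vw: "v \<in> l2 X" "w \<in> l2 X" for v w x
   using vw l2_add(1)[OF vw] by (simp add: compress_def e bop_add[OF T] extend_l2)
  show "compress T (\<lambda>x. c * v x) x = c * compress T v x" if "v \<in> l2 X" for c v x
   using that l2_scale[OF that] by (simp add: compress_def e bop_scale[OF T] extend_l2)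
 qed (use C compress_l2[OF T] op_leD[OF compress_le[OF T C(2)]] in auto)
qed

lemma compress_entry: "x \<in> X \<Longrightarrow> y \<in> X \<Longrightarrow> compress T (delta x) y = T (delta (i x)) (i y)"
 by (simp add: compress_def extend_delta)

lemma bounded_on_compress: "A \<subseteq> bop Y \<Longrightarrow> bounded_on Y X A compress"
 unfolding bounded_on_def linear_on_def
 by (auto intro!: exI[of _ 1] compress_le bop_eqI[of _ X] simp: compress_entry subset_iff)

end

context group
begin

subsection \<open>The Haar state\<close>

lemma delta_self [simp]: "delta x x = 1" by (simp add: delta_def)

definition haar :: "('a \<Rightarrow> complex) op \<Rightarrow> complex" where
 "haar = (\<lambda>a\<in>reduced_alg G. a \<xi> \<one>)"

lemma haar_apply [simp]: "a \<in> cred \<Longrightarrow> haar a = a \<xi> \<one>"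
 by (simp add: haar_def)

text \<open>The GNS inner product is the one of the vectors a \<xi> and b \<xi>. Positivity of the
  state, the GNS distance and the isometric identification with \<open>ell2\<close> all follow from
  this formula.\<close>

lemma haar_gns:
 assumes "a \<in> cred" "b \<in> cred"
 shows "haar (adjG b \<otimes>\<^bsub>BG\<^esub> a) = ipG (a \<xi>) (b \<xi>)"
proof -
 have ad: "a \<xi> \<in> l2G" "b \<xi> \<in> l2G"
  using assms by (auto intro: bop_in[of _ "carrier G"])
 have "haar (adjG b \<otimes>\<^bsub>BG\<^esub> a) = adjG b (a \<xi>) \<one>"
  using assms cred_mult[OF cred_adjoint] by simp
 also have "\<dots> = ipG (adjG b (a \<xi>)) \<xi>"
  by (simp add: hip_delta_right)
 also have "\<dots> = ipG (a \<xi>) (b \<xi>)"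
  using adjoint_op_hip[of "adjG b" "carrier G" "a \<xi>" "delta \<one>"] assms ad
  by (simp add: adjoint_adjoint)
 finally show ?thesis .
qed

lemma cred_space: "op_space (carrier G) cred" using cred_alg by (simp add: op_alg_def)

lemma haar_bound: assumes a: "a \<in> cred" shows "cmod (haar a) \<le> op_norm HG a"
proof -
 have "cmod (a \<xi> \<one>) \<le> normG (a \<xi>)"
  using a by (intro l2_coord_le bop_in[OF cred_bopD[OF a]]) simp
 also have "\<dots> \<le> op_norm HG a"
  using op_leD[OF op_le_op_norm[OF cred_bopD[OF a]], of "delta \<one>"] by simp
 finally show ?thesis using a by simp
qed

lemma haar_cstar_state: "cstar_state HG cred haar"
 unfolding cstar_state_def
proof (intro conjI ballI allI)
 show "haar \<in> extensional cred" unfolding haar_def by (rule restrict_extensional)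
 show "haar (adjG a \<otimes>\<^bsub>BG\<^esub> a) \<in> \<real>"
  "0 \<le> Re (haar (adjG a \<otimes>\<^bsub>BG\<^esub> a))" if "a \<in> cred" for a
  unfolding haar_gns[OF that that] hip_self by simp_all
 show "cmod (haar a) \<le> op_norm HG a" if "a \<in> cred" for a by (rule haar_bound[OF that])
qed (use op_spaceD[OF cred_space] in \<open>auto simp: cred_one\<close>)

lemma embed_left: "embed (carrier G) GxG (Pair \<one>) snd"
 and embed_right: "embed (carrier G) GxG (\<lambda>x. (x, \<one>)) fst"
 by unfold_locales auto

lemma haar_haar_state_on: "haar_state_on (reduced_cqg G) haar"
proof -
 let ?L = "embed.compress (carrier G) (Pair \<one>) snd" and ?R = "embed.compress (carrier G) (\<lambda>x. (x, \<one>)) fst"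
 note L = embed.bounded_on_compress[OF embed_left cred2_bop] and R = embed.bounded_on_compress[OF embed_right cred2_bop]
 note entry = embed.compress_entry[OF embed_left] embed.compress_entry[OF embed_right]
 note bop = embed.compress_bop[OF embed_left] embed.compress_bop[OF embed_right]
 have norm: "op_norm HG (?L x) \<le> 1 * op_norm HG2 x"
  "op_norm HG (?R x) \<le> 1 * op_norm HG2 x" if "x \<in> cred2" for x
  using embed.compress_le[OF embed_left cred2_bopD[OF that] op_le_op_norm[OF cred2_bopD[OF that]]]
   embed.compress_le[OF embed_right cred2_bopD[OF that] op_le_op_norm[OF cred2_bopD[OF that]]]
   op_norm_nonneg[OF cred2_bopD[OF that]] by (auto intro!: op_norm_le)
 show ?thesis
  unfolding haar_state_on_def reduced_cqg_simps
 proof (rule conjI[OF haar_cstar_state], rule exI[of _ ?L], rule exI[of _ ?R], rule exI[of _ 1],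
   intro conjI ballI bounded_on_linear[OF L] bounded_on_linear[OF R] norm)
  fix a b assume ab: "a \<in> cred" "b \<in> cred"
  show "?L (otimes a b) = haar a \<odot>\<^bsub>BG\<^esub> b"
   using ab by (intro bop_eqI[of _ "carrier G"]) (simp_all add: bop entry op_tensor_entry)
  show "?R (otimes a b) = haar b \<odot>\<^bsub>BG\<^esub> a"
   using ab by (intro bop_eqI[of _ "carrier G"]) (simp_all add: bop entry op_tensor_entry)
 next
  fix a assume a: "a \<in> cred"
  show "?L (comult a) = haar a \<odot>\<^bsub>BG\<^esub> \<one>\<^bsub>BG\<^esub>"
   using a by (intro bop_eqI[of _ "carrier G"]) (simp_all add: bop entry com.amp_entry, simp add: delta_def)
  \<comment> \<open>On the right, slicing leaves a diagonal operator whose entries are the diagonal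
    entries of a. They are all equal because a commutes with right translations, which is the
    content of \<open>cred_entry\<close>.\<close>
  show "?R (comult a) = haar a \<odot>\<^bsub>BG\<^esub> \<one>\<^bsub>BG\<^esub>"
  proof (rule bop_eqI[of _ "carrier G"])
   fix x y assume xy: "x \<in> carrier G" "y \<in> carrier G"
   have "inv x = inv y \<longleftrightarrow> y = x" using xy inv_inj by (auto dest: inj_onD)
   moreover have "a (delta x) x = a \<xi> \<one>" using cred_entry[OF a xy(1) xy(1)] xy by simp
   ultimately show "?R (comult a) (delta x) y = (haar a \<odot>\<^bsub>BG\<^esub> \<one>\<^bsub>BG\<^esub>) (delta x) y"
    using xy a by (simp add: entry com.amp_entry) (auto simp: delta_def)
  qed (use a in \<open>simp_all add: bop\<close>)
 qed
qed

text \<open>Invariance at \<lambda>_g reads h(\<lambda>_g) \<lambda>_g = h(\<lambda>_g) 1, which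
  forces h(\<lambda>_g) = 0 unless g is the unit. Linearity and the norm bound of a state carry this
  to the whole algebra.\<close>

lemma haar_unique:
 assumes h: "haar_state_on (reduced_cqg G) h" shows "h = haar"
proof -
 let ?B = "BG"
 have st: "cstar_state HG cred h" using h by (simp add: haar_state_on_def)
 obtain L where L: "\<And>a b. a \<in> cred \<Longrightarrow> b \<in> cred \<Longrightarrow> L (otimes a b) = h a \<odot>\<^bsub>?B\<^esub> b"
  "\<And>a. a \<in> cred \<Longrightarrow> L (comult a) = h a \<odot>\<^bsub>?B\<^esub> \<one>\<^bsub>?B\<^esub>"
  using h unfolding haar_state_on_def reduced_cqg_simps by blast
 have gen: "h (lreg g) = haar (lreg g)" if g: "g \<in> carrier G" for g
 proof (cases "g = \<one>")
  case True thus ?thesis using st g by (simp add: lreg_one cstar_state_def cred_one)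
 next
  case False
  have "h (lreg g) \<odot>\<^bsub>?B\<^esub> lreg g = h (lreg g) \<odot>\<^bsub>?B\<^esub> \<one>\<^bsub>?B\<^esub>"
   using L(1)[of "lreg g" "lreg g"] L(2)[of "lreg g"] g by (simp add: com_lreg)
  hence "(h (lreg g) \<odot>\<^bsub>?B\<^esub> lreg g) \<xi> \<one> = (h (lreg g) \<odot>\<^bsub>?B\<^esub> \<one>\<^bsub>?B\<^esub>) \<xi> \<one>" by simp
  hence "h (lreg g) = 0" using g False by (simp add: lreg_delta) (simp add: delta_def)
  thus ?thesis using g False by (simp add: lreg_delta) (simp add: delta_def)
 qed
 have hl: "h (a \<oplus>\<^bsub>?B\<^esub> b) = h a + h b" "h (c \<odot>\<^bsub>?B\<^esub> a) = c * h a" "cmod (h a) \<le> op_norm HG a"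
  if "a \<in> cred" "b \<in> cred" for a b c using st that by (auto simp: cstar_state_def)
 have gs: "h a = haar a" if "a \<in> gspan" for a
  using that
 proof induction
  case lin_span_zero
  have z: "\<zero>\<^bsub>?B\<^esub> \<in> cred" by (rule op_spaceD(2)[OF cred_space])
  have "0 \<odot>\<^bsub>?B\<^esub> \<zero>\<^bsub>?B\<^esub> = \<zero>\<^bsub>?B\<^esub>" by (rule bop_eq[of _ "carrier G"]) auto
  hence "h \<zero>\<^bsub>?B\<^esub> = 0" using hl(2)[OF z z, of 0] by simp
  thus ?case using z by simp
 next
  case (lin_span_add a b)
  hence "a \<in> cred" "b \<in> cred" using gspan_cred by auto
  thus ?case using lin_span_add hl op_spaceD(3)[OF cred_space] by simp
 next
  case (lin_span_smult a c)
  hence "a \<in> cred" using gspan_cred by auto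
  thus ?case using lin_span_smult hl op_spaceD(4)[OF cred_space] by simp
 qed (use gen in auto)
 have "h a = haar a" if a: "a \<in> cred" for a
 proof -
  have "cmod (h a - haar a) \<le> 0"
  proof (rule field_le_epsilon)
   fix e :: real assume "e > 0"
   hence e: "e / 2 > 0" by simp
   obtain R where R: "R \<in> gspan" "op_le (carrier G) (op_diff (carrier G) a R) (e / 2)"
    using a e unfolding cred_eq op_closure_iff[OF gspan_bop] by blast
   have RA: "R \<in> cred" using R gspan_cred by blast
   let ?d = "op_diff (carrier G) a R"
   have d: "?d \<in> cred" by (rule op_spaceD(5)[OF cred_space a RA])
   have n: "op_norm HG ?d \<le> e / 2" using e R by (intro op_norm_le) auto
   have "h ?d = h a - h R" using hl a RA op_spaceD(4)[OF cred_space RA] by simp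
   moreover have "haar ?d = haar a - haar R" using a RA d by simp
   ultimately have "h a - haar a = h ?d - haar ?d" using gs[OF R(1)] by simp
   also have "cmod \<dots> \<le> e / 2 + e / 2"
    by (rule order_trans[OF norm_triangle_ineq4 add_mono[OF order_trans[OF hl(3)[OF d d] n] order_trans[OF haar_bound[OF d] n]]])
   finally show "cmod (h a - haar a) \<le> 0 + e" by simp
  qed
  thus ?thesis by simp
 qed
 thus ?thesis using st haar_cstar_state
  by (intro extensionalityI[of _ cred]) (auto simp: cstar_state_def)
qed

lemma haar_state_eq: "haar_state (reduced_cqg G) = haar"
 unfolding haar_state_def by (rule the_equality, rule haar_haar_state_on, rule haar_unique)

text \<open>With coefficients taken at the unit vector, h(ab) is the sum of b(x) a(inv x), and
  inversion of the group exchanges the two factors.\<close>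

lemma haar_trace:
 assumes "a \<in> cred" "b \<in> cred"
 shows "haar (a \<otimes>\<^bsub>BG\<^esub> b) = haar (b \<otimes>\<^bsub>BG\<^esub> a)"
proof -
 have eq: "haar (a \<otimes>\<^bsub>BG\<^esub> b) = (\<Sum>\<^sub>\<infinity>x\<in>carrier G. b \<xi> x * a \<xi> (inv x))"
  if ab: "a \<in> cred" "b \<in> cred" for a b
 proof -
  have bd: "b \<xi> \<in> l2G" using ab by (auto intro: bop_in[of _ "carrier G"])
  have "haar (a \<otimes>\<^bsub>BG\<^esub> b) = ipG (a (b \<xi>)) \<xi>"
   using cred_mult[OF ab] by (simp add: hip_delta_right)
  also have "\<dots> = ipG (b \<xi>) (adjG a \<xi>)"
   using ab bd by (intro adjoint_op_hip) auto
  also have "\<dots> = (\<Sum>\<^sub>\<infinity>x\<in>carrier G. b \<xi> x * a \<xi> (inv x))"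
   unfolding ell2_hip
  proof (rule infsum_cong)
   fix x assume "x \<in> carrier G"
   thus "b \<xi> x * cnj (adjG a \<xi> x) = b \<xi> x * a \<xi> (inv x)"
    using ab(1) cred_entry[OF ab(1), of x \<one>] by (simp add: adjoint_entry)
  qed
  finally show ?thesis .
 qed
 have bij: "bij_betw (\<lambda>x. inv x) (carrier G) (carrier G)"
  by (rule bij_betwI[where g="\<lambda>x. inv x"]) auto
 have "(\<Sum>\<^sub>\<infinity>x\<in>carrier G. b \<xi> x * a \<xi> (inv x)) = (\<Sum>\<^sub>\<infinity>x\<in>carrier G. b \<xi> (inv x) * a \<xi> (inv (inv x)))"
  by (rule infsum_reindex_bij_betw[OF bij, symmetric])
 also have "\<dots> = (\<Sum>\<^sub>\<infinity>x\<in>carrier G. a \<xi> x * b \<xi> (inv x))"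
  by (rule infsum_cong) simp
 finally show ?thesis using eq assms by simp
qed

end

subsection \<open>The GNS space of the Haar state\<close>

context group
begin

abbreviation "dist2 f g \<equiv> normG (\<lambda>x. f x - g x)"
abbreviation "gnsH \<equiv> gns_space HG (reduced_alg G) haar"

text \<open>The sequences in \<open>A\<close> that represent the vector \<open>f \<in> \<ell>\<^sup>2(\<Gamma>)\<close> in the completion.\<close>

definition gns_map :: "('a \<Rightarrow> complex) \<Rightarrow> (nat \<Rightarrow> ('a \<Rightarrow> complex) op) set" where
 "gns_map f = {s. (\<forall>n. s n \<in> cred) \<and> (\<lambda>n. dist2 (s n \<xi>) f) \<longlonglongrightarrow> 0}"

lemma vec_l2 [simp]: "T \<in> bopG \<Longrightarrow> T \<xi> \<in> l2G"
 by (simp add: bop_in)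

lemma BG_vec [simp]:
 "(S \<oplus>\<^bsub>BG\<^esub> T) \<xi> = (\<lambda>x. S \<xi> x + T \<xi> x)"
 "(c \<odot>\<^bsub>BG\<^esub> T) \<xi> = (\<lambda>x. c * T \<xi> x)"
 "(S \<otimes>\<^bsub>BG\<^esub> T) \<xi> = S (T \<xi>)"
 "\<zero>\<^bsub>BG\<^esub> \<xi> = (\<lambda>x. 0)"
 by simp_all

lemma gns_dist_eq:
 assumes "a \<in> cred" "b \<in> cred"
 shows "gns_dist HG haar a b = dist2 (a \<xi>) (b \<xi>)"
proof -
 have d: "op_diff (carrier G) a b \<in> cred" by (rule op_spaceD(5)[OF cred_space assms])
 show ?thesis unfolding gns_dist_def Let_def haar_gns[OF d d] by (simp add: hip_self)
qed

lemma tendsto_0_le: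
 assumes "\<And>n. 0 \<le> u n" "\<And>n. u n \<le> v n" "v \<longlonglongrightarrow> 0" shows "(u :: nat \<Rightarrow> real) \<longlonglongrightarrow> 0"
 by (rule Lim_null_comparison[OF _ assms(3)]) (use assms in auto)

lemma gspan_finite_support:
 assumes "finite F" "F \<subseteq> carrier G"
 shows "\<exists>a\<in>gspan. a \<xi> = (\<lambda>x. if x \<in> F then f x else 0)"
 using assms
proof (induction F)
 case empty
 have "\<zero>\<^bsub>BG\<^esub> \<in> gspan" by (rule lin_span_zero)
 thus ?case by (rule bexI[rotated]) simp
next
 case (insert y F)
 then obtain a where a: "a \<in> gspan" "a \<xi> = (\<lambda>x. if x \<in> F then f x else 0)" by auto
 let ?b = "a \<oplus>\<^bsub>BG\<^esub> f y \<odot>\<^bsub>BG\<^esub> lreg y"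
 have "?b \<in> gspan" using insert.prems by (intro lin_span_add lin_span_smult lin_span_incl a imageI) simp
 moreover have "?b \<xi> = (\<lambda>x. if x \<in> insert y F then f x else 0)"
  using insert by (simp add: a lreg_delta) (auto simp: delta_def fun_eq_iff)
 ultimately show ?case by blast
qed

text \<open>Every finitely supported function equals a \<xi> for some a in the group algebra, so
  truncations of f supply the approximating operators. Surjectivity of the identification with the
  GNS space rests on this.\<close>

lemma gns_map_nonempty:
 assumes f: "f \<in> l2G" obtains s where "s \<in> gns_map f"
proof -
 have "\<exists>a\<in>cred. dist2 (a \<xi>) f \<le> inverse (real (Suc n))" for n
 proof -
  obtain F where F: "finite F" "F \<subseteq> carrier G" "dist2 f (\<lambda>x. if x \<in> F then f x else 0) \<le> inverse (real (Suc n))"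
   using l2_approx[OF f, of "inverse (real (Suc n))"] by auto
  obtain a where a: "a \<in> gspan" "a \<xi> = (\<lambda>x. if x \<in> F then f x else 0)" using gspan_finite_support[OF F(1,2)] by blast
  hence "dist2 (a \<xi>) f \<le> inverse (real (Suc n))" unfolding a(2) using F(3) by (subst l2norm_minus_commute)
  thus ?thesis using a(1) gspan_cred by blast
 qed
 then obtain s where s: "\<And>n. s n \<in> cred" "\<And>n. dist2 (s n \<xi>) f \<le> inverse (real (Suc n))" by metis
 have "(\<lambda>n. dist2 (s n \<xi>) f) \<longlonglongrightarrow> 0"
  by (rule tendsto_0_le[OF _ s(2) LIMSEQ_inverse_real_of_nat]) simp
 thus ?thesis using s(1) by (intro that[of s]) (simp add: gns_map_def)
qed

lemma gns_map_ne: "f \<in> l2G \<Longrightarrow> gns_map f \<noteq> {}"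
 by (rule gns_map_nonempty) auto

lemma gns_mapD:
 assumes "s \<in> gns_map f" shows "s n \<in> cred" "(\<lambda>n. dist2 (s n \<xi>) f) \<longlonglongrightarrow> 0"
 using assms by (auto simp: gns_map_def)

lemma gns_map_cauchy:
 assumes f: "f \<in> l2G" and s: "s \<in> gns_map f"
 shows "s \<in> gns_cauchy HG cred haar"
 unfolding gns_cauchy_def
proof (intro CollectI conjI allI impI)
 fix e :: real assume "e > 0"
 hence "\<exists>N. \<forall>n\<ge>N. dist2 (s n \<xi>) f < e/2" using LIMSEQ_D[OF gns_mapD(2)[OF s], of "e/2"] by simp
 then obtain N where N: "\<And>n. n \<ge> N \<Longrightarrow> dist2 (s n \<xi>) f < e/2" by blast
 have "gns_dist HG haar (s m) (s n) < e" if "m \<ge> N" "n \<ge> N" for m n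
 proof -
  have "gns_dist HG haar (s m) (s n) \<le> dist2 (s m \<xi>) f + dist2 f (s n \<xi>)"
   unfolding gns_dist_eq[OF gns_mapD(1)[OF s] gns_mapD(1)[OF s]]
   by (rule l2_triangle3[OF vec_l2 f vec_l2]) (simp_all add: gns_mapD(1)[OF s])
  also have "\<dots> < e" using N[OF that(1)] N[OF that(2)] l2norm_minus_commute[of "carrier G" f "s n \<xi>"] by simp
  finally show ?thesis .
 qed
 thus "\<exists>N. \<forall>m\<ge>N. \<forall>n\<ge>N. gns_dist HG haar (s m) (s n) < e" by blast
qed (simp add: gns_mapD[OF s])

lemma gns_cauchy_map:
 assumes s: "s \<in> gns_cauchy HG cred haar"
 obtains f where "f \<in> l2G" "s \<in> gns_map f"
proof -
 have c: "s n \<in> cred" for n using s by (simp add: gns_cauchy_def)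
 have C: "\<exists>N. \<forall>m\<ge>N. \<forall>n\<ge>N. dist2 (s m \<xi>) (s n \<xi>) \<le> e" if e: "e > 0" for e
 proof -
  have "\<exists>N. \<forall>m\<ge>N. \<forall>n\<ge>N. gns_dist HG haar (s m) (s n) < e" using s e by (simp add: gns_cauchy_def)
  thus ?thesis unfolding gns_dist_eq[OF c c] by (meson less_imp_le)
 qed
 show ?thesis
 proof (rule l2_complete[of "\<lambda>n. s n \<xi>" "carrier G"])
  show "s n \<xi> \<in> l2G" for n using c by simp
  show "\<exists>N. \<forall>m\<ge>N. \<forall>n\<ge>N. dist2 (s m \<xi>) (s n \<xi>) \<le> e" if e: "e > 0" for e by (rule C[OF e])
  fix g
  assume g: "g \<in> l2G" and lim: "\<And>N e n. (\<And>m n. m \<ge> N \<Longrightarrow> n \<ge> N \<Longrightarrow> dist2 (s m \<xi>) (s n \<xi>) \<le> e) \<Longrightarrow>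
    n \<ge> N \<Longrightarrow> dist2 (s n \<xi>) g \<le> e"
  have "(\<lambda>n. dist2 (s n \<xi>) g) \<longlonglongrightarrow> 0"
  proof (rule LIMSEQ_I)
   fix r :: real assume r: "0 < r"
   have "\<exists>N. \<forall>m\<ge>N. \<forall>n\<ge>N. dist2 (s m \<xi>) (s n \<xi>) \<le> r/2" using C[of "r/2"] r by simp
   then obtain N where N: "\<And>m n. m \<ge> N \<Longrightarrow> n \<ge> N \<Longrightarrow> dist2 (s m \<xi>) (s n \<xi>) \<le> r/2" by blast
   have "norm (dist2 (s n \<xi>) g - 0) < r" if n: "n \<ge> N" for n using lim[OF N n] r by simp
   thus "\<exists>no. \<forall>n\<ge>no. norm (dist2 (s n \<xi>) g - 0) < r" by blast
  qed
  thus thesis using g c by (intro that[of g]) (simp_all add: gns_map_def)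
 qed
qed

text \<open>Classes of Cauchy sequences are exactly the sets of sequences with a common limit in
  \<open>ell2\<close>. The operations of the GNS space are unions over representatives; each member
  of such a union is now the same set, so the union collapses.\<close>

lemma gns_class_eq:
 assumes f: "f \<in> l2G" and s: "s \<in> gns_map f"
 shows "gns_class HG cred haar s = gns_map f"
proof (rule subset_antisym; rule subsetI)
 note S = gns_mapD[OF s]
 fix t assume "t \<in> gns_class HG cred haar s"
 hence t: "\<And>n. t n \<in> cred" "(\<lambda>n. gns_dist HG haar (s n) (t n)) \<longlonglongrightarrow> 0"
  by (auto simp: gns_class_def gns_cauchy_def)
 have d: "(\<lambda>n. dist2 (s n \<xi>) (t n \<xi>)) \<longlonglongrightarrow> 0" using t(2) unfolding gns_dist_eq[OF S(1) t(1)] .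
 have "dist2 (t n \<xi>) f \<le> dist2 (s n \<xi>) (t n \<xi>) + dist2 (s n \<xi>) f" for n
  using l2_triangle3[OF vec_l2 vec_l2 f, of "t n" "s n"] S(1)[of n] t(1)[of n]
   l2norm_minus_commute[of "carrier G" "t n \<xi>" "s n \<xi>"] by simp
 from tendsto_0_le[OF _ this] have "(\<lambda>n. dist2 (t n \<xi>) f) \<longlonglongrightarrow> 0" using tendsto_add[OF d S(2)] by simp
 thus "t \<in> gns_map f" using t(1) by (simp add: gns_map_def)
next
 note S = gns_mapD[OF s]
 fix t assume t: "t \<in> gns_map f"
 note T = gns_mapD[OF t]
 have "dist2 (s n \<xi>) (t n \<xi>) \<le> dist2 (s n \<xi>) f + dist2 (t n \<xi>) f" for n
  using l2_triangle3[OF vec_l2 f vec_l2, of "s n" "t n"] S(1)[of n] T(1)[of n]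
   l2norm_minus_commute[of "carrier G" "t n \<xi>" f] by simp
 from tendsto_0_le[OF _ this] have "(\<lambda>n. dist2 (s n \<xi>) (t n \<xi>)) \<longlonglongrightarrow> 0" using tendsto_add[OF S(2) T(2)] by simp
 thus "t \<in> gns_class HG cred haar s"
  using gns_map_cauchy[OF f t] by (simp add: gns_class_def gns_dist_eq[OF S(1) T(1)])
qed

lemma gns_map_unique:
 assumes "f \<in> l2G" "g \<in> l2G" "s \<in> gns_map f" "s \<in> gns_map g"
 shows "f = g"
proof -
 note S = gns_mapD[OF assms(3)] and T = gns_mapD[OF assms(4)]
 have "dist2 f g \<le> dist2 (s n \<xi>) f + dist2 (s n \<xi>) g" for n
  using l2_triangle3[OF assms(1) vec_l2 assms(2), of "s n"] S(1)[of n]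
   l2norm_minus_commute[of "carrier G" f "s n \<xi>"] by simp
 from tendsto_0_le[of "\<lambda>n. dist2 f g", OF _ this] have "(\<lambda>n::nat. dist2 f g) \<longlonglongrightarrow> 0" using tendsto_add[OF S(2) T(2)] by simp
 hence "dist2 f g = 0" by (simp add: LIMSEQ_const_iff)
 hence "(\<lambda>x. f x - g x) = (\<lambda>x. 0)" using l2_norm_le0[OF l2_diff(1)[OF assms(1,2)]] by simp
 thus ?thesis by (simp add: fun_eq_iff)
qed

section \<open>The operations of the GNS space\<close>

lemma gns_carrier: "carrier gnsH = gns_map ` l2G"
proof (rule subset_antisym; rule subsetI)
 fix X assume "X \<in> carrier gnsH"
 then obtain s where s: "s \<in> gns_cauchy HG cred haar" "X = gns_class HG cred haar s"
  by (auto simp: gns_space_def)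
 obtain f where "f \<in> l2G" "s \<in> gns_map f" by (rule gns_cauchy_map[OF s(1)])
 thus "X \<in> gns_map ` l2G" using gns_class_eq s(2) by blast
next
 fix X assume "X \<in> gns_map ` l2G"
 then obtain f where f: "f \<in> l2G" "X = gns_map f" by blast
 obtain s where s: "s \<in> gns_map f" by (rule gns_map_nonempty[OF f(1)])
 hence "X = gns_class HG cred haar s" using gns_class_eq[OF f(1)] f(2) by simp
 thus "X \<in> carrier gnsH" using gns_map_cauchy[OF f(1) s] by (auto simp: gns_space_def)
qed

lemma gns_map_const: "a \<in> cred \<Longrightarrow> (\<lambda>n. a) \<in> gns_map (a \<xi>)"
 by (simp add: gns_map_def)

lemma gns_map_add:
 assumes fg: "f \<in> l2G" "g \<in> l2G" and s: "s \<in> gns_map f" "t \<in> gns_map g"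
 shows "(\<lambda>n. s n \<oplus>\<^bsub>BG\<^esub> t n) \<in> gns_map (\<lambda>x. f x + g x)"
proof -
 note S = gns_mapD[OF s(1)] and T = gns_mapD[OF s(2)]
 have "dist2 (\<lambda>x. s n \<xi> x + t n \<xi> x) (\<lambda>x. f x + g x) \<le> dist2 (s n \<xi>) f + dist2 (t n \<xi>) g" for n
  using l2_add(2)[OF l2_diff(1)[OF vec_l2 fg(1)] l2_diff(1)[OF vec_l2 fg(2)], of "s n" "t n"] S(1)[of n] T(1)[of n]
  by (simp add: algebra_simps)
 from tendsto_0_le[OF _ this] have "(\<lambda>n. dist2 (\<lambda>x. s n \<xi> x + t n \<xi> x) (\<lambda>x. f x + g x)) \<longlonglongrightarrow> 0" using tendsto_add[OF S(2) T(2)] by simp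
 thus ?thesis using op_spaceD(3)[OF cred_space S(1) T(1)] by (simp add: gns_map_def)
qed

lemma gns_map_act:
 assumes f: "f \<in> l2G" and s: "s \<in> gns_map f" and a: "a \<in> cred"
 shows "(\<lambda>n. a \<otimes>\<^bsub>BG\<^esub> s n) \<in> gns_map (a f)"
proof -
 note S = gns_mapD[OF s(1)]
 obtain C where C: "0 \<le> C" "\<And>v. v \<in> l2G \<Longrightarrow> normG (a v) \<le> C * normG v"
  using bop_bound[OF cred_bopD[OF a]] by blast
 have "dist2 (a (s n \<xi>)) (a f) \<le> C * dist2 (s n \<xi>) f" for n
  using C(2)[OF l2_diff(1)[OF vec_l2 f], of "s n"] bop_diff[OF cred_bopD[OF a] vec_l2 f, of "s n"] S(1)[of n] by simp
 from tendsto_0_le[OF _ this] have "(\<lambda>n. dist2 (a (s n \<xi>)) (a f)) \<longlonglongrightarrow> 0"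
  using tendsto_mult_left[OF S(2), of C] by simp
 thus ?thesis using cred_mult[OF a S(1)] by (simp add: gns_map_def)
qed

lemma gns_map_scale:
 assumes f: "f \<in> l2G" and s: "s \<in> gns_map f"
 shows "(\<lambda>n. c \<odot>\<^bsub>BG\<^esub> s n) \<in> gns_map (\<lambda>x. c * f x)"
proof -
 note S = gns_mapD[OF s(1)]
 have "dist2 (\<lambda>x. c * s n \<xi> x) (\<lambda>x. c * f x) = cmod c * dist2 (s n \<xi>) f" for n
  using l2norm_scale[of "carrier G" c "\<lambda>x. s n \<xi> x - f x"] by (simp add: algebra_simps)
 hence "(\<lambda>n. dist2 (\<lambda>x. c * s n \<xi> x) (\<lambda>x. c * f x)) \<longlonglongrightarrow> 0"
  using tendsto_mult_left[OF S(2), of "cmod c"] by simp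
 thus ?thesis using op_spaceD(4)[OF cred_space S(1)] by (simp add: gns_map_def)
qed

lemma gns_hadd:
 assumes fg: "f \<in> l2G" "g \<in> l2G"
 shows "hadd gnsH (gns_map f) (gns_map g) = gns_map (\<lambda>x. f x + g x)"
proof -
 have "(\<Union>t\<in>gns_map g. gns_class HG cred haar (\<lambda>n. s n \<oplus>\<^bsub>BG\<^esub> t n)) = gns_map (\<lambda>x. f x + g x)"
  if s: "s \<in> gns_map f" for s
  by (rule SUP_eq_const[OF gns_map_ne[OF fg(2)]], rule gns_class_eq[OF l2_add(1)[OF fg]], rule gns_map_add[OF fg s])
 hence "(\<Union>s\<in>gns_map f. \<Union>t\<in>gns_map g. gns_class HG cred haar (\<lambda>n. s n \<oplus>\<^bsub>BG\<^esub> t n)) = gns_map (\<lambda>x. f x + g x)"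
  by (rule SUP_eq_const[OF gns_map_ne[OF fg(1)]])
 thus ?thesis by (simp add: gns_space_def)
qed

lemma gns_hscale:
 assumes f: "f \<in> l2G"
 shows "hscale gnsH c (gns_map f) = gns_map (\<lambda>x. c * f x)"
proof -
 have "(\<Union>s\<in>gns_map f. gns_class HG cred haar (\<lambda>n. c \<odot>\<^bsub>BG\<^esub> s n)) = gns_map (\<lambda>x. c * f x)"
  by (rule SUP_eq_const[OF gns_map_ne[OF f]], rule gns_class_eq[OF l2_scale[OF f]], rule gns_map_scale[OF f])
 thus ?thesis by (simp add: gns_space_def)
qed

lemma gns_rep_map:
 assumes f: "f \<in> l2G" and a: "a \<in> cred"
 shows "gns_rep HG cred haar a (gns_map f) = gns_map (a f)"
proof -
 have "(\<Union>s\<in>gns_map f. gns_class HG cred haar (\<lambda>n. a \<otimes>\<^bsub>BG\<^esub> s n)) = gns_map (a f)"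
  by (rule SUP_eq_const[OF gns_map_ne[OF f]], rule gns_class_eq[OF bop_in[OF cred_bopD[OF a] f]], rule gns_map_act[OF f _ a])
 thus ?thesis using f by (simp add: gns_rep_def gns_carrier)
qed

lemma gns_vec_map: "a \<in> cred \<Longrightarrow> gns_vec HG cred haar a = gns_map (a \<xi>)"
 unfolding gns_vec_def by (rule gns_class_eq[OF vec_l2 gns_map_const]) simp_all

lemma gns_hzero: "hzero gnsH = gns_map (\<lambda>x. 0)"
 using gns_vec_map[OF op_spaceD(2)[OF cred_space]] by (simp add: gns_space_def gns_vec_def)

lemma gns_hip:
 assumes fg: "f \<in> l2G" "g \<in> l2G"
 shows "hip gnsH (gns_map f) (gns_map g) = ipG f g"
proof -
 let ?ip = "ipG"
 have lim: "(\<lambda>n. haar (adjG (t n) \<otimes>\<^bsub>BG\<^esub> s n)) \<longlonglongrightarrow> ?ip f g"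
  if s: "s \<in> gns_map f" and t: "t \<in> gns_map g" for s t
 proof -
  note S = gns_mapD[OF s] and T = gns_mapD[OF t]
  let ?s = "\<lambda>n. s n \<xi>" and ?t = "\<lambda>n. t n \<xi>"
  \<comment> \<open>The error is split as (s - f, t) + (f, t - g). The norm of t n is replaced by
    its distance to g plus the norm of g, so that every factor on the right has a limit.\<close>
  have bd: "norm (?ip (?s n) (?t n) - ?ip f g) \<le> dist2 (?s n) f * (dist2 (?t n) g + normG g) + normG f * dist2 (?t n) g" for n
  proof -
   have v: "?s n \<in> l2G" "?t n \<in> l2G" using S(1)[of n] T(1)[of n] by simp_all
   have e: "?ip (?s n) (?t n) - ?ip f g = ?ip (\<lambda>x. ?s n x - f x) (?t n) + ?ip f (\<lambda>x. ?t n x - g x)"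
    using hip_diff_left[OF v(1) fg(1) v(2)] hip_diff_right[OF v(2) fg(2) fg(1)] by simp
   have "norm (?ip (?s n) (?t n) - ?ip f g) \<le> dist2 (?s n) f * normG (?t n) + normG f * dist2 (?t n) g"
    unfolding e by (rule order_trans[OF norm_triangle_ineq add_mono[OF hip_bound[OF l2_diff(1)[OF v(1) fg(1)] v(2)] hip_bound[OF fg(1) l2_diff(1)[OF v(2) fg(2)]]]])
   moreover have "dist2 (?s n) f * normG (?t n) \<le> dist2 (?s n) f * (dist2 (?t n) g + normG g)"
    by (rule mult_left_mono[OF l2_triangle_diff[OF v(2) fg(2)]]) simp
   ultimately show ?thesis by linarith
  qed
  have tz: "(\<lambda>n. dist2 (?s n) f * (dist2 (?t n) g + normG g) + normG f * dist2 (?t n) g) \<longlonglongrightarrow> 0"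
   using tendsto_add[OF tendsto_mult[OF S(2) tendsto_add[OF T(2) tendsto_const]] tendsto_mult_left[OF T(2)], of "normG g" "normG f"] by simp
  have "(\<lambda>n. ?ip (?s n) (?t n) - ?ip f g) \<longlonglongrightarrow> 0" by (rule Lim_null_comparison[OF always_eventually[OF allI[OF bd]] tz])
  hence "(\<lambda>n. ?ip (?s n) (?t n)) \<longlonglongrightarrow> ?ip f g" by (rule LIM_zero_cancel)
  thus ?thesis by (simp add: haar_gns[OF S(1) T(1)])
 qed
 obtain s where s: "s \<in> gns_map f" by (rule gns_map_nonempty[OF fg(1)])
 obtain t where t: "t \<in> gns_map g" by (rule gns_map_nonempty[OF fg(2)])
 show ?thesis
  unfolding gns_space_def hilbert.simps
 proof (rule the_equality)
  show "\<forall>s\<in>gns_map f. \<forall>t\<in>gns_map g. (\<lambda>n. haar (adjG (t n) \<otimes>\<^bsub>BG\<^esub> s n)) \<longlonglongrightarrow> ?ip f g"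
   by (intro ballI lim)
  fix z assume "\<forall>s\<in>gns_map f. \<forall>t\<in>gns_map g. (\<lambda>n. haar (adjG (t n) \<otimes>\<^bsub>BG\<^esub> s n)) \<longlonglongrightarrow> z"
  hence "(\<lambda>n. haar (adjG (t n) \<otimes>\<^bsub>BG\<^esub> s n)) \<longlonglongrightarrow> z" using s t by blast
  thus "z = ?ip f g" using lim[OF s t] LIMSEQ_unique by blast
 qed
qed

lemma gns_map_bij: "bij_betw gns_map l2G (carrier gnsH)"
 unfolding bij_betw_def gns_carrier
proof (intro conjI inj_onI refl)
 fix f g assume fg: "f \<in> l2G" "g \<in> l2G" "gns_map f = gns_map g"
 obtain s where s: "s \<in> gns_map f" by (rule gns_map_nonempty[OF fg(1)])
 thus "f = g" using gns_map_unique[OF fg(1,2) s] fg(3) by simp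
qed

lemma gns_map_iso: "hilbert_iso HG gnsH gns_map"
 unfolding hilbert_iso_def using gns_map_bij by (simp add: gns_hadd gns_hscale gns_hip)

text \<open>To commute with a fixed T is an equality between two bounded linear maps, so it extends
  from the generators to the span and to the norm closure.\<close>

lemma commutant_cred: "commutant HG cred = commutant HG (lreg ` carrier G)"
proof (rule subset_antisym)
 have "lreg ` carrier G \<subseteq> cred" by auto
 thus "commutant HG cred \<subseteq> commutant HG (lreg ` carrier G)"
  unfolding commutant_def by blast
 show "commutant HG (lreg ` carrier G) \<subseteq> commutant HG cred"
 proof
  fix T assume "T \<in> commutant HG (lreg ` carrier G)"
  hence T: "T \<in> bopG" "\<And>R. R \<in> lreg ` carrier G \<Longrightarrow> T \<otimes>\<^bsub>BG\<^esub> R = R \<otimes>\<^bsub>BG\<^esub> T"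
   by (auto simp: commutant_def)
  note l = bounded_on_lmult[OF T(1)] and r = bounded_on_rmult[OF T(1)]
  have sp: "linear_on BG BG gspan (\<lambda>R. T \<otimes>\<^bsub>BG\<^esub> R)" "linear_on BG BG gspan (\<lambda>R. R \<otimes>\<^bsub>BG\<^esub> T)"
   using bounded_on_linear[OF l] bounded_on_linear[OF r] gspan_bop unfolding linear_on_def by blast+
  have g: "T \<otimes>\<^bsub>BG\<^esub> R = R \<otimes>\<^bsub>BG\<^esub> T" if "R \<in> gspan" for R
   by (rule linear_on_eq_span[OF sp T(2) lreg_range that])
  have bsp: "op_space (carrier G) bopG" by (simp add: op_space_def)
  have "T \<otimes>\<^bsub>BG\<^esub> R = R \<otimes>\<^bsub>BG\<^esub> T" if "R \<in> cred" for R
   by (rule bounded_on_eq[OF l r bsp gspan_bop g cred_bopD[OF that]]) (use that in \<open>simp_all add: cred_eq\<close>)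
  thus "T \<in> commutant HG cred" using T(1) by (simp add: commutant_def)
 qed
qed

end

text \<open>The link from size to finiteness: a fixed lower bound on non-zero coefficients, as for
  the idempotents of a corepresentation, leaves finitely many of them.\<close>

lemma l2_large_finite:
 assumes f: "f \<in> l2 X" and e: "e > 0" shows "finite {x. e \<le> cmod (f x)}"
proof -
 obtain F where F: "finite F" "F \<subseteq> X" "l2norm X (\<lambda>x. f x - (if x \<in> F then f x else 0)) \<le> e/2"
  using l2_approx[OF f, of "e/2"] e by auto
 have g: "(\<lambda>x. f x - (if x \<in> F then f x else 0)) \<in> l2 X"
  by (rule l2_diff(1)[OF f l2_finite_support(1)[OF F(1,2)]]) simp
 have "x \<in> F" if "e \<le> cmod (f x)" for x
  using l2_coord_le[OF g, of x] F(3) that e by (cases "x \<in> F") auto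
 thus ?thesis by (intro finite_subset[OF _ F(1)]) auto
qed

lemma finite_support_add:
 fixes f g :: "'x \<Rightarrow> complex"
 shows "finite {x. f x \<noteq> 0} \<Longrightarrow> finite {x. g x \<noteq> 0} \<Longrightarrow> finite {x. f x + g x \<noteq> 0}"
 by (rule finite_subset[of _ "{x. f x \<noteq> 0} \<union> {x. g x \<noteq> 0}"]) auto

subsection \<open>The group ring as the Hopf algebra\<close>

context group
begin

abbreviation "GR \<equiv> group_ring G"
abbreviation "rep \<equiv> group_ring_rep G"

lemma GR_carrier: "f \<in> carrier GR \<longleftrightarrow> finite {x. f x \<noteq> 0} \<and> (\<forall>x. x \<notin> carrier G \<longrightarrow> f x = 0)"
 by (auto simp: group_ring_def)

lemma GR_l2: "f \<in> carrier GR \<Longrightarrow> f \<in> l2G"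
 by (rule l2_finite_support(1)[of "{x. f x \<noteq> 0}"]) (auto simp: group_ring_def)

lemma GR_add: "f \<in> carrier GR \<Longrightarrow> g \<in> carrier GR \<Longrightarrow> (\<lambda>x. f x + g x) \<in> carrier GR"
 by (simp add: GR_carrier finite_support_add)

lemma GR_scale: "f \<in> carrier GR \<Longrightarrow> (\<lambda>x. c * f x) \<in> carrier GR"
 by (auto simp: GR_carrier elim: rev_finite_subset)

lemma rep_apply:
 assumes f: "f \<in> carrier GR"
 shows "rep f \<in> bopG" "v \<in> l2G \<Longrightarrow> rep f v = (\<lambda>x. \<Sum>y\<in>{y. f y \<noteq> 0}. f y * lreg y v x)"
proof -
 have "finite {x. f x \<noteq> 0}" "\<And>y. f y \<noteq> 0 \<Longrightarrow> y \<in> carrier G" using f by (auto simp: GR_carrier)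
 note * = BH_finsum[of "{x. f x \<noteq> 0}" "\<lambda>y. f y \<odot>\<^bsub>BG\<^esub> lreg y" "carrier G", OF this(1)]
 show "rep f \<in> bopG" unfolding group_ring_rep_def Let_def
  by (rule *(1)) (use \<open>\<And>y. f y \<noteq> 0 \<Longrightarrow> y \<in> carrier G\<close> in simp)
 show "v \<in> l2G \<Longrightarrow> rep f v = (\<lambda>x. \<Sum>y\<in>{y. f y \<noteq> 0}. f y * lreg y v x)"
  unfolding group_ring_rep_def Let_def
  by (subst *(2)) (use \<open>\<And>y. f y \<noteq> 0 \<Longrightarrow> y \<in> carrier G\<close> in \<open>auto\<close>)
qed

lemma rep_vec: 
 assumes f: "f \<in> carrier GR" shows "rep f \<xi> = f"
proof
 fix x
 have s: "finite {y. f y \<noteq> 0}" "\<And>y. f y \<noteq> 0 \<Longrightarrow> y \<in> carrier G" using f by (auto simp: GR_carrier)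
 have "rep f \<xi> x = (\<Sum>y\<in>{y. f y \<noteq> 0}. f y * lreg y \<xi> x)" using rep_apply(2)[OF f] by simp
 also have "\<dots> = (\<Sum>y\<in>{y. f y \<noteq> 0}. if y = x then f x else 0)"
  by (rule sum.cong[OF refl]) (use s in \<open>auto simp: lreg_delta, auto simp: delta_def\<close>)
 also have "\<dots> = f x" using s(1) by (simp add: sum.delta)
 finally show "rep f \<xi> x = f x" .
qed

lemma rep_gspan: 
 assumes f: "f \<in> carrier GR" shows "rep f \<in> gspan"
proof -
 interpret abelian_group BG by (rule abelian_group_BH)
 have s: "finite {y. f y \<noteq> 0}" "\<And>y. f y \<noteq> 0 \<Longrightarrow> y \<in> carrier G" using f by (auto simp: GR_carrier)
 have "(\<Oplus>\<^bsub>BG\<^esub>x\<in>S. f x \<odot>\<^bsub>BG\<^esub> lreg x) \<in> gspan" if "finite S" "S \<subseteq> {y. f y \<noteq> 0}" for S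
  using that
 proof (induction S)
  case (insert x S)
  hence x: "x \<in> carrier G" and S: "(\<Oplus>\<^bsub>BG\<^esub>x\<in>S. f x \<odot>\<^bsub>BG\<^esub> lreg x) \<in> gspan" using s by auto
  have "(\<Oplus>\<^bsub>BG\<^esub>x\<in>insert x S. f x \<odot>\<^bsub>BG\<^esub> lreg x) = f x \<odot>\<^bsub>BG\<^esub> lreg x \<oplus>\<^bsub>BG\<^esub> (\<Oplus>\<^bsub>BG\<^esub>x\<in>S. f x \<odot>\<^bsub>BG\<^esub> lreg x)"
   by (rule finsum_insert) (use insert s in auto)
  thus ?case using lin_span_add[OF lin_span_smult[OF lin_span_incl[OF imageI[OF x]]] S, of "f x"] by simp
 qed (simp add: lin_span_zero)
 thus ?thesis using s(1) unfolding group_ring_rep_def Let_def by blast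
qed

lemma gspan_vec: assumes "a \<in> gspan" shows "a \<xi> \<in> carrier GR"
 using assms
proof induction
 case lin_span_zero
 thus ?case by (simp add: GR_carrier)
next
 case (lin_span_incl a)
 thus ?case by (auto simp: lreg_delta GR_carrier) (auto simp: delta_def)
qed (simp_all only: BG_vec GR_add GR_scale)

lemma gspan_credD: "a \<in> gspan \<Longrightarrow> a \<in> cred" using gspan_cred by blast

lemma gspan_eqI: "a \<in> gspan \<Longrightarrow> b \<in> gspan \<Longrightarrow> a \<xi> = b \<xi> \<Longrightarrow> a = b"
 by (rule cred_eqI) (simp_all add: gspan_credD)

lemma rep_ev: "a \<in> gspan \<Longrightarrow> rep (a \<xi>) = a"
 by (rule gspan_eqI) (simp_all add: rep_gspan gspan_vec rep_vec)

lemma rep_add: "f \<in> carrier GR \<Longrightarrow> g \<in> carrier GR \<Longrightarrow> rep (\<lambda>x. f x + g x) = rep f \<oplus>\<^bsub>BG\<^esub> rep g"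
 by (rule gspan_eqI) (simp_all only: BG_vec rep_vec GR_add rep_gspan lin_span_add)

lemma rep_scale: "f \<in> carrier GR \<Longrightarrow> rep (\<lambda>x. c * f x) = c \<odot>\<^bsub>BG\<^esub> rep f"
 by (rule gspan_eqI) (simp_all only: BG_vec rep_vec GR_scale rep_gspan lin_span_smult)

lemma gspan_mult: "a \<in> gspan \<Longrightarrow> b \<in> gspan \<Longrightarrow> a \<otimes>\<^bsub>BG\<^esub> b \<in> gspan"
 using gspan_alg by (simp add: op_alg_def)

lemma gspan_one: "\<one>\<^bsub>BG\<^esub> \<in> gspan"
 using gspan_alg by (simp add: op_alg_def)

text \<open>Convolution is the product of operators evaluated at the unit vector. All algebra in the
  group ring is done through this dictionary.\<close>

lemma rep_mult_vec:
 assumes f: "f \<in> carrier GR" and g: "g \<in> carrier GR"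
 shows "(rep f \<otimes>\<^bsub>BG\<^esub> rep g) \<xi> = f \<otimes>\<^bsub>GR\<^esub> g"
proof -
 have "(rep f \<otimes>\<^bsub>BG\<^esub> rep g) \<xi> = (\<lambda>x. \<Sum>y\<in>{y. f y \<noteq> 0}. f y * lreg y g x)"
  using rep_apply(2)[OF f GR_l2[OF g]] by (simp only: BG_vec rep_vec[OF g])
 also have "\<dots> = f \<otimes>\<^bsub>GR\<^esub> g" by (auto simp: group_ring_def lreg_apply[OF GR_l2[OF g]] fun_eq_iff)
 finally show ?thesis .
qed

lemma rep_mult:
 assumes "f \<in> carrier GR" "g \<in> carrier GR"
 shows "f \<otimes>\<^bsub>GR\<^esub> g \<in> carrier GR" "rep (f \<otimes>\<^bsub>GR\<^esub> g) = rep f \<otimes>\<^bsub>BG\<^esub> rep g"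
proof -
 have m: "rep f \<otimes>\<^bsub>BG\<^esub> rep g \<in> gspan" using assms by (intro gspan_mult rep_gspan)
 show "f \<otimes>\<^bsub>GR\<^esub> g \<in> carrier GR" using gspan_vec[OF m] by (simp only: rep_mult_vec[OF assms])
 show "rep (f \<otimes>\<^bsub>GR\<^esub> g) = rep f \<otimes>\<^bsub>BG\<^esub> rep g" using rep_ev[OF m] by (simp only: rep_mult_vec[OF assms])
qed

lemma gspan_subring: "subring gspan BG"
proof (rule ring.subringI[OF ring_BH])
 show "gspan \<subseteq> carrier BG" using gspan_bop by simp
 show "\<ominus>\<^bsub>BG\<^esub> a \<in> gspan" if "a \<in> gspan" for a
  using that by (simp add: BH_uminus gspan_credD lin_span_smult)
qed (simp_all add: gspan_one gspan_mult lin_span_add)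

abbreviation "GS \<equiv> BG\<lparr>carrier := gspan\<rparr>"

lemma ring_gspan: "ring GS"
 by (rule ring.subring_is_ring[OF ring_BH gspan_subring])

lemma rep_one: "\<one>\<^bsub>GR\<^esub> \<in> carrier GR" "rep \<one>\<^bsub>GR\<^esub> = \<one>\<^bsub>BG\<^esub>"
proof -
 have e: "\<one>\<^bsub>GR\<^esub> = \<one>\<^bsub>BG\<^esub> \<xi>" by (simp add: group_ring_def delta_one_eq)
 show "\<one>\<^bsub>GR\<^esub> \<in> carrier GR" "rep \<one>\<^bsub>GR\<^esub> = \<one>\<^bsub>BG\<^esub>" unfolding e by (rule gspan_vec[OF gspan_one], rule rep_ev[OF gspan_one])
qed

lemma GR_plus: "f \<oplus>\<^bsub>GR\<^esub> g = (\<lambda>x. f x + g x)"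
 by (simp add: group_ring_def)

lemma ev_hom: "(\<lambda>a. a \<xi>) \<in> ring_hom GS GR"
proof (rule ring_hom_memI)
 fix a b assume "a \<in> carrier GS" "b \<in> carrier GS"
 hence ab: "a \<in> gspan" "b \<in> gspan" by simp_all
 show "a \<xi> \<in> carrier GR" by (rule gspan_vec[OF ab(1)])
 show "(a \<otimes>\<^bsub>GS\<^esub> b) \<xi> = a \<xi> \<otimes>\<^bsub>GR\<^esub> b \<xi>"
  using rep_mult_vec[OF gspan_vec gspan_vec, OF ab] by (simp add: rep_ev ab)
 show "(a \<oplus>\<^bsub>GS\<^esub> b) \<xi> = a \<xi> \<oplus>\<^bsub>GR\<^esub> b \<xi>" by (simp add: GR_plus)
qed (simp add: group_ring_def delta_one_eq)

lemma rep_hom: "rep \<in> ring_hom GR GS"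
 by (rule ring_hom_memI) (simp_all add: rep_gspan rep_mult rep_one GR_plus rep_add)

text \<open>The ring axioms are inherited from operators through evaluation at the unit vector,
  which avoids manipulating convolution sums.\<close>

lemma ring_GR: "ring GR"
proof -
 interpret ring GS by (rule ring_gspan)
 have "(\<lambda>a. a \<xi>) \<in> ring_iso GS GR"
  unfolding ring_iso_def using ev_hom
  by (auto intro!: bij_betwI[of _ _ _ rep] simp: gspan_vec rep_gspan rep_ev rep_vec)
 \<comment> \<open>The transported structure has the image of zero as its zero; the record update
   disappears because that image is the zero function.\<close>
 from ring_iso_imp_img_ring[OF this] have "ring (GR\<lparr>ring.zero := \<zero>\<^bsub>GR\<^esub>\<rparr>)" by (simp add: group_ring_def)
 moreover have "GR\<lparr>ring.zero := \<zero>\<^bsub>GR\<^esub>\<rparr> = GR" by (simp add: group_ring_def)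
 ultimately show ?thesis by simp
qed

text \<open>Applied to the unit vector of the product, \<Delta>(a) places the coefficients of a on
  the diagonal. Both the idempotency of corepresentation coefficients and the computation of the
  slices of \<Delta>(a) read off this vector.\<close>

lemma comult_entry:
 assumes "a \<in> cred" "x \<in> carrier G" "y \<in> carrier G"
 shows "comult a (delta (\<one>, \<one>)) (x, y) = (if x = y then a \<xi> x else 0)"
proof -
 have "\<one> = inv x \<otimes> y \<longleftrightarrow> x = y"
  using assms by (metis inv_closed inv_inv inv_equality l_inv)
 thus ?thesis using assms by (simp add: com.amp_entry)
qed

text \<open>For a finite-dimensional corepresentation \<open>u\<close> the matrices \<open>p\<^sub>x = (\<langle>u\<^sub>i\<^sub>j \<delta>\<^sub>e, \<delta>\<^sub>x\<rangle>)\<close> are pairwise orthogonal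
 idempotents. A non-zero one has an entry of modulus at least \<open>1/n\<close>, so only finitely many are non-zero.\<close>

lemma corep_gspan:
 assumes u: "unitary_corep (reduced_cqg G) n u" and ij: "i < n" "j < n"
 shows "u i j \<in> gspan"
proof -
 let ?p = "\<lambda>x i j. u i j \<xi> x"
 have n: "0 < n" using u by (simp add: unitary_corep_def)
 have c: "u i j \<in> cred" if "i < n" "j < n" for i j using u that by (simp add: unitary_corep_def)
 have D: "comult (u i j) = (\<Oplus>\<^bsub>BG2\<^esub>k\<in>{..<n}. otimes (u i k) (u k j))" if "i < n" "j < n" for i j
  using u that by (simp add: unitary_corep_def del: comult_apply)
 have idem: "?p x i j = (\<Sum>k<n. ?p x i k * ?p x k j)" if x: "x \<in> carrier G" and ij: "i < n" "j < n" for x i j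
 proof -
  have "?p x i j = comult (u i j) (delta (\<one>, \<one>)) (x, x)" using comult_entry[OF c[OF ij] x x] by simp
  also have "\<dots> = (\<Sum>k<n. otimes (u i k) (u k j) (delta (\<one>, \<one>)) (x, x))"
   unfolding D[OF ij] by (subst BH_finsum(2)) (auto simp: c ij)
  also have "\<dots> = (\<Sum>k<n. ?p x i k * ?p x k j)"
   by (rule sum.cong[OF refl]) (use x in \<open>simp add: op_tensor_entry c ij\<close>)
  finally show ?thesis .
 qed
 have big: "\<exists>i<n. \<exists>j<n. inverse (real n) \<le> cmod (?p x i j)" if x: "x \<in> carrier G" and nz: "i < n" "j < n" "?p x i j \<noteq> 0" for x i j
 proof -
  \<comment> \<open>If M is the largest modulus of an entry, idempotency bounds it by a sum of n
    products, M \<le> n M^2. A positive M is therefore at least 1 / n, independently of x.\<close>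
  define M where "M = Max ((\<lambda>(i, j). cmod (?p x i j)) ` ({..<n} \<times> {..<n}))"
  have le: "cmod (?p x i j) \<le> M" if "i < n" "j < n" for i j
   unfolding M_def by (rule Max_ge) (use that in auto)
  have "M \<in> (\<lambda>(i, j). cmod (?p x i j)) ` ({..<n} \<times> {..<n})" unfolding M_def by (rule Max_in) (use n in auto)
  then obtain a b where ab: "a < n" "b < n" "M = cmod (?p x a b)" by auto
  have pos: "M > 0" using le[OF nz(1,2)] nz(3) by (meson less_le_trans zero_less_norm_iff)
  have "M \<le> (\<Sum>k<n. cmod (?p x a k * ?p x k b))"
   unfolding ab(3) by (subst idem[OF x ab(1,2)]) (rule norm_sum)
  also have "\<dots> \<le> (\<Sum>k<n. M * M)"
   by (rule sum_mono) (use le ab pos in \<open>auto simp: norm_mult intro!: mult_mono\<close>)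
  finally have "M \<le> real n * M * M" by simp
  hence "inverse (real n) \<le> M" using pos n by (simp add: field_simps)
  thus ?thesis using ab by auto
 qed
 have "{x. ?p x i j \<noteq> 0} \<subseteq> (\<Union>i\<in>{..<n}. \<Union>j\<in>{..<n}. {x. inverse (real n) \<le> cmod (?p x i j)})"
 proof
  fix x assume "x \<in> {x. ?p x i j \<noteq> 0}"
  hence x: "?p x i j \<noteq> 0" by simp
  have "x \<in> carrier G" by (rule ccontr) (use x l2_outside[OF vec_l2[OF cred_bopD[OF c[OF ij]]]] in blast)
  from big[OF this ij x] show "x \<in> (\<Union>i\<in>{..<n}. \<Union>j\<in>{..<n}. {x. inverse (real n) \<le> cmod (?p x i j)})" by auto
 qed
 moreover have "finite (\<Union>i\<in>{..<n}. \<Union>j\<in>{..<n}. {x. inverse (real n) \<le> cmod (?p x i j)})"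
  using n c by (intro finite_UN_I finite_lessThan l2_large_finite[of _ "carrier G"]) auto
 ultimately have "finite {x. ?p x i j \<noteq> 0}" by (rule finite_subset)
 hence f: "u i j \<xi> \<in> carrier GR"
  using l2_outside[OF vec_l2[OF cred_bopD[OF c[OF ij]]]] by (simp add: GR_carrier)
 have "u i j = rep (u i j \<xi>)"
  by (rule cred_eqI[OF c[OF ij] gspan_credD[OF rep_gspan[OF f]]]) (simp add: rep_vec[OF f])
 thus ?thesis using rep_gspan[OF f] by simp
qed

lemma lreg_corep:
 assumes g: "g \<in> carrier G"
 shows "unitary_corep (reduced_cqg G) 1 (\<lambda>i j. lreg g)" "irreducible_corep (reduced_cqg G) 1 (\<lambda>i j. lreg g)"
proof -
 interpret B: abelian_group BG by (rule abelian_group_BH)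
 interpret B2: abelian_group "BG2" by (rule abelian_group_BH)
 have "adjG (lreg g) \<otimes>\<^bsub>BG\<^esub> lreg g = \<one>\<^bsub>BG\<^esub>" "lreg g \<otimes>\<^bsub>BG\<^esub> adjG (lreg g) = \<one>\<^bsub>BG\<^esub>"
  using g by (simp_all add: lreg_adjoint lreg_mult lreg_one[symmetric])
 thus "unitary_corep (reduced_cqg G) 1 (\<lambda>i j. lreg g)"
  using g by (simp add: unitary_corep_def com_lreg lessThan_Suc)
 show "irreducible_corep (reduced_cqg G) 1 (\<lambda>i j. lreg g)"
  by (auto simp: irreducible_corep_def)
qed

text \<open>For one inclusion \<open>corep_gspan\<close> treats every finite-dimensional unitary
  corepresentation; for the other, each \<lambda>_g is itself a one-dimensional one, irreducible
  because a 1 by 1 matrix is scalar.\<close>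

lemma hopf_alg_eq: "hopf_alg (reduced_cqg G) = gspan"
proof -
 let ?C = "{u i j | n u i j. unitary_corep (reduced_cqg G) n u \<and> irreducible_corep (reduced_cqg G) n u \<and> i < n \<and> j < n}"
 have h: "hopf_alg (reduced_cqg G) = lin_span BG ?C" by (simp add: hopf_alg_def)
 have sp: "op_space (carrier G) gspan" using gspan_alg by (simp add: op_alg_def)
 have C: "?C \<subseteq> gspan" using corep_gspan by auto
 have L: "lreg ` carrier G \<subseteq> ?C"
 proof
  fix a assume "a \<in> lreg ` carrier G"
  then obtain g where g: "g \<in> carrier G" "a = lreg g" by blast
  have "a = (\<lambda>i j. lreg g) (0::nat) (0::nat) \<and> unitary_corep (reduced_cqg G) 1 (\<lambda>i j. lreg g) \<and> irreducible_corep (reduced_cqg G) 1 (\<lambda>i j. lreg g) \<and> (0::nat) < 1 \<and> (0::nat) < 1"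
   using lreg_corep[OF g(1)] g(2) by simp
  thus "a \<in> ?C"
   by (intro CollectI exI[of _ 1] exI[of _ "\<lambda>i j. lreg g"] exI[of _ "0::nat"])
 qed
 have "lin_span BG ?C \<subseteq> gspan" by (rule lin_span_least[OF sp C])
 moreover have "gspan \<subseteq> lin_span BG ?C"
 proof (rule lin_span_least)
  show "op_space (carrier G) (lin_span BG ?C)" by (rule lin_span_space) (use C gspan_bop in blast)
  show "lreg ` carrier G \<subseteq> lin_span BG ?C" using L lin_span_incl' by (rule subset_trans)
 qed
 ultimately show ?thesis using h by simp
qed

section \<open>The counit\<close>

definition augmentation :: "('a \<Rightarrow> complex) op \<Rightarrow> complex" where
 "augmentation = (\<lambda>a\<in>gspan. Sum_any (a \<xi>))"

lemma augmentation_apply: "a \<in> gspan \<Longrightarrow> augmentation a = Sum_any (a \<xi>)"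
 by (simp add: augmentation_def)

lemma GR_finite: "f \<in> carrier GR \<Longrightarrow> finite {x. f x \<noteq> 0}"
 by (simp add: GR_carrier)

lemma augmentation_add: "a \<in> gspan \<Longrightarrow> b \<in> gspan \<Longrightarrow> augmentation (a \<oplus>\<^bsub>BG\<^esub> b) = augmentation a + augmentation b"
 by (simp only: augmentation_apply lin_span_add BG_vec Sum_any.distrib GR_finite gspan_vec)

lemma augmentation_scale: "a \<in> gspan \<Longrightarrow> augmentation (c \<odot>\<^bsub>BG\<^esub> a) = c * augmentation a"
 by (simp only: augmentation_apply lin_span_smult BG_vec Sum_any_right_distrib GR_finite gspan_vec)

lemma augmentation_zero: "augmentation \<zero>\<^bsub>BG\<^esub> = 0"
 by (simp only: augmentation_apply lin_span_zero BG_vec Sum_any.neutral)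

lemma augmentation_lreg:
 assumes g: "g \<in> carrier G" shows "augmentation (lreg g) = 1"
proof -
 have "lreg g \<in> gspan" by (rule lin_span_incl[OF imageI[OF g]])
 hence "augmentation (lreg g) = Sum_any (\<lambda>x. if x = g then 1 else 0 :: complex)"
  using g by (simp add: augmentation_apply lreg_delta) (simp add: delta_def)
 also have "\<dots> = 1" by simp
 finally show ?thesis .
qed

lemma augmentation_mult:
 assumes a: "a \<in> gspan" and b: "b \<in> gspan"
 shows "augmentation (a \<otimes>\<^bsub>BG\<^esub> b) = augmentation a * augmentation b"
proof -
 have bop: "\<And>a. a \<in> gspan \<Longrightarrow> a \<in> bopG" using gspan_bop by blast
 have l: "augmentation (lreg g \<otimes>\<^bsub>BG\<^esub> b) = augmentation b" if g: "g \<in> carrier G" for g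
  using b
 proof induction
  case lin_span_zero
  have "lreg g \<otimes>\<^bsub>BG\<^esub> \<zero>\<^bsub>BG\<^esub> = \<zero>\<^bsub>BG\<^esub>" using g by (simp add: ring.ring_simprules(25)[OF ring_BH])
  thus ?case by simp
 next
  case (lin_span_incl b)
  then obtain h where h: "h \<in> carrier G" "b = lreg h" by blast
  thus ?case using g by (simp add: lreg_mult augmentation_lreg)
 next
  case (lin_span_add b c)
  have "lreg g \<otimes>\<^bsub>BG\<^esub> (b \<oplus>\<^bsub>BG\<^esub> c) = lreg g \<otimes>\<^bsub>BG\<^esub> b \<oplus>\<^bsub>BG\<^esub> lreg g \<otimes>\<^bsub>BG\<^esub> c"
   using g lin_span_add by (intro ring.ring_simprules(23)[OF ring_BH]) (simp_all add: bop)
  thus ?case using lin_span_add g by (simp add: augmentation_add gspan_mult lin_span.lin_span_incl)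
 next
  case (lin_span_smult b c)
  have "lreg g \<otimes>\<^bsub>BG\<^esub> (c \<odot>\<^bsub>BG\<^esub> b) = c \<odot>\<^bsub>BG\<^esub> (lreg g \<otimes>\<^bsub>BG\<^esub> b)"
   by (rule bop_eq[of _ "carrier G"]) (use g bop[OF lin_span_smult(1)] in \<open>simp_all add: bop_in bop_scale[OF lreg_bop]\<close>)
  thus ?case using lin_span_smult g by (simp add: augmentation_scale gspan_mult lin_span.lin_span_incl)
 qed
 show ?thesis
  using a
 proof induction
  case lin_span_zero
  have "\<zero>\<^bsub>BG\<^esub> \<otimes>\<^bsub>BG\<^esub> b = \<zero>\<^bsub>BG\<^esub>" using bop[OF b] by (simp add: ring.ring_simprules(24)[OF ring_BH])
  thus ?case by (simp add: augmentation_zero)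
 next
  case (lin_span_incl a)
  then obtain h where h: "h \<in> carrier G" "a = lreg h" by blast
  thus ?case by (simp add: l augmentation_lreg)
 next
  case (lin_span_add a c)
  have "(a \<oplus>\<^bsub>BG\<^esub> c) \<otimes>\<^bsub>BG\<^esub> b = a \<otimes>\<^bsub>BG\<^esub> b \<oplus>\<^bsub>BG\<^esub> c \<otimes>\<^bsub>BG\<^esub> b"
   using lin_span_add b by (intro ring.ring_simprules(13)[OF ring_BH]) (simp_all add: bop)
  thus ?case using lin_span_add b by (simp add: augmentation_add gspan_mult algebra_simps)
 next
  case (lin_span_smult a c)
  have "(c \<odot>\<^bsub>BG\<^esub> a) \<otimes>\<^bsub>BG\<^esub> b = c \<odot>\<^bsub>BG\<^esub> (a \<otimes>\<^bsub>BG\<^esub> b)"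
   by (rule bop_eq[of _ "carrier G"]) (use bop[OF b] bop[OF lin_span_smult(1)] in \<open>simp_all add: bop_in\<close>)
  thus ?case using lin_span_smult b by (simp add: augmentation_scale gspan_mult algebra_simps)
 qed
qed

abbreviation "T2 \<equiv> alg_tensor (carrier G) gspan (carrier G) gspan"

text \<open>Finiteness of the support is what makes \<open>Sum_any\<close> additive, hence the slice
  maps linear, on the algebraic tensor product.\<close>

lemma T2_finite:
 assumes "X \<in> T2" shows "finite {p. X (delta (\<one>, \<one>)) p \<noteq> 0}"
 using assms unfolding alg_tensor_def
proof induction
 case lin_span_zero
 thus ?case by simp
next
 case (lin_span_incl X)
 then obtain a b where ab: "X = otimes a b" "a \<in> gspan" "b \<in> gspan" by blast
 have bop: "a \<in> bopG" "b \<in> bopG" using ab gspan_credD by auto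
 have "{p. X (delta (\<one>, \<one>)) p \<noteq> 0} \<subseteq> {x. a \<xi> x \<noteq> 0} \<times> {y. b \<xi> y \<noteq> 0}"
 proof
  fix p assume p: "p \<in> {p. X (delta (\<one>, \<one>)) p \<noteq> 0}"
  obtain x y where xy: "p = (x, y)" by (cases p)
  have o: "otimes a b \<in> bopG2" by (rule op_tensor_bop[OF bop])
  have "p \<in> GxG" by (rule ccontr) (use p bop_outside[OF o delta_l2, of "(\<one>, \<one>)" p] ab(1) in simp)
  hence "X (delta (\<one>, \<one>)) p = a \<xi> x * b \<xi> y" unfolding ab(1) xy by (intro op_tensor_entry bop) auto
  thus "p \<in> {x. a \<xi> x \<noteq> 0} \<times> {y. b \<xi> y \<noteq> 0}" using p xy by simp
 qed
 thus ?case using GR_finite[OF gspan_vec[OF ab(2)]] GR_finite[OF gspan_vec[OF ab(3)]] by (blast intro: finite_subset)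
next
 case (lin_span_add X Y)
 thus ?case by (simp add: finite_support_add)
next
 case (lin_span_smult X c)
 thus ?case by (auto elim: rev_finite_subset)
qed

lemma T2_bop: "X \<in> T2 \<Longrightarrow> X \<in> bopG2"
 using alg_tensor_bop[OF gspan_bop gspan_bop] by blast

text \<open>The slice maps \<open>\<epsilon> \<otimes> id\<close> and \<open>id \<otimes> \<epsilon>\<close>, in terms of the coefficients of \<open>X (\<delta>\<^sub>e \<otimes> \<delta>\<^sub>e)\<close>.\<close>

definition slice_left :: "('a \<times> 'a \<Rightarrow> complex) op \<Rightarrow> 'a \<Rightarrow> complex" where
 "slice_left X y = Sum_any (\<lambda>x. X (delta (\<one>, \<one>)) (x, y))"

definition slice_right :: "('a \<times> 'a \<Rightarrow> complex) op \<Rightarrow> 'a \<Rightarrow> complex" where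
 "slice_right X x = Sum_any (\<lambda>y. X (delta (\<one>, \<one>)) (x, y))"

lemma T2_slice_finite:
 assumes X: "X \<in> T2"
 shows "finite {x. X (delta (\<one>, \<one>)) (x, y) \<noteq> 0}" "finite {y. X (delta (\<one>, \<one>)) (x, y) \<noteq> 0}"
 by (rule finite_subset[OF _ finite_imageI[OF T2_finite[OF X], of fst]]; force)
  (rule finite_subset[OF _ finite_imageI[OF T2_finite[OF X], of snd]]; force)

lemma slice_GR:
 assumes X: "X \<in> T2" shows "slice_left X \<in> carrier GR" "slice_right X \<in> carrier GR"
proof -
 have out: "X (delta (\<one>, \<one>)) (x, y) = 0" if "x \<notin> carrier G \<or> y \<notin> carrier G" for x y
  using bop_outside[OF T2_bop[OF X] delta_l2, of "(\<one>, \<one>)" "(x, y)"] that by auto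
 have "{y. slice_left X y \<noteq> 0} \<subseteq> snd ` {p. X (delta (\<one>, \<one>)) p \<noteq> 0}"
 proof
  fix y assume "y \<in> {y. slice_left X y \<noteq> 0}"
  hence "\<exists>x. X (delta (\<one>, \<one>)) (x, y) \<noteq> 0" unfolding slice_left_def by (auto intro: ccontr)
  thus "y \<in> snd ` {p. X (delta (\<one>, \<one>)) p \<noteq> 0}" by force
 qed
 thus "slice_left X \<in> carrier GR" unfolding GR_carrier
  using finite_subset[OF _ finite_imageI[OF T2_finite[OF X]]] out by (auto simp: slice_left_def)
 have "{y. slice_right X y \<noteq> 0} \<subseteq> fst ` {p. X (delta (\<one>, \<one>)) p \<noteq> 0}"
 proof
  fix x assume "x \<in> {x. slice_right X x \<noteq> 0}"
  hence "\<exists>y. X (delta (\<one>, \<one>)) (x, y) \<noteq> 0" unfolding slice_right_def by (auto intro: ccontr)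
  thus "x \<in> fst ` {p. X (delta (\<one>, \<one>)) p \<noteq> 0}" by force
 qed
 thus "slice_right X \<in> carrier GR" unfolding GR_carrier
  using finite_subset[OF _ finite_imageI[OF T2_finite[OF X]]] out by (auto simp: slice_right_def)
qed

lemma slice_add:
 assumes "X \<in> T2" "Y \<in> T2"
 shows "slice_left (X \<oplus>\<^bsub>BG2\<^esub> Y) = (\<lambda>x. slice_left X x + slice_left Y x)"
  "slice_right (X \<oplus>\<^bsub>BG2\<^esub> Y) = (\<lambda>x. slice_right X x + slice_right Y x)"
 by (simp_all add: slice_left_def slice_right_def fun_eq_iff Sum_any.distrib[symmetric] T2_slice_finite assms)

lemma slice_smult:
 assumes "X \<in> T2"
 shows "slice_left (c \<odot>\<^bsub>BG2\<^esub> X) = (\<lambda>x. c * slice_left X x)"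
  "slice_right (c \<odot>\<^bsub>BG2\<^esub> X) = (\<lambda>x. c * slice_right X x)"
 by (simp_all add: slice_left_def slice_right_def fun_eq_iff Sum_any_right_distrib T2_slice_finite assms)

lemma slice_tensor:
 assumes a: "a \<in> gspan" and b: "b \<in> gspan"
 shows "slice_left (otimes a b) = (\<lambda>y. augmentation a * b \<xi> y)"
  "slice_right (otimes a b) = (\<lambda>x. augmentation b * a \<xi> x)"
proof -
 have bop: "a \<in> bopG" "b \<in> bopG" using a b gspan_credD by auto
 have o: "otimes a b \<in> bopG2" by (rule op_tensor_bop[OF bop])
 have out: "a \<xi> x = 0" "b \<xi> x = 0" if "x \<notin> carrier G" for x
  using that l2_outside[OF vec_l2[OF bop(1)]] l2_outside[OF vec_l2[OF bop(2)]] by auto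
 have e: "otimes a b (delta (\<one>, \<one>)) (x, y) = a \<xi> x * b \<xi> y" for x y
 proof (cases "x \<in> carrier G \<and> y \<in> carrier G")
  case True thus ?thesis by (intro op_tensor_entry bop) auto
 next
  case False
  hence "otimes a b (delta (\<one>, \<one>)) (x, y) = 0" by (intro bop_outside[OF o delta_l2]) auto
  thus ?thesis using False out by auto
 qed
 show "slice_left (otimes a b) = (\<lambda>y. augmentation a * b \<xi> y)"
  by (rule ext) (simp add: slice_left_def e augmentation_apply[OF a] Sum_any_left_distrib GR_finite gspan_vec a)
 show "slice_right (otimes a b) = (\<lambda>x. augmentation b * a \<xi> x)"
  by (rule ext) (simp add: slice_right_def e augmentation_apply[OF b] Sum_any_left_distrib GR_finite gspan_vec b mult.commute)
qed

lemma slice_comult: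
 assumes a: "a \<in> gspan"
 shows "slice_left (comult a) = a \<xi>" "slice_right (comult a) = a \<xi>"
proof -
 have c: "a \<in> cred" by (rule gspan_credD[OF a])
 have o: "comult a \<in> bopG2" using cred2_bopD[OF com_cred[OF c]] c by simp
 have e: "comult a (delta (\<one>, \<one>)) (x, y) = (if x = y then a \<xi> x else 0)" for x y
 proof (cases "x \<in> carrier G \<and> y \<in> carrier G")
  case True thus ?thesis by (intro comult_entry c) auto
 next
  case False
  hence "comult a (delta (\<one>, \<one>)) (x, y) = 0" by (intro bop_outside[OF o delta_l2]) auto
  thus ?thesis using False l2_outside[OF vec_l2[OF cred_bopD[OF c]]] by auto
 qed
 have d: "Sum_any (\<lambda>x. if x = y then a \<xi> x else 0) = a \<xi> y"
  "Sum_any (\<lambda>x. if y = x then a \<xi> y else 0) = a \<xi> y" for y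
  by (simp_all cong: if_cong)
 show "slice_left (comult a) = a \<xi>" "slice_right (comult a) = a \<xi>"
  by (rule ext, simp only: slice_left_def slice_right_def e d)+
qed

text \<open>The slice maps are computed on coefficients at the unit vector and turned back into
  operators by \<open>rep\<close>. Defined on operators in this way, they are well defined without
  decomposing an element of the tensor product.\<close>

lemma counit_on_augmentation: "counit_on (reduced_cqg G) augmentation"
proof -
 let ?B2 = "BG2"
 have T2_add: "X \<oplus>\<^bsub>?B2\<^esub> Y \<in> T2" if "X \<in> T2" "Y \<in> T2" for X Y
  using that unfolding alg_tensor_def by (rule lin_span_add)
 have T2_smult: "c \<odot>\<^bsub>?B2\<^esub> X \<in> T2" if "X \<in> T2" for X c
  using that unfolding alg_tensor_def by (rule lin_span_smult)
 have L: "linear_on ?B2 BG T2 (\<lambda>X. rep (slice_left X))" "linear_on ?B2 BG T2 (\<lambda>X. rep (slice_right X))"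
  unfolding linear_on_def
  by (auto simp only: slice_add slice_smult rep_add rep_scale slice_GR BH_carrier intro!: gspan_bop[THEN subsetD] rep_gspan)
 have t: "rep (slice_left (otimes a b)) = augmentation a \<odot>\<^bsub>BG\<^esub> b" "rep (slice_right (otimes a b)) = augmentation b \<odot>\<^bsub>BG\<^esub> a"
  if "a \<in> gspan" "b \<in> gspan" for a b
  by (simp_all only: slice_tensor[OF that] rep_scale gspan_vec that rep_ev)
 have d: "rep (slice_left (comult a)) = a" "rep (slice_right (comult a)) = a" if "a \<in> gspan" for a
  by (simp_all only: slice_comult[OF that] rep_ev[OF that])
 have "\<exists>L R. linear_on ?B2 BG T2 L \<and> linear_on ?B2 BG T2 R \<and>
   (\<forall>a\<in>gspan. \<forall>b\<in>gspan. L (otimes a b) = augmentation a \<odot>\<^bsub>BG\<^esub> b \<and> R (otimes a b) = augmentation b \<odot>\<^bsub>BG\<^esub> a) \<and>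
   (\<forall>a\<in>gspan. L (comult a) = a \<and> R (comult a) = a)"
  by (rule exI[of _ "\<lambda>X. rep (slice_left X)"], rule exI[of _ "\<lambda>X. rep (slice_right X)"])
   (intro conjI ballI L t d)
 moreover have "augmentation \<one>\<^bsub>BG\<^esub> = 1" using augmentation_lreg[OF one_closed] by (simp only: lreg_one)
 moreover have "augmentation \<in> extensional gspan" by (simp add: augmentation_def)
 ultimately show ?thesis
  unfolding counit_on_def hopf_alg_eq reduced_cqg_simps Let_def
  using augmentation_add augmentation_mult augmentation_scale by (intro conjI ballI allI)
qed

text \<open>At \<lambda>_g the counit axiom is e(\<lambda>_g) \<lambda>_g = \<lambda>_g, so any
  counit is 1 on group elements and linearity determines it.\<close>

lemma counit_eq: "counit (reduced_cqg G) = augmentation"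
 unfolding counit_def
proof (rule the_equality, rule counit_on_augmentation)
 fix e assume "counit_on (reduced_cqg G) e"
 hence e: "e \<in> extensional gspan" "\<And>a b. a \<in> gspan \<Longrightarrow> b \<in> gspan \<Longrightarrow> e (a \<oplus>\<^bsub>BG\<^esub> b) = e a + e b"
  "\<And>c a. a \<in> gspan \<Longrightarrow> e (c \<odot>\<^bsub>BG\<^esub> a) = c * e a"
  "\<exists>L. \<forall>a\<in>gspan. (\<forall>b\<in>gspan. L (otimes a b) = e a \<odot>\<^bsub>BG\<^esub> b) \<and> L (comult a) = a"
  unfolding counit_on_def hopf_alg_eq reduced_cqg_simps Let_def by (simp_all, blast)
 obtain L where L: "\<And>a b. a \<in> gspan \<Longrightarrow> b \<in> gspan \<Longrightarrow> L (otimes a b) = e a \<odot>\<^bsub>BG\<^esub> b" "\<And>a. a \<in> gspan \<Longrightarrow> L (comult a) = a"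
  using e(4) by blast
 have lreg1: "e (lreg g) = 1" if g: "g \<in> carrier G" for g
 proof -
  have s: "lreg g \<in> gspan" by (rule lin_span_incl[OF imageI[OF g]])
  have "e (lreg g) \<odot>\<^bsub>BG\<^esub> lreg g = lreg g" using L(1)[OF s s] L(2)[OF s] g by (simp add: com_lreg)
  hence "(e (lreg g) \<odot>\<^bsub>BG\<^esub> lreg g) \<xi> g = lreg g \<xi> g" by simp
  thus ?thesis using g by (simp add: lreg_delta)
 qed
 have "e a = augmentation a" if "a \<in> gspan" for a
  using that
 proof induction
  case lin_span_zero
  have "(0::complex) \<odot>\<^bsub>BG\<^esub> \<zero>\<^bsub>BG\<^esub> = \<zero>\<^bsub>BG\<^esub>" by (rule bop_eq[of _ "carrier G"]) simp_all
  thus ?case using e(3)[OF lin_span.lin_span_zero, of 0] by (simp add: augmentation_zero)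
 next
  case (lin_span_incl a)
  thus ?case using lreg1 augmentation_lreg by auto
 next
  case (lin_span_add a b)
  thus ?case by (simp only: e(2) augmentation_add)
 next
  case (lin_span_smult a c)
  thus ?case by (simp only: e(3) augmentation_scale)
 qed
 thus "e = augmentation" by (intro extensionalityI[OF e(1)]) (auto simp: augmentation_def)
qed

lemma counit_rep: "f \<in> carrier GR \<Longrightarrow> counit (reduced_cqg G) (rep f) = (\<Sum>x\<in>{x. f x \<noteq> 0}. f x)"
 by (simp only: counit_eq augmentation_apply rep_gspan rep_vec Sum_any.expand_set)

end

subsection \<open>Left modules and semilinear maps\<close>

locale left_mod = R: ring R + M: abelian_group M for R :: "('r, 'z) ring_scheme" and M :: "('r, 'm) module" +
 assumes smult_closed [simp]: "r \<in> carrier R \<Longrightarrow> x \<in> carrier M \<Longrightarrow> r \<odot>\<^bsub>M\<^esub> x \<in> carrier M"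
  and smult_add: "r \<in> carrier R \<Longrightarrow> x \<in> carrier M \<Longrightarrow> y \<in> carrier M \<Longrightarrow> r \<odot>\<^bsub>M\<^esub> (x \<oplus>\<^bsub>M\<^esub> y) = r \<odot>\<^bsub>M\<^esub> x \<oplus>\<^bsub>M\<^esub> r \<odot>\<^bsub>M\<^esub> y"
  and add_smult: "r \<in> carrier R \<Longrightarrow> s \<in> carrier R \<Longrightarrow> x \<in> carrier M \<Longrightarrow> (r \<oplus>\<^bsub>R\<^esub> s) \<odot>\<^bsub>M\<^esub> x = r \<odot>\<^bsub>M\<^esub> x \<oplus>\<^bsub>M\<^esub> s \<odot>\<^bsub>M\<^esub> x"
  and mult_smult: "r \<in> carrier R \<Longrightarrow> s \<in> carrier R \<Longrightarrow> x \<in> carrier M \<Longrightarrow> (r \<otimes>\<^bsub>R\<^esub> s) \<odot>\<^bsub>M\<^esub> x = r \<odot>\<^bsub>M\<^esub> (s \<odot>\<^bsub>M\<^esub> x)"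
  and one_smult [simp]: "x \<in> carrier M \<Longrightarrow> \<one>\<^bsub>R\<^esub> \<odot>\<^bsub>M\<^esub> x = x"
begin

lemma zero_smult [simp]: assumes x: "x \<in> carrier M" shows "\<zero>\<^bsub>R\<^esub> \<odot>\<^bsub>M\<^esub> x = \<zero>\<^bsub>M\<^esub>"
proof -
 have "\<zero>\<^bsub>R\<^esub> \<odot>\<^bsub>M\<^esub> x \<oplus>\<^bsub>M\<^esub> \<zero>\<^bsub>R\<^esub> \<odot>\<^bsub>M\<^esub> x = \<zero>\<^bsub>R\<^esub> \<odot>\<^bsub>M\<^esub> x"
  using add_smult[of "\<zero>\<^bsub>R\<^esub>" "\<zero>\<^bsub>R\<^esub>" x] x by simp
 thus ?thesis using x by (metis M.add.r_cancel_one' smult_closed R.zero_closed)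
qed

lemma smult_zero [simp]: assumes r: "r \<in> carrier R" shows "r \<odot>\<^bsub>M\<^esub> \<zero>\<^bsub>M\<^esub> = \<zero>\<^bsub>M\<^esub>"
proof -
 have "r \<odot>\<^bsub>M\<^esub> \<zero>\<^bsub>M\<^esub> \<oplus>\<^bsub>M\<^esub> r \<odot>\<^bsub>M\<^esub> \<zero>\<^bsub>M\<^esub> = r \<odot>\<^bsub>M\<^esub> \<zero>\<^bsub>M\<^esub>"
  using smult_add[of r "\<zero>\<^bsub>M\<^esub>" "\<zero>\<^bsub>M\<^esub>"] r by simp
 thus ?thesis using r by (metis M.add.r_cancel_one' smult_closed M.zero_closed)
qed

lemma smult_minus: assumes r: "r \<in> carrier R" and x: "x \<in> carrier M"
 shows "r \<odot>\<^bsub>M\<^esub> (\<ominus>\<^bsub>M\<^esub> x) = \<ominus>\<^bsub>M\<^esub> (r \<odot>\<^bsub>M\<^esub> x)"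
proof -
 have "r \<odot>\<^bsub>M\<^esub> (\<ominus>\<^bsub>M\<^esub> x) \<oplus>\<^bsub>M\<^esub> r \<odot>\<^bsub>M\<^esub> x = \<zero>\<^bsub>M\<^esub>"
  using smult_add[of r "\<ominus>\<^bsub>M\<^esub> x" x] r x by (simp add: M.l_neg)
 thus ?thesis using r x M.minus_equality by (metis M.a_inv_closed smult_closed)
qed

lemma smult_finsum:
 assumes "finite I" "r \<in> carrier R" "f \<in> I \<rightarrow> carrier M"
 shows "r \<odot>\<^bsub>M\<^esub> (\<Oplus>\<^bsub>M\<^esub>i\<in>I. f i) = (\<Oplus>\<^bsub>M\<^esub>i\<in>I. r \<odot>\<^bsub>M\<^esub> f i)"
 using assms by (induction I) (auto simp: Pi_iff smult_add)

end

text \<open>Linearity along a ring map \<Phi>. Working with it directly compares modules over two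
  rings without restricting scalars; ordinary linear maps are the case of the identity.\<close>

definition semilinear :: "('r, 'z) ring_scheme \<Rightarrow> ('r \<Rightarrow> 's) \<Rightarrow> ('r, 'm) module \<Rightarrow> ('s, 'n) module \<Rightarrow> ('m \<Rightarrow> 'n) \<Rightarrow> bool" where
 "semilinear R \<Phi> M N f \<longleftrightarrow> f \<in> carrier M \<rightarrow> carrier N \<and>
   (\<forall>x\<in>carrier M. \<forall>y\<in>carrier M. f (x \<oplus>\<^bsub>M\<^esub> y) = f x \<oplus>\<^bsub>N\<^esub> f y) \<and>
   (\<forall>r\<in>carrier R. \<forall>x\<in>carrier M. f (r \<odot>\<^bsub>M\<^esub> x) = \<Phi> r \<odot>\<^bsub>N\<^esub> f x)"

abbreviation "rlinear R \<equiv> semilinear R (\<lambda>r. r)"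

lemma left_module_hom_semilinear: "left_module_hom R M N f \<longleftrightarrow> rlinear R M N f"
 by (simp add: left_module_hom_def semilinear_def)

lemma semilinearD:
 assumes "semilinear R \<Phi> M N f"
 shows "x \<in> carrier M \<Longrightarrow> f x \<in> carrier N"
  "x \<in> carrier M \<Longrightarrow> y \<in> carrier M \<Longrightarrow> f (x \<oplus>\<^bsub>M\<^esub> y) = f x \<oplus>\<^bsub>N\<^esub> f y"
  "r \<in> carrier R \<Longrightarrow> x \<in> carrier M \<Longrightarrow> f (r \<odot>\<^bsub>M\<^esub> x) = \<Phi> r \<odot>\<^bsub>N\<^esub> f x"
 using assms by (auto simp: semilinear_def)

lemma additive_zero:
 assumes M: "abelian_group M" and N: "abelian_group N"
  and f: "\<And>x. x \<in> carrier M \<Longrightarrow> f x \<in> carrier N"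
   "\<And>x y. x \<in> carrier M \<Longrightarrow> y \<in> carrier M \<Longrightarrow> f (x \<oplus>\<^bsub>M\<^esub> y) = f x \<oplus>\<^bsub>N\<^esub> f y"
 shows "f \<zero>\<^bsub>M\<^esub> = \<zero>\<^bsub>N\<^esub>" "x \<in> carrier M \<Longrightarrow> f (\<ominus>\<^bsub>M\<^esub> x) = \<ominus>\<^bsub>N\<^esub> f x"
  "x \<in> carrier M \<Longrightarrow> y \<in> carrier M \<Longrightarrow> f (x \<ominus>\<^bsub>M\<^esub> y) = f x \<ominus>\<^bsub>N\<^esub> f y"
proof -
 interpret M: abelian_group M by fact
 interpret N: abelian_group N by fact
 have "f \<zero>\<^bsub>M\<^esub> \<oplus>\<^bsub>N\<^esub> f \<zero>\<^bsub>M\<^esub> = f \<zero>\<^bsub>M\<^esub>" using f(2)[of "\<zero>\<^bsub>M\<^esub>" "\<zero>\<^bsub>M\<^esub>"] by simp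
 thus z: "f \<zero>\<^bsub>M\<^esub> = \<zero>\<^bsub>N\<^esub>" using f(1)[of "\<zero>\<^bsub>M\<^esub>"] by (metis N.add.r_cancel_one' M.zero_closed)
 have m: "f (\<ominus>\<^bsub>M\<^esub> x) = \<ominus>\<^bsub>N\<^esub> f x" if x: "x \<in> carrier M" for x
  using f(2)[of "\<ominus>\<^bsub>M\<^esub> x" x] x z N.minus_equality[of "f (\<ominus>\<^bsub>M\<^esub> x)" "f x"] f(1) by (simp add: M.l_neg)
 thus "x \<in> carrier M \<Longrightarrow> f (\<ominus>\<^bsub>M\<^esub> x) = \<ominus>\<^bsub>N\<^esub> f x" .
 show "x \<in> carrier M \<Longrightarrow> y \<in> carrier M \<Longrightarrow> f (x \<ominus>\<^bsub>M\<^esub> y) = f x \<ominus>\<^bsub>N\<^esub> f y"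
  using f(2)[of x "\<ominus>\<^bsub>M\<^esub> y"] m[of y] by (simp add: a_minus_def)
qed

lemma semilinear_zero:
 assumes "semilinear R \<Phi> M N f" "abelian_group M" "abelian_group N"
 shows "f \<zero>\<^bsub>M\<^esub> = \<zero>\<^bsub>N\<^esub>" "x \<in> carrier M \<Longrightarrow> f (\<ominus>\<^bsub>M\<^esub> x) = \<ominus>\<^bsub>N\<^esub> f x"
  "x \<in> carrier M \<Longrightarrow> y \<in> carrier M \<Longrightarrow> f (x \<ominus>\<^bsub>M\<^esub> y) = f x \<ominus>\<^bsub>N\<^esub> f y"
 by (rule additive_zero[where f=f, OF assms(2,3) semilinearD(1,2)[OF assms(1)]], assumption+)+

lemma semilinear_comp:
 assumes "semilinear R \<Phi> M N f" "semilinear R' \<Phi>' N P g" "\<And>r. r \<in> carrier R \<Longrightarrow> \<Phi> r \<in> carrier R'"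
 shows "semilinear R (\<lambda>r. \<Phi>' (\<Phi> r)) M P (\<lambda>x. g (f x))"
 using semilinearD[OF assms(1)] semilinearD[OF assms(2)] assms(3) unfolding semilinear_def by simp

lemma semilinear_cong:
 assumes "semilinear R \<Phi> M N f" "\<And>r. r \<in> carrier R \<Longrightarrow> \<Phi> r = \<Phi>' r" shows "semilinear R \<Phi>' M N f"
 using assms by (simp add: semilinear_def)

lemma semilinear_minus:
 assumes N: "left_mod R' N" and fg: "semilinear R \<Phi> M N f" "semilinear R \<Phi> M N g"
  and \<Phi>: "\<And>r. r \<in> carrier R \<Longrightarrow> \<Phi> r \<in> carrier R'"
 shows "semilinear R \<Phi> M N (\<lambda>x. f x \<ominus>\<^bsub>N\<^esub> g x)"
proof -
 interpret N: left_mod R' N by fact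
 note D = semilinearD[OF fg(1)] semilinearD[OF fg(2)]
 have "f x \<oplus>\<^bsub>N\<^esub> f y \<ominus>\<^bsub>N\<^esub> (g x \<oplus>\<^bsub>N\<^esub> g y) = f x \<ominus>\<^bsub>N\<^esub> g x \<oplus>\<^bsub>N\<^esub> (f y \<ominus>\<^bsub>N\<^esub> g y)"
  if "x \<in> carrier M" "y \<in> carrier M" for x y
  using D that by (simp add: a_minus_def N.M.minus_add N.M.a_ac)
 moreover have "\<Phi> r \<odot>\<^bsub>N\<^esub> f x \<ominus>\<^bsub>N\<^esub> \<Phi> r \<odot>\<^bsub>N\<^esub> g x = \<Phi> r \<odot>\<^bsub>N\<^esub> (f x \<ominus>\<^bsub>N\<^esub> g x)"
  if "r \<in> carrier R" "x \<in> carrier M" for r x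
  using D that \<Phi> by (simp add: a_minus_def N.smult_add N.smult_minus)
 ultimately show ?thesis unfolding semilinear_def using D by auto
qed

lemma semilinear_id: "rlinear R M M (\<lambda>x. x)"
 by (simp add: semilinear_def)

subsection \<open>Free modules\<close>

abbreviation "Free \<equiv> free_module"

lemma free_module_carrier: "f \<in> carrier (Free R I) \<longleftrightarrow> (\<forall>i\<in>I. f i \<in> carrier R) \<and> (\<forall>i. i \<notin> I \<longrightarrow> f i = \<zero>\<^bsub>R\<^esub>) \<and> finite {i. f i \<noteq> \<zero>\<^bsub>R\<^esub>}"
 by (simp add: free_module_def)

lemma free_module_simps [simp]:
 "\<zero>\<^bsub>Free R I\<^esub> = (\<lambda>i. \<zero>\<^bsub>R\<^esub>)" "f \<oplus>\<^bsub>Free R I\<^esub> g = (\<lambda>i. f i \<oplus>\<^bsub>R\<^esub> g i)"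
 "r \<odot>\<^bsub>Free R I\<^esub> f = (\<lambda>i. r \<otimes>\<^bsub>R\<^esub> f i)"
 by (simp_all add: free_module_def)

context ring
begin

lemma free_module_in: "f \<in> carrier (Free R I) \<Longrightarrow> f i \<in> carrier R"
 by (cases "i \<in> I") (auto simp: free_module_carrier)

lemma free_left_mod: "left_mod R (Free R I)"
proof -
 let ?F = "Free R I"
 have add: "(\<lambda>i. f i \<oplus> g i) \<in> carrier ?F" if "f \<in> carrier ?F" "g \<in> carrier ?F" for f g
 proof -
  have "{i. f i \<oplus> g i \<noteq> \<zero>} \<subseteq> {i. f i \<noteq> \<zero>} \<union> {i. g i \<noteq> \<zero>}" by auto
  hence "finite {i. f i \<oplus> g i \<noteq> \<zero>}"
   by (rule finite_subset) (use that in \<open>auto simp: free_module_carrier\<close>)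
  thus ?thesis using that by (auto simp: free_module_carrier)
 qed
 have sm: "(\<lambda>i. r \<otimes> f i) \<in> carrier ?F" if "f \<in> carrier ?F" "r \<in> carrier R" for f r
 proof -
  have "{i. r \<otimes> f i \<noteq> \<zero>} \<subseteq> {i. f i \<noteq> \<zero>}" using that by auto
  hence "finite {i. r \<otimes> f i \<noteq> \<zero>}" by (rule finite_subset) (use that in \<open>auto simp: free_module_carrier\<close>)
  thus ?thesis using that by (auto simp: free_module_carrier)
 qed
 have mem: "f i \<in> carrier R" if "f \<in> carrier ?F" for f i using free_module_in[OF that] .
 have ab: "abelian_group ?F"
 proof (rule abelian_groupI)
  show "\<zero>\<^bsub>?F\<^esub> \<in> carrier ?F" by (auto simp: free_module_carrier)
  fix f assume f: "f \<in> carrier ?F"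
  show "\<exists>g\<in>carrier ?F. g \<oplus>\<^bsub>?F\<^esub> f = \<zero>\<^bsub>?F\<^esub>"
  proof (rule bexI[of _ "\<lambda>i. (\<ominus> \<one>) \<otimes> f i"])
   show "(\<lambda>i. (\<ominus> \<one>) \<otimes> f i) \<in> carrier ?F" using sm[OF f] by simp
   have "(\<ominus> \<one>) \<otimes> f i \<oplus> f i = \<zero>" for i
    using free_module_in[OF f, of i] by (simp add: l_minus l_neg)
   thus "(\<lambda>i. (\<ominus> \<one>) \<otimes> f i) \<oplus>\<^bsub>?F\<^esub> f = \<zero>\<^bsub>?F\<^esub>" by simp
  qed
 qed (auto simp: add a_ac mem fun_eq_iff)
 show ?thesis
  by (rule left_mod.intro[OF ring_axioms ab], unfold_locales)
   (auto simp: sm mem r_distr l_distr m_assoc fun_eq_iff)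
qed

definition fbasis :: "'i \<Rightarrow> 'i \<Rightarrow> 'a" where "fbasis i = (\<lambda>k. if k = i then \<one> else \<zero>)"

lemma fbasis_in [simp]: "i \<in> I \<Longrightarrow> fbasis i \<in> carrier (Free R I)"
 by (auto simp: free_module_carrier fbasis_def intro: finite_subset[of _ "{i}"])

lemma free_module_induct:
 assumes f: "f \<in> carrier (Free R I)" and z: "P (\<lambda>i. \<zero>)"
  and s: "\<And>f r i. f \<in> carrier (Free R I) \<Longrightarrow> P f \<Longrightarrow> r \<in> carrier R \<Longrightarrow> i \<in> I \<Longrightarrow>
    P (f \<oplus>\<^bsub>Free R I\<^esub> r \<odot>\<^bsub>Free R I\<^esub> fbasis i)"
 shows "P f"
proof -
 have "\<forall>f\<in>carrier (Free R I). {i. f i \<noteq> \<zero>} \<subseteq> S \<longrightarrow> P f" if "finite S" for S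
  using that
 proof (induction S)
  case empty
  have "f = (\<lambda>i. \<zero>)" if "{i. f i \<noteq> \<zero>} \<subseteq> {}" for f using that by auto
  thus ?case using z by blast
 next
  case (insert a S)
  show ?case
  proof (intro ballI impI)
   fix f assume f: "f \<in> carrier (Free R I)" and S: "{i. f i \<noteq> \<zero>} \<subseteq> insert a S"
   let ?g = "f(a := \<zero>)"
   have "{i. ?g i \<noteq> \<zero>} \<subseteq> {i. f i \<noteq> \<zero>}" by auto
   hence "finite {i. ?g i \<noteq> \<zero>}" by (rule finite_subset) (use f in \<open>auto simp: free_module_carrier\<close>)
   hence g: "?g \<in> carrier (Free R I)" using f by (auto simp: free_module_carrier)
   have Pg: "P ?g" by (rule insert.IH[rule_format, OF g]) (use S in auto)
   show "P f"
   proof (cases "a \<in> I")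
    case True
    have "f = ?g \<oplus>\<^bsub>Free R I\<^esub> f a \<odot>\<^bsub>Free R I\<^esub> fbasis a"
     using free_module_in[OF f] by (auto simp: fbasis_def)
    thus ?thesis using s[OF g Pg free_module_in[OF f] True, of a] by metis
   next
    case False
    hence "?g = f" using f by (auto simp: free_module_carrier)
    thus ?thesis using Pg by simp
   qed
  qed
 qed
 thus ?thesis using f by (auto simp: free_module_carrier)
qed

end

lemma free_ext:
 assumes R: "ring R" and P: "abelian_group P"
  and f: "semilinear R \<Phi> (Free R I) P f" and g: "semilinear R \<Phi> (Free R I) P g"
  and eq: "\<And>i. i \<in> I \<Longrightarrow> f (ring.fbasis R i) = g (ring.fbasis R i)" and x: "x \<in> carrier (Free R I)"
 shows "f x = g x"
proof -
 interpret R: ring R by fact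
 interpret F: left_mod R "Free R I" by (rule R.free_left_mod)
 show ?thesis using x
 proof (induction x rule: R.free_module_induct[consumes 1])
  case 1
  thus ?case
   using semilinear_zero(1)[OF f F.M.abelian_group_axioms P]
    semilinear_zero(1)[OF g F.M.abelian_group_axioms P] by simp
 next
  case (2 x r i)
  have b: "R.fbasis i \<in> carrier (Free R I)" "r \<odot>\<^bsub>Free R I\<^esub> R.fbasis i \<in> carrier (Free R I)"
   using 2 by (auto simp del: free_module_simps)
  show ?case
   using 2 b semilinearD[OF f] semilinearD[OF g] eq by (simp del: free_module_simps)
 qed
qed

lemma free_lift:
 assumes R: "ring R" and P: "left_mod R' P" and \<Phi>: "\<Phi> \<in> ring_hom R R'"
  and b: "\<And>i. i \<in> I \<Longrightarrow> b i \<in> carrier P"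
 shows "\<exists>f. semilinear R \<Phi> (Free R I) P f \<and> (\<forall>i\<in>I. f (ring.fbasis R i) = b i)"
proof -
 interpret R: ring R by fact
 interpret P: left_mod R' P by fact
 interpret F: left_mod R "Free R I" by (rule R.free_left_mod)
 have \<Phi>c: "\<Phi> r \<in> carrier R'" if "r \<in> carrier R" for r using \<Phi> that by (rule ring_hom_closed)
 have \<Phi>0: "\<Phi> \<zero>\<^bsub>R\<^esub> = \<zero>\<^bsub>R'\<^esub>"
  using ring_hom_zero[OF \<Phi> R P.R.ring_axioms] .
 define f where "f x = (\<Oplus>\<^bsub>P\<^esub>i\<in>{i. x i \<noteq> \<zero>\<^bsub>R\<^esub>}. \<Phi> (x i) \<odot>\<^bsub>P\<^esub> b i)" for x
 \<comment> \<open>The defining sum may be taken over any finite set containing the support. The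
   supports of x, y and their sum differ, and additivity needs one common index set.\<close>
 have fS: "f x = (\<Oplus>\<^bsub>P\<^esub>i\<in>S. \<Phi> (x i) \<odot>\<^bsub>P\<^esub> b i)"
  if x: "x \<in> carrier (Free R I)" and S: "finite S" "{i. x i \<noteq> \<zero>\<^bsub>R\<^esub>} \<subseteq> S" "S \<subseteq> I" for x S
  unfolding f_def
 proof (rule P.M.add.finprod_mono_neutral_cong_left[OF S(1,2)])
  show "\<Phi> (x i) \<odot>\<^bsub>P\<^esub> b i = \<zero>\<^bsub>P\<^esub>" if "i \<in> S - {i. x i \<noteq> \<zero>\<^bsub>R\<^esub>}" for i
   using that \<Phi>0 b S by auto
  show "(\<lambda>i. \<Phi> (x i) \<odot>\<^bsub>P\<^esub> b i) \<in> S \<rightarrow> carrier P"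
   using \<Phi>c b S R.free_module_in[OF x] by auto
 qed auto
 have supp: "{i. x i \<noteq> \<zero>\<^bsub>R\<^esub>} \<subseteq> I" "finite {i. x i \<noteq> \<zero>\<^bsub>R\<^esub>}" if "x \<in> carrier (Free R I)" for x
  using that by (auto simp: free_module_carrier)
 have t: "\<Phi> (x i) \<odot>\<^bsub>P\<^esub> b i \<in> carrier P" if "x \<in> carrier (Free R I)" "i \<in> I" for x i
  by (rule P.smult_closed[OF \<Phi>c[OF R.free_module_in[OF that(1)]] b[OF that(2)]])
 have "semilinear R \<Phi> (Free R I) P f"
  unfolding semilinear_def
 proof (intro conjI ballI funcsetI)
  fix x assume x: "x \<in> carrier (Free R I)"
  show "f x \<in> carrier P" unfolding f_def using t[OF x] supp(1)[OF x] by (intro P.M.finsum_closed) auto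
  fix y assume y: "y \<in> carrier (Free R I)"
  let ?S = "{i. x i \<noteq> \<zero>\<^bsub>R\<^esub>} \<union> {i. y i \<noteq> \<zero>\<^bsub>R\<^esub>}"
  have S: "finite ?S" "?S \<subseteq> I" using supp x y by auto
  have xy: "x \<oplus>\<^bsub>Free R I\<^esub> y \<in> carrier (Free R I)" using x y by (rule F.M.a_closed)
  have "f (x \<oplus>\<^bsub>Free R I\<^esub> y) = (\<Oplus>\<^bsub>P\<^esub>i\<in>?S. \<Phi> ((x \<oplus>\<^bsub>Free R I\<^esub> y) i) \<odot>\<^bsub>P\<^esub> b i)"
   by (rule fS[OF xy S(1) _ S(2)]) auto
  also have "\<dots> = (\<Oplus>\<^bsub>P\<^esub>i\<in>?S. \<Phi> (x i) \<odot>\<^bsub>P\<^esub> b i \<oplus>\<^bsub>P\<^esub> \<Phi> (y i) \<odot>\<^bsub>P\<^esub> b i)"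
  proof (rule P.M.finsum_cong')
   fix i assume "i \<in> ?S"
   thus "\<Phi> ((x \<oplus>\<^bsub>Free R I\<^esub> y) i) \<odot>\<^bsub>P\<^esub> b i = \<Phi> (x i) \<odot>\<^bsub>P\<^esub> b i \<oplus>\<^bsub>P\<^esub> \<Phi> (y i) \<odot>\<^bsub>P\<^esub> b i"
    using S b R.free_module_in[OF x] R.free_module_in[OF y]
    by (auto simp: ring_hom_add[OF \<Phi>] P.add_smult \<Phi>c)
  qed (use t x y S in auto)
  also have "\<dots> = (\<Oplus>\<^bsub>P\<^esub>i\<in>?S. \<Phi> (x i) \<odot>\<^bsub>P\<^esub> b i) \<oplus>\<^bsub>P\<^esub> (\<Oplus>\<^bsub>P\<^esub>i\<in>?S. \<Phi> (y i) \<odot>\<^bsub>P\<^esub> b i)"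
   using t x y S by (intro P.M.finsum_addf) auto
  also have "\<dots> = f x \<oplus>\<^bsub>P\<^esub> f y"
   using fS[OF x S(1) _ S(2)] fS[OF y S(1) _ S(2)] by auto
  finally show "f (x \<oplus>\<^bsub>Free R I\<^esub> y) = f x \<oplus>\<^bsub>P\<^esub> f y" .
 next
  fix r x assume r: "r \<in> carrier R" and x: "x \<in> carrier (Free R I)"
  let ?S = "{i. x i \<noteq> \<zero>\<^bsub>R\<^esub>}"
  have rx: "r \<odot>\<^bsub>Free R I\<^esub> x \<in> carrier (Free R I)" by (rule F.smult_closed[OF r x])
  have "f (r \<odot>\<^bsub>Free R I\<^esub> x) = (\<Oplus>\<^bsub>P\<^esub>i\<in>?S. \<Phi> ((r \<odot>\<^bsub>Free R I\<^esub> x) i) \<odot>\<^bsub>P\<^esub> b i)"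
   by (rule fS[OF rx supp(2)[OF x] _ supp(1)[OF x]]) (use r in auto)
  also have "\<dots> = (\<Oplus>\<^bsub>P\<^esub>i\<in>?S. \<Phi> r \<odot>\<^bsub>P\<^esub> (\<Phi> (x i) \<odot>\<^bsub>P\<^esub> b i))"
  proof (rule P.M.finsum_cong')
   fix i assume "i \<in> ?S"
   thus "\<Phi> ((r \<odot>\<^bsub>Free R I\<^esub> x) i) \<odot>\<^bsub>P\<^esub> b i = \<Phi> r \<odot>\<^bsub>P\<^esub> (\<Phi> (x i) \<odot>\<^bsub>P\<^esub> b i)"
    using supp(1)[OF x] b r R.free_module_in[OF x]
    by (auto simp: ring_hom_mult[OF \<Phi>] P.mult_smult \<Phi>c)
  qed (use t[OF x] supp(1)[OF x] \<Phi>c[OF r] in auto)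
  also have "\<dots> = \<Phi> r \<odot>\<^bsub>P\<^esub> f x"
   unfolding f_def using t[OF x] supp[OF x] \<Phi>c[OF r] by (intro P.smult_finsum[symmetric]) auto
  finally show "f (r \<odot>\<^bsub>Free R I\<^esub> x) = \<Phi> r \<odot>\<^bsub>P\<^esub> f x" .
 qed
 moreover have "f (R.fbasis i) = b i" if i: "i \<in> I" for i
 proof -
  have "f (R.fbasis i) = (\<Oplus>\<^bsub>P\<^esub>k\<in>{i}. \<Phi> (R.fbasis i k) \<odot>\<^bsub>P\<^esub> b k)"
   using i by (intro fS[OF R.fbasis_in[OF i]]) (auto simp: R.fbasis_def)
  also have "\<dots> = b i" using i b by (simp add: R.fbasis_def ring_hom_one[OF \<Phi>])
  finally show ?thesis .
 qed
 ultimately show ?thesis by blast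
qed

text \<open>Projectivity of a free module, for maps semilinear along \<Phi>: preimages are chosen on
  the basis, and two semilinear maps that agree on the basis are equal.\<close>

lemma free_lift_through:
 assumes R: "ring R" and P: "left_mod R' P" and Q: "left_mod R' Q" and \<Phi>: "\<Phi> \<in> ring_hom R R'"
  and g: "semilinear R' (\<lambda>r. r) P Q g" and u: "semilinear R \<Phi> (Free R I) Q u"
  and im: "\<And>x. x \<in> carrier (Free R I) \<Longrightarrow> u x \<in> g ` carrier P"
 shows "\<exists>f. semilinear R \<Phi> (Free R I) P f \<and> (\<forall>x\<in>carrier (Free R I). g (f x) = u x)"
proof -
 interpret R: ring R by fact
 have "\<forall>i\<in>I. \<exists>b. b \<in> carrier P \<and> g b = u (R.fbasis i)" using im[OF R.fbasis_in] by (metis imageE)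
 from bchoice[OF this] obtain b where b: "\<And>i. i \<in> I \<Longrightarrow> b i \<in> carrier P" "\<And>i. i \<in> I \<Longrightarrow> g (b i) = u (R.fbasis i)" by blast
 obtain f where f: "semilinear R \<Phi> (Free R I) P f" "\<And>i. i \<in> I \<Longrightarrow> f (R.fbasis i) = b i"
  using free_lift[OF R P \<Phi>, of I b] b by blast
 have gf: "semilinear R \<Phi> (Free R I) Q (\<lambda>x. g (f x))"
  by (rule semilinear_comp[OF f(1) g]) (rule ring_hom_closed[OF \<Phi>])
 have "g (f x) = u x" if "x \<in> carrier (Free R I)" for x
  by (rule free_ext[OF R _ gf u _ that]) (use Q f b in \<open>auto simp: left_mod_def\<close>)
 thus ?thesis using f by blast
qed

subsection \<open>Comparison of free resolutions\<close>

text \<open>The augmentation takes the place of the differential below degree 0. Exactness thereby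
  becomes one statement for all n and the inductions have no special first step.\<close>

definition "res_kernel R N I d e n = (case n of 0 \<Rightarrow> {x \<in> carrier (Free R (I 0)). e x = \<zero>\<^bsub>N\<^esub>}
   | Suc m \<Rightarrow> {x \<in> carrier (Free R (I (Suc m))). d m x = \<zero>\<^bsub>Free R (I m)\<^esub>})"

lemma free_resolution_iff:
 "free_resolution R N I d e \<longleftrightarrow> rlinear R (Free R (I 0)) N e \<and>
   (\<forall>n. rlinear R (Free R (I (Suc n))) (Free R (I n)) (d n)) \<and>
   e ` carrier (Free R (I 0)) = carrier N \<and>
   (\<forall>n. d n ` carrier (Free R (I (Suc n))) = res_kernel R N I d e n)"
proof -
 have "(\<forall>n. d n ` carrier (Free R (I (Suc n))) = res_kernel R N I d e n) \<longleftrightarrow>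
  d 0 ` carrier (Free R (I (Suc 0))) = res_kernel R N I d e 0 \<and>
  (\<forall>n. d (Suc n) ` carrier (Free R (I (Suc (Suc n)))) = res_kernel R N I d e (Suc n))"
  by (metis not0_implies_Suc)
 thus ?thesis
  unfolding free_resolution_def left_module_hom_semilinear
  by (simp add: res_kernel_def a_kernel_def')
qed

lemma res_kernel_sub: "x \<in> res_kernel R N I d e n \<Longrightarrow> x \<in> carrier (Free R (I n))"
 by (cases n) (auto simp: res_kernel_def)

text \<open>The comparison theorem: the maps are built degree by degree, each by lifting through the
  next differential, whose image is the whole kernel below.\<close>

lemma chain_lift:
 assumes R: "ring R" and R': "ring R'" and \<Phi>: "\<Phi> \<in> ring_hom R R'"
  and N: "left_mod R N" and N': "left_mod R' N'" and \<theta>: "semilinear R \<Phi> N N' \<theta>"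
  and F: "free_resolution R N I d e" and F': "free_resolution R' N' I' d' e'"
 shows "\<exists>\<phi>. (\<forall>n. semilinear R \<Phi> (Free R (I n)) (Free R' (I' n)) (\<phi> n)) \<and>
   (\<forall>x\<in>carrier (Free R (I 0)). e' (\<phi> 0 x) = \<theta> (e x)) \<and>
   (\<forall>n. \<forall>x\<in>carrier (Free R (I (Suc n))). d' n (\<phi> (Suc n) x) = \<phi> n (d n x))"
proof -
 let ?F = "\<lambda>n. Free R (I n)" and ?F' = "\<lambda>n. Free R' (I' n)"
 let ?Z = "res_kernel R N I d e" and ?Z' = "res_kernel R' N' I' d' e'"
 note r = F[unfolded free_resolution_iff] and r' = F'[unfolded free_resolution_iff]
 have fm: "left_mod R (?F n)" "left_mod R' (?F' n)" for n
  using ring.free_left_mod[OF R] ring.free_left_mod[OF R'] by auto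
 have ag: "abelian_group (?F n)" "abelian_group (?F' n)" "abelian_group N" "abelian_group N'" for n
  using fm[of n] N N' by (auto simp: left_mod_def)
 have \<Phi>c: "\<And>r. r \<in> carrier R \<Longrightarrow> \<Phi> r \<in> carrier R'" by (rule ring_hom_closed[OF \<Phi>])
 have "semilinear R \<Phi> (?F 0) N' (\<lambda>x. \<theta> (e x))"
  using semilinear_comp[of R "\<lambda>r. r" "?F 0" N e R \<Phi> N' \<theta>] r \<theta> by simp
 hence "\<exists>f. semilinear R \<Phi> (?F 0) (?F' 0) f \<and> (\<forall>x\<in>carrier (?F 0). e' (f x) = \<theta> (e x))"
 proof (rule free_lift_through[OF R fm(2) N' \<Phi>, rotated])
  show "semilinear R' (\<lambda>r. r) (?F' 0) N' e'" using r' by blast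
  show "\<theta> (e x) \<in> e' ` carrier (?F' 0)" if "x \<in> carrier (?F 0)" for x
  proof -
   have "\<theta> (e x) \<in> carrier N'" by (rule semilinearD(1)[OF \<theta> semilinearD(1)[OF conjunct1[OF r] that]])
   thus ?thesis using r' by simp
  qed
 qed
 then obtain f0 where f0: "semilinear R \<Phi> (?F 0) (?F' 0) f0" "\<And>x. x \<in> carrier (?F 0) \<Longrightarrow> e' (f0 x) = \<theta> (e x)" by blast
 \<comment> \<open>To continue, a map only has to send the kernel in degree n into the kernel in
   degree n. The commuting square joins two consecutive maps and is therefore the relation between
   choices, not part of the invariant.\<close>
 define P where "P n f \<longleftrightarrow> semilinear R \<Phi> (?F n) (?F' n) f \<and> (\<forall>x\<in>?Z n. f x \<in> ?Z' n) \<and>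
   (n = 0 \<longrightarrow> (\<forall>x\<in>carrier (?F 0). e' (f x) = \<theta> (e x)))" for n f
 have "P 0 f0"
  unfolding P_def using f0 semilinear_zero(1)[OF \<theta> ag(3,4)] semilinearD(1)[OF f0(1)]
  by (auto simp: res_kernel_def)
 moreover have "\<exists>g. P (Suc n) g \<and> (\<forall>x\<in>carrier (?F (Suc n)). d' n (g x) = f (d n x))" if P: "P n f" for n f
 proof -
  have f: "semilinear R \<Phi> (?F n) (?F' n) f" using P by (simp add: P_def)
  have dn: "rlinear R (?F (Suc n)) (?F n) (d n)" using r by blast
  have u: "semilinear R \<Phi> (?F (Suc n)) (?F' n) (\<lambda>x. f (d n x))"
   using semilinear_comp[OF dn f] by simp
  have "\<exists>g. semilinear R \<Phi> (?F (Suc n)) (?F' (Suc n)) g \<and> (\<forall>x\<in>carrier (?F (Suc n)). d' n (g x) = f (d n x))"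
  proof (rule free_lift_through[OF R fm(2) fm(2) \<Phi> _ u])
   show "semilinear R' (\<lambda>r. r) (?F' (Suc n)) (?F' n) (d' n)" using r' by blast
   show "f (d n x) \<in> d' n ` carrier (?F' (Suc n))" if "x \<in> carrier (?F (Suc n))" for x
   proof -
    have "d n x \<in> ?Z n" using r that by blast
    hence "f (d n x) \<in> ?Z' n" using P by (simp add: P_def)
    thus ?thesis using r' by blast
   qed
  qed
  then obtain g where g: "semilinear R \<Phi> (?F (Suc n)) (?F' (Suc n)) g"
   "\<And>x. x \<in> carrier (?F (Suc n)) \<Longrightarrow> d' n (g x) = f (d n x)" by blast
  have "g x \<in> ?Z' (Suc n)" if "x \<in> ?Z (Suc n)" for x
   using that g semilinearD(1)[OF g(1)] semilinear_zero(1)[OF f ag(1,2)]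
   by (simp add: res_kernel_def)
  thus ?thesis using g by (auto simp: P_def)
 qed
 ultimately obtain \<phi> where \<phi>: "\<And>n. P n (\<phi> n)" "\<And>n. \<forall>x\<in>carrier (?F (Suc n)). d' n (\<phi> (Suc n) x) = \<phi> n (d n x)"
  using dependent_nat_choice[of P "\<lambda>n f g. \<forall>x\<in>carrier (?F (Suc n)). d' n (g x) = f (d n x)"] by metis
 thus ?thesis by (intro exI[of _ \<phi>]) (auto simp: P_def)
qed

lemma diff_zero_group: assumes "abelian_group M" "x \<in> carrier M" shows "x \<ominus>\<^bsub>M\<^esub> \<zero>\<^bsub>M\<^esub> = x"
proof -
 interpret M: abelian_group M by fact
 have "\<ominus>\<^bsub>M\<^esub> \<zero>\<^bsub>M\<^esub> = \<zero>\<^bsub>M\<^esub>" by (rule M.minus_equality) auto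
 thus ?thesis using assms by (simp add: a_minus_def)
qed

text \<open>Only the comparison of a chain endomorphism with the identity is treated, because the
  two composites of the comparison maps are all that has to be deformed.\<close>

lemma chain_homotopy:
 assumes R: "ring R" and N: "left_mod R N" and F: "free_resolution R N I d e"
  and f: "\<And>n. rlinear R (Free R (I n)) (Free R (I n)) (f n)"
  and fe: "\<And>x. x \<in> carrier (Free R (I 0)) \<Longrightarrow> e (f 0 x) = e x"
  and fd: "\<And>n x. x \<in> carrier (Free R (I (Suc n))) \<Longrightarrow> d n (f (Suc n) x) = f n (d n x)"
 shows "\<exists>s. (\<forall>n. rlinear R (Free R (I n)) (Free R (I (Suc n))) (s n)) \<and>
   (\<forall>x\<in>carrier (Free R (I 0)). d 0 (s 0 x) = f 0 x \<ominus>\<^bsub>Free R (I 0)\<^esub> x) \<and>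
   (\<forall>n. \<forall>x\<in>carrier (Free R (I (Suc n))).
    d (Suc n) (s (Suc n) x) = (f (Suc n) x \<ominus>\<^bsub>Free R (I (Suc n))\<^esub> x) \<ominus>\<^bsub>Free R (I (Suc n))\<^esub> s n (d n x))"
proof -
 let ?F = "\<lambda>n. Free R (I n)" and ?Z = "res_kernel R N I d e"
 note r = F[unfolded free_resolution_iff]
 have id: "(\<lambda>r. r) \<in> ring_hom R R" by (rule ring_hom_memI) auto
 have fm: "left_mod R (?F n)" for n by (rule ring.free_left_mod[OF R])
 have ag: "abelian_group (?F n)" "abelian_group N" for n
  using fm[of n] N by (auto simp: left_mod_def)
 have e: "rlinear R (?F 0) N e" and d: "\<And>n. rlinear R (?F (Suc n)) (?F n) (d n)"
  using r by blast+
 have im: "d n ` carrier (?F (Suc n)) = ?Z n" for n using r by blast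
 have fid: "rlinear R (?F n) (?F n) (\<lambda>x. f n x \<ominus>\<^bsub>?F n\<^esub> x)" for n
  by (rule semilinear_minus[OF fm f semilinear_id])
 have dz: "d n \<zero>\<^bsub>?F (Suc n)\<^esub> = \<zero>\<^bsub>?F n\<^esub>" for n by (rule semilinear_zero(1)[OF d ag(1) ag(1)])
 \<comment> \<open>On cycles the term s d vanishes, so the homotopy relation there involves the
   current map alone and can serve as the invariant; the full relation goes into Q.\<close>
 define P where "P n s \<longleftrightarrow> rlinear R (?F n) (?F (Suc n)) s \<and> (\<forall>x\<in>?Z n. d n (s x) = f n x \<ominus>\<^bsub>?F n\<^esub> x) \<and>
   (n = 0 \<longrightarrow> (\<forall>x\<in>carrier (?F 0). d 0 (s x) = f 0 x \<ominus>\<^bsub>?F 0\<^esub> x))" for n s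
 define Q where "Q n s t \<longleftrightarrow> (\<forall>x\<in>carrier (?F (Suc n)).
   d (Suc n) (t x) = (f (Suc n) x \<ominus>\<^bsub>?F (Suc n)\<^esub> x) \<ominus>\<^bsub>?F (Suc n)\<^esub> s (d n x))" for n s t
 have "\<exists>s. rlinear R (?F 0) (?F (Suc 0)) s \<and> (\<forall>x\<in>carrier (?F 0). d 0 (s x) = f 0 x \<ominus>\<^bsub>?F 0\<^esub> x)"
 proof (rule free_lift_through[OF R fm fm id d fid])
  fix x assume x: "x \<in> carrier (?F 0)"
  interpret N: abelian_group N by (rule ag)
  have "e (f 0 x \<ominus>\<^bsub>?F 0\<^esub> x) = e (f 0 x) \<ominus>\<^bsub>N\<^esub> e x"
   by (rule semilinear_zero(3)[OF e ag(1) ag(2) semilinearD(1)[OF f x] x])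
  also have "\<dots> = \<zero>\<^bsub>N\<^esub>" using fe[OF x] semilinearD(1)[OF e x] by (simp add: N.r_neg a_minus_def)
  finally have "f 0 x \<ominus>\<^bsub>?F 0\<^esub> x \<in> ?Z 0" using semilinearD(1)[OF fid x] by (simp add: res_kernel_def del: free_module_simps)
  thus "f 0 x \<ominus>\<^bsub>?F 0\<^esub> x \<in> d 0 ` carrier (?F (Suc 0))" by (simp only: im)
 qed
 then obtain s0 where s0: "rlinear R (?F 0) (?F (Suc 0)) s0"
  "\<And>x. x \<in> carrier (?F 0) \<Longrightarrow> d 0 (s0 x) = f 0 x \<ominus>\<^bsub>?F 0\<^esub> x" by blast
 have "P 0 s0" using s0 res_kernel_sub[of _ R N I d e 0] by (simp add: P_def del: free_module_simps)
 moreover have "\<exists>t. P (Suc n) t \<and> Q n s t" if P: "P n s" for n s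
 proof -
  interpret Fn: abelian_group "?F n" by (rule ag)
  interpret Fs: abelian_group "?F (Suc n)" by (rule ag)
  have s: "rlinear R (?F n) (?F (Suc n)) s" using P by (simp add: P_def)
  let ?u = "\<lambda>x. (f (Suc n) x \<ominus>\<^bsub>?F (Suc n)\<^esub> x) \<ominus>\<^bsub>?F (Suc n)\<^esub> s (d n x)"
  have u: "rlinear R (?F (Suc n)) (?F (Suc n)) ?u"
   by (rule semilinear_minus[OF fm fid]) (use semilinear_comp[OF d s] in auto)
  have "\<exists>t. rlinear R (?F (Suc n)) (?F (Suc (Suc n))) t \<and> (\<forall>x\<in>carrier (?F (Suc n)). d (Suc n) (t x) = ?u x)"
  proof (rule free_lift_through[OF R fm fm id d u])
   fix x assume x: "x \<in> carrier (?F (Suc n))"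
   have dx: "d n x \<in> carrier (?F n)" and dxZ: "d n x \<in> ?Z n" using semilinearD(1)[OF d x] im x by blast+
   have fx: "f (Suc n) x \<in> carrier (?F (Suc n))" and fdx: "f n (d n x) \<in> carrier (?F n)"
    using semilinearD(1)[OF f] x dx by blast+
   have sx: "s (d n x) \<in> carrier (?F (Suc n))" using semilinearD(1)[OF s dx] .
   \<comment> \<open>The invariant is applied to d x, which is a cycle: d s d x = f d x - d x. This
     cancels d (f x - x), so \<open>?u\<close> has values in cycles and can be lifted.\<close>
   have "d n (?u x) = (d n (f (Suc n) x) \<ominus>\<^bsub>?F n\<^esub> d n x) \<ominus>\<^bsub>?F n\<^esub> d n (s (d n x))"
    using semilinear_zero(3)[OF d ag(1) ag(1)] fx x sx Fs.minus_closed by (simp del: free_module_simps)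
   also have "\<dots> = (f n (d n x) \<ominus>\<^bsub>?F n\<^esub> d n x) \<ominus>\<^bsub>?F n\<^esub> (f n (d n x) \<ominus>\<^bsub>?F n\<^esub> d n x)"
    using fd[OF x] P dxZ by (simp add: P_def del: free_module_simps)
   also have "\<dots> = \<zero>\<^bsub>?F n\<^esub>"
    using Fn.r_neg[OF Fn.minus_closed[OF fdx dx]] by (simp add: a_minus_def del: free_module_simps)
   finally have "?u x \<in> ?Z (Suc n)" using semilinearD(1)[OF u x] by (simp add: res_kernel_def del: free_module_simps)
   thus "?u x \<in> d (Suc n) ` carrier (?F (Suc (Suc n)))" by (simp only: im)
  qed
  then obtain t where t: "rlinear R (?F (Suc n)) (?F (Suc (Suc n))) t"
   "\<And>x. x \<in> carrier (?F (Suc n)) \<Longrightarrow> d (Suc n) (t x) = ?u x" by blast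
  have "d (Suc n) (t x) = f (Suc n) x \<ominus>\<^bsub>?F (Suc n)\<^esub> x" if x: "x \<in> ?Z (Suc n)" for x
  proof -
   have xF: "x \<in> carrier (?F (Suc n))" "d n x = \<zero>\<^bsub>?F n\<^esub>" using x by (auto simp: res_kernel_def)
   have "s (d n x) = \<zero>\<^bsub>?F (Suc n)\<^esub>" using semilinear_zero(1)[OF s ag(1) ag(1)] xF by (simp only:)
   hence "d (Suc n) (t x) = (f (Suc n) x \<ominus>\<^bsub>?F (Suc n)\<^esub> x) \<ominus>\<^bsub>?F (Suc n)\<^esub> \<zero>\<^bsub>?F (Suc n)\<^esub>" using t(2)[OF xF(1)] by (simp only:)
   also have "\<dots> = f (Suc n) x \<ominus>\<^bsub>?F (Suc n)\<^esub> x"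
    by (rule diff_zero_group[OF ag(1) semilinearD(1)[OF fid xF(1)]])
   finally show ?thesis .
  qed
  thus ?thesis using t unfolding P_def Q_def by blast
 qed
 ultimately obtain s where "\<And>n. P n (s n)" "\<And>n. Q n (s n) (s (Suc n))"
  using dependent_nat_choice[of P Q] by metis
 thus ?thesis unfolding P_def Q_def by (intro exI[of _ s]) blast
qed

subsection \<open>Existence of free resolutions\<close>

text \<open>Lists of lists are coded by lists: every letter is preceded by \<open>a\<close> and every block is closed by \<open>b, b\<close>.
 Finitely supported functions on lists can thus be indexed by lists.\<close>

fun enc_list :: "'a \<Rightarrow> 'a \<Rightarrow> 'a list \<Rightarrow> 'a list \<Rightarrow> 'a list" where
 "enc_list a b [] r = b # b # r"
| "enc_list a b (x # xs) r = a # x # enc_list a b xs r"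

fun enc_lists :: "'a \<Rightarrow> 'a \<Rightarrow> 'a list list \<Rightarrow> 'a list" where
 "enc_lists a b [] = []"
| "enc_lists a b (xs # xss) = enc_list a b xs (enc_lists a b xss)"

lemma enc_list_inj: "a \<noteq> b \<Longrightarrow> enc_list a b xs r = enc_list a b ys s \<Longrightarrow> xs = ys \<and> r = s"
proof (induction xs arbitrary: ys)
 case Nil thus ?case by (cases ys) auto
next
 case (Cons x xs) thus ?case by (cases ys) auto
qed

lemma enc_list_not_Nil: "enc_list a b xs r \<noteq> []"
 by (cases xs) auto

lemma enc_lists_inj: "a \<noteq> b \<Longrightarrow> enc_lists a b xss = enc_lists a b yss \<Longrightarrow> xss = yss"
proof (induction xss arbitrary: yss)
 case Nil
 thus ?case using enc_list_not_Nil[of a b] by (cases yss) (simp_all add: eq_commute[of "[]"])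
next
 case (Cons xs xss)
 then obtain ys yss' where yss: "yss = ys # yss'"
  using enc_list_not_Nil[of a b] by (cases yss) auto
 from Cons.prems have "xs = ys \<and> enc_lists a b xss = enc_lists a b yss'"
  unfolding yss enc_lists.simps by (rule enc_list_inj)
 thus ?case using Cons.IH[OF Cons.prems(1)] yss by simp
qed

lemma finite_support_code:
 fixes z :: 'r
 shows "\<exists>c :: (('r + 'n) list \<Rightarrow> 'r) \<Rightarrow> ('r + 'n) list. inj_on c {f. finite {i. f i \<noteq> z}}"
proof -
 define L where "L f = (SOME xs. set xs = {i. f i \<noteq> z} \<and> distinct xs)" for f :: "('r + 'n) list \<Rightarrow> 'r"
 have L: "set (L f) = {i. f i \<noteq> z}" if "finite {i. f i \<noteq> z}" for f
  unfolding L_def using someI_ex[OF finite_distinct_list[OF that]] by blast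
 \<comment> \<open>The sum type supplies two distinct letters whatever the types are, as required by
   the code for lists of lists.\<close>
 define a :: "'r + 'n" where "a = Inl undefined"
 define b :: "'r + 'n" where "b = Inr undefined"
 have ab: "a \<noteq> b" by (simp add: a_def b_def)
 \<comment> \<open>A value f i at the word i is recorded as the word with f i put in front. The set
   of these words is the graph of f on its support, hence determines f whatever listing
   \<open>L\<close> has chosen.\<close>
 define M where "M f = map (\<lambda>i. Inl (f i) # i) (L f)" for f
 have "inj_on (\<lambda>f. enc_lists a b (M f)) {f. finite {i. f i \<noteq> z}}"
 proof (rule inj_onI, rule ext)
  fix f g :: "('r + 'n) list \<Rightarrow> 'r" and i
  assume f: "f \<in> {f. finite {i. f i \<noteq> z}}" and g: "g \<in> {f. finite {i. f i \<noteq> z}}"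
   and "enc_lists a b (M f) = enc_lists a b (M g)"
  hence "M f = M g" by (intro enc_lists_inj[OF ab])
  hence "set (M f) = set (M g)" by simp
  hence M: "(\<lambda>i. Inl (f i) # i) ` {i. f i \<noteq> z} = (\<lambda>i. Inl (g i) # i) ` {i. g i \<noteq> z}"
   using L f g by (simp add: M_def)
  show "f i = g i"
  proof (cases "f i = z")
   case True
   have "g i = z"
   proof (rule ccontr)
    assume "g i \<noteq> z"
    hence "Inl (g i) # i \<in> (\<lambda>i. Inl (f i) # i) ` {i. f i \<noteq> z}" unfolding M by simp
    thus False using True \<open>g i \<noteq> z\<close> by auto
   qed
   thus ?thesis using True by simp
  next
   case False
   hence "Inl (f i) # i \<in> (\<lambda>i. Inl (g i) # i) ` {i. g i \<noteq> z}" unfolding M[symmetric] by simp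
   thus ?thesis by auto
  qed
 qed
 thus ?thesis by blast
qed

text \<open>The free module on the elements of P maps onto P. The injection c places these elements
  into a prescribed index type, which is what allows one type for a whole resolution.\<close>

lemma free_cover:
 fixes c :: "'m \<Rightarrow> 'i"
 assumes R: "ring R" and P: "left_mod R P" and c: "inj_on c (carrier P)"
 shows "\<exists>(I :: 'i set) f. rlinear R (Free R I) P f \<and> f ` carrier (Free R I) = carrier P"
proof -
 interpret R: ring R by fact
 have id: "(\<lambda>r. r) \<in> ring_hom R R" by (rule ring_hom_memI) auto
 let ?I = "c ` carrier P"
 have inv: "inv_into (carrier P) c i \<in> carrier P" if "i \<in> ?I" for i using that by (rule inv_into_into)
 obtain f where f: "rlinear R (Free R ?I) P f"
  "\<And>i. i \<in> ?I \<Longrightarrow> f (R.fbasis i) = inv_into (carrier P) c i"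
  using free_lift[OF R P id, of ?I "inv_into (carrier P) c"] inv by blast
 have "x \<in> f ` carrier (Free R ?I)" if x: "x \<in> carrier P" for x
  using f(2)[of "c x"] x c by (intro image_eqI[of _ _ "R.fbasis (c x)"]) auto
 hence "f ` carrier (Free R ?I) = carrier P" using semilinearD(1)[OF f(1)] by (intro subset_antisym subsetI) auto
 thus ?thesis using f(1) by (intro exI[of _ ?I] exI[of _ f]) simp
qed

lemma kernel_left_mod:
 assumes M: "left_mod R M" and N: "left_mod R N" and f: "rlinear R M N f"
 shows "left_mod R (M\<lparr>carrier := {x \<in> carrier M. f x = \<zero>\<^bsub>N\<^esub>}\<rparr>)" (is "left_mod R ?K")
proof -
 interpret M: left_mod R M by fact
 interpret N: left_mod R N by fact
 note z = semilinear_zero[OF f M.M.abelian_group_axioms N.M.abelian_group_axioms]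
 have "abelian_group ?K"
 proof (rule abelian_groupI)
  fix x assume x: "x \<in> carrier ?K"
  thus "\<exists>y\<in>carrier ?K. y \<oplus>\<^bsub>?K\<^esub> x = \<zero>\<^bsub>?K\<^esub>"
   using z(2)[of x] by (intro bexI[of _ "\<ominus>\<^bsub>M\<^esub> x"]) (auto simp: M.M.l_neg)
 qed (use z semilinearD[OF f] in \<open>auto simp: M.M.a_ac\<close>)
 thus ?thesis
  by (rule left_mod.intro[OF M.R.ring_axioms], unfold_locales)
   (use semilinearD[OF f] in \<open>auto simp: M.smult_add M.add_smult M.mult_smult\<close>)
qed

lemma free_cover_kernel:
 fixes c :: "('i \<Rightarrow> 'r) \<Rightarrow> 'i" and I :: "'i set"
 assumes R: "ring R" and Q: "left_mod R Q" and g: "rlinear R (Free R I) Q g"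
  and c: "inj_on c {f. finite {i. f i \<noteq> \<zero>\<^bsub>R\<^esub>}}"
 shows "\<exists>(I' :: 'i set) d. rlinear R (Free R I') (Free R I) d \<and>
   d ` carrier (Free R I') = {x \<in> carrier (Free R I). g x = \<zero>\<^bsub>Q\<^esub>}"
proof -
 let ?K = "(Free R I)\<lparr>carrier := {x \<in> carrier (Free R I). g x = \<zero>\<^bsub>Q\<^esub>}\<rparr>"
 have "inj_on c (carrier ?K)" by (rule inj_on_subset[OF c]) (auto simp: free_module_carrier)
 from free_cover[OF R kernel_left_mod[OF ring.free_left_mod[OF R] Q g] this] obtain I' :: "'i set" and d
  where "rlinear R (Free R I') ?K d" "d ` carrier (Free R I') = carrier ?K" by blast
 thus ?thesis by (intro exI[of _ I'] exI[of _ d]) (auto simp: semilinear_def)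
qed

text \<open>This justifies the choice made in the definition of Tor. A kernel in a free module
  consists of finitely supported functions on words, and \<open>finite_support_code\<close> makes it
  small enough to be covered by a free module on words again.\<close>

lemma free_resolution_exists:
 fixes R :: "('r, 'z) ring_scheme" and N :: "('r, 'n) module"
 assumes R: "ring R" and N: "left_mod R N"
 shows "\<exists>(I :: nat \<Rightarrow> ('r + 'n) list set) d e. free_resolution R N I d e"
proof -
 have fm: "left_mod R (Free R I)" for I :: "('r + 'n) list set" by (rule ring.free_left_mod[OF R])
 have "inj_on (\<lambda>x. [Inr x :: 'r + 'n]) (carrier N)" by (auto intro: inj_onI)
 from free_cover[OF R N this] obtain I0 :: "('r + 'n) list set" and e
  where e: "rlinear R (Free R I0) N e" "e ` carrier (Free R I0) = carrier N" by blast
 obtain c :: "(('r + 'n) list \<Rightarrow> 'r) \<Rightarrow> ('r + 'n) list" where c: "inj_on c {f. finite {i. f i \<noteq> \<zero>\<^bsub>R\<^esub>}}"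
  using finite_support_code[of "\<zero>\<^bsub>R\<^esub>"] by blast
 note cover = free_cover_kernel[OF R _ _ c]
 obtain I1 :: "('r + 'n) list set" and d0 where d0: "rlinear R (Free R I1) (Free R I0) d0"
   "d0 ` carrier (Free R I1) = {x \<in> carrier (Free R I0). e x = \<zero>\<^bsub>N\<^esub>}"
  using cover[OF N e(1)] by blast
 \<comment> \<open>The clause for n = 0 pins the first differential to the given cover of the kernel
   of the augmentation; otherwise the chosen sequence could start anywhere.\<close>
 define P where "P = (\<lambda>(n::nat) (I, J, d). rlinear R (Free R I) (Free R J) d \<and>
   (n = 0 \<longrightarrow> I = I1 \<and> J = I0 \<and> d = d0))"
 define Q where "Q = (\<lambda>(n::nat) (I :: ('r + 'n) list set, J :: ('r + 'n) list set, d) (I' :: ('r + 'n) list set, J', d'). J' = I \<and>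
   d' ` carrier (Free R I') = {x \<in> carrier (Free R I). d x = \<zero>\<^bsub>Free R J\<^esub>})"
 have "\<exists>s. \<forall>n. P n (s n) \<and> Q n (s n) (s (Suc n))"
 proof (rule dependent_nat_choice)
  show "\<exists>x. P 0 x" using d0 by (auto simp: P_def)
  fix x n assume "P n x"
  then obtain I J d where x: "x = (I, J, d)" "rlinear R (Free R I) (Free R J) d"
   by (cases x) (auto simp: P_def)
  from cover[OF fm x(2)] obtain I' :: "('r + 'n) list set" and d' where
   "rlinear R (Free R I') (Free R I) d'"
   "d' ` carrier (Free R I') = {y \<in> carrier (Free R I). d y = \<zero>\<^bsub>Free R J\<^esub>}" by blast
  hence "P (Suc n) (I', I, d') \<and> Q n x (I', I, d')" by (simp add: P_def Q_def x(1))
  thus "\<exists>y. P (Suc n) y \<and> Q n x y" by blast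
 qed
 then obtain s where s: "\<And>n. P n (s n)" "\<And>n. Q n (s n) (s (Suc n))" by blast
 \<comment> \<open>A triple in position n holds the source index set, the target index set and the
   differential. The set of degree n is the target in position n and, by Q, the source in position n
   - 1.\<close>
 let ?I = "\<lambda>n. fst (snd (s n))" and ?d = "\<lambda>n. snd (snd (s n))"
 have I: "fst (s n) = ?I (Suc n)" for n using s(2)[of n] by (simp add: Q_def split_beta)
 have s0: "s 0 = (I1, I0, d0)" using s(1)[of 0] by (cases "s 0") (auto simp: P_def)
 have "free_resolution R N ?I ?d e"
  unfolding free_resolution_iff
 proof (intro conjI allI)
  show "rlinear R (Free R (?I 0)) N e" "e ` carrier (Free R (?I 0)) = carrier N"
   using e s0 by auto
  fix n
  show "rlinear R (Free R (?I (Suc n))) (Free R (?I n)) (?d n)"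
   using s(1)[of n] by (simp add: P_def split_beta I)
  show "?d n ` carrier (Free R (?I (Suc n))) = res_kernel R N ?I ?d e n"
  proof (cases n)
   case 0
   thus ?thesis using d0(2) I[of 0] s0 by (simp add: res_kernel_def)
  next
   case (Suc m)
   thus ?thesis using s(2)[of m] I[of "Suc m"] by (simp add: Q_def split_beta I res_kernel_def)
  qed
 qed
 thus ?thesis by blast
qed

subsection \<open>Functoriality of tensor products\<close>

definition tensor_closed :: "('r, 'z) ring_scheme \<Rightarrow> ('s, 'm) module \<Rightarrow> ('m \<Rightarrow> 'r \<Rightarrow> 'm) \<Rightarrow> ('r, 'p) module \<Rightarrow> bool" where
 "tensor_closed R M act P \<longleftrightarrow> (\<forall>m\<in>carrier M. \<forall>m'\<in>carrier M. m \<oplus>\<^bsub>M\<^esub> m' \<in> carrier M) \<and>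
   (\<forall>m\<in>carrier M. \<forall>r\<in>carrier R. act m r \<in> carrier M) \<and>
   (\<forall>p\<in>carrier P. \<forall>p'\<in>carrier P. p \<oplus>\<^bsub>P\<^esub> p' \<in> carrier P) \<and>
   (\<forall>r\<in>carrier R. \<forall>p\<in>carrier P. r \<odot>\<^bsub>P\<^esub> p \<in> carrier P)"

definition "tcoset R M act P c = (\<lambda>k. k + c) ` tensor_relations R M act P"

definition frag_map :: "('x \<Rightarrow> 'y) \<Rightarrow> ('x \<Rightarrow>\<^sub>0 int) \<Rightarrow> ('y \<Rightarrow>\<^sub>0 int)" where
 "frag_map g = frag_extend (\<lambda>p. frag_of (g p))"

definition "tensor_lift R M act P g X = (\<Union>c\<in>X. tcoset R M act P (frag_map g c))"

text \<open>The conditions for \<Psi> \<otimes> \<phi> to be defined when the ring changes along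
  \<Phi>. Differentials 1 \<otimes> d, left multiplications by scalars and comparison maps between
  the two sides are all instances, so well-definedness and composition are proved once.\<close>

definition "balanced R \<Phi> M act P R' M' act' P' \<Psi> \<phi> \<longleftrightarrow>
   (\<forall>r\<in>carrier R. \<Phi> r \<in> carrier R') \<and> (\<forall>m\<in>carrier M. \<Psi> m \<in> carrier M') \<and>
   (\<forall>m\<in>carrier M. \<forall>m'\<in>carrier M. \<Psi> (m \<oplus>\<^bsub>M\<^esub> m') = \<Psi> m \<oplus>\<^bsub>M'\<^esub> \<Psi> m') \<and>
   (\<forall>m\<in>carrier M. \<forall>r\<in>carrier R. \<Psi> (act m r) = act' (\<Psi> m) (\<Phi> r)) \<and> semilinear R \<Phi> P P' \<phi>"

lemma frag_map_simps [simp]: "frag_map g 0 = 0" "frag_map g (frag_of p) = frag_of (g p)"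
 "frag_map g (a + b) = frag_map g a + frag_map g b" "frag_map g (a - b) = frag_map g a - frag_map g b"
 "frag_map g (- a) = - frag_map g a"
 by (simp_all add: frag_map_def frag_extend_add frag_extend_diff frag_extend_minus)

lemma frag_map_comp: "frag_map g (frag_map f c) = frag_map (\<lambda>p. g (f p)) c"
 unfolding frag_map_def using frag_extend_compose[of "\<lambda>p. frag_of (g p)" f c] by (simp add: o_def)

lemma frag_map_cong: "(\<And>p. p \<in> Poly_Mapping.keys c \<Longrightarrow> f p = g p) \<Longrightarrow> frag_map f c = frag_map g c"
 unfolding frag_map_def by (rule frag_extend_eq) simp

lemma frag_map_ident: "frag_map (\<lambda>p. p) c = c"
 unfolding frag_map_def using frag_expansion[of c] by simp

lemma frag_map_keys: "Poly_Mapping.keys c \<subseteq> S \<Longrightarrow> g ` S \<subseteq> S' \<Longrightarrow> Poly_Mapping.keys (frag_map g c) \<subseteq> S'"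
proof -
 assume S: "Poly_Mapping.keys c \<subseteq> S" "g ` S \<subseteq> S'"
 have "Poly_Mapping.keys (frag_map g c) \<subseteq> (\<Union>x\<in>Poly_Mapping.keys c. {g x})"
  using keys_frag_extend[of "\<lambda>p. frag_of (g p)" c] unfolding frag_map_def keys_frag_of .
 thus ?thesis using S by blast
qed

abbreviation tensor_gens :: "('r, 'z) ring_scheme \<Rightarrow> ('s, 'm) module \<Rightarrow> ('m \<Rightarrow> 'r \<Rightarrow> 'm) \<Rightarrow> ('r, 'p) module
  \<Rightarrow> ('m \<times> 'p \<Rightarrow>\<^sub>0 int) set" where
 "tensor_gens R M act P \<equiv> {frag_of (m \<oplus>\<^bsub>M\<^esub> m', p) - frag_of (m, p) - frag_of (m', p) | m m' p.
     m \<in> carrier M \<and> m' \<in> carrier M \<and> p \<in> carrier P} \<union>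
   {frag_of (m, p \<oplus>\<^bsub>P\<^esub> p') - frag_of (m, p) - frag_of (m, p') | m p p'.
     m \<in> carrier M \<and> p \<in> carrier P \<and> p' \<in> carrier P} \<union>
   {frag_of (act m r, p) - frag_of (m, r \<odot>\<^bsub>P\<^esub> p) | m r p.
     m \<in> carrier M \<and> r \<in> carrier R \<and> p \<in> carrier P}"

abbreviation frags :: "('s, 'm) module \<Rightarrow> ('r, 'p) module \<Rightarrow> ('m \<times> 'p \<Rightarrow>\<^sub>0 int) set" where
 "frags M P \<equiv> {c. Poly_Mapping.keys c \<subseteq> carrier M \<times> carrier P}"

lemma frags_closed:
 "a \<in> frags M P \<Longrightarrow> b \<in> frags M P \<Longrightarrow> a + b \<in> frags M P"
 "a \<in> frags M P \<Longrightarrow> b \<in> frags M P \<Longrightarrow> a - b \<in> frags M P"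
 "a \<in> frags M P \<Longrightarrow> - a \<in> frags M P" "0 \<in> frags M P"
 "m \<in> carrier M \<Longrightarrow> p \<in> carrier P \<Longrightarrow> frag_of (m, p) \<in> frags M P"
 using Poly_Mapping.keys_add[of a b] keys_diff[of a b] by (auto simp: keys_frag_of)

lemma tensor_gens_carrier:
 assumes "tensor_closed R M act P" shows "tensor_gens R M act P \<subseteq> frags M P"
 using assms unfolding tensor_closed_def
 by (intro Un_least subsetI) (elim CollectE exE conjE, simp only:, intro frags_closed; simp)+

lemma tensor_relations_subgroup:
 assumes "tensor_closed R M act P"
 shows "subgroup (tensor_relations R M act P) (free_Abelian_group (carrier M \<times> carrier P))"
 unfolding tensor_relations_def
 by (rule group.generate_is_subgroup[OF group_free_Abelian_group])
  (use tensor_gens_carrier[OF assms] in \<open>simp add: free_Abelian_group_def\<close>)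

lemma tensor_relations_closed:
 assumes T: "tensor_closed R M act P"
 shows "0 \<in> tensor_relations R M act P" "tensor_relations R M act P \<subseteq> frags M P"
  "a \<in> tensor_relations R M act P \<Longrightarrow> b \<in> tensor_relations R M act P \<Longrightarrow> a + b \<in> tensor_relations R M act P"
  "a \<in> tensor_relations R M act P \<Longrightarrow> - a \<in> tensor_relations R M act P"
  "a \<in> tensor_relations R M act P \<Longrightarrow> b \<in> tensor_relations R M act P \<Longrightarrow> a - b \<in> tensor_relations R M act P"
proof -
 let ?F = "free_Abelian_group (carrier M \<times> carrier P)"
 interpret subgroup "tensor_relations R M act P" ?F by (rule tensor_relations_subgroup[OF T])
 show 0: "0 \<in> tensor_relations R M act P" using one_closed by simp
 show sub: "tensor_relations R M act P \<subseteq> frags M P" using subset by (auto simp: subset_iff)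
 show add: "a \<in> tensor_relations R M act P \<Longrightarrow> b \<in> tensor_relations R M act P \<Longrightarrow> a + b \<in> tensor_relations R M act P" for a b
  using m_closed by simp
 show m: "- a \<in> tensor_relations R M act P" if a: "a \<in> tensor_relations R M act P" for a
 proof -
  have "Poly_Mapping.keys a \<subseteq> carrier M \<times> carrier P" using a sub by blast
  from inv_free_Abelian_group[OF this] m_inv_closed[OF a] show ?thesis by simp
 qed
 show "a \<in> tensor_relations R M act P \<Longrightarrow> b \<in> tensor_relations R M act P \<Longrightarrow> a - b \<in> tensor_relations R M act P"
  using add[OF _ m[of b], of a] by simp
qed

lemma tcoset_eq:
 assumes T: "tensor_closed R M act P"
 shows "tcoset R M act P c = tcoset R M act P c' \<longleftrightarrow> c - c' \<in> tensor_relations R M act P"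
proof
 note K = tensor_relations_closed[OF T]
 assume "tcoset R M act P c = tcoset R M act P c'"
 moreover have "c \<in> tcoset R M act P c" unfolding tcoset_def using K(1) by (intro image_eqI[of _ _ 0]) auto
 ultimately have "c \<in> tcoset R M act P c'" by simp
 then obtain k where "k \<in> tensor_relations R M act P" "c = k + c'" unfolding tcoset_def by blast
 thus "c - c' \<in> tensor_relations R M act P" by simp
next
 note K = tensor_relations_closed[OF T]
 assume d: "c - c' \<in> tensor_relations R M act P"
 show "tcoset R M act P c = tcoset R M act P c'"
 proof (rule subset_antisym; rule subsetI)
  fix x assume "x \<in> tcoset R M act P c"
  then obtain k where k: "k \<in> tensor_relations R M act P" "x = k + c" unfolding tcoset_def by blast
  hence "x = (k + (c - c')) + c'" by simp
  thus "x \<in> tcoset R M act P c'" unfolding tcoset_def using K(3)[OF k(1) d] by blast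
 next
  fix x assume "x \<in> tcoset R M act P c'"
  then obtain k where k: "k \<in> tensor_relations R M act P" "x = k + c'" unfolding tcoset_def by blast
  hence "x = (k - (c - c')) + c" by simp
  thus "x \<in> tcoset R M act P c" unfolding tcoset_def using K(5)[OF k(1) d] by blast
 qed
qed

lemma tcoset_self: "tensor_closed R M act P \<Longrightarrow> c \<in> tcoset R M act P c"
 unfolding tcoset_def using tensor_relations_closed(1) by (intro image_eqI[of _ _ 0]) auto

lemma r_coset_tensor: "r_coset (free_Abelian_group S) (tensor_relations R M act P) c = tcoset R M act P c"
 by (auto simp: r_coset_def tcoset_def)

lemma tensor_module_carrier: "carrier (tensor_module R M act P) = tcoset R M act P ` frags M P"
 unfolding tensor_module_def Let_def
 by (auto simp: RCOSETS_def r_coset_tensor)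

lemma tcoset_in: "c \<in> frags M P \<Longrightarrow> tcoset R M act P c \<in> carrier (tensor_module R M act P)"
 unfolding tensor_module_carrier by (rule imageI)

lemma tensor_module_smult:
 "s \<odot>\<^bsub>tensor_module R M act P\<^esub> X = tensor_lift R M act P (\<lambda>(m, p). (s \<odot>\<^bsub>M\<^esub> m, p)) X"
 by (simp add: tensor_module_def Let_def r_coset_tensor tensor_lift_def frag_map_def split_def)

lemma tensor_map_lift: "tensor_map R M act Q f X = tensor_lift R M act Q (\<lambda>(m, p). (m, f p)) X"
 by (simp add: tensor_map_def r_coset_tensor tensor_lift_def frag_map_def split_def)

lemma tensor_module_zero: "\<zero>\<^bsub>tensor_module R M act P\<^esub> = tcoset R M act P 0"
 by (simp add: tensor_module_def Let_def tcoset_def)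

lemma tensor_module_add:
 assumes T: "tensor_closed R M act P"
 shows "tcoset R M act P a \<oplus>\<^bsub>tensor_module R M act P\<^esub> tcoset R M act P b = tcoset R M act P (a + b)"
proof -
 note K = tensor_relations_closed[OF T]
 have "tcoset R M act P a \<oplus>\<^bsub>tensor_module R M act P\<^esub> tcoset R M act P b =
   (\<Union>x\<in>tcoset R M act P a. \<Union>y\<in>tcoset R M act P b. {x + y})"
  by (simp add: tensor_module_def Let_def set_mult_def)
 also have "\<dots> = tcoset R M act P (a + b)"
 proof (rule subset_antisym; rule subsetI)
  fix z assume "z \<in> (\<Union>x\<in>tcoset R M act P a. \<Union>y\<in>tcoset R M act P b. {x + y})"
  then obtain k l where kl: "k \<in> tensor_relations R M act P" "l \<in> tensor_relations R M act P" "z = (k + a) + (l + b)"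
   unfolding tcoset_def by blast
  hence "z = (k + l) + (a + b)" by (simp add: algebra_simps)
  thus "z \<in> tcoset R M act P (a + b)" unfolding tcoset_def using K(3)[OF kl(1,2)] by blast
 next
  fix z assume "z \<in> tcoset R M act P (a + b)"
  then obtain k where k: "k \<in> tensor_relations R M act P" "z = (k + a) + b"
   unfolding tcoset_def by (auto simp: add.assoc)
  hence "k + a \<in> tcoset R M act P a" unfolding tcoset_def by blast
  thus "z \<in> (\<Union>x\<in>tcoset R M act P a. \<Union>y\<in>tcoset R M act P b. {x + y})"
   using tcoset_self[OF T, of b] k(2) by blast
 qed
 finally show ?thesis .
qed

lemma tensor_abelian_group:
 assumes T: "tensor_closed R M act P" shows "abelian_group (tensor_module R M act P)"
proof (rule abelian_groupI)
 fix x assume "x \<in> carrier (tensor_module R M act P)"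
 then obtain c where c: "c \<in> frags M P" "x = tcoset R M act P c" unfolding tensor_module_carrier by blast
 thus "\<exists>y\<in>carrier (tensor_module R M act P). y \<oplus>\<^bsub>tensor_module R M act P\<^esub> x = \<zero>\<^bsub>tensor_module R M act P\<^esub>"
  using frags_closed(3)[OF c(1)]
  by (intro bexI[of _ "tcoset R M act P (- c)"]) (auto simp: tensor_module_add[OF T] tensor_module_zero tensor_module_carrier)
next
 fix x y assume "x \<in> carrier (tensor_module R M act P)" "y \<in> carrier (tensor_module R M act P)"
 then obtain a b where ab: "a \<in> frags M P" "x = tcoset R M act P a" "b \<in> frags M P" "y = tcoset R M act P b"
  unfolding tensor_module_carrier by blast
 show "x \<oplus>\<^bsub>tensor_module R M act P\<^esub> y \<in> carrier (tensor_module R M act P)"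
  unfolding ab tensor_module_add[OF T] by (rule tcoset_in[OF frags_closed(1)[OF ab(1,3)]])
next
 show "\<zero>\<^bsub>tensor_module R M act P\<^esub> \<in> carrier (tensor_module R M act P)"
  unfolding tensor_module_zero by (rule tcoset_in[OF frags_closed(4)])
qed (auto simp: tensor_module_add[OF T] tensor_module_zero tensor_module_carrier algebra_simps)

text \<open>Each of the three families of generating relations is mapped into the same family:
  additivity of \<Psi>, additivity of \<phi>, and the compatibility of both with \<Phi>.\<close>

lemma balanced_relations:
 assumes T: "tensor_closed R M act P" and T': "tensor_closed R' M' act' P'"
  and b: "balanced R \<Phi> M act P R' M' act' P' \<Psi> \<phi>" and c: "c \<in> tensor_relations R M act P"
 shows "frag_map (\<lambda>(m, p). (\<Psi> m, \<phi> p)) c \<in> tensor_relations R' M' act' P'"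
proof -
 let ?g = "\<lambda>(m, p). (\<Psi> m, \<phi> p)"
 note K' = tensor_relations_closed[OF T']
 have bl: "\<And>r. r \<in> carrier R \<Longrightarrow> \<Phi> r \<in> carrier R'" "\<And>m. m \<in> carrier M \<Longrightarrow> \<Psi> m \<in> carrier M'"
  "\<And>m m'. m \<in> carrier M \<Longrightarrow> m' \<in> carrier M \<Longrightarrow> \<Psi> (m \<oplus>\<^bsub>M\<^esub> m') = \<Psi> m \<oplus>\<^bsub>M'\<^esub> \<Psi> m'"
  "\<And>m r. m \<in> carrier M \<Longrightarrow> r \<in> carrier R \<Longrightarrow> \<Psi> (act m r) = act' (\<Psi> m) (\<Phi> r)" "semilinear R \<Phi> P P' \<phi>"
  using b by (auto simp: balanced_def)
 note sl = semilinearD[OF bl(5)]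
 have gen: "frag_map ?g c \<in> tensor_relations R' M' act' P'" if "c \<in> tensor_gens R M act P" for c
 proof -
  have "frag_map ?g c \<in> tensor_gens R' M' act' P'"
   using that
  proof (elim UnE)
   assume "c \<in> {frag_of (m \<oplus>\<^bsub>M\<^esub> m', p) - frag_of (m, p) - frag_of (m', p) | m m' p.
     m \<in> carrier M \<and> m' \<in> carrier M \<and> p \<in> carrier P}"
   then obtain m m' p where "c = frag_of (m \<oplus>\<^bsub>M\<^esub> m', p) - frag_of (m, p) - frag_of (m', p)"
    and m: "m \<in> carrier M" "m' \<in> carrier M" "p \<in> carrier P" by blast
   hence "frag_map ?g c = frag_of (\<Psi> m \<oplus>\<^bsub>M'\<^esub> \<Psi> m', \<phi> p) - frag_of (\<Psi> m, \<phi> p) - frag_of (\<Psi> m', \<phi> p)"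
    by (simp add: bl)
   thus ?thesis using bl(2)[OF m(1)] bl(2)[OF m(2)] sl(1)[OF m(3)] by blast
  next
   assume "c \<in> {frag_of (m, p \<oplus>\<^bsub>P\<^esub> p') - frag_of (m, p) - frag_of (m, p') | m p p'.
     m \<in> carrier M \<and> p \<in> carrier P \<and> p' \<in> carrier P}"
   then obtain m p p' where "c = frag_of (m, p \<oplus>\<^bsub>P\<^esub> p') - frag_of (m, p) - frag_of (m, p')"
    and m: "m \<in> carrier M" "p \<in> carrier P" "p' \<in> carrier P" by blast
   hence "frag_map ?g c = frag_of (\<Psi> m, \<phi> p \<oplus>\<^bsub>P'\<^esub> \<phi> p') - frag_of (\<Psi> m, \<phi> p) - frag_of (\<Psi> m, \<phi> p')"
    by (simp add: sl)
   thus ?thesis using bl(2)[OF m(1)] sl(1)[OF m(2)] sl(1)[OF m(3)] by blast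
  next
   assume "c \<in> {frag_of (act m r, p) - frag_of (m, r \<odot>\<^bsub>P\<^esub> p) | m r p.
     m \<in> carrier M \<and> r \<in> carrier R \<and> p \<in> carrier P}"
   then obtain m r p where "c = frag_of (act m r, p) - frag_of (m, r \<odot>\<^bsub>P\<^esub> p)"
    and m: "m \<in> carrier M" "r \<in> carrier R" "p \<in> carrier P" by blast
   hence "frag_map ?g c = frag_of (act' (\<Psi> m) (\<Phi> r), \<phi> p) - frag_of (\<Psi> m, \<Phi> r \<odot>\<^bsub>P'\<^esub> \<phi> p)"
    by (simp add: bl sl)
   thus ?thesis using bl(2)[OF m(1)] bl(1)[OF m(2)] sl(1)[OF m(3)] by blast
  qed
  thus ?thesis unfolding tensor_relations_def by (rule generate.incl)
 qed
 have "c \<in> generate (free_Abelian_group (carrier M \<times> carrier P)) (tensor_gens R M act P)"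
  using c by (simp add: tensor_relations_def)
 thus ?thesis
 proof induction
  case (inv h)
  have "Poly_Mapping.keys h \<subseteq> carrier M \<times> carrier P"
   by (rule CollectD[OF subsetD[OF tensor_gens_carrier[OF T] inv]])
  from inv_free_Abelian_group[OF this] show ?case using K'(4)[OF gen[OF inv]] by (simp only: frag_map_simps)
 qed (use gen K' in auto)
qed

text \<open>Two representatives differ by a relation, and relations go to relations; hence the union
  over representatives is a union of copies of one coset.\<close>

lemma tensor_lift_coset:
 assumes T: "tensor_closed R M act P" and T': "tensor_closed R' M' act' P'"
  and b: "balanced R \<Phi> M act P R' M' act' P' \<Psi> \<phi>"
 shows "tensor_lift R' M' act' P' (\<lambda>(m, p). (\<Psi> m, \<phi> p)) (tcoset R M act P c) =
  tcoset R' M' act' P' (frag_map (\<lambda>(m, p). (\<Psi> m, \<phi> p)) c)"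
proof -
 let ?g = "\<lambda>(m, p). (\<Psi> m, \<phi> p)"
 have "tcoset R' M' act' P' (frag_map ?g x) = tcoset R' M' act' P' (frag_map ?g c)"
  if "x \<in> tcoset R M act P c" for x
 proof -
  obtain k where "k \<in> tensor_relations R M act P" "x = k + c" using \<open>x \<in> _\<close> unfolding tcoset_def by blast
  thus ?thesis using balanced_relations[OF T T' b, of k] by (simp add: tcoset_eq[OF T'])
 qed
 moreover have "tcoset R M act P c \<noteq> {}" using tcoset_self[OF T, of c] by auto
 ultimately show ?thesis unfolding tensor_lift_def by (rule SUP_eq_const[rotated])
qed

lemma balanced_image:
 assumes "balanced R \<Phi> M act P R' M' act' P' \<Psi> \<phi>" "c \<in> frags M P"
 shows "frag_map (\<lambda>(m, p). (\<Psi> m, \<phi> p)) c \<in> frags M' P'"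
proof -
 have "(\<lambda>(m, p). (\<Psi> m, \<phi> p)) ` (carrier M \<times> carrier P) \<subseteq> carrier M' \<times> carrier P'"
  using assms(1) by (auto simp: balanced_def semilinear_def)
 from frag_map_keys[OF _ this] show ?thesis using assms(2) by simp
qed

lemma tensor_lift_additive:
 assumes T: "tensor_closed R M act P" and T': "tensor_closed R' M' act' P'"
  and b: "balanced R \<Phi> M act P R' M' act' P' \<Psi> \<phi>"
  and x: "x \<in> carrier (tensor_module R M act P)"
 shows "tensor_lift R' M' act' P' (\<lambda>(m, p). (\<Psi> m, \<phi> p)) x \<in> carrier (tensor_module R' M' act' P')"
  "y \<in> carrier (tensor_module R M act P) \<Longrightarrow>
   tensor_lift R' M' act' P' (\<lambda>(m, p). (\<Psi> m, \<phi> p)) (x \<oplus>\<^bsub>tensor_module R M act P\<^esub> y) =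
   tensor_lift R' M' act' P' (\<lambda>(m, p). (\<Psi> m, \<phi> p)) x \<oplus>\<^bsub>tensor_module R' M' act' P'\<^esub>
   tensor_lift R' M' act' P' (\<lambda>(m, p). (\<Psi> m, \<phi> p)) y"
proof -
 obtain c where c: "c \<in> frags M P" "x = tcoset R M act P c" using x unfolding tensor_module_carrier by blast
 thus "tensor_lift R' M' act' P' (\<lambda>(m, p). (\<Psi> m, \<phi> p)) x \<in> carrier (tensor_module R' M' act' P')"
  using balanced_image[OF b] by (simp add: tensor_lift_coset[OF T T' b] tensor_module_carrier)
 assume "y \<in> carrier (tensor_module R M act P)"
 then obtain c' where "c' \<in> frags M P" "y = tcoset R M act P c'" unfolding tensor_module_carrier by blast
 thus "tensor_lift R' M' act' P' (\<lambda>(m, p). (\<Psi> m, \<phi> p)) (x \<oplus>\<^bsub>tensor_module R M act P\<^esub> y) =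
   tensor_lift R' M' act' P' (\<lambda>(m, p). (\<Psi> m, \<phi> p)) x \<oplus>\<^bsub>tensor_module R' M' act' P'\<^esub>
   tensor_lift R' M' act' P' (\<lambda>(m, p). (\<Psi> m, \<phi> p)) y"
  using c by (simp add: tensor_module_add[OF T] tensor_module_add[OF T'] tensor_lift_coset[OF T T' b])
qed

lemma tensor_lift_comp:
 assumes T: "tensor_closed R M act P" and T': "tensor_closed R' M' act' P'" and T'': "tensor_closed R'' M'' act'' P''"
  and b: "balanced R \<Phi> M act P R' M' act' P' \<Psi> \<phi>" and b': "balanced R' \<Phi>' M' act' P' R'' M'' act'' P'' \<Psi>' \<phi>'"
  and x: "x \<in> carrier (tensor_module R M act P)"
 shows "tensor_lift R'' M'' act'' P'' (\<lambda>(m, p). (\<Psi>' m, \<phi>' p)) (tensor_lift R' M' act' P' (\<lambda>(m, p). (\<Psi> m, \<phi> p)) x) =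
  tensor_lift R'' M'' act'' P'' (\<lambda>(m, p). (\<Psi>' (\<Psi> m), \<phi>' (\<phi> p))) x"
proof -
 obtain c where c: "c \<in> frags M P" "x = tcoset R M act P c" using x unfolding tensor_module_carrier by blast
 have bb: "balanced R (\<lambda>r. \<Phi>' (\<Phi> r)) M act P R'' M'' act'' P'' (\<lambda>m. \<Psi>' (\<Psi> m)) (\<lambda>p. \<phi>' (\<phi> p))"
  using b b' semilinear_comp[of R \<Phi> P P' \<phi> R' \<Phi>' P'' \<phi>'] unfolding balanced_def by simp
 show ?thesis
  unfolding c(2) tensor_lift_coset[OF T T' b] tensor_lift_coset[OF T' T'' b'] tensor_lift_coset[OF T T'' bb] frag_map_comp
  by (simp add: split_def)
qed

lemma tensor_lift_cong:
 assumes T: "tensor_closed R M act P" and T': "tensor_closed R' M' act' P'"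
  and b: "balanced R \<Phi> M act P R' M' act' P' \<Psi> \<phi>" "balanced R \<Phi>' M act P R' M' act' P' \<Psi>' \<phi>'"
  and eq: "\<And>m. m \<in> carrier M \<Longrightarrow> \<Psi> m = \<Psi>' m" "\<And>p. p \<in> carrier P \<Longrightarrow> \<phi> p = \<phi>' p"
  and x: "x \<in> carrier (tensor_module R M act P)"
 shows "tensor_lift R' M' act' P' (\<lambda>(m, p). (\<Psi> m, \<phi> p)) x = tensor_lift R' M' act' P' (\<lambda>(m, p). (\<Psi>' m, \<phi>' p)) x"
proof -
 obtain c where c: "c \<in> frags M P" "x = tcoset R M act P c" using x unfolding tensor_module_carrier by blast
 have "frag_map (\<lambda>(m, p). (\<Psi> m, \<phi> p)) c = frag_map (\<lambda>(m, p). (\<Psi>' m, \<phi>' p)) c"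
  using c eq by (intro frag_map_cong) auto
 thus ?thesis unfolding c(2) tensor_lift_coset[OF T T' b(1)] tensor_lift_coset[OF T T' b(2)] by simp
qed

lemma tensor_lift_id:
 assumes T: "tensor_closed R M act P" and x: "x \<in> carrier (tensor_module R M act P)"
 shows "tensor_lift R M act P (\<lambda>(m, p). (m, p)) x = x"
proof -
 obtain c where c: "c \<in> frags M P" "x = tcoset R M act P c" using x unfolding tensor_module_carrier by blast
 have b: "balanced R (\<lambda>r. r) M act P R M act P (\<lambda>m. m) (\<lambda>p. p)"
  using T by (simp add: balanced_def semilinear_id)
 have "frag_map (\<lambda>(m, p). (m, p)) c = frag_map (\<lambda>p. p) c" by (rule frag_map_cong) auto
 thus ?thesis unfolding c(2) tensor_lift_coset[OF T T b] frag_map_ident by (rule arg_cong)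
qed

text \<open>This is what turns chain homotopies into chain homotopies.\<close>

lemma tensor_lift_sum:
 assumes T: "tensor_closed R M act P" and T': "tensor_closed R' M' act' P'"
  and b: "balanced R \<Phi> M act P R' M' act' P' \<Psi> \<phi>" "balanced R \<Phi> M act P R' M' act' P' \<Psi> \<phi>1" "balanced R \<Phi> M act P R' M' act' P' \<Psi> \<phi>2"
  and eq: "\<And>p. p \<in> carrier P \<Longrightarrow> \<phi> p = \<phi>1 p \<oplus>\<^bsub>P'\<^esub> \<phi>2 p"
  and x: "x \<in> carrier (tensor_module R M act P)"
 shows "tensor_lift R' M' act' P' (\<lambda>(m, p). (\<Psi> m, \<phi> p)) x =
  tensor_lift R' M' act' P' (\<lambda>(m, p). (\<Psi> m, \<phi>1 p)) x \<oplus>\<^bsub>tensor_module R' M' act' P'\<^esub> tensor_lift R' M' act' P' (\<lambda>(m, p). (\<Psi> m, \<phi>2 p)) x"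
proof -
 note K' = tensor_relations_closed[OF T']
 obtain c where c: "c \<in> frags M P" "x = tcoset R M act P c" using x unfolding tensor_module_carrier by blast
 let ?g = "\<lambda>(m, p). (\<Psi> m, \<phi> p)" and ?g1 = "\<lambda>(m, p). (\<Psi> m, \<phi>1 p)" and ?g2 = "\<lambda>(m, p). (\<Psi> m, \<phi>2 p)"
 have "Poly_Mapping.keys c \<subseteq> carrier M \<times> carrier P" using c by simp
 hence "frag_map ?g c - (frag_map ?g1 c + frag_map ?g2 c) \<in> tensor_relations R' M' act' P'"
 proof (induction c rule: frag_induction)
  case (one z)
  then obtain m p where z: "z = (m, p)" "m \<in> carrier M" "p \<in> carrier P" by blast
  have mem: "\<Psi> m \<in> carrier M'" "\<phi>1 p \<in> carrier P'" "\<phi>2 p \<in> carrier P'"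
   using b z by (auto simp: balanced_def semilinear_def)
  hence "frag_of (\<Psi> m, \<phi>1 p \<oplus>\<^bsub>P'\<^esub> \<phi>2 p) - frag_of (\<Psi> m, \<phi>1 p) - frag_of (\<Psi> m, \<phi>2 p) \<in> tensor_gens R' M' act' P'"
   by blast
  hence "frag_of (\<Psi> m, \<phi>1 p \<oplus>\<^bsub>P'\<^esub> \<phi>2 p) - frag_of (\<Psi> m, \<phi>1 p) - frag_of (\<Psi> m, \<phi>2 p) \<in> tensor_relations R' M' act' P'"
   unfolding tensor_relations_def by (rule generate.incl)
  thus ?case using eq[OF z(3)] z by (simp add: diff_diff_eq)
 next
  case (diff a b)
  have "frag_map ?g (a - b) - (frag_map ?g1 (a - b) + frag_map ?g2 (a - b)) =
   (frag_map ?g a - (frag_map ?g1 a + frag_map ?g2 a)) - (frag_map ?g b - (frag_map ?g1 b + frag_map ?g2 b))" by simp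
  thus ?case using K'(5)[OF diff] by (simp only:)
 qed (use K' in simp)
 thus ?thesis
  unfolding c(2) tensor_lift_coset[OF T T' b(1)] tensor_lift_coset[OF T T' b(2)] tensor_lift_coset[OF T T' b(3)]
   tensor_module_add[OF T'] by (simp add: tcoset_eq[OF T'])
qed

subsection \<open>Subquotients\<close>

definition add_subgroup :: "('s, 'm) module \<Rightarrow> 'm set \<Rightarrow> bool" where
 "add_subgroup C B \<longleftrightarrow> B \<subseteq> carrier C \<and> \<zero>\<^bsub>C\<^esub> \<in> B \<and> (\<forall>x\<in>B. \<forall>y\<in>B. x \<oplus>\<^bsub>C\<^esub> y \<in> B) \<and> (\<forall>x\<in>B. \<ominus>\<^bsub>C\<^esub> x \<in> B)"

definition add_coset :: "('s, 'm) module \<Rightarrow> 'm set \<Rightarrow> 'm \<Rightarrow> 'm set" where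
 "add_coset C B z = (\<lambda>b. b \<oplus>\<^bsub>C\<^esub> z) ` B"

lemma add_coset_self: "abelian_group C \<Longrightarrow> add_subgroup C B \<Longrightarrow> z \<in> carrier C \<Longrightarrow> z \<in> add_coset C B z"
proof -
 assume "abelian_group C" and B: "add_subgroup C B" "z \<in> carrier C"
 then interpret C: abelian_group C by simp
 show ?thesis unfolding add_coset_def using B by (intro image_eqI[of _ _ "\<zero>\<^bsub>C\<^esub>"]) (auto simp: add_subgroup_def)
qed

lemma add_coset_eq:
 assumes C: "abelian_group C" and B: "add_subgroup C B" and zw: "z \<in> carrier C" "w \<in> carrier C"
 shows "add_coset C B z = add_coset C B w \<longleftrightarrow> z \<ominus>\<^bsub>C\<^esub> w \<in> B"
proof
 interpret C: abelian_group C by fact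
 assume "add_coset C B z = add_coset C B w"
 hence "z \<in> add_coset C B w" using add_coset_self[OF C B zw(1)] by simp
 then obtain b where b: "b \<in> B" "z = b \<oplus>\<^bsub>C\<^esub> w" unfolding add_coset_def by blast
 hence "b \<in> carrier C" using B by (auto simp: add_subgroup_def)
 hence "z \<ominus>\<^bsub>C\<^esub> w = b" unfolding b(2) a_minus_def using zw by (simp add: C.a_assoc C.r_neg)
 thus "z \<ominus>\<^bsub>C\<^esub> w \<in> B" using b by simp
next
 interpret C: abelian_group C by fact
 assume d: "z \<ominus>\<^bsub>C\<^esub> w \<in> B"
 have dC: "z \<ominus>\<^bsub>C\<^esub> w \<in> carrier C" using zw by simp
 have z: "(z \<ominus>\<^bsub>C\<^esub> w) \<oplus>\<^bsub>C\<^esub> w = z" unfolding a_minus_def using zw by (simp add: C.a_assoc C.l_neg)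
 have BC: "\<And>b. b \<in> B \<Longrightarrow> b \<in> carrier C" using B by (auto simp: add_subgroup_def)
 show "add_coset C B z = add_coset C B w"
 proof (rule subset_antisym; rule subsetI)
  fix x assume "x \<in> add_coset C B z"
  then obtain b where b: "b \<in> B" "x = b \<oplus>\<^bsub>C\<^esub> z" unfolding add_coset_def by blast
  hence "x = (b \<oplus>\<^bsub>C\<^esub> (z \<ominus>\<^bsub>C\<^esub> w)) \<oplus>\<^bsub>C\<^esub> w" using BC[OF b(1)] dC zw z by (simp add: C.a_assoc)
  moreover have "b \<oplus>\<^bsub>C\<^esub> (z \<ominus>\<^bsub>C\<^esub> w) \<in> B" using B b d by (simp add: add_subgroup_def)
  ultimately show "x \<in> add_coset C B w" unfolding add_coset_def by blast
 next
  fix x assume "x \<in> add_coset C B w"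
  then obtain b where b: "b \<in> B" "x = b \<oplus>\<^bsub>C\<^esub> w" unfolding add_coset_def by blast
  have "x = (b \<oplus>\<^bsub>C\<^esub> \<ominus>\<^bsub>C\<^esub> (z \<ominus>\<^bsub>C\<^esub> w)) \<oplus>\<^bsub>C\<^esub> ((z \<ominus>\<^bsub>C\<^esub> w) \<oplus>\<^bsub>C\<^esub> w)"
   using b(2) BC[OF b(1)] dC zw by (simp add: C.a_assoc C.r_neg1)
  hence "x = (b \<oplus>\<^bsub>C\<^esub> \<ominus>\<^bsub>C\<^esub> (z \<ominus>\<^bsub>C\<^esub> w)) \<oplus>\<^bsub>C\<^esub> z" by (simp only: z)
  moreover have "b \<oplus>\<^bsub>C\<^esub> \<ominus>\<^bsub>C\<^esub> (z \<ominus>\<^bsub>C\<^esub> w) \<in> B" using B b d by (simp add: add_subgroup_def)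
  ultimately show "x \<in> add_coset C B z" unfolding add_coset_def by blast
 qed
qed

lemma add_coset_add:
 assumes C: "abelian_group C" and B: "add_subgroup C B" and zw: "z \<in> carrier C" "w \<in> carrier C"
 shows "(\<Union>x\<in>add_coset C B z. \<Union>y\<in>add_coset C B w. {x \<oplus>\<^bsub>C\<^esub> y}) = add_coset C B (z \<oplus>\<^bsub>C\<^esub> w)"
proof -
 interpret C: abelian_group C by fact
 have BC: "\<And>b. b \<in> B \<Longrightarrow> b \<in> carrier C" using B by (auto simp: add_subgroup_def)
 show ?thesis
 proof (rule subset_antisym; rule subsetI)
  fix x assume "x \<in> (\<Union>x\<in>add_coset C B z. \<Union>y\<in>add_coset C B w. {x \<oplus>\<^bsub>C\<^esub> y})"
  then obtain b c where bc: "b \<in> B" "c \<in> B" "x = (b \<oplus>\<^bsub>C\<^esub> z) \<oplus>\<^bsub>C\<^esub> (c \<oplus>\<^bsub>C\<^esub> w)" unfolding add_coset_def by blast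
  hence "x = (b \<oplus>\<^bsub>C\<^esub> c) \<oplus>\<^bsub>C\<^esub> (z \<oplus>\<^bsub>C\<^esub> w)" using BC zw by (simp add: C.a_ac)
  moreover have "b \<oplus>\<^bsub>C\<^esub> c \<in> B" using B bc by (simp add: add_subgroup_def)
  ultimately show "x \<in> add_coset C B (z \<oplus>\<^bsub>C\<^esub> w)" unfolding add_coset_def by blast
 next
  fix x assume "x \<in> add_coset C B (z \<oplus>\<^bsub>C\<^esub> w)"
  then obtain b where b: "b \<in> B" "x = b \<oplus>\<^bsub>C\<^esub> (z \<oplus>\<^bsub>C\<^esub> w)" unfolding add_coset_def by blast
  hence x: "x = (b \<oplus>\<^bsub>C\<^esub> z) \<oplus>\<^bsub>C\<^esub> w" using BC zw by (simp add: C.a_assoc)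
  have "b \<oplus>\<^bsub>C\<^esub> z \<in> add_coset C B z" unfolding add_coset_def using b(1) by blast
  thus "x \<in> (\<Union>x\<in>add_coset C B z. \<Union>y\<in>add_coset C B w. {x \<oplus>\<^bsub>C\<^esub> y})"
   using add_coset_self[OF C B zw(2)] x by blast
 qed
qed

text \<open>Cutting the carrier down to Z only limits which cosets occur. Sums and cosets are still
  computed in C, so a subquotient can be handled by lemmas about C.\<close>

lemma quotient_module_simps:
 "carrier (quotient_module (C\<lparr>carrier := Z\<rparr>) B) = add_coset C B ` Z"
 "X \<oplus>\<^bsub>quotient_module (C\<lparr>carrier := Z\<rparr>) B\<^esub> Y = (\<Union>x\<in>X. \<Union>y\<in>Y. {x \<oplus>\<^bsub>C\<^esub> y})"
 "s \<odot>\<^bsub>quotient_module (C\<lparr>carrier := Z\<rparr>) B\<^esub> X = (\<Union>x\<in>X. add_coset C B (s \<odot>\<^bsub>C\<^esub> x))"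
 by (auto simp: quotient_module_def A_RCOSETS_def' a_r_coset_def' set_add_def' add_coset_def image_def)

text \<open>Only \<open>f\<close> and \<open>g\<close> modulo \<open>B\<close> and \<open>B'\<close> have to be mutually inverse.\<close>

lemma quotient_module_iso:
 assumes C: "abelian_group C" and C': "abelian_group C'" and B: "add_subgroup C B" and B': "add_subgroup C' B'"
  and Z: "Z \<subseteq> carrier C" "Z' \<subseteq> carrier C'" and Zadd: "\<And>x y. x \<in> Z \<Longrightarrow> y \<in> Z \<Longrightarrow> x \<oplus>\<^bsub>C\<^esub> y \<in> Z"
  and f: "\<And>x. x \<in> carrier C \<Longrightarrow> f x \<in> carrier C'" "\<And>x y. x \<in> carrier C \<Longrightarrow> y \<in> carrier C \<Longrightarrow> f (x \<oplus>\<^bsub>C\<^esub> y) = f x \<oplus>\<^bsub>C'\<^esub> f y"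
  and fZ: "\<And>x. x \<in> Z \<Longrightarrow> f x \<in> Z'" and fB: "\<And>x. x \<in> B \<Longrightarrow> f x \<in> B'"
  and g: "\<And>x. x \<in> carrier C' \<Longrightarrow> g x \<in> carrier C" "\<And>x y. x \<in> carrier C' \<Longrightarrow> y \<in> carrier C' \<Longrightarrow> g (x \<oplus>\<^bsub>C'\<^esub> y) = g x \<oplus>\<^bsub>C\<^esub> g y"
  and gZ: "\<And>x. x \<in> Z' \<Longrightarrow> g x \<in> Z" and gB: "\<And>x. x \<in> B' \<Longrightarrow> g x \<in> B"
  and gf: "\<And>x. x \<in> Z \<Longrightarrow> g (f x) \<ominus>\<^bsub>C\<^esub> x \<in> B" and fg: "\<And>x. x \<in> Z' \<Longrightarrow> f (g x) \<ominus>\<^bsub>C'\<^esub> x \<in> B'"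
  and sm: "\<And>s x. s \<in> carrier S \<Longrightarrow> x \<in> carrier C \<Longrightarrow> s \<odot>\<^bsub>C\<^esub> x \<in> carrier C"
   "\<And>s x y. s \<in> carrier S \<Longrightarrow> x \<in> carrier C \<Longrightarrow> y \<in> carrier C \<Longrightarrow> s \<odot>\<^bsub>C\<^esub> (x \<oplus>\<^bsub>C\<^esub> y) = s \<odot>\<^bsub>C\<^esub> x \<oplus>\<^bsub>C\<^esub> s \<odot>\<^bsub>C\<^esub> y"
   "\<And>s x. s \<in> carrier S \<Longrightarrow> x \<in> B \<Longrightarrow> s \<odot>\<^bsub>C\<^esub> x \<in> B" "\<And>s x. s \<in> carrier S \<Longrightarrow> x \<in> Z \<Longrightarrow> s \<odot>\<^bsub>C\<^esub> x \<in> Z"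
  and sm': "\<And>s x. s \<in> carrier S' \<Longrightarrow> x \<in> carrier C' \<Longrightarrow> s \<odot>\<^bsub>C'\<^esub> x \<in> carrier C'"
   "\<And>s x y. s \<in> carrier S' \<Longrightarrow> x \<in> carrier C' \<Longrightarrow> y \<in> carrier C' \<Longrightarrow> s \<odot>\<^bsub>C'\<^esub> (x \<oplus>\<^bsub>C'\<^esub> y) = s \<odot>\<^bsub>C'\<^esub> x \<oplus>\<^bsub>C'\<^esub> s \<odot>\<^bsub>C'\<^esub> y"
   "\<And>s x. s \<in> carrier S' \<Longrightarrow> x \<in> B' \<Longrightarrow> s \<odot>\<^bsub>C'\<^esub> x \<in> B'"
  and \<sigma>: "\<And>s. s \<in> carrier S \<Longrightarrow> \<sigma> s \<in> carrier S'" "\<And>s x. s \<in> carrier S \<Longrightarrow> x \<in> carrier C \<Longrightarrow> f (s \<odot>\<^bsub>C\<^esub> x) = \<sigma> s \<odot>\<^bsub>C'\<^esub> f x"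
 shows "\<exists>F. left_module_iso_along S \<sigma> (quotient_module (C\<lparr>carrier := Z\<rparr>) B) (quotient_module (C'\<lparr>carrier := Z'\<rparr>) B') F"
proof -
 interpret C: abelian_group C by fact
 interpret C': abelian_group C' by fact
 define F where "F X = (\<Union>z\<in>X. add_coset C' B' (f z))" for X
 have BC: "\<And>b. b \<in> B \<Longrightarrow> b \<in> carrier C" "\<And>b. b \<in> B' \<Longrightarrow> b \<in> carrier C'" using B B' by (auto simp: add_subgroup_def)
 have ZC: "\<And>z. z \<in> Z \<Longrightarrow> z \<in> carrier C" "\<And>z. z \<in> Z' \<Longrightarrow> z \<in> carrier C'" using Z by auto
 have absorb: "add_coset C B (b \<oplus>\<^bsub>C\<^esub> z) = add_coset C B z" if "b \<in> B" "z \<in> carrier C" for b z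
  using that BC by (subst add_coset_eq[OF C B]) (auto simp: a_minus_def C.a_assoc C.r_neg)
 have absorb': "add_coset C' B' (b \<oplus>\<^bsub>C'\<^esub> z) = add_coset C' B' z" if "b \<in> B'" "z \<in> carrier C'" for b z
  using that BC by (subst add_coset_eq[OF C' B']) (auto simp: a_minus_def C'.a_assoc C'.r_neg)
 have F: "F (add_coset C B z) = add_coset C' B' (f z)" if z: "z \<in> carrier C" for z
  unfolding F_def
 proof (rule SUP_eq_const)
  show "add_coset C B z \<noteq> {}" using add_coset_self[OF C B z] by auto
  fix x assume "x \<in> add_coset C B z"
  then obtain b where b: "b \<in> B" "x = b \<oplus>\<^bsub>C\<^esub> z" unfolding add_coset_def by blast
  thus "add_coset C' B' (f x) = add_coset C' B' (f z)"
   using z by (simp add: f BC absorb'[OF fB])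
 qed
 have smq: "(\<Union>x\<in>add_coset C B z. add_coset C B (s \<odot>\<^bsub>C\<^esub> x)) = add_coset C B (s \<odot>\<^bsub>C\<^esub> z)"
  if z: "z \<in> carrier C" and s: "s \<in> carrier S" for z s
 proof (rule SUP_eq_const)
  show "add_coset C B z \<noteq> {}" using add_coset_self[OF C B z] by auto
  fix x assume "x \<in> add_coset C B z"
  then obtain b where b: "b \<in> B" "x = b \<oplus>\<^bsub>C\<^esub> z" unfolding add_coset_def by blast
  thus "add_coset C B (s \<odot>\<^bsub>C\<^esub> x) = add_coset C B (s \<odot>\<^bsub>C\<^esub> z)"
   using z s by (simp add: sm BC absorb[OF sm(3)])
 qed
 have smq': "(\<Union>x\<in>add_coset C' B' z. add_coset C' B' (s \<odot>\<^bsub>C'\<^esub> x)) = add_coset C' B' (s \<odot>\<^bsub>C'\<^esub> z)"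
  if z: "z \<in> carrier C'" and s: "s \<in> carrier S'" for z s
 proof (rule SUP_eq_const)
  show "add_coset C' B' z \<noteq> {}" using add_coset_self[OF C' B' z] by auto
  fix x assume "x \<in> add_coset C' B' z"
  then obtain b where b: "b \<in> B'" "x = b \<oplus>\<^bsub>C'\<^esub> z" unfolding add_coset_def by blast
  thus "add_coset C' B' (s \<odot>\<^bsub>C'\<^esub> x) = add_coset C' B' (s \<odot>\<^bsub>C'\<^esub> z)"
   using z s by (simp add: sm' BC absorb'[OF sm'(3)])
 qed
 \<comment> \<open>If f z and f w agree modulo B', applying g puts g (f z) and g (f w) in one coset
   of B, and those are congruent to z and w.\<close>
 have inj: "inj_on F (add_coset C B ` Z)"
 proof (rule inj_onI, elim imageE)
  fix X Y z w assume zw: "X = add_coset C B z" "z \<in> Z" "Y = add_coset C B w" "w \<in> Z" and eq: "F X = F Y"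
  have c: "z \<in> carrier C" "w \<in> carrier C" "f z \<in> carrier C'" "f w \<in> carrier C'" using ZC zw f by auto
  have "f z \<ominus>\<^bsub>C'\<^esub> f w \<in> B'" using eq c by (simp add: zw F add_coset_eq[OF C' B'])
  hence "g (f z \<ominus>\<^bsub>C'\<^esub> f w) \<in> B" by (rule gB)
  hence "g (f z) \<ominus>\<^bsub>C\<^esub> g (f w) \<in> B" using additive_zero(3)[OF C' C, of g] g c by simp
  hence "add_coset C B (g (f z)) = add_coset C B (g (f w))" using g c by (simp add: add_coset_eq[OF C B])
  moreover have "add_coset C B (g (f z)) = add_coset C B z" "add_coset C B (g (f w)) = add_coset C B w"
   using gf zw g c by (simp_all add: add_coset_eq[OF C B])
  ultimately show "X = Y" using zw by simp
 qed
 have surj: "F ` (add_coset C B ` Z) = add_coset C' B' ` Z'"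
 proof (rule subset_antisym; rule subsetI)
  fix X assume "X \<in> F ` (add_coset C B ` Z)"
  thus "X \<in> add_coset C' B' ` Z'" using F ZC fZ by auto
 next
  fix X assume "X \<in> add_coset C' B' ` Z'"
  then obtain z where z: "z \<in> Z'" "X = add_coset C' B' z" by blast
  have "add_coset C' B' (f (g z)) = add_coset C' B' z"
   using fg[OF z(1)] ZC(2)[OF z(1)] f g by (simp add: add_coset_eq[OF C' B'])
  hence "F (add_coset C B (g z)) = X" using F[OF g(1)[OF ZC(2)[OF z(1)]]] z by simp
  thus "X \<in> F ` (add_coset C B ` Z)" using gZ[OF z(1)] by blast
 qed
 have "left_module_iso_along S \<sigma> (quotient_module (C\<lparr>carrier := Z\<rparr>) B) (quotient_module (C'\<lparr>carrier := Z'\<rparr>) B') F"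
  unfolding left_module_iso_along_def quotient_module_simps
 proof (intro conjI ballI)
  show "bij_betw F (add_coset C B ` Z) (add_coset C' B' ` Z')" using inj surj by (simp add: bij_betw_def)
 next
  fix X Y assume "X \<in> add_coset C B ` Z" "Y \<in> add_coset C B ` Z"
  then obtain z w where zw: "z \<in> Z" "X = add_coset C B z" "w \<in> Z" "Y = add_coset C B w" by blast
  have c: "z \<in> carrier C" "w \<in> carrier C" using ZC zw by auto
  show "F (\<Union>x\<in>X. \<Union>y\<in>Y. {x \<oplus>\<^bsub>C\<^esub> y}) = (\<Union>x\<in>F X. \<Union>y\<in>F Y. {x \<oplus>\<^bsub>C'\<^esub> y})"
   unfolding zw add_coset_add[OF C B c] F[OF C.a_closed[OF c]] F[OF c(1)] F[OF c(2)]
    add_coset_add[OF C' B' f(1)[OF c(1)] f(1)[OF c(2)]] f(2)[OF c] ..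
 next
  fix s X assume s: "s \<in> carrier S" and "X \<in> add_coset C B ` Z"
  then obtain z where z: "z \<in> Z" "X = add_coset C B z" by blast
  have c: "z \<in> carrier C" using ZC z by auto
  show "F (\<Union>x\<in>X. add_coset C B (s \<odot>\<^bsub>C\<^esub> x)) = (\<Union>x\<in>F X. add_coset C' B' (\<sigma> s \<odot>\<^bsub>C'\<^esub> x))"
   unfolding z smq[OF c s] F[OF sm(1)[OF s c]] F[OF c] smq'[OF f(1)[OF c] \<sigma>(1)[OF s]] \<sigma>(2)[OF s c] ..
 qed
 thus ?thesis by blast
qed

subsection \<open>Tor does not depend on the resolution\<close>

definition bimodule :: "('s, 'y) ring_scheme \<Rightarrow> ('r, 'z) ring_scheme \<Rightarrow> ('s, 'm) module \<Rightarrow> ('m \<Rightarrow> 'r \<Rightarrow> 'm) \<Rightarrow> bool" where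
 "bimodule S R M act \<longleftrightarrow> (\<forall>m\<in>carrier M. \<forall>m'\<in>carrier M. m \<oplus>\<^bsub>M\<^esub> m' \<in> carrier M) \<and>
   (\<forall>m\<in>carrier M. \<forall>r\<in>carrier R. act m r \<in> carrier M) \<and>
   (\<forall>s\<in>carrier S. \<forall>m\<in>carrier M. s \<odot>\<^bsub>M\<^esub> m \<in> carrier M) \<and>
   (\<forall>s\<in>carrier S. \<forall>m\<in>carrier M. \<forall>m'\<in>carrier M. s \<odot>\<^bsub>M\<^esub> (m \<oplus>\<^bsub>M\<^esub> m') = s \<odot>\<^bsub>M\<^esub> m \<oplus>\<^bsub>M\<^esub> s \<odot>\<^bsub>M\<^esub> m') \<and>
   (\<forall>s\<in>carrier S. \<forall>m\<in>carrier M. \<forall>r\<in>carrier R. s \<odot>\<^bsub>M\<^esub> act m r = act (s \<odot>\<^bsub>M\<^esub> m) r)"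

definition "tor_cycles R M act I d n = (case n of 0 \<Rightarrow> carrier (tensor_module R M act (Free R (I 0)))
   | Suc m \<Rightarrow> {x \<in> carrier (tensor_module R M act (Free R (I (Suc m)))).
     tensor_map R M act (Free R (I m)) (d m) x = \<zero>\<^bsub>tensor_module R M act (Free R (I m))\<^esub>})"

definition "tor_boundaries R M act I d n = tensor_map R M act (Free R (I n)) (d n) `
   carrier (tensor_module R M act (Free R (I (Suc n))))"

definition tor_homology where
 "tor_homology R M act I d n = quotient_module ((tensor_module R M act (Free R (I n)))\<lparr>carrier := tor_cycles R M act I d n\<rparr>)
   (tor_boundaries R M act I d n)"

lemma Tor_homology: "Tor R M act N n = (case chosen_resolution R N of (I, d) \<Rightarrow> tor_homology R M act I d n)"
 by (simp add: Tor_def tor_homology_def tor_cycles_def tor_boundaries_def Let_def a_kernel_def' split: prod.splits nat.splits)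

locale tor_complex =
 fixes S :: "('s, 'y) ring_scheme" and R :: "('r, 'z) ring_scheme" and M :: "('s, 'm) module" and act :: "'m \<Rightarrow> 'r \<Rightarrow> 'm"
  and N :: "('r, 'n) module" and I :: "nat \<Rightarrow> 'i set" and d e
 assumes R: "ring R" and N: "left_mod R N" and bimod: "bimodule S R M act" and res: "free_resolution R N I d e"
begin

abbreviation "F n \<equiv> Free R (I n)"
abbreviation "C n \<equiv> tensor_module R M act (Free R (I n))"
abbreviation "lift n \<Psi> \<phi> \<equiv> tensor_lift R M act (Free R (I n)) (\<lambda>(m, p). (\<Psi> m, \<phi> p))"

lemma F_mod: "left_mod R (F n)" by (rule ring.free_left_mod[OF R])

lemma F_group: "abelian_group (F n)" using F_mod by (auto simp: left_mod_def)

lemma closed: "tensor_closed R M act (F n)"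
proof -
 interpret left_mod R "F n" by (rule F_mod)
 show ?thesis using bimod unfolding tensor_closed_def bimodule_def by (simp del: free_module_simps)
qed

lemma C_group: "abelian_group (C n)" by (rule tensor_abelian_group[OF closed])

lemma d: "rlinear R (F (Suc n)) (F n) (d n)" using res by (simp add: free_resolution_iff)

lemma balanced_id: "rlinear R (F n) (F k) \<phi> \<Longrightarrow> balanced R (\<lambda>r. r) M act (F n) R M act (F k) (\<lambda>m. m) \<phi>"
 by (simp add: balanced_def)

lemma balanced_smult: "s \<in> carrier S \<Longrightarrow> balanced R (\<lambda>r. r) M act (F n) R M act (F n) (\<lambda>m. s \<odot>\<^bsub>M\<^esub> m) (\<lambda>p. p)"
 using bimod by (simp add: balanced_def semilinear_id bimodule_def)

lemma lift_additive:
 assumes "rlinear R (F n) (F k) \<phi>" "x \<in> carrier (C n)"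
 shows "lift k (\<lambda>m. m) \<phi> x \<in> carrier (C k)" "y \<in> carrier (C n) \<Longrightarrow> lift k (\<lambda>m. m) \<phi> (x \<oplus>\<^bsub>C n\<^esub> y) = lift k (\<lambda>m. m) \<phi> x \<oplus>\<^bsub>C k\<^esub> lift k (\<lambda>m. m) \<phi> y"
 using tensor_lift_additive[OF closed closed balanced_id[OF assms(1)] assms(2)] by blast+

lemma lift_zero: "rlinear R (F n) (F k) \<phi> \<Longrightarrow> lift k (\<lambda>m. m) \<phi> \<zero>\<^bsub>C n\<^esub> = \<zero>\<^bsub>C k\<^esub>"
 by (rule additive_zero(1)[where f="lift k (\<lambda>m. m) \<phi>", OF C_group C_group lift_additive])

lemma smult_closed: "s \<in> carrier S \<Longrightarrow> x \<in> carrier (C n) \<Longrightarrow> s \<odot>\<^bsub>C n\<^esub> x \<in> carrier (C n)"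
 and smult_add: "s \<in> carrier S \<Longrightarrow> x \<in> carrier (C n) \<Longrightarrow> y \<in> carrier (C n) \<Longrightarrow> s \<odot>\<^bsub>C n\<^esub> (x \<oplus>\<^bsub>C n\<^esub> y) = s \<odot>\<^bsub>C n\<^esub> x \<oplus>\<^bsub>C n\<^esub> s \<odot>\<^bsub>C n\<^esub> y"
 unfolding tensor_module_smult using tensor_lift_additive[OF closed closed balanced_smult] by blast+

lemma smult_zero: "s \<in> carrier S \<Longrightarrow> s \<odot>\<^bsub>C n\<^esub> \<zero>\<^bsub>C n\<^esub> = \<zero>\<^bsub>C n\<^esub>"
 by (rule additive_zero(1)[where f="\<lambda>x. s \<odot>\<^bsub>C n\<^esub> x", OF C_group C_group smult_closed smult_add])

lemma smult_lift:
 assumes s: "s \<in> carrier S" and \<phi>: "rlinear R (F n) (F k) \<phi>" and x: "x \<in> carrier (C n)"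
 shows "s \<odot>\<^bsub>C k\<^esub> lift k (\<lambda>m. m) \<phi> x = lift k (\<lambda>m. m) \<phi> (s \<odot>\<^bsub>C n\<^esub> x)"
 unfolding tensor_module_smult tensor_lift_comp[OF closed closed closed balanced_id[OF \<phi>] balanced_smult[OF s] x]
  tensor_lift_comp[OF closed closed closed balanced_smult[OF s] balanced_id[OF \<phi>] x] ..

lemma boundaries_subgroup: "add_subgroup (C n) (tor_boundaries R M act I d n)"
proof -
 interpret Cs: abelian_group "C (Suc n)" by (rule C_group)
 note l = lift_additive[OF d]
 have z: "lift n (\<lambda>m. m) (d n) (\<ominus>\<^bsub>C (Suc n)\<^esub> u) = \<ominus>\<^bsub>C n\<^esub> lift n (\<lambda>m. m) (d n) u" if "u \<in> carrier (C (Suc n))" for u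
  by (rule additive_zero(2)[where f="lift n (\<lambda>m. m) (d n)", OF C_group C_group _ _ that]) (rule l, assumption+)+
 show ?thesis
  unfolding add_subgroup_def tor_boundaries_def tensor_map_lift
 proof (intro conjI ballI)
  show "lift n (\<lambda>m. m) (d n) ` carrier (C (Suc n)) \<subseteq> carrier (C n)" using l by blast
  show "\<zero>\<^bsub>C n\<^esub> \<in> lift n (\<lambda>m. m) (d n) ` carrier (C (Suc n))"
   by (rule image_eqI[where x="\<zero>\<^bsub>C (Suc n)\<^esub>"]) (simp_all only: lift_zero[OF d] Cs.zero_closed)
 next
  fix x y assume "x \<in> lift n (\<lambda>m. m) (d n) ` carrier (C (Suc n))" "y \<in> lift n (\<lambda>m. m) (d n) ` carrier (C (Suc n))"
  then obtain u v where uv: "u \<in> carrier (C (Suc n))" "x = lift n (\<lambda>m. m) (d n) u" "v \<in> carrier (C (Suc n))" "y = lift n (\<lambda>m. m) (d n) v" by blast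
  show "x \<oplus>\<^bsub>C n\<^esub> y \<in> lift n (\<lambda>m. m) (d n) ` carrier (C (Suc n))"
   unfolding uv(2,4) l(2)[OF uv(1,3), symmetric] by (rule imageI[OF Cs.a_closed[OF uv(1,3)]])
 next
  fix x assume "x \<in> lift n (\<lambda>m. m) (d n) ` carrier (C (Suc n))"
  then obtain u where u: "u \<in> carrier (C (Suc n))" "x = lift n (\<lambda>m. m) (d n) u" by blast
  show "\<ominus>\<^bsub>C n\<^esub> x \<in> lift n (\<lambda>m. m) (d n) ` carrier (C (Suc n))"
   unfolding u(2) z[OF u(1), symmetric] by (rule imageI[OF Cs.a_inv_closed[OF u(1)]])
 qed
qed

lemma cycles_sub: "tor_cycles R M act I d n \<subseteq> carrier (C n)"
 by (cases n) (auto simp: tor_cycles_def)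

lemma cycles_add:
 assumes "x \<in> tor_cycles R M act I d n" "y \<in> tor_cycles R M act I d n"
 shows "x \<oplus>\<^bsub>C n\<^esub> y \<in> tor_cycles R M act I d n"
proof -
 have xy: "x \<in> carrier (C n)" "y \<in> carrier (C n)" using assms cycles_sub by blast+
 interpret Cn: abelian_group "C n" by (rule C_group)
 show ?thesis
 proof (cases n)
  case 0 thus ?thesis using xy by (simp add: tor_cycles_def Cn.a_closed[unfolded 0])
 next
  case (Suc m)
  interpret Cm: abelian_group "C m" by (rule C_group)
  show ?thesis using assms xy lift_additive(2)[OF d[of m], of x y] Cn.a_closed[OF xy]
   unfolding Suc by (simp add: tor_cycles_def tensor_map_lift)
 qed
qed

lemma smult_boundaries:
 assumes s: "s \<in> carrier S" and x: "x \<in> tor_boundaries R M act I d n" shows "s \<odot>\<^bsub>C n\<^esub> x \<in> tor_boundaries R M act I d n"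
proof -
 obtain u where u: "u \<in> carrier (C (Suc n))" "x = lift n (\<lambda>m. m) (d n) u"
  using x unfolding tor_boundaries_def tensor_map_lift by blast
 show ?thesis
  unfolding tor_boundaries_def tensor_map_lift u(2) smult_lift[OF s d u(1)] by (rule imageI[OF smult_closed[OF s u(1)]])
qed

lemma smult_cycles:
 assumes s: "s \<in> carrier S" and x: "x \<in> tor_cycles R M act I d n" shows "s \<odot>\<^bsub>C n\<^esub> x \<in> tor_cycles R M act I d n"
proof (cases n)
 case 0 thus ?thesis using x smult_closed[OF s, of x 0] by (simp add: tor_cycles_def)
next
 case (Suc m)
 have x': "x \<in> carrier (C (Suc m))" "lift m (\<lambda>m. m) (d m) x = \<zero>\<^bsub>C m\<^esub>"
  using x unfolding Suc by (simp_all add: tor_cycles_def tensor_map_lift)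
 have "lift m (\<lambda>m. m) (d m) (s \<odot>\<^bsub>C (Suc m)\<^esub> x) = \<zero>\<^bsub>C m\<^esub>"
  unfolding smult_lift[OF s d x'(1), symmetric] x'(2) by (rule smult_zero[OF s])
 thus ?thesis unfolding Suc using smult_closed[OF s x'(1)] by (simp add: tor_cycles_def tensor_map_lift)
qed

text \<open>Tensoring the homotopy gives f z = z + d s z + s d z, and the last term vanishes on a
  cycle. The relation is rewritten as a sum before tensoring, since \<open>tensor_lift_sum\<close>
  is about sums; in degree 0 the term s d is absent.\<close>

lemma homotopic_to_id:
 assumes f: "\<And>n. rlinear R (F n) (F n) (f n)"
  and fe: "\<And>x. x \<in> carrier (F 0) \<Longrightarrow> e (f 0 x) = e x"
  and fd: "\<And>n x. x \<in> carrier (F (Suc n)) \<Longrightarrow> d n (f (Suc n) x) = f n (d n x)"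
  and z: "z \<in> tor_cycles R M act I d n"
 shows "lift n (\<lambda>m. m) (f n) z \<ominus>\<^bsub>C n\<^esub> z \<in> tor_boundaries R M act I d n"
proof -
 obtain s where ss: "(\<forall>n. rlinear R (F n) (F (Suc n)) (s n)) \<and>
   (\<forall>x\<in>carrier (F 0). d 0 (s 0 x) = f 0 x \<ominus>\<^bsub>F 0\<^esub> x) \<and>
   (\<forall>n. \<forall>x\<in>carrier (F (Suc n)). d (Suc n) (s (Suc n) x) = (f (Suc n) x \<ominus>\<^bsub>F (Suc n)\<^esub> x) \<ominus>\<^bsub>F (Suc n)\<^esub> s n (d n x))"
  using chain_homotopy[OF R N res f fe fd] by (rule exE)
 have s: "\<And>n. rlinear R (F n) (F (Suc n)) (s n)" by (rule spec[OF conjunct1[OF ss]])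
 have s0: "\<And>x. x \<in> carrier (F 0) \<Longrightarrow> d 0 (s 0 x) = f 0 x \<ominus>\<^bsub>F 0\<^esub> x" by (rule bspec[OF conjunct1[OF conjunct2[OF ss]]])
 have sS: "d (Suc n) (s (Suc n) x) = (f (Suc n) x \<ominus>\<^bsub>F (Suc n)\<^esub> x) \<ominus>\<^bsub>F (Suc n)\<^esub> s n (d n x)"
  if "x \<in> carrier (F (Suc n))" for n x
  by (rule bspec[OF spec[OF conjunct2[OF conjunct2[OF ss]], of n] that])
 interpret Cn: abelian_group "C n" by (rule C_group)
 interpret Fn: abelian_group "F n" by (rule F_group)
 have zC: "z \<in> carrier (C n)" using z cycles_sub by blast
 have ds: "rlinear R (F n) (F n) (\<lambda>x. d n (s n x))"
  using semilinear_comp[OF s d] by simp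
 let ?b = "lift n (\<lambda>m. m) (\<lambda>x. d n (s n x)) z"
 have b: "?b \<in> tor_boundaries R M act I d n"
  unfolding tor_boundaries_def tensor_map_lift tensor_lift_comp[OF closed closed closed balanced_id[OF s] balanced_id[OF d] zC, symmetric]
  by (rule imageI[OF lift_additive(1)[OF s zC]])
 have bC: "?b \<in> carrier (C n)" by (rule lift_additive(1)[OF ds zC])
 have idz: "lift n (\<lambda>m. m) (\<lambda>x. x) z = z" by (rule tensor_lift_id[OF closed zC])
 have "lift n (\<lambda>m. m) (f n) z = z \<oplus>\<^bsub>C n\<^esub> ?b"
 proof (cases n)
  case 0
  have "f n x = x \<oplus>\<^bsub>F n\<^esub> d n (s n x)" if x: "x \<in> carrier (F n)" for x
   using s0[of x] x Fn.a_lcomm[of x "f n x" "\<ominus>\<^bsub>F n\<^esub> x"] semilinearD(1)[OF f x]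
   by (simp add: 0[symmetric] a_minus_def Fn.r_neg del: free_module_simps)
  from tensor_lift_sum[OF closed closed balanced_id[OF f] balanced_id[OF semilinear_id] balanced_id[OF ds] this zC]
  show ?thesis unfolding idz .
 next
  case (Suc m)
  have sd: "rlinear R (F n) (F n) (\<lambda>x. s m (d m x))"
   unfolding Suc using semilinear_comp[OF d s] by simp
  have dssd: "rlinear R (F n) (F n) (\<lambda>x. d n (s n x) \<oplus>\<^bsub>F n\<^esub> s m (d m x))"
  proof -
   interpret L: left_mod R "F n" by (rule F_mod)
   show ?thesis
    unfolding semilinear_def using semilinearD[OF ds] semilinearD[OF sd]
    by (auto simp: Fn.a_ac L.smult_add simp del: free_module_simps)
  qed
  have eq: "f n x = x \<oplus>\<^bsub>F n\<^esub> (d n (s n x) \<oplus>\<^bsub>F n\<^esub> s m (d m x))" if x: "x \<in> carrier (F n)" for x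
  proof -
   have fx: "f n x \<in> carrier (F n)" and sx: "s m (d m x) \<in> carrier (F n)"
    using semilinearD(1)[OF f x] semilinearD(1)[OF sd x] .
   have "d n (s n x) = (f n x \<ominus>\<^bsub>F n\<^esub> x) \<ominus>\<^bsub>F n\<^esub> s m (d m x)" using sS[of x m] x unfolding Suc .
   hence "d n (s n x) \<oplus>\<^bsub>F n\<^esub> s m (d m x) = f n x \<ominus>\<^bsub>F n\<^esub> x"
    using fx sx x by (simp add: a_minus_def Fn.a_assoc Fn.l_neg del: free_module_simps)
   thus ?thesis
    using fx x Fn.a_lcomm[of x "f n x" "\<ominus>\<^bsub>F n\<^esub> x"] by (simp add: a_minus_def Fn.r_neg del: free_module_simps)
  qed
  have zm: "z \<in> carrier (C (Suc m))" "lift m (\<lambda>m. m) (d m) z = \<zero>\<^bsub>C m\<^esub>"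
   using z unfolding Suc by (simp_all add: tor_cycles_def tensor_map_lift)
  have "lift n (\<lambda>m. m) (\<lambda>x. s m (d m x)) z = lift (Suc m) (\<lambda>m. m) (s m) (lift m (\<lambda>m. m) (d m) z)"
   unfolding Suc by (rule tensor_lift_comp[OF closed closed closed balanced_id[OF d] balanced_id[OF s] zm(1), symmetric])
  also have "\<dots> = \<zero>\<^bsub>C n\<^esub>" unfolding zm(2) Suc by (rule lift_zero[OF s])
  finally have sdz: "lift n (\<lambda>m. m) (\<lambda>x. s m (d m x)) z = \<zero>\<^bsub>C n\<^esub>" .
  have "lift n (\<lambda>m. m) (f n) z = z \<oplus>\<^bsub>C n\<^esub> lift n (\<lambda>m. m) (\<lambda>x. d n (s n x) \<oplus>\<^bsub>F n\<^esub> s m (d m x)) z"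
   using tensor_lift_sum[OF closed closed balanced_id[OF f] balanced_id[OF semilinear_id] balanced_id[OF dssd] eq zC] unfolding idz .
  also have "lift n (\<lambda>m. m) (\<lambda>x. d n (s n x) \<oplus>\<^bsub>F n\<^esub> s m (d m x)) z = ?b \<oplus>\<^bsub>C n\<^esub> lift n (\<lambda>m. m) (\<lambda>x. s m (d m x)) z"
   by (rule tensor_lift_sum[OF closed closed balanced_id[OF dssd] balanced_id[OF ds] balanced_id[OF sd] refl zC])
  also have "\<dots> = ?b" unfolding sdz using bC by simp
  finally show ?thesis .
 qed
 hence "lift n (\<lambda>m. m) (f n) z \<ominus>\<^bsub>C n\<^esub> z = ?b"
  using zC bC Fn.a_comm by (simp add: a_minus_def Cn.a_comm[of z ?b] Cn.a_assoc Cn.r_neg)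
 thus ?thesis using b by simp
qed

end

definition "bimodule_map S R \<sigma> \<Phi> M act M' act' \<Psi> \<longleftrightarrow> (\<forall>m\<in>carrier M. \<Psi> m \<in> carrier M') \<and>
   (\<forall>m\<in>carrier M. \<forall>m'\<in>carrier M. \<Psi> (m \<oplus>\<^bsub>M\<^esub> m') = \<Psi> m \<oplus>\<^bsub>M'\<^esub> \<Psi> m') \<and>
   (\<forall>m\<in>carrier M. \<forall>r\<in>carrier R. \<Psi> (act m r) = act' (\<Psi> m) (\<Phi> r)) \<and>
   (\<forall>s\<in>carrier S. \<forall>m\<in>carrier M. \<Psi> (s \<odot>\<^bsub>M\<^esub> m) = \<sigma> s \<odot>\<^bsub>M'\<^esub> \<Psi> m)"

text \<open>Three changes happen at once: left scalars along \<sigma>, the resolved ring along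
  \<Phi>, the bimodule along \<Psi>; \<phi> is a chain map covering \<Phi>. In the application
  \<sigma> and \<Psi> are the same conjugation by a unitary.\<close>

locale tor_map = A: tor_complex S R M act N I d e + B: tor_complex S' R' M' act' N' I' d' e'
 for S :: "('s, 'y) ring_scheme" and R :: "('r, 'z) ring_scheme" and M :: "('s, 'm) module" and act N and I :: "nat \<Rightarrow> 'i set" and d e
 and S' :: "('s1, 'y1) ring_scheme" and R' :: "('r1, 'z1) ring_scheme" and M' :: "('s1, 'm1) module" and act' N' and I' :: "nat \<Rightarrow> 'i1 set" and d' e' +
 fixes \<sigma> \<Phi> \<Psi> \<phi>
 assumes \<sigma>: "s \<in> carrier S \<Longrightarrow> \<sigma> s \<in> carrier S'" and \<Phi>: "\<Phi> \<in> ring_hom R R'"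
  and \<Psi>: "bimodule_map S R \<sigma> \<Phi> M act M' act' \<Psi>"
  and \<phi>: "semilinear R \<Phi> (Free R (I n)) (Free R' (I' n)) (\<phi> n)"
  and \<phi>d: "x \<in> carrier (Free R (I (Suc n))) \<Longrightarrow> d' n (\<phi> (Suc n) x) = \<phi> n (d n x)"
begin

abbreviation "T n \<equiv> tensor_lift R' M' act' (Free R' (I' n)) (\<lambda>(m, p). (\<Psi> m, \<phi> n p))"

lemma \<Phi>_closed: "r \<in> carrier R \<Longrightarrow> \<Phi> r \<in> carrier R'" by (rule ring_hom_closed[OF \<Phi>])

lemma bal: "balanced R \<Phi> M act (A.F n) R' M' act' (B.F n) \<Psi> (\<phi> n)"
 using \<Psi> \<phi>[of n] \<Phi>_closed by (simp add: balanced_def bimodule_map_def)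

lemma T_additive:
 assumes "x \<in> carrier (A.C n)"
 shows "T n x \<in> carrier (B.C n)" "y \<in> carrier (A.C n) \<Longrightarrow> T n (x \<oplus>\<^bsub>A.C n\<^esub> y) = T n x \<oplus>\<^bsub>B.C n\<^esub> T n y"
 using tensor_lift_additive[OF A.closed B.closed bal assms] by blast+

lemma T_zero: "T n \<zero>\<^bsub>A.C n\<^esub> = \<zero>\<^bsub>B.C n\<^esub>"
 by (rule additive_zero(1)[where f="T n", OF A.C_group B.C_group T_additive])

lemma T_chain:
 assumes x: "x \<in> carrier (A.C (Suc n))"
 shows "B.lift n (\<lambda>m. m) (d' n) (T (Suc n) x) = T n (A.lift n (\<lambda>m. m) (d n) x)"
proof -
 have b: "balanced R \<Phi> M act (A.F (Suc n)) R' M' act' (B.F n) \<Psi> (\<lambda>x. d' n (\<phi> (Suc n) x))"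
  "balanced R \<Phi> M act (A.F (Suc n)) R' M' act' (B.F n) \<Psi> (\<lambda>x. \<phi> n (d n x))"
  using bal[of n] semilinear_comp[OF \<phi> B.d] \<Phi>_closed semilinear_comp[OF A.d \<phi>] by (auto simp: balanced_def)
 show ?thesis
  unfolding tensor_lift_comp[OF A.closed B.closed B.closed bal B.balanced_id[OF B.d] x]
   tensor_lift_comp[OF A.closed A.closed B.closed A.balanced_id[OF A.d] bal x]
  by (rule tensor_lift_cong[OF A.closed B.closed b _ _ x]) (simp_all only: \<phi>d)
qed

lemma T_boundaries: "x \<in> tor_boundaries R M act I d n \<Longrightarrow> T n x \<in> tor_boundaries R' M' act' I' d' n"
proof -
 assume "x \<in> tor_boundaries R M act I d n"
 then obtain u where u: "u \<in> carrier (A.C (Suc n))" "x = A.lift n (\<lambda>m. m) (d n) u"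
  unfolding tor_boundaries_def tensor_map_lift by blast
 show ?thesis
  unfolding tor_boundaries_def tensor_map_lift u(2) T_chain[OF u(1), symmetric] by (rule imageI[OF T_additive(1)[OF u(1)]])
qed

lemma T_cycles: assumes x: "x \<in> tor_cycles R M act I d n" shows "T n x \<in> tor_cycles R' M' act' I' d' n"
proof (cases n)
 case 0 thus ?thesis using x T_additive(1)[of x 0] by (simp add: tor_cycles_def)
next
 case (Suc m)
 have x': "x \<in> carrier (A.C (Suc m))" "A.lift m (\<lambda>m. m) (d m) x = \<zero>\<^bsub>A.C m\<^esub>"
  using x unfolding Suc by (simp_all add: tor_cycles_def tensor_map_lift)
 have "B.lift m (\<lambda>m. m) (d' m) (T (Suc m) x) = \<zero>\<^bsub>B.C m\<^esub>"
  unfolding T_chain[OF x'(1)] x'(2) by (rule T_zero)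
 thus ?thesis unfolding Suc using T_additive(1)[OF x'(1)] by (simp add: tor_cycles_def tensor_map_lift)
qed

lemma T_smult:
 assumes s: "s \<in> carrier S" and x: "x \<in> carrier (A.C n)" shows "T n (s \<odot>\<^bsub>A.C n\<^esub> x) = \<sigma> s \<odot>\<^bsub>B.C n\<^esub> T n x"
proof -
 have b: "balanced R \<Phi> M act (A.F n) R' M' act' (B.F n) (\<lambda>m. \<Psi> (s \<odot>\<^bsub>M\<^esub> m)) (\<phi> n)"
  "balanced R \<Phi> M act (A.F n) R' M' act' (B.F n) (\<lambda>m. \<sigma> s \<odot>\<^bsub>M'\<^esub> \<Psi> m) (\<phi> n)"
  using bal[of n] A.balanced_smult[OF s, of n] B.balanced_smult[OF \<sigma>[OF s], of n] by (auto simp: balanced_def)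
 show ?thesis
  unfolding tensor_module_smult tensor_lift_comp[OF A.closed A.closed B.closed A.balanced_smult[OF s] bal x]
   tensor_lift_comp[OF A.closed B.closed B.closed bal B.balanced_smult[OF \<sigma>[OF s]] x]
  by (rule tensor_lift_cong[OF A.closed B.closed b _ refl x]) (use \<Psi> s in \<open>simp add: bimodule_map_def\<close>)
qed

end

text \<open>Lifts of \<theta> and \<theta>' give comparison maps both ways. Their composites cover
  the identity of the resolved module, hence are homotopic to the identity, and after tensoring they
  agree with it on cycles up to boundaries. That is the form of invertibility
  \<open>quotient_module_iso\<close> asks for.\<close>

theorem tor_homology_iso:
 assumes A: "tor_complex S R M act N I d e" and B: "tor_complex S' R' M' act' N' I' d' e'"
  and \<Phi>: "\<Phi> \<in> ring_hom R R'" "\<Phi>' \<in> ring_hom R' R" "\<And>r. r \<in> carrier R \<Longrightarrow> \<Phi>' (\<Phi> r) = r" "\<And>r. r \<in> carrier R' \<Longrightarrow> \<Phi> (\<Phi>' r) = r"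
  and \<theta>: "semilinear R \<Phi> N N' \<theta>" "semilinear R' \<Phi>' N' N \<theta>'"
   "\<And>x. x \<in> carrier N \<Longrightarrow> \<theta>' (\<theta> x) = x" "\<And>x. x \<in> carrier N' \<Longrightarrow> \<theta> (\<theta>' x) = x"
  and \<sigma>: "\<And>s. s \<in> carrier S \<Longrightarrow> \<sigma> s \<in> carrier S'" "\<And>s. s \<in> carrier S' \<Longrightarrow> \<sigma>' s \<in> carrier S"
  and \<Psi>: "bimodule_map S R \<sigma> \<Phi> M act M' act' \<Psi>" "bimodule_map S' R' \<sigma>' \<Phi>' M' act' M act \<Psi>'"
   "\<And>m. m \<in> carrier M \<Longrightarrow> \<Psi>' (\<Psi> m) = m" "\<And>m. m \<in> carrier M' \<Longrightarrow> \<Psi> (\<Psi>' m) = m"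
 shows "\<exists>f. left_module_iso_along S \<sigma> (tor_homology R M act I d n) (tor_homology R' M' act' I' d' n) f"
proof -
 interpret A: tor_complex S R M act N I d e by fact
 interpret B: tor_complex S' R' M' act' N' I' d' e' by fact
 obtain \<phi> where \<phi>: "\<And>n. semilinear R \<Phi> (A.F n) (B.F n) (\<phi> n)" "\<And>x. x \<in> carrier (A.F 0) \<Longrightarrow> e' (\<phi> 0 x) = \<theta> (e x)"
  "\<And>n x. x \<in> carrier (A.F (Suc n)) \<Longrightarrow> d' n (\<phi> (Suc n) x) = \<phi> n (d n x)"
  using chain_lift[OF A.R B.R \<Phi>(1) A.N B.N \<theta>(1) A.res B.res] by blast
 obtain \<psi> where \<psi>: "\<And>n. semilinear R' \<Phi>' (B.F n) (A.F n) (\<psi> n)" "\<And>x. x \<in> carrier (B.F 0) \<Longrightarrow> e (\<psi> 0 x) = \<theta>' (e' x)"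
  "\<And>n x. x \<in> carrier (B.F (Suc n)) \<Longrightarrow> d n (\<psi> (Suc n) x) = \<psi> n (d' n x)"
  using chain_lift[OF B.R A.R \<Phi>(2) B.N A.N \<theta>(2) B.res A.res] by blast
 interpret X: tor_map S R M act N I d e S' R' M' act' N' I' d' e' \<sigma> \<Phi> \<Psi> \<phi>
  by (rule tor_map.intro[OF A B], rule tor_map_axioms.intro)
   (rule \<sigma>(1), assumption | rule \<Phi>(1) | rule \<Psi>(1) | rule \<phi>(1) | rule \<phi>(3), assumption)+
 interpret Y: tor_map S' R' M' act' N' I' d' e' S R M act N I d e \<sigma>' \<Phi>' \<Psi>' \<psi>
  by (rule tor_map.intro[OF B A], rule tor_map_axioms.intro)
   (rule \<sigma>(2), assumption | rule \<Phi>(2) | rule \<Psi>(2) | rule \<psi>(1) | rule \<psi>(3), assumption)+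
 have e: "e x \<in> carrier N" if "x \<in> carrier (A.F 0)" for x
  using A.res that semilinearD(1)[of R "\<lambda>r. r" "A.F 0" N e x] by (simp add: free_resolution_iff)
 have e': "e' x \<in> carrier N'" if "x \<in> carrier (B.F 0)" for x
  using B.res that semilinearD(1)[of R' "\<lambda>r. r" "B.F 0" N' e' x] by (simp add: free_resolution_iff)
 have \<psi>\<phi>: "rlinear R (A.F n) (A.F n) (\<lambda>x. \<psi> n (\<phi> n x))" for n
  by (rule semilinear_cong[OF semilinear_comp[OF \<phi>(1) \<psi>(1) X.\<Phi>_closed]]) (simp_all add: \<Phi>)
 have \<phi>\<psi>: "semilinear R' (\<lambda>r. r) (B.F n) (B.F n) (\<lambda>x. \<phi> n (\<psi> n x))" for n
  by (rule semilinear_cong[OF semilinear_comp[OF \<psi>(1) \<phi>(1) Y.\<Phi>_closed]]) (simp_all add: \<Phi>)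
 have gf: "Y.T n (X.T n x) \<ominus>\<^bsub>A.C n\<^esub> x \<in> tor_boundaries R M act I d n" if x: "x \<in> tor_cycles R M act I d n" for x
 proof -
  have xC: "x \<in> carrier (A.C n)" using x A.cycles_sub by blast
  have b: "balanced R (\<lambda>r. r) M act (A.F n) R M act (A.F n) (\<lambda>m. \<Psi>' (\<Psi> m)) (\<lambda>x. \<psi> n (\<phi> n x))"
   using A.balanced_id[OF \<psi>\<phi>[of n]] A.balanced_smult A.closed[of n] \<Psi>(3) \<psi>\<phi>[of n] by (simp add: balanced_def tensor_closed_def)
  have "Y.T n (X.T n x) = A.lift n (\<lambda>m. \<Psi>' (\<Psi> m)) (\<lambda>x. \<psi> n (\<phi> n x)) x"
   by (rule tensor_lift_comp[OF A.closed B.closed A.closed X.bal Y.bal xC])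
  also have "\<dots> = A.lift n (\<lambda>m. m) (\<lambda>x. \<psi> n (\<phi> n x)) x"
   by (rule tensor_lift_cong[OF A.closed A.closed b A.balanced_id[OF \<psi>\<phi>] \<Psi>(3) refl xC])
  finally show ?thesis
   using A.homotopic_to_id[OF \<psi>\<phi> _ _ x] \<phi> \<psi> \<theta>(3) e semilinearD(1)[OF \<phi>(1)] semilinearD(1)[OF A.d] by (simp del: free_module_simps)
 qed
 have fg: "X.T n (Y.T n x) \<ominus>\<^bsub>B.C n\<^esub> x \<in> tor_boundaries R' M' act' I' d' n" if x: "x \<in> tor_cycles R' M' act' I' d' n" for x
 proof -
  have xC: "x \<in> carrier (B.C n)" using x B.cycles_sub by blast
  have b: "balanced R' (\<lambda>r. r) M' act' (B.F n) R' M' act' (B.F n) (\<lambda>m. \<Psi> (\<Psi>' m)) (\<lambda>x. \<phi> n (\<psi> n x))"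
   using B.balanced_id[OF \<phi>\<psi>[of n]] B.closed[of n] \<Psi>(4) \<phi>\<psi>[of n] by (simp add: balanced_def tensor_closed_def)
  have "X.T n (Y.T n x) = B.lift n (\<lambda>m. \<Psi> (\<Psi>' m)) (\<lambda>x. \<phi> n (\<psi> n x)) x"
   by (rule tensor_lift_comp[OF B.closed A.closed B.closed Y.bal X.bal xC])
  also have "\<dots> = B.lift n (\<lambda>m. m) (\<lambda>x. \<phi> n (\<psi> n x)) x"
   by (rule tensor_lift_cong[OF B.closed B.closed b B.balanced_id[OF \<phi>\<psi>] \<Psi>(4) refl xC])
  finally show ?thesis
   using B.homotopic_to_id[OF \<phi>\<psi> _ _ x] \<phi> \<psi> \<theta>(4) e' semilinearD(1)[OF \<psi>(1)] semilinearD(1)[OF B.d] by (simp del: free_module_simps)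
 qed
 show ?thesis
  unfolding tor_homology_def
 proof (rule quotient_module_iso[OF A.C_group B.C_group A.boundaries_subgroup B.boundaries_subgroup A.cycles_sub B.cycles_sub
    A.cycles_add X.T_additive X.T_cycles X.T_boundaries Y.T_additive Y.T_cycles Y.T_boundaries gf fg
    A.smult_closed A.smult_add A.smult_boundaries A.smult_cycles B.smult_closed B.smult_add B.smult_boundaries X.\<sigma> X.T_smult])
 qed
qed

text \<open>Tor remembers only the index sets and differentials of the chosen resolution; an
  augmentation has to be recovered from the specification of the choice, because the comparison of
  resolutions starts from it.\<close>

lemma chosen_resolution_tor_complex:
 fixes R :: "('r, 'z) ring_scheme" and N :: "('r, 'n) module"
 assumes "ring R" "left_mod R N" "bimodule S R M act"
 shows "\<exists>I d e. chosen_resolution R N = (I, d) \<and> tor_complex S R M act N I d e"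
proof -
 from free_resolution_exists[OF assms(1,2)]
 have "\<exists>x :: (nat \<Rightarrow> ('r + 'n) list set) \<times> (nat \<Rightarrow> (('r + 'n) list \<Rightarrow> 'r) \<Rightarrow> ('r + 'n) list \<Rightarrow> 'r).
   case x of (I, d) \<Rightarrow> \<exists>e. free_resolution R N I d e"
  by simp
 from someI_ex[OF this] have "case chosen_resolution R N of (I, d) \<Rightarrow> \<exists>e. free_resolution R N I d e"
  unfolding chosen_resolution_def .
 thus ?thesis using assms by (auto simp: tor_complex_def split: prod.splits)
qed

theorem Tor_iso:
 assumes R: "ring R" "ring R'" and N: "left_mod R N" "left_mod R' N'" and M: "bimodule S R M act" "bimodule S' R' M' act'"
  and \<Phi>: "\<Phi> \<in> ring_hom R R'" "\<Phi>' \<in> ring_hom R' R" "\<And>r. r \<in> carrier R \<Longrightarrow> \<Phi>' (\<Phi> r) = r" "\<And>r. r \<in> carrier R' \<Longrightarrow> \<Phi> (\<Phi>' r) = r"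
  and \<theta>: "semilinear R \<Phi> N N' \<theta>" "semilinear R' \<Phi>' N' N \<theta>'"
   "\<And>x. x \<in> carrier N \<Longrightarrow> \<theta>' (\<theta> x) = x" "\<And>x. x \<in> carrier N' \<Longrightarrow> \<theta> (\<theta>' x) = x"
  and \<sigma>: "\<And>s. s \<in> carrier S \<Longrightarrow> \<sigma> s \<in> carrier S'" "\<And>s. s \<in> carrier S' \<Longrightarrow> \<sigma>' s \<in> carrier S"
  and \<Psi>: "bimodule_map S R \<sigma> \<Phi> M act M' act' \<Psi>" "bimodule_map S' R' \<sigma>' \<Phi>' M' act' M act \<Psi>'"
   "\<And>m. m \<in> carrier M \<Longrightarrow> \<Psi>' (\<Psi> m) = m" "\<And>m. m \<in> carrier M' \<Longrightarrow> \<Psi> (\<Psi>' m) = m"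
 shows "\<exists>f. left_module_iso_along S \<sigma> (Tor R M act N n) (Tor R' M' act' N' n) f"
proof -
 obtain I d e where A: "chosen_resolution R N = (I, d)" "tor_complex S R M act N I d e"
  using chosen_resolution_tor_complex[OF R(1) N(1) M(1)] by blast
 obtain I' d' e' where B: "chosen_resolution R' N' = (I', d')" "tor_complex S' R' M' act' N' I' d' e'"
  using chosen_resolution_tor_complex[OF R(2) N(2) M(2)] by blast
 show ?thesis
  using tor_homology_iso[OF A(2) B(2) \<Phi> \<theta> \<sigma> \<Psi>, of n] by (simp add: Tor_homology A(1) B(1))
qed

section \<open>The additive group of Tor\<close>

lemma quotient_abelian_group:
 assumes C: "abelian_group C" and Z: "add_subgroup C Z" and B: "add_subgroup C B"
 shows "abelian_group (quotient_module (C\<lparr>carrier := Z\<rparr>) B)" (is "abelian_group ?Q")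
proof -
 interpret C: abelian_group C by fact
 have ZC: "\<And>z. z \<in> Z \<Longrightarrow> z \<in> carrier C" and Zc: "\<zero>\<^bsub>C\<^esub> \<in> Z" "\<And>x y. x \<in> Z \<Longrightarrow> y \<in> Z \<Longrightarrow> x \<oplus>\<^bsub>C\<^esub> y \<in> Z" "\<And>x. x \<in> Z \<Longrightarrow> \<ominus>\<^bsub>C\<^esub> x \<in> Z"
  using Z by (auto simp: add_subgroup_def)
 have BC: "\<And>z. z \<in> B \<Longrightarrow> z \<in> carrier C" using B by (auto simp: add_subgroup_def)
 have zero: "\<zero>\<^bsub>?Q\<^esub> = add_coset C B \<zero>\<^bsub>C\<^esub>"
  using BC by (simp add: quotient_module_def add_coset_def)
 have add: "add_coset C B z \<oplus>\<^bsub>?Q\<^esub> add_coset C B w = add_coset C B (z \<oplus>\<^bsub>C\<^esub> w)" if "z \<in> Z" "w \<in> Z" for z w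
  unfolding quotient_module_simps by (rule add_coset_add[OF C B ZC[OF that(1)] ZC[OF that(2)]])
 show ?thesis
 proof (rule abelian_groupI)
  fix x assume "x \<in> carrier ?Q"
  then obtain z where z: "z \<in> Z" "x = add_coset C B z" unfolding quotient_module_simps by blast
  show "\<exists>y\<in>carrier ?Q. y \<oplus>\<^bsub>?Q\<^esub> x = \<zero>\<^bsub>?Q\<^esub>"
   using z Zc by (intro bexI[of _ "add_coset C B (\<ominus>\<^bsub>C\<^esub> z)"]) (auto simp: add zero C.l_neg ZC quotient_module_simps(1))
 next
  show "\<zero>\<^bsub>?Q\<^esub> \<in> carrier ?Q" unfolding zero quotient_module_simps(1) using Zc by blast
 next
  fix x y assume "x \<in> carrier ?Q" "y \<in> carrier ?Q"
  then obtain z w where zw: "z \<in> Z" "x = add_coset C B z" "w \<in> Z" "y = add_coset C B w" unfolding quotient_module_simps(1) by blast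
  show "x \<oplus>\<^bsub>?Q\<^esub> y \<in> carrier ?Q" unfolding zw add[OF zw(1,3)] quotient_module_simps(1) using Zc zw by blast
  show "x \<oplus>\<^bsub>?Q\<^esub> y = y \<oplus>\<^bsub>?Q\<^esub> x" unfolding zw add[OF zw(1,3)] add[OF zw(3,1)] using ZC zw by (simp add: C.a_comm)
  show "\<zero>\<^bsub>?Q\<^esub> \<oplus>\<^bsub>?Q\<^esub> x = x" unfolding zw zero add[OF Zc(1) zw(1)] using ZC zw by simp
  fix u assume "u \<in> carrier ?Q"
  then obtain v where v: "v \<in> Z" "u = add_coset C B v" unfolding quotient_module_simps(1) by blast
  show "x \<oplus>\<^bsub>?Q\<^esub> y \<oplus>\<^bsub>?Q\<^esub> u = x \<oplus>\<^bsub>?Q\<^esub> (y \<oplus>\<^bsub>?Q\<^esub> u)"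
   unfolding zw v add[OF zw(1,3)] add[OF zw(3) v(1)] add[OF Zc(2)[OF zw(1,3)] v(1)] add[OF zw(1) Zc(2)[OF zw(3) v(1)]]
   using ZC zw v by (simp add: C.a_assoc)
 qed
qed

lemma (in tor_complex) cycles_subgroup: "add_subgroup (C n) (tor_cycles R M act I d n)"
proof -
 interpret Cn: abelian_group "C n" by (rule C_group)
 have "\<zero>\<^bsub>C n\<^esub> \<in> tor_cycles R M act I d n \<and> (\<forall>x\<in>tor_cycles R M act I d n. \<ominus>\<^bsub>C n\<^esub> x \<in> tor_cycles R M act I d n)"
 proof (cases n)
  case 0
  interpret C0: abelian_group "C 0" by (rule C_group)
  show ?thesis unfolding 0 by (simp add: tor_cycles_def)
 next
  case (Suc m)
  interpret Cs: abelian_group "C (Suc m)" by (rule C_group)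
  interpret Cm: abelian_group "C m" by (rule C_group)
  have neg: "lift m (\<lambda>m. m) (d m) (\<ominus>\<^bsub>C (Suc m)\<^esub> x) = \<ominus>\<^bsub>C m\<^esub> lift m (\<lambda>m. m) (d m) x" if "x \<in> carrier (C (Suc m))" for x
   by (rule additive_zero(2)[where f="lift m (\<lambda>m. m) (d m)", OF C_group C_group _ _ that]) (rule lift_additive[OF d], assumption+)+
  have "\<ominus>\<^bsub>C m\<^esub> \<zero>\<^bsub>C m\<^esub> = \<zero>\<^bsub>C m\<^esub>" by (rule Cm.minus_equality) auto
  thus ?thesis unfolding Suc using lift_zero[OF d] neg
   by (simp add: tor_cycles_def tensor_map_lift)
 qed
 thus ?thesis using cycles_sub cycles_add by (auto simp: add_subgroup_def)
qed

text \<open>Dimension and capacity are suprema over submodules. Transporting a submodule along an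
  isomorphism requires that zero and negatives be preserved, which follows from additivity once both
  sides are known to be groups.\<close>

lemma Tor_abelian_group:
 assumes "ring R" "left_mod R N" "bimodule S R M act"
 shows "abelian_group (Tor R M act N n)"
proof -
 obtain I d e where A: "chosen_resolution R N = (I, d)" "tor_complex S R M act N I d e"
  using chosen_resolution_tor_complex[OF assms] by blast
 interpret tor_complex S R M act N I d e by (rule A(2))
 show ?thesis
  using quotient_abelian_group[OF C_group cycles_subgroup boundaries_subgroup, of n]
  by (simp add: Tor_homology A(1) tor_homology_def)
qed

subsection \<open>Transport of dimension and capacity along an isomorphism of scalars\<close>

abbreviation "Fr N k \<equiv> Free (vring N) {..<k::nat}"
abbreviation "vmul N \<equiv> row_mult (vring N)"

lemma finsum_map:
 assumes A: "abelian_group A" and B: "abelian_group B" and h: "\<And>x. x \<in> carrier A \<Longrightarrow> h x \<in> carrier B"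
  "\<And>x y. x \<in> carrier A \<Longrightarrow> y \<in> carrier A \<Longrightarrow> h (x \<oplus>\<^bsub>A\<^esub> y) = h x \<oplus>\<^bsub>B\<^esub> h y"
  and I: "finite I" "\<And>i. i \<in> I \<Longrightarrow> f i \<in> carrier A"
 shows "h (\<Oplus>\<^bsub>A\<^esub>i\<in>I. f i) = (\<Oplus>\<^bsub>B\<^esub>i\<in>I. h (f i))"
proof -
 interpret A: abelian_group A by fact
 interpret B: abelian_group B by fact
 show ?thesis using I
 proof (induction I)
  case empty thus ?case using additive_zero(1)[of A B h, OF A B h] by simp
 next
  case (insert a I)
  have "(\<Oplus>\<^bsub>A\<^esub>i\<in>insert a I. f i) = f a \<oplus>\<^bsub>A\<^esub> (\<Oplus>\<^bsub>A\<^esub>i\<in>I. f i)"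
   using insert by (intro A.finsum_insert) auto
  moreover have "(\<Oplus>\<^bsub>B\<^esub>i\<in>insert a I. h (f i)) = h (f a) \<oplus>\<^bsub>B\<^esub> (\<Oplus>\<^bsub>B\<^esub>i\<in>I. h (f i))"
   using insert h by (intro B.finsum_insert) auto
  moreover have "(\<Oplus>\<^bsub>A\<^esub>i\<in>I. f i) \<in> carrier A" using insert by (intro A.finsum_closed) auto
  ultimately show ?case using insert h by simp
 qed
qed

lemma vring_simps [simp]: "carrier (vring N) = velems N"
 by (simp add: vring_def)

text \<open>What an isomorphism of scalars must preserve for dimension and capacity: the ring,
  projections over it, the trace and the Novikov-Shubin invariant. Every assumption comes with its
  converse, so \<open>sym\<close> exchanges the two sides and each transport lemma is needed in one
  direction only.\<close>

locale vna_iso =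
 fixes N :: "'v traced_vna" and N' :: "'w traced_vna" and \<Phi> \<Phi>'
 assumes rings: "ring (vring N)" "ring (vring N')"
  and \<Phi>: "\<Phi> \<in> ring_hom (vring N) (vring N')" and \<Phi>': "\<Phi>' \<in> ring_hom (vring N') (vring N)"
  and inv: "x \<in> velems N \<Longrightarrow> \<Phi>' (\<Phi> x) = x" and inv': "y \<in> velems N' \<Longrightarrow> \<Phi> (\<Phi>' y) = y"
  and proj: "matrix_over (vring N) k k E \<Longrightarrow> projection_matrix (vspace N) k E \<Longrightarrow> projection_matrix (vspace N') k (\<lambda>i j. \<Phi> (E i j))"
  and proj': "matrix_over (vring N') k k E' \<Longrightarrow> projection_matrix (vspace N') k E' \<Longrightarrow> projection_matrix (vspace N) k (\<lambda>i j. \<Phi>' (E' i j))"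
  and trace: "x \<in> velems N \<Longrightarrow> vtrace N' (\<Phi> x) = vtrace N x" and trace': "y \<in> velems N' \<Longrightarrow> vtrace N (\<Phi>' y) = vtrace N' y"
  and novikov: "matrix_over (vring N) k l B \<Longrightarrow> novikov_shubin N' k l (\<lambda>i j. \<Phi> (B i j)) = novikov_shubin N k l B"
  and novikov': "matrix_over (vring N') k l B' \<Longrightarrow> novikov_shubin N k l (\<lambda>i j. \<Phi>' (B' i j)) = novikov_shubin N' k l B'"
begin

lemma sym: "vna_iso N' N \<Phi>' \<Phi>"
 by (rule vna_iso.intro) (rule rings \<Phi> \<Phi>' | erule inv' inv | rule proj' proj, assumption, assumption |
  erule trace' trace novikov' novikov)+

interpretation R: ring "vring N" by (rule rings)
interpretation R': ring "vring N'" by (rule rings)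

lemma \<Phi>_in: "x \<in> velems N \<Longrightarrow> \<Phi> x \<in> velems N'" using ring_hom_closed[OF \<Phi>] by simp
lemma \<Phi>'_in: "x \<in> velems N' \<Longrightarrow> \<Phi>' x \<in> velems N" using ring_hom_closed[OF \<Phi>'] by simp
lemma \<Phi>_zero: "\<Phi> \<zero>\<^bsub>vring N\<^esub> = \<zero>\<^bsub>vring N'\<^esub>" by (rule ring_hom_zero[OF \<Phi> rings])
lemma \<Phi>_add: "x \<in> velems N \<Longrightarrow> y \<in> velems N \<Longrightarrow> \<Phi> (x \<oplus>\<^bsub>vring N\<^esub> y) = \<Phi> x \<oplus>\<^bsub>vring N'\<^esub> \<Phi> y" using ring_hom_add[OF \<Phi>] by simp
lemma \<Phi>_mult: "x \<in> velems N \<Longrightarrow> y \<in> velems N \<Longrightarrow> \<Phi> (x \<otimes>\<^bsub>vring N\<^esub> y) = \<Phi> x \<otimes>\<^bsub>vring N'\<^esub> \<Phi> y" using ring_hom_mult[OF \<Phi>] by simp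

lemma matrix_map: "matrix_over (vring N) k l B \<Longrightarrow> matrix_over (vring N') k l (\<lambda>i j. \<Phi> (B i j))"
 using \<Phi>_in by (simp add: matrix_over_def)

lemma free_map: "x \<in> carrier (Free (vring N) I) \<Longrightarrow> (\<lambda>i. \<Phi> (x i)) \<in> carrier (Free (vring N') I)"
proof -
 assume x: "x \<in> carrier (Free (vring N) I)"
 have "{i. \<Phi> (x i) \<noteq> \<zero>\<^bsub>vring N'\<^esub>} \<subseteq> {i. x i \<noteq> \<zero>\<^bsub>vring N\<^esub>}" using \<Phi>_zero by auto
 hence "finite {i. \<Phi> (x i) \<noteq> \<zero>\<^bsub>vring N'\<^esub>}" by (rule finite_subset) (use x in \<open>simp add: free_module_carrier\<close>)
 thus ?thesis using x \<Phi>_in \<Phi>_zero by (simp add: free_module_carrier)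
qed

lemma free_inv: "x \<in> carrier (Free (vring N) I) \<Longrightarrow> (\<lambda>i. \<Phi>' (\<Phi> (x i))) = x"
 using R.free_module_in[of x I] inv by fastforce

lemma row_mult_closed:
 assumes "matrix_over (vring N) k l B" "x \<in> carrier (Fr N k)"
 shows "vmul N k l B x \<in> carrier (Fr N l)"
proof -
 have "(\<Oplus>\<^bsub>vring N\<^esub>i\<in>{..<k}. x i \<otimes>\<^bsub>vring N\<^esub> B i j) \<in> velems N" if "j < l" for j
  using R.finsum_closed[of "\<lambda>i. x i \<otimes>\<^bsub>vring N\<^esub> B i j" "{..<k}"] that assms R.free_module_in[OF assms(2)]
   R.m_closed by (auto simp: matrix_over_def)
 moreover have "{j. vmul N k l B x j \<noteq> \<zero>\<^bsub>vring N\<^esub>} \<subseteq> {..<l}" by (auto simp: row_mult_def)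
 ultimately show ?thesis by (auto simp: free_module_carrier row_mult_def intro: finite_subset)
qed

lemma row_mult_add:
 assumes B: "matrix_over (vring N) k l B" and x: "x \<in> carrier (Fr N k)" and y: "y \<in> carrier (Fr N k)"
 shows "vmul N k l B (x \<oplus>\<^bsub>Fr N k\<^esub> y) = vmul N k l B x \<oplus>\<^bsub>Fr N l\<^esub> vmul N k l B y"
proof
 fix j
 show "vmul N k l B (x \<oplus>\<^bsub>Fr N k\<^esub> y) j = (vmul N k l B x \<oplus>\<^bsub>Fr N l\<^esub> vmul N k l B y) j"
 proof (cases "j < l")
  case True
  have m: "x i \<in> carrier (vring N)" "y i \<in> carrier (vring N)" for i using R.free_module_in[OF x] R.free_module_in[OF y] by auto
  have b: "B i j \<in> carrier (vring N)" if "i < k" for i using B True that by (simp add: matrix_over_def)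
  have "(\<Oplus>\<^bsub>vring N\<^esub>i\<in>{..<k}. (x i \<oplus>\<^bsub>vring N\<^esub> y i) \<otimes>\<^bsub>vring N\<^esub> B i j) =
    (\<Oplus>\<^bsub>vring N\<^esub>i\<in>{..<k}. x i \<otimes>\<^bsub>vring N\<^esub> B i j \<oplus>\<^bsub>vring N\<^esub> y i \<otimes>\<^bsub>vring N\<^esub> B i j)"
   using m b by (intro R.finsum_cong') (auto simp: R.l_distr simp del: vring_simps)
  also have "\<dots> = (\<Oplus>\<^bsub>vring N\<^esub>i\<in>{..<k}. x i \<otimes>\<^bsub>vring N\<^esub> B i j) \<oplus>\<^bsub>vring N\<^esub> (\<Oplus>\<^bsub>vring N\<^esub>i\<in>{..<k}. y i \<otimes>\<^bsub>vring N\<^esub> B i j)"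
   using m b by (intro R.finsum_addf) (auto simp del: vring_simps)
  finally show ?thesis using True by (simp add: row_mult_def)
 qed (use R.r_zero R.zero_closed in \<open>simp add: row_mult_def\<close>)
qed

lemma row_mult_map:
 assumes B: "matrix_over (vring N) k l B" and x: "x \<in> carrier (Fr N k)"
 shows "(\<lambda>j. \<Phi> (vmul N k l B x j)) = vmul N' k l (\<lambda>i j. \<Phi> (B i j)) (\<lambda>i. \<Phi> (x i))"
proof
 fix j
 show "\<Phi> (vmul N k l B x j) = vmul N' k l (\<lambda>i j. \<Phi> (B i j)) (\<lambda>i. \<Phi> (x i)) j"
 proof (cases "j < l")
  case True
  have m: "x i \<in> velems N" for i using R.free_module_in[OF x] by simp
  have b: "B i j \<in> velems N" if "i < k" for i using B True that by (simp add: matrix_over_def)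
  have "\<Phi> (\<Oplus>\<^bsub>vring N\<^esub>i\<in>{..<k}. x i \<otimes>\<^bsub>vring N\<^esub> B i j) = (\<Oplus>\<^bsub>vring N'\<^esub>i\<in>{..<k}. \<Phi> (x i \<otimes>\<^bsub>vring N\<^esub> B i j))"
   by (rule finsum_map[where h=\<Phi>, OF R.abelian_group_axioms R'.abelian_group_axioms])
    (use m b R.m_closed \<Phi>_in \<Phi>_add in auto)
  also have "\<dots> = (\<Oplus>\<^bsub>vring N'\<^esub>i\<in>{..<k}. \<Phi> (x i) \<otimes>\<^bsub>vring N'\<^esub> \<Phi> (B i j))"
   using m b \<Phi>_in R'.m_closed by (intro R'.finsum_cong') (auto simp: \<Phi>_mult)
  finally show ?thesis using True by (simp add: row_mult_def)
 qed (simp add: row_mult_def \<Phi>_zero)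
qed

lemma row_mult_image:
 assumes B: "matrix_over (vring N) k l B"
 shows "vmul N' k l (\<lambda>i j. \<Phi> (B i j)) ` carrier (Fr N' k) =
  (\<lambda>y j. \<Phi> (y j)) ` vmul N k l B ` carrier (Fr N k)"
proof (rule subset_antisym; rule subsetI)
 fix y assume "y \<in> vmul N' k l (\<lambda>i j. \<Phi> (B i j)) ` carrier (Fr N' k)"
 then obtain x where x: "x \<in> carrier (Fr N' k)" "y = vmul N' k l (\<lambda>i j. \<Phi> (B i j)) x" by blast
 interpret S: vna_iso N' N \<Phi>' \<Phi> by (rule sym)
 let ?x = "\<lambda>i. \<Phi>' (x i)"
 have "(\<lambda>i. \<Phi> (?x i)) = x" by (rule S.free_inv[OF x(1)])
 hence "y = (\<lambda>j. \<Phi> (vmul N k l B ?x j))"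
  using row_mult_map[OF B S.free_map[OF x(1)]] x(2) by simp
 thus "y \<in> (\<lambda>y j. \<Phi> (y j)) ` vmul N k l B ` carrier (Fr N k)"
  using S.free_map[OF x(1)] by blast
next
 fix y assume "y \<in> (\<lambda>y j. \<Phi> (y j)) ` vmul N k l B ` carrier (Fr N k)"
 then obtain x where x: "x \<in> carrier (Fr N k)" "y = (\<lambda>j. \<Phi> (vmul N k l B x j))" by blast
 show "y \<in> vmul N' k l (\<lambda>i j. \<Phi> (B i j)) ` carrier (Fr N' k)"
  unfolding x(2) row_mult_map[OF B x(1)] by (rule imageI[OF free_map[OF x(1)]])
qed

lemma row_mult_subgroup:
 assumes B: "matrix_over (vring N) k l B"
 shows "add_subgroup (Fr N l) (vmul N k l B ` carrier (Fr N k))"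
proof -
 interpret Fk: left_mod "vring N" "Fr N k" by (rule R.free_left_mod)
 interpret Fl: left_mod "vring N" "Fr N l" by (rule R.free_left_mod)
 note c = row_mult_closed[OF B] and a = row_mult_add[OF B]
 note z = additive_zero[where f="vmul N k l B", OF Fk.M.abelian_group_axioms Fl.M.abelian_group_axioms c a]
 show ?thesis
  unfolding add_subgroup_def
 proof (intro conjI ballI)
  show "\<zero>\<^bsub>Fr N l\<^esub> \<in> vmul N k l B ` carrier (Fr N k)"
   by (rule image_eqI[where x="\<zero>\<^bsub>Fr N k\<^esub>"]) (simp_all only: z(1) Fk.M.zero_closed)
 next
  fix x y assume "x \<in> vmul N k l B ` carrier (Fr N k)" "y \<in> vmul N k l B ` carrier (Fr N k)"
  then obtain u v where uv: "u \<in> carrier (Fr N k)" "x = vmul N k l B u"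
   "v \<in> carrier (Fr N k)" "y = vmul N k l B v" by blast
  show "x \<oplus>\<^bsub>Fr N l\<^esub> y \<in> vmul N k l B ` carrier (Fr N k)"
   unfolding uv(2,4) a[OF uv(1,3), symmetric] by (rule imageI[OF Fk.M.a_closed[OF uv(1,3)]])
 next
  fix x assume "x \<in> vmul N k l B ` carrier (Fr N k)"
  then obtain u where u: "u \<in> carrier (Fr N k)" "x = vmul N k l B u" by blast
  have "\<ominus>\<^bsub>Fr N l\<^esub> x = vmul N k l B (\<ominus>\<^bsub>Fr N k\<^esub> u)"
   unfolding u(2) by (rule additive_zero(2)[where f="vmul N k l B", OF Fk.M.abelian_group_axioms Fl.M.abelian_group_axioms _ _ u(1), symmetric])
    (rule c a, assumption+)+
  thus "\<ominus>\<^bsub>Fr N l\<^esub> x \<in> vmul N k l B ` carrier (Fr N k)"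
   using Fk.M.a_inv_closed[OF u(1)] by blast
 qed (use c in blast)
qed

lemma row_mult_smult:
 assumes B: "matrix_over (vring N) k l B" and x: "x \<in> carrier (Fr N k)" and s: "s \<in> velems N"
 shows "s \<odot>\<^bsub>Fr N l\<^esub> vmul N k l B x = vmul N k l B (s \<odot>\<^bsub>Fr N k\<^esub> x)"
proof
 fix j
 show "(s \<odot>\<^bsub>Fr N l\<^esub> vmul N k l B x) j = vmul N k l B (s \<odot>\<^bsub>Fr N k\<^esub> x) j"
 proof (cases "j < l")
  case True
  have m: "x i \<in> carrier (vring N)" for i using R.free_module_in[OF x] by auto
  have b: "B i j \<in> carrier (vring N)" if "i < k" for i using B True that by (simp add: matrix_over_def)
  have s': "s \<in> carrier (vring N)" using s by simp
  have "s \<otimes>\<^bsub>vring N\<^esub> (\<Oplus>\<^bsub>vring N\<^esub>i\<in>{..<k}. x i \<otimes>\<^bsub>vring N\<^esub> B i j) = (\<Oplus>\<^bsub>vring N\<^esub>i\<in>{..<k}. s \<otimes>\<^bsub>vring N\<^esub> (x i \<otimes>\<^bsub>vring N\<^esub> B i j))"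
   using m b s' by (intro R.finsum_rdistr) (auto simp del: vring_simps)
  also have "\<dots> = (\<Oplus>\<^bsub>vring N\<^esub>i\<in>{..<k}. (s \<otimes>\<^bsub>vring N\<^esub> x i) \<otimes>\<^bsub>vring N\<^esub> B i j)"
   using m b s' by (intro R.finsum_cong') (auto simp: R.m_assoc simp del: vring_simps)
  finally show ?thesis using True by (simp add: row_mult_def)
 qed (use s R.r_null in \<open>simp add: row_mult_def\<close>)
qed

lemma presented_group: "matrix_over (vring N) k l B \<Longrightarrow> abelian_group (presented_module N k l B)"
proof -
 assume B: "matrix_over (vring N) k l B"
 interpret Fl: left_mod "vring N" "Fr N l" by (rule R.free_left_mod)
 have "add_subgroup (Fr N l) (carrier (Fr N l))"
  unfolding add_subgroup_def by (simp del: free_module_simps)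
 from quotient_abelian_group[OF Fl.M.abelian_group_axioms this row_mult_subgroup[OF B]]
 show ?thesis by (simp add: presented_module_def)
qed

text \<open>Applying \<Phi> to coordinates carries the row space of B onto that of the image matrix,
  and the map descends to the quotients. The composites with \<Phi>' are exactly the identity, so
  the differences required to be relations are zero.\<close>

lemma presented_iso:
 assumes B: "matrix_over (vring N) k l B"
 shows "\<exists>F. left_module_iso_along (vring N) \<Phi> (presented_module N k l B) (presented_module N' k l (\<lambda>i j. \<Phi> (B i j))) F"
proof -
 interpret S: vna_iso N' N \<Phi>' \<Phi> by (rule sym)
 let ?C = "Fr N l" and ?C' = "Fr N' l"
 interpret Fl: left_mod "vring N" ?C by (rule R.free_left_mod)
 interpret Fl': left_mod "vring N'" ?C' by (rule R'.free_left_mod)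
 let ?B = "vmul N k l B ` carrier (Fr N k)"
 let ?B' = "vmul N' k l (\<lambda>i j. \<Phi> (B i j)) ` carrier (Fr N' k)"
 note g = row_mult_subgroup[OF B] S.row_mult_subgroup[OF matrix_map[OF B]]
 have 0: "\<zero>\<^bsub>?C\<^esub> \<in> ?B" "\<zero>\<^bsub>?C'\<^esub> \<in> ?B'" using g by (auto simp only: add_subgroup_def)
 have "\<exists>F. left_module_iso_along (vring N) \<Phi> (quotient_module (?C\<lparr>carrier := carrier ?C\<rparr>) ?B) (quotient_module (?C'\<lparr>carrier := carrier ?C'\<rparr>) ?B') F"
 proof (rule quotient_module_iso[where f="\<lambda>x i. \<Phi> (x i)" and g="\<lambda>x i. \<Phi>' (x i)" and S'="vring N'",
    OF Fl.M.abelian_group_axioms Fl'.M.abelian_group_axioms g order_refl order_refl Fl.M.a_closed])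
  fix x assume x: "x \<in> carrier ?C"
  show "(\<lambda>i. \<Phi> (x i)) \<in> carrier ?C'" by (rule free_map[OF x])
  show "(\<lambda>i. \<Phi> (x i)) \<in> carrier ?C'" by (rule free_map[OF x])
  have "x \<ominus>\<^bsub>?C\<^esub> x = \<zero>\<^bsub>?C\<^esub>" using x by (simp add: a_minus_def Fl.M.r_neg del: free_module_simps)
  thus "(\<lambda>i. \<Phi>' (\<Phi> (x i))) \<ominus>\<^bsub>?C\<^esub> x \<in> ?B" using 0 free_inv[OF x] by simp
  fix s assume s: "s \<in> carrier (vring N)"
  show "s \<odot>\<^bsub>?C\<^esub> x \<in> carrier ?C" "s \<odot>\<^bsub>?C\<^esub> x \<in> carrier ?C" using Fl.smult_closed[OF s x] by blast+
  show "(\<lambda>i. \<Phi> ((s \<odot>\<^bsub>?C\<^esub> x) i)) = \<Phi> s \<odot>\<^bsub>?C'\<^esub> (\<lambda>i. \<Phi> (x i))"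
   using s R.free_module_in[OF x] by (simp add: \<Phi>_mult)
 next
  fix x y assume x: "x \<in> carrier ?C" and y: "y \<in> carrier ?C"
  show "(\<lambda>i. \<Phi> ((x \<oplus>\<^bsub>?C\<^esub> y) i)) = (\<lambda>i. \<Phi> (x i)) \<oplus>\<^bsub>?C'\<^esub> (\<lambda>i. \<Phi> (y i))"
   using R.free_module_in[OF x] R.free_module_in[OF y] by (simp add: \<Phi>_add)
  fix s assume s: "s \<in> carrier (vring N)"
  show "s \<odot>\<^bsub>?C\<^esub> (x \<oplus>\<^bsub>?C\<^esub> y) = s \<odot>\<^bsub>?C\<^esub> x \<oplus>\<^bsub>?C\<^esub> s \<odot>\<^bsub>?C\<^esub> y" by (rule Fl.smult_add[OF s x y])
 next
  fix x assume "x \<in> ?B"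
  thus "(\<lambda>i. \<Phi> (x i)) \<in> ?B'" unfolding row_mult_image[OF B] by (rule imageI)
 next
  fix x assume x: "x \<in> carrier ?C'"
  show "(\<lambda>i. \<Phi>' (x i)) \<in> carrier ?C" by (rule S.free_map[OF x])
  show "(\<lambda>i. \<Phi>' (x i)) \<in> carrier ?C" by (rule S.free_map[OF x])
  have "x \<ominus>\<^bsub>?C'\<^esub> x = \<zero>\<^bsub>?C'\<^esub>" using x by (simp add: a_minus_def Fl'.M.r_neg del: free_module_simps)
  thus "(\<lambda>i. \<Phi> (\<Phi>' (x i))) \<ominus>\<^bsub>?C'\<^esub> x \<in> ?B'" using 0 S.free_inv[OF x] by simp
  fix s assume s: "s \<in> carrier (vring N')"
  show "s \<odot>\<^bsub>?C'\<^esub> x \<in> carrier ?C'" by (rule Fl'.smult_closed[OF s x])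
 next
  fix x y assume x: "x \<in> carrier ?C'" and y: "y \<in> carrier ?C'"
  show "(\<lambda>i. \<Phi>' ((x \<oplus>\<^bsub>?C'\<^esub> y) i)) = (\<lambda>i. \<Phi>' (x i)) \<oplus>\<^bsub>?C\<^esub> (\<lambda>i. \<Phi>' (y i))"
   using R'.free_module_in[OF x] R'.free_module_in[OF y] by (simp add: S.\<Phi>_add)
  fix s assume s: "s \<in> carrier (vring N')"
  show "s \<odot>\<^bsub>?C'\<^esub> (x \<oplus>\<^bsub>?C'\<^esub> y) = s \<odot>\<^bsub>?C'\<^esub> x \<oplus>\<^bsub>?C'\<^esub> s \<odot>\<^bsub>?C'\<^esub> y" by (rule Fl'.smult_add[OF s x y])
 next
  fix x assume "x \<in> ?B'"
  then obtain y where y: "y \<in> ?B" "x = (\<lambda>j. \<Phi> (y j))" unfolding row_mult_image[OF B] by blast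
  hence "y \<in> carrier ?C" using g by (auto simp only: add_subgroup_def)
  thus "(\<lambda>i. \<Phi>' (x i)) \<in> ?B" unfolding y(2) using y(1) by (simp only: free_inv)
 next
  fix s x assume s: "s \<in> carrier (vring N)" and "x \<in> ?B"
  then obtain u where u: "u \<in> carrier (Fr N k)" "x = vmul N k l B u" by blast
  show "s \<odot>\<^bsub>?C\<^esub> x \<in> ?B" unfolding u(2) row_mult_smult[OF B u(1) s[unfolded vring_simps]]
   by (rule imageI[OF left_mod.smult_closed[OF R.free_left_mod s u(1)]])
 next
  fix s x assume s: "s \<in> carrier (vring N')" and "x \<in> ?B'"
  then obtain u where u: "u \<in> carrier (Fr N' k)" "x = vmul N' k l (\<lambda>i j. \<Phi> (B i j)) u" by blast
  show "s \<odot>\<^bsub>?C'\<^esub> x \<in> ?B'" unfolding u(2) S.row_mult_smult[OF matrix_map[OF B] u(1) s[unfolded vring_simps]]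
   by (rule imageI[OF left_mod.smult_closed[OF R'.free_left_mod s u(1)]])
 next
  fix s assume "s \<in> carrier (vring N)" thus "\<Phi> s \<in> carrier (vring N')" using \<Phi>_in by simp
 qed
 thus ?thesis by (simp add: presented_module_def)
qed

end

section \<open>Inequalities for dimension and capacity\<close>

lemma submodule_iff:
 assumes Q: "abelian_group Q"
 shows "submodule P R Q \<longleftrightarrow> add_subgroup Q P \<and> (\<forall>r\<in>carrier R. \<forall>x\<in>P. r \<odot>\<^bsub>Q\<^esub> x \<in> P)"
 unfolding submodule_def submodule_axioms_def add_subgroup_def subgroup_def a_inv_def by auto

lemma left_module_iso_alongD:
 assumes "left_module_iso_along R \<Phi> M N f"
 shows "bij_betw f (carrier M) (carrier N)" "x \<in> carrier M \<Longrightarrow> f x \<in> carrier N"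
  "x \<in> carrier M \<Longrightarrow> y \<in> carrier M \<Longrightarrow> f (x \<oplus>\<^bsub>M\<^esub> y) = f x \<oplus>\<^bsub>N\<^esub> f y"
  "r \<in> carrier R \<Longrightarrow> x \<in> carrier M \<Longrightarrow> f (r \<odot>\<^bsub>M\<^esub> x) = \<Phi> r \<odot>\<^bsub>N\<^esub> f x"
 using assms by (auto simp: left_module_iso_along_def bij_betw_def)

lemma submodule_image:
 assumes Q: "abelian_group Q" "abelian_group Q'" and f: "left_module_iso_along R \<Phi> Q Q' f"
  and P: "submodule P R Q" and \<Phi>: "\<Phi> ` carrier R = carrier R'"
 shows "submodule (f ` P) R' Q'"
proof -
 note D = left_module_iso_alongD[OF f]
 have PQ: "P \<subseteq> carrier Q" "\<zero>\<^bsub>Q\<^esub> \<in> P" "\<And>x y. x \<in> P \<Longrightarrow> y \<in> P \<Longrightarrow> x \<oplus>\<^bsub>Q\<^esub> y \<in> P" "\<And>x. x \<in> P \<Longrightarrow> \<ominus>\<^bsub>Q\<^esub> x \<in> P"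
  "\<And>r x. r \<in> carrier R \<Longrightarrow> x \<in> P \<Longrightarrow> r \<odot>\<^bsub>Q\<^esub> x \<in> P"
  using P unfolding submodule_iff[OF Q(1)] add_subgroup_def by auto
 have c: "\<And>x. x \<in> P \<Longrightarrow> x \<in> carrier Q" using PQ by blast
 have z: "f \<zero>\<^bsub>Q\<^esub> = \<zero>\<^bsub>Q'\<^esub>" by (rule additive_zero(1)[where f=f, OF Q D(2,3)])
 have m: "f (\<ominus>\<^bsub>Q\<^esub> x) = \<ominus>\<^bsub>Q'\<^esub> f x" if "x \<in> carrier Q" for x
  by (rule additive_zero(2)[where f=f, OF Q _ _ that]) (rule D, assumption+)+
 show ?thesis
  unfolding submodule_iff[OF Q(2)] add_subgroup_def
 proof (intro conjI ballI)
  show "f ` P \<subseteq> carrier Q'" using D(2) c by blast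
  show "\<zero>\<^bsub>Q'\<^esub> \<in> f ` P" using z PQ(2) by (metis imageI)
 next
  fix x y assume "x \<in> f ` P" "y \<in> f ` P"
  then obtain u v where uv: "u \<in> P" "x = f u" "v \<in> P" "y = f v" by blast
  show "x \<oplus>\<^bsub>Q'\<^esub> y \<in> f ` P" unfolding uv(2,4) D(3)[OF c[OF uv(1)] c[OF uv(3)], symmetric] by (rule imageI[OF PQ(3)[OF uv(1,3)]])
 next
  fix x assume "x \<in> f ` P"
  then obtain u where u: "u \<in> P" "x = f u" by blast
  show "\<ominus>\<^bsub>Q'\<^esub> x \<in> f ` P" unfolding u(2) m[OF c[OF u(1)], symmetric] by (rule imageI[OF PQ(4)[OF u(1)]])
 next
  fix r' x assume "r' \<in> carrier R'" "x \<in> f ` P"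
  then obtain r u where u: "u \<in> P" "x = f u" "r \<in> carrier R" "r' = \<Phi> r" using \<Phi> by blast
  show "r' \<odot>\<^bsub>Q'\<^esub> x \<in> f ` P" unfolding u(2,4) D(4)[OF u(3) c[OF u(1)], symmetric] by (rule imageI[OF PQ(5)[OF u(3,1)]])
 qed
qed

context vna_iso
begin

lemma \<Phi>_image: "\<Phi> ` carrier (vring N) = carrier (vring N')"
proof (intro equalityI subsetI)
 fix y assume "y \<in> \<Phi> ` carrier (vring N)" thus "y \<in> carrier (vring N')" using \<Phi>_in by auto
next
 fix y assume "y \<in> carrier (vring N')"
 hence "y = \<Phi> (\<Phi>' y)" "\<Phi>' y \<in> carrier (vring N)" using inv' \<Phi>'_in by auto
 thus "y \<in> \<Phi> ` carrier (vring N)" by (rule image_eqI)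
qed

text \<open>Each competitor (k, E, P) in the supremum has a counterpart with the matrix \<Phi>(E)
  and the submodule f(P), of the same trace. The isomorphism onto f(P) is f after the old one after
  \<Phi>' on coordinates.\<close>

lemma dim_le:
 assumes Q: "abelian_group Q" "abelian_group Q'" and f: "left_module_iso_along (vring N) \<Phi> Q Q' f"
 shows "dim_vna N Q \<le> dim_vna N' Q'"
proof -
 interpret S: vna_iso N' N \<Phi>' \<Phi> by (rule sym)
 note D = left_module_iso_alongD[OF f]
 show ?thesis
  unfolding dim_vna_def
 proof (rule Sup_subset_mono, rule subsetI, elim CollectE exE conjE)
  fix d k E P f0
  assume d: "d = ennreal (\<Sum>i<k. Re (vtrace N (E i i)))" and E: "matrix_over (vring N) k k E" "projection_matrix (vspace N) k E"
   and P: "submodule P (vring N) Q"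
   and f0: "left_module_iso_along (vring N) id ((Fr N k)\<lparr>carrier :=
     vmul N k k E ` carrier (Fr N k)\<rparr>) (Q\<lparr>carrier := P\<rparr>) f0"
  let ?X = "vmul N k k E ` carrier (Fr N k)"
  let ?E = "\<lambda>i j. \<Phi> (E i j)"
  let ?X' = "vmul N' k k ?E ` carrier (Fr N' k)"
  have f0b: "bij_betw f0 ?X P"
   and f0a: "\<And>x y. x \<in> ?X \<Longrightarrow> y \<in> ?X \<Longrightarrow> f0 (x \<oplus>\<^bsub>Fr N k\<^esub> y) = f0 x \<oplus>\<^bsub>Q\<^esub> f0 y"
   and f0s: "\<And>r x. r \<in> velems N \<Longrightarrow> x \<in> ?X \<Longrightarrow> f0 (r \<odot>\<^bsub>Fr N k\<^esub> x) = r \<odot>\<^bsub>Q\<^esub> f0 x"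
   using f0 unfolding left_module_iso_along_def by (auto simp: free_module_def)
  have PQ: "P \<subseteq> carrier Q" using P unfolding submodule_iff[OF Q(1)] add_subgroup_def by auto
  have XF: "\<And>x. x \<in> ?X \<Longrightarrow> x \<in> carrier (Fr N k)" using row_mult_closed[OF E(1)] by auto
  have X': "?X' = (\<lambda>y j. \<Phi> (y j)) ` ?X" by (rule row_mult_image[OF E(1)])
  have retract: "(\<lambda>j. \<Phi>' (\<Phi> (x j))) = x" if "x \<in> ?X" for x by (rule free_inv[OF XF[OF that]])
  let ?g = "\<lambda>y. f (f0 (\<lambda>j. \<Phi>' (y j)))"
  have gX: "?g (\<lambda>j. \<Phi> (x j)) = f (f0 x)" if "x \<in> ?X" for x using retract[OF that] by simp
  have f0P: "f0 x \<in> carrier Q" if "x \<in> ?X" for x using f0b PQ that by (auto simp: bij_betw_def)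
  have b1: "bij_betw (\<lambda>y j. \<Phi>' (y j)) ?X' ?X"
  proof (rule bij_betwI[where g="\<lambda>x j. \<Phi> (x j)"])
   have r: "(\<lambda>j. \<Phi>' (y j)) \<in> ?X \<and> (\<lambda>j. \<Phi> (\<Phi>' (y j))) = y" if y: "y \<in> ?X'" for y
   proof -
    obtain x where x: "x \<in> ?X" "y = (\<lambda>j. \<Phi> (x j))" using y unfolding X' by blast
    have e: "(\<lambda>j. \<Phi>' (y j)) = x" unfolding x(2) by (rule retract[OF x(1)])
    have "(\<lambda>j. \<Phi> (\<Phi>' (y j))) = y"
    proof
     fix j
     have "\<Phi>' (y j) = x j" using fun_cong[OF e] by (simp only:)
     thus "\<Phi> (\<Phi>' (y j)) = y j" using x(2) by (simp only:)
    qed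
    with x(1) show ?thesis unfolding e by (rule conjI)
   qed
   show "(\<lambda>y j. \<Phi>' (y j)) \<in> ?X' \<rightarrow> ?X" by (rule funcsetI, rule conjunct1, rule r)
   show "(\<lambda>x j. \<Phi> (x j)) \<in> ?X \<rightarrow> ?X'" unfolding X' by (rule funcsetI, rule imageI)
   show "(\<lambda>j. \<Phi> (\<Phi>' (y j))) = y" if "y \<in> ?X'" for y by (rule conjunct2, rule r, rule that)
   show "(\<lambda>j. \<Phi>' (\<Phi> (x j))) = x" if "x \<in> ?X" for x by (rule retract, rule that)
  qed
  have b2: "bij_betw f P (f ` P)" using D(1) PQ by (auto simp: bij_betw_def inj_on_subset)
  have bij: "bij_betw ?g ?X' (f ` P)"
   using bij_betw_trans[OF bij_betw_trans[OF b1 f0b] b2] by (simp add: o_def)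
  have mem: "\<And>x j. x \<in> ?X \<Longrightarrow> x j \<in> velems N" using ring.free_module_in[OF rings(1) XF] by simp
  have iso: "left_module_iso_along (vring N') id ((Fr N' k)\<lparr>carrier := ?X'\<rparr>) (Q'\<lparr>carrier := f ` P\<rparr>) ?g"
   unfolding left_module_iso_along_def
  proof (intro conjI ballI)
   show "bij_betw ?g (carrier ((Fr N' k)\<lparr>carrier := ?X'\<rparr>)) (carrier (Q'\<lparr>carrier := f ` P\<rparr>))" using bij by simp
  next
   fix x' y' assume "x' \<in> carrier ((Fr N' k)\<lparr>carrier := ?X'\<rparr>)" "y' \<in> carrier ((Fr N' k)\<lparr>carrier := ?X'\<rparr>)"
   hence "x' \<in> ?X'" "y' \<in> ?X'" by simp_all
   then obtain x y where xy: "x \<in> ?X" "x' = (\<lambda>j. \<Phi> (x j))" "y \<in> ?X" "y' = (\<lambda>j. \<Phi> (y j))" unfolding X' by blast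
   have s: "x \<oplus>\<^bsub>Fr N k\<^esub> y \<in> ?X"
    using row_mult_subgroup[OF E(1)] xy(1,3) unfolding add_subgroup_def by blast
   have "x' \<oplus>\<^bsub>(Fr N' k)\<lparr>carrier := ?X'\<rparr>\<^esub> y' = (\<lambda>j. \<Phi> ((x \<oplus>\<^bsub>Fr N k\<^esub> y) j))"
    using mem[OF xy(1)] mem[OF xy(3)] unfolding xy(2,4) by (simp add: free_module_def \<Phi>_add)
   hence "?g (x' \<oplus>\<^bsub>(Fr N' k)\<lparr>carrier := ?X'\<rparr>\<^esub> y') = f (f0 (x \<oplus>\<^bsub>Fr N k\<^esub> y))"
    using gX[OF s] by (simp only:)
   also have "\<dots> = f (f0 x) \<oplus>\<^bsub>Q'\<^esub> f (f0 y)" unfolding f0a[OF xy(1,3)] by (rule D(3)[OF f0P[OF xy(1)] f0P[OF xy(3)]])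
   finally show "?g (x' \<oplus>\<^bsub>(Fr N' k)\<lparr>carrier := ?X'\<rparr>\<^esub> y') = ?g x' \<oplus>\<^bsub>Q'\<lparr>carrier := f ` P\<rparr>\<^esub> ?g y'"
    using gX[OF xy(1)] gX[OF xy(3)] unfolding xy(2,4) by simp
  next
   fix r' x' assume "r' \<in> carrier (vring N')" "x' \<in> carrier ((Fr N' k)\<lparr>carrier := ?X'\<rparr>)"
   hence r': "r' \<in> velems N'" and "x' \<in> ?X'" by simp_all
   then obtain x where x: "x \<in> ?X" "x' = (\<lambda>j. \<Phi> (x j))" unfolding X' by blast
   define r where "r = \<Phi>' r'"
   have r: "r \<in> velems N" "r' = \<Phi> r" using r' \<Phi>'_in inv' by (auto simp: r_def)
   obtain u where u: "u \<in> carrier (Fr N k)" "x = vmul N k k E u" using x by blast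
   have s: "r \<odot>\<^bsub>Fr N k\<^esub> x \<in> ?X"
    unfolding u(2) row_mult_smult[OF E(1) u(1) r(1)]
    by (rule imageI[OF left_mod.smult_closed[OF ring.free_left_mod[OF rings(1)] _ u(1)]]) (use r in simp)
   have "r' \<odot>\<^bsub>(Fr N' k)\<lparr>carrier := ?X'\<rparr>\<^esub> x' = (\<lambda>j. \<Phi> ((r \<odot>\<^bsub>Fr N k\<^esub> x) j))"
    using mem[OF x(1)] r unfolding x(2) by (simp add: free_module_def \<Phi>_mult)
   hence "?g (r' \<odot>\<^bsub>(Fr N' k)\<lparr>carrier := ?X'\<rparr>\<^esub> x') = f (f0 (r \<odot>\<^bsub>Fr N k\<^esub> x))"
    using gX[OF s] by (simp only:)
   also have "\<dots> = r' \<odot>\<^bsub>Q'\<^esub> f (f0 x)" unfolding f0s[OF r(1) x(1)] r(2) by (rule D(4)) (use r f0P[OF x(1)] in simp_all)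
   finally show "?g (r' \<odot>\<^bsub>(Fr N' k)\<lparr>carrier := ?X'\<rparr>\<^esub> x') = id r' \<odot>\<^bsub>Q'\<lparr>carrier := f ` P\<rparr>\<^esub> ?g x'"
    using gX[OF x(1)] unfolding x(2) by simp
  qed
  have deq: "d = ennreal (\<Sum>i<k. Re (vtrace N' (?E i i)))"
   using E(1) trace unfolding d by (simp add: matrix_over_def)
  have sub: "submodule (f ` P) (vring N') Q'" by (rule submodule_image[OF Q f P \<Phi>_image])
  show "d \<in> {ennreal (\<Sum>i<k. Re (vtrace N' (E i i))) | k E P f.
    matrix_over (vring N') k k E \<and> projection_matrix (vspace N') k E \<and> submodule P (vring N') Q' \<and>
    left_module_iso_along (vring N') id ((Fr N' k)\<lparr>carrier :=
     vmul N' k k E ` carrier (Fr N' k)\<rparr>) (Q'\<lparr>carrier := P\<rparr>) f}"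
   by (rule CollectI, rule exI[of _ k], rule exI[of _ ?E], rule exI[of _ "f ` P"], rule exI[of _ ?g])
    (intro conjI, rule deq, rule matrix_map[OF E(1)], rule proj[OF E], rule sub, rule iso)
 qed
qed

lemma zero_dim_presented:
 assumes B: "matrix_over (vring N) k l B" and 0: "dim_vna N (presented_module N k l B) = 0"
 shows "dim_vna N' (presented_module N' k l (\<lambda>i j. \<Phi> (B i j))) = 0"
proof -
 interpret S: vna_iso N' N \<Phi>' \<Phi> by (rule sym)
 let ?B = "\<lambda>i j. \<Phi> (B i j)"
 have B': "matrix_over (vring N') k l ?B" by (rule matrix_map[OF B])
 obtain F where "left_module_iso_along (vring N') \<Phi>' (presented_module N' k l ?B) (presented_module N k l (\<lambda>i j. \<Phi>' (?B i j))) F"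
  using S.presented_iso[OF B'] by blast
 from S.dim_le[OF S.presented_group[OF B'] presented_group[OF S.matrix_map[OF B']] this]
 have "dim_vna N' (presented_module N' k l ?B) \<le> dim_vna N (presented_module N k l (\<lambda>i j. \<Phi>' (?B i j)))" .
 \<comment> \<open>\<Phi>' and \<Phi> cancel only on entries known to lie in the algebra, those with
   i < k and j < l. Outside this range the two matrices may differ, but row multiplication does not
   look there.\<close>
 also have "presented_module N k l (\<lambda>i j. \<Phi>' (?B i j)) = presented_module N k l B"
 proof -
  have "vmul N k l (\<lambda>i j. \<Phi>' (?B i j)) x = vmul N k l B x" if x: "x \<in> carrier (Fr N k)" for x
  proof
   fix j
   interpret R: ring "vring N" by (rule rings)
   have "(\<Oplus>\<^bsub>vring N\<^esub>i\<in>{..<k}. x i \<otimes>\<^bsub>vring N\<^esub> \<Phi>' (?B i j)) = (\<Oplus>\<^bsub>vring N\<^esub>i\<in>{..<k}. x i \<otimes>\<^bsub>vring N\<^esub> B i j)" if "j < l"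
    using B that inv R.free_module_in[OF x] R.m_closed by (intro R.finsum_cong') (auto simp: matrix_over_def)
   thus "vmul N k l (\<lambda>i j. \<Phi>' (?B i j)) x j = vmul N k l B x j" by (simp add: row_mult_def)
  qed
  thus ?thesis unfolding presented_module_def by (metis (no_types, lifting) image_cong)
 qed
 finally show ?thesis using 0 by simp
qed

text \<open>The new covering map is f after the old one after the inverse of
  \<open>presented_iso\<close>; it has the scalars changed twice, so it is linear over the new
  algebra.\<close>

lemma zero_dim_cover_map:
 assumes f: "left_module_iso_along (vring N) \<Phi> Q Q' f" and z: "zero_dim_cover N Q k l B"
 shows "zero_dim_cover N' Q' k l (\<lambda>i j. \<Phi> (B i j))"
proof -
 interpret S: vna_iso N' N \<Phi>' \<Phi> by (rule sym)
 note D = left_module_iso_alongD[OF f]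
 let ?B = "\<lambda>i j. \<Phi> (B i j)"
 let ?P = "presented_module N k l B" and ?P' = "presented_module N' k l ?B"
 have B: "matrix_over (vring N) k l B" and d: "dim_vna N ?P = 0" using z by (auto simp: zero_dim_cover_def)
 obtain h where h: "semilinear (vring N) (\<lambda>r. r) ?P Q h" "h ` carrier ?P = carrier Q"
  using z unfolding zero_dim_cover_def left_module_hom_semilinear by blast
 obtain F where F: "left_module_iso_along (vring N) \<Phi> ?P ?P' F" using presented_iso[OF B] by blast
 note FD = left_module_iso_alongD[OF F]
 interpret P: abelian_group ?P by (rule presented_group[OF B])
 let ?G = "inv_into (carrier ?P) F"
 have G: "?G y \<in> carrier ?P" "F (?G y) = y" if "y \<in> carrier ?P'" for y
  using FD(1) that by (auto simp: bij_betw_def f_inv_into_f inv_into_into)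
 have GF: "?G (F x) = x" if "x \<in> carrier ?P" for x using FD(1) that by (auto simp: bij_betw_def)
 \<comment> \<open>Semilinearity of the inverse of F is deduced by applying F, which needs scalar
   multiples of cosets to be cosets again.\<close>
 have Psm: "r \<odot>\<^bsub>?P\<^esub> x \<in> carrier ?P" if r0: "r \<in> velems N" and x0: "x \<in> carrier ?P" for r x
 proof -
  interpret Fl: left_mod "vring N" "Fr N l" by (rule ring.free_left_mod[OF rings(1)])
  let ?C = "Fr N l" and ?Bk = "vmul N k l B ` carrier (Fr N k)"
  have P: "?P = quotient_module (?C\<lparr>carrier := carrier ?C\<rparr>) ?Bk" by (simp add: presented_module_def)
  obtain z where z: "z \<in> carrier ?C" "x = add_coset ?C ?Bk z" using x0 unfolding P quotient_module_simps by blast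
  have r: "r \<in> carrier (vring N)" using r0 by simp
  have rz: "r \<odot>\<^bsub>?C\<^esub> z \<in> carrier ?C" by (rule Fl.smult_closed[OF r z(1)])
  have "(\<Union>y\<in>x. add_coset ?C ?Bk (r \<odot>\<^bsub>?C\<^esub> y)) = add_coset ?C ?Bk (r \<odot>\<^bsub>?C\<^esub> z)"
  proof (rule SUP_eq_const)
   show "x \<noteq> {}" using add_coset_self[OF Fl.M.abelian_group_axioms row_mult_subgroup[OF B] z(1)] z(2) by auto
   fix y assume "y \<in> x"
   then obtain b where b: "b \<in> ?Bk" "y = b \<oplus>\<^bsub>?C\<^esub> z" unfolding z(2) add_coset_def by blast
   have bC: "b \<in> carrier ?C" using b(1) row_mult_closed[OF B] by blast
   obtain u where u: "u \<in> carrier (Fr N k)" "b = vmul N k l B u" using b by blast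
   have rb: "r \<odot>\<^bsub>?C\<^esub> b \<in> ?Bk" unfolding u(2) row_mult_smult[OF B u(1) r0]
    by (rule imageI[OF left_mod.smult_closed[OF ring.free_left_mod[OF rings(1)] r u(1)]])
   have rbC: "r \<odot>\<^bsub>?C\<^esub> b \<in> carrier ?C" by (rule Fl.smult_closed[OF r bC])
   have "(r \<odot>\<^bsub>?C\<^esub> b \<oplus>\<^bsub>?C\<^esub> r \<odot>\<^bsub>?C\<^esub> z) \<ominus>\<^bsub>?C\<^esub> (r \<odot>\<^bsub>?C\<^esub> z) = r \<odot>\<^bsub>?C\<^esub> b"
    using rz rbC by (simp add: a_minus_def Fl.M.a_assoc Fl.M.r_neg del: free_module_simps)
   thus "add_coset ?C ?Bk (r \<odot>\<^bsub>?C\<^esub> y) = add_coset ?C ?Bk (r \<odot>\<^bsub>?C\<^esub> z)"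
    unfolding b(2) Fl.smult_add[OF r bC z(1)] add_coset_eq[OF Fl.M.abelian_group_axioms row_mult_subgroup[OF B] Fl.M.a_closed[OF rbC rz] rz]
    using rb by (simp only:)
  qed
  thus ?thesis unfolding P quotient_module_simps using rz by (simp only: imageI)
 qed
 have G2: "?G (x \<oplus>\<^bsub>?P'\<^esub> y) = ?G x \<oplus>\<^bsub>?P\<^esub> ?G y" if "x \<in> carrier ?P'" "y \<in> carrier ?P'" for x y
  using GF[OF P.a_closed[OF G(1)[OF that(1)] G(1)[OF that(2)]]] FD(3)[OF G(1)[OF that(1)] G(1)[OF that(2)]] G(2)[OF that(1)] G(2)[OF that(2)]
  by simp
 have G3: "?G (r \<odot>\<^bsub>?P'\<^esub> x) = \<Phi>' r \<odot>\<^bsub>?P\<^esub> ?G x" if "r \<in> velems N'" "x \<in> carrier ?P'" for r x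
  using GF[OF Psm[OF \<Phi>'_in[OF that(1)] G(1)[OF that(2)]]] FD(4)[OF _ G(1)[OF that(2)], of "\<Phi>' r"] \<Phi>'_in[OF that(1)] inv'[OF that(1)] G(2)[OF that(2)]
  by simp
 have "semilinear (vring N') (\<lambda>r. r) ?P' Q' (\<lambda>x. f (h (?G x)))"
  unfolding semilinear_def
 proof (intro conjI ballI funcsetI)
  fix x assume x: "x \<in> carrier ?P'"
  show "f (h (?G x)) \<in> carrier Q'" by (rule D(2)[OF semilinearD(1)[OF h(1) G(1)[OF x]]])
  fix y assume y: "y \<in> carrier ?P'"
  show "f (h (?G (x \<oplus>\<^bsub>?P'\<^esub> y))) = f (h (?G x)) \<oplus>\<^bsub>Q'\<^esub> f (h (?G y))"
   unfolding G2[OF x y] semilinearD(2)[OF h(1) G(1)[OF x] G(1)[OF y]]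
   by (rule D(3)[OF semilinearD(1)[OF h(1) G(1)[OF x]] semilinearD(1)[OF h(1) G(1)[OF y]]])
 next
  fix r x assume "r \<in> carrier (vring N')" and x: "x \<in> carrier ?P'"
  hence r: "r \<in> velems N'" by simp
  have r': "\<Phi>' r \<in> carrier (vring N)" using \<Phi>'_in[OF r] by simp
  show "f (h (?G (r \<odot>\<^bsub>?P'\<^esub> x))) = r \<odot>\<^bsub>Q'\<^esub> f (h (?G x))"
   unfolding G3[OF r x] semilinearD(3)[OF h(1) r' G(1)[OF x]] D(4)[OF r' semilinearD(1)[OF h(1) G(1)[OF x]]] inv'[OF r] ..
 qed
 moreover have "(\<lambda>x. f (h (?G x))) ` carrier ?P' = carrier Q'"
 proof -
  have "?G ` carrier ?P' = carrier ?P" using bij_betw_inv_into[OF FD(1)] by (simp add: bij_betw_def)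
  hence "(\<lambda>x. f (h (?G x))) ` carrier ?P' = f ` h ` carrier ?P" by (metis image_image)
  thus ?thesis using h(2) D(1) by (simp add: bij_betw_def)
 qed
 ultimately show ?thesis
  unfolding zero_dim_cover_def left_module_hom_semilinear
  using matrix_map[OF B] zero_dim_presented[OF B d] by blast
qed

lemma measurable_capacity_le:
 assumes f: "left_module_iso_along (vring N) \<Phi> Q Q' f"
 shows "measurable_capacity N' Q' \<le> measurable_capacity N Q" "measurable_module N Q \<Longrightarrow> measurable_module N' Q'"
proof -
 show "measurable_capacity N' Q' \<le> measurable_capacity N Q"
  unfolding measurable_capacity_def
 proof (rule Inf_superset_mono, rule subsetI, elim CollectE exE conjE)
  fix c k l B assume c: "c = presented_capacity N k l B" and z: "zero_dim_cover N Q k l B"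
  have "matrix_over (vring N) k l B" using z by (simp add: zero_dim_cover_def)
  hence "c = presented_capacity N' k l (\<lambda>i j. \<Phi> (B i j))" unfolding c presented_capacity_def by (simp add: novikov)
  thus "c \<in> {presented_capacity N' k l B |k l B. zero_dim_cover N' Q' k l B}" using zero_dim_cover_map[OF f z] by blast
 qed
 show "measurable_module N Q \<Longrightarrow> measurable_module N' Q'" unfolding measurable_module_def using zero_dim_cover_map[OF f] by blast
qed

text \<open>Capacity is a supremum of infima. More covers make the infimum smaller, so the
  inequality between measurable capacities runs the wrong way for the supremum; each submodule
  therefore needs equality, obtained from f on P together with its inverse.\<close>

lemma capacity_le:
 assumes Q: "abelian_group Q" "abelian_group Q'" and f: "left_module_iso_along (vring N) \<Phi> Q Q' f"
 shows "capacity N Q \<le> capacity N' Q'"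
proof -
 interpret S: vna_iso N' N \<Phi>' \<Phi> by (rule sym)
 note D = left_module_iso_alongD[OF f]
 show ?thesis
  unfolding capacity_def
 proof (rule Sup_subset_mono, rule subsetI, elim CollectE exE conjE)
  fix c P assume c: "c = measurable_capacity N (Q\<lparr>carrier := P\<rparr>)" and P: "submodule P (vring N) Q" and m: "measurable_module N (Q\<lparr>carrier := P\<rparr>)"
  let ?P = "Q\<lparr>carrier := P\<rparr>" and ?P' = "Q'\<lparr>carrier := f ` P\<rparr>"
  have PQ: "P \<subseteq> carrier Q" "\<And>x y. x \<in> P \<Longrightarrow> y \<in> P \<Longrightarrow> x \<oplus>\<^bsub>Q\<^esub> y \<in> P" "\<And>r x. r \<in> velems N \<Longrightarrow> x \<in> P \<Longrightarrow> r \<odot>\<^bsub>Q\<^esub> x \<in> P"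
   using P unfolding submodule_iff[OF Q(1)] add_subgroup_def by auto
  have cP: "\<And>x. x \<in> P \<Longrightarrow> x \<in> carrier Q" using PQ by blast
  have inj: "inj_on f P" using D(1) PQ(1) by (auto simp: bij_betw_def inj_on_subset)
  have i: "left_module_iso_along (vring N) \<Phi> ?P ?P' f"
   using D(3,4) cP inj by (auto simp: left_module_iso_along_def bij_betw_def)
  let ?g = "inv_into P f"
  have g: "?g (f x) = x" if "x \<in> P" for x using inj that by simp
  have g_add: "?g (f x \<oplus>\<^bsub>Q'\<^esub> f y) = x \<oplus>\<^bsub>Q\<^esub> y" if "x \<in> P" "y \<in> P" for x y
   using g[OF PQ(2)[OF that]] D(3)[OF cP[OF that(1)] cP[OF that(2)]] by simp
  have g_smult: "?g (r \<odot>\<^bsub>Q'\<^esub> f x) = \<Phi>' r \<odot>\<^bsub>Q\<^esub> x" if "x \<in> P" "r \<in> velems N'" for x r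
   using g[OF PQ(3)[OF \<Phi>'_in[OF that(2)] that(1)]] D(4)[OF _ cP[OF that(1)], of "\<Phi>' r"] \<Phi>'_in[OF that(2)] inv'[OF that(2)] by simp
  have j: "left_module_iso_along (vring N') \<Phi>' ?P' ?P ?g"
   unfolding left_module_iso_along_def using bij_betw_inv_into[of f P "f ` P"] inj g g_add g_smult
   by (auto simp: bij_betw_def)
  have "c = measurable_capacity N' ?P'"
   unfolding c by (rule antisym[OF S.measurable_capacity_le(1)[OF j] measurable_capacity_le(1)[OF i]])
  thus "c \<in> {measurable_capacity N' (Q'\<lparr>carrier := P\<rparr>) |P. submodule P (vring N') Q' \<and> measurable_module N' (Q'\<lparr>carrier := P\<rparr>)}"
   using submodule_image[OF Q f P \<Phi>_image] measurable_capacity_le(2)[OF i m] by blast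
 qed
qed

end

subsection \<open>Transport along a unitary\<close>

lemma bounded_opsD:
 assumes "T \<in> bounded_ops H"
 shows "T \<in> extensional (carrier H)" "v \<in> carrier H \<Longrightarrow> T v \<in> carrier H"
  "v \<in> carrier H \<Longrightarrow> w \<in> carrier H \<Longrightarrow> T (hadd H v w) = hadd H (T v) (T w)"
  "v \<in> carrier H \<Longrightarrow> T (hscale H c v) = hscale H c (T v)"
  "\<exists>C. \<forall>v\<in>carrier H. hnorm H (T v) \<le> C * hnorm H v"
 using assms by (auto simp: bounded_ops_def PiE_def)

lemma commutant_ring:
 assumes "ring (BH H)" "A \<subseteq> bounded_ops H"
 shows "subring (commutant H A) (BH H)" "ring ((BH H)\<lparr>carrier := commutant H A\<rparr>)"
proof -
 interpret ring "BH H" by fact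
 have A: "\<And>R. R \<in> A \<Longrightarrow> R \<in> carrier (BH H)" using assms(2) by auto
 have com: "T \<in> commutant H A \<longleftrightarrow> T \<in> carrier (BH H) \<and> (\<forall>R\<in>A. T \<otimes>\<^bsub>BH H\<^esub> R = R \<otimes>\<^bsub>BH H\<^esub> T)" for T
  by (simp add: commutant_def)
 show "subring (commutant H A) (BH H)"
 proof (rule subringI)
  show "commutant H A \<subseteq> carrier (BH H)" using com by blast
  show "\<one>\<^bsub>BH H\<^esub> \<in> commutant H A" unfolding com using A l_one r_one one_closed by metis
 next
  fix h assume h: "h \<in> commutant H A"
  show "\<ominus>\<^bsub>BH H\<^esub> h \<in> commutant H A"
   unfolding com using h[unfolded com] A l_minus r_minus a_inv_closed by metis
  fix h' assume h': "h' \<in> commutant H A"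
  show "h \<otimes>\<^bsub>BH H\<^esub> h' \<in> commutant H A"
   unfolding com
  proof (intro conjI ballI)
   fix R assume R: "R \<in> A"
   have e: "h \<otimes>\<^bsub>BH H\<^esub> R = R \<otimes>\<^bsub>BH H\<^esub> h" "h' \<otimes>\<^bsub>BH H\<^esub> R = R \<otimes>\<^bsub>BH H\<^esub> h'" 
    and c: "h \<in> carrier (BH H)" "h' \<in> carrier (BH H)"
    using h h' R unfolding com by blast+
   show "h \<otimes>\<^bsub>BH H\<^esub> h' \<otimes>\<^bsub>BH H\<^esub> R = R \<otimes>\<^bsub>BH H\<^esub> (h \<otimes>\<^bsub>BH H\<^esub> h')"
    by (simp only: m_assoc[OF c A[OF R]] e(2)) (simp only: m_assoc[OF c(1) A[OF R] c(2), symmetric] e(1) m_assoc[OF A[OF R] c])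
  qed (use h h' com m_closed in blast)
  show "h \<oplus>\<^bsub>BH H\<^esub> h' \<in> commutant H A"
   unfolding com using h[unfolded com] h'[unfolded com] A l_distr r_distr a_closed by metis
 qed
 thus "ring ((BH H)\<lparr>carrier := commutant H A\<rparr>)" by (rule subring_is_ring)
qed

text \<open>K is going to be the GNS space, whose vectors are sets of sequences. Closure under the
  operations is assumed for H alone and pulled over to K by U. The inverse V is a separate parameter
  so that the roles can be exchanged.\<close>

locale unitary_map =
 fixes H :: "'v hilbert" and K :: "'w hilbert" and U V
 assumes iso: "hilbert_iso H K U"
  and V_in: "w \<in> carrier K \<Longrightarrow> V w \<in> carrier H"
  and UV: "w \<in> carrier K \<Longrightarrow> U (V w) = w"
  and VU: "v \<in> carrier H \<Longrightarrow> V (U v) = v"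
  and hadd_closed: "v \<in> carrier H \<Longrightarrow> v' \<in> carrier H \<Longrightarrow> hadd H v v' \<in> carrier H"
  and hscale_closed: "v \<in> carrier H \<Longrightarrow> hscale H c v \<in> carrier H"
  and hzero_closed: "hzero H \<in> carrier H" and U_zero: "U (hzero H) = hzero K"
begin

abbreviation "cj \<equiv> conj_op H K U"
abbreviation "cj' \<equiv> conj_op K H V"

lemma U_in: "v \<in> carrier H \<Longrightarrow> U v \<in> carrier K"
 and U_add: "v \<in> carrier H \<Longrightarrow> w \<in> carrier H \<Longrightarrow> U (hadd H v w) = hadd K (U v) (U w)"
 and U_scale: "v \<in> carrier H \<Longrightarrow> U (hscale H c v) = hscale K c (U v)"
 and U_hip: "v \<in> carrier H \<Longrightarrow> w \<in> carrier H \<Longrightarrow> hip K (U v) (U w) = hip H v w"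
 and U_bij: "bij_betw U (carrier H) (carrier K)"
 using iso by (auto simp: hilbert_iso_def bij_betw_def)

lemma K_cases: "w \<in> carrier K \<Longrightarrow> (\<And>v. v \<in> carrier H \<Longrightarrow> w = U v \<Longrightarrow> thesis) \<Longrightarrow> thesis"
 using V_in UV by metis

lemma U_hnorm: "v \<in> carrier H \<Longrightarrow> hnorm K (U v) = hnorm H v"
 by (simp add: hnorm_def U_hip)

lemma cj_U: "v \<in> carrier H \<Longrightarrow> cj T (U v) = U (T v)"
 using U_bij by (simp add: conj_op_def U_in bij_betw_def)

lemma cj_ext: "cj T \<in> extensional (carrier K)"
 by (simp add: conj_op_def)

lemma cj_eqI:
 assumes "S \<in> extensional (carrier K)" "\<And>v. v \<in> carrier H \<Longrightarrow> S (U v) = U (T v)"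
 shows "cj T = S"
proof (rule extensionalityI[OF cj_ext assms(1)])
 fix w assume "w \<in> carrier K"
 thus "cj T w = S w" by (rule K_cases) (simp add: cj_U assms(2))
qed

lemma cj_bounded: 
 assumes T: "T \<in> bounded_ops H"
 shows "cj T \<in> bounded_ops K"
proof -
 note D = bounded_opsD[OF T]
 obtain C where C: "\<And>v. v \<in> carrier H \<Longrightarrow> hnorm H (T v) \<le> C * hnorm H v" using D(5) by blast
 have 1: "cj T w \<in> carrier K" if "w \<in> carrier K" for w
  by (rule K_cases[OF that]) (simp add: cj_U D U_in)
 have 2: "cj T (hadd K w w') = hadd K (cj T w) (cj T w')" if "w \<in> carrier K" "w' \<in> carrier K" for w w'
  by (rule K_cases[OF that(1)], rule K_cases[OF that(2)])
   (simp add: cj_U D(2,3) U_add[symmetric] hadd_closed)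
 have 3: "cj T (hscale K c w) = hscale K c (cj T w)" if "w \<in> carrier K" for c w
  by (rule K_cases[OF that]) (simp add: cj_U D(2,4) U_scale[symmetric] hscale_closed)
 have 4: "hnorm K (cj T w) \<le> C * hnorm K w" if "w \<in> carrier K" for w
  by (rule K_cases[OF that]) (simp add: cj_U D(2) U_hnorm C)
 have 5: "\<exists>C. \<forall>v\<in>carrier K. hnorm K (cj T v) \<le> C * hnorm K v" using 4 by blast
 show ?thesis unfolding bounded_ops_def using 1 2 3 5 cj_ext by (auto simp: PiE_def)
qed

lemma BH_ext:
 "S \<oplus>\<^bsub>BH K\<^esub> T \<in> extensional (carrier K)" "S \<otimes>\<^bsub>BH K\<^esub> T \<in> extensional (carrier K)"
 "c \<odot>\<^bsub>BH K\<^esub> T \<in> extensional (carrier K)" "\<zero>\<^bsub>BH K\<^esub> \<in> extensional (carrier K)" "\<one>\<^bsub>BH K\<^esub> \<in> extensional (carrier K)"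
 by (auto simp: BH_def compose_def)

lemma cj_add: "S \<in> bounded_ops H \<Longrightarrow> T \<in> bounded_ops H \<Longrightarrow> cj (S \<oplus>\<^bsub>BH H\<^esub> T) = cj S \<oplus>\<^bsub>BH K\<^esub> cj T"
 by (rule cj_eqI[OF BH_ext(1)]) (simp add: BH_def U_in cj_U U_add bounded_opsD(2))

lemma cj_mult: "S \<in> bounded_ops H \<Longrightarrow> T \<in> bounded_ops H \<Longrightarrow> cj (S \<otimes>\<^bsub>BH H\<^esub> T) = cj S \<otimes>\<^bsub>BH K\<^esub> cj T"
 by (rule cj_eqI[OF BH_ext(2)]) (simp add: BH_def compose_def U_in cj_U bounded_opsD(2))

lemma cj_zero: "cj \<zero>\<^bsub>BH H\<^esub> = \<zero>\<^bsub>BH K\<^esub>"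
 by (rule cj_eqI[OF BH_ext(4)]) (simp add: BH_def U_in U_zero)

lemma cj_one: "cj \<one>\<^bsub>BH H\<^esub> = \<one>\<^bsub>BH K\<^esub>"
 by (rule cj_eqI[OF BH_ext(5)]) (simp add: BH_def U_in)

lemma K_closed: "w \<in> carrier K \<Longrightarrow> w' \<in> carrier K \<Longrightarrow> hadd K w w' \<in> carrier K"
 "w \<in> carrier K \<Longrightarrow> hscale K c w \<in> carrier K" "hzero K \<in> carrier K"
 using U_in[OF hzero_closed]
 by (auto elim!: K_cases simp: U_add[symmetric] U_scale[symmetric] hadd_closed hscale_closed U_in U_zero)

lemma V_zero: "V (hzero K) = hzero H"
 by (simp add: U_zero[symmetric] VU hzero_closed)

lemma iso': "hilbert_iso K H V"
proof -
 have "bij_betw V (carrier K) (carrier H)"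
  by (rule bij_betwI[of _ _ _ U]) (auto simp: V_in U_in UV VU)
 moreover have "V (hadd K w w') = hadd H (V w) (V w')" if "w \<in> carrier K" "w' \<in> carrier K" for w w'
  by (rule K_cases[OF that(1)], rule K_cases[OF that(2)]) (simp add: VU U_add[symmetric] hadd_closed)
 moreover have "V (hscale K c w) = hscale H c (V w)" if "w \<in> carrier K" for c w
  by (rule K_cases[OF that(1)]) (simp add: VU U_scale[symmetric] hscale_closed)
 moreover have "hip H (V w) (V w') = hip K w w'" if "w \<in> carrier K" "w' \<in> carrier K" for w w'
  by (rule K_cases[OF that(1)], rule K_cases[OF that(2)]) (simp add: VU U_hip)
 ultimately show ?thesis by (simp add: hilbert_iso_def)
qed

lemma unitary_sym: "unitary_map K H V U"
 by unfold_locales (simp_all add: iso' U_in UV VU K_closed V_zero)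

lemma cj'_apply: "v \<in> carrier H \<Longrightarrow> cj' S v = V (S (U v))"
 using unitary_map.cj_U[OF unitary_sym U_in, of v S] by (simp add: VU)

lemma cj'_cj: "T \<in> bounded_ops H \<Longrightarrow> cj' (cj T) = T"
 by (rule extensionalityI[OF unitary_map.cj_ext[OF unitary_sym] bounded_opsD(1)])
  (simp_all add: cj'_apply cj_U VU bounded_opsD(2))

lemma cj_image_commutant:
 assumes "A \<subseteq> bounded_ops H"
 shows "cj ` commutant H A \<subseteq> commutant K (cj ` A)"
 using assms by (auto simp: commutant_def cj_bounded cj_mult[symmetric] subset_iff)

end

text \<open>The adjoint is a definite description, so on K it means nothing before existence and
  uniqueness are known there. Both are assumed for H, where they hold for \<open>ell2\<close>, and
  derived for K in \<open>transport_sym\<close>, which then yields the converse of every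
  transport.\<close>

locale hilbert_transport = unitary_map +
 assumes ring_H: "ring (BH H)"
  and adjoint_ex: "T \<in> bounded_ops H \<Longrightarrow>
   \<exists>S\<in>bounded_ops H. \<forall>v\<in>carrier H. \<forall>w\<in>carrier H. hip H (T v) w = hip H v (S w)"
  and adjoint_uniq: "S \<in> bounded_ops H \<Longrightarrow> S' \<in> bounded_ops H \<Longrightarrow>
   (\<And>v w. v \<in> carrier H \<Longrightarrow> w \<in> carrier H \<Longrightarrow> hip H v (S w) = hip H v (S' w)) \<Longrightarrow> S = S'"
begin

lemma cj'_bounded: "S \<in> bounded_ops K \<Longrightarrow> cj' S \<in> bounded_ops H"
 by (rule unitary_map.cj_bounded[OF unitary_sym])

lemma cj_cj': "S \<in> bounded_ops K \<Longrightarrow> cj (cj' S) = S"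
 by (rule unitary_map.cj'_cj[OF unitary_sym])

lemma ring_K: "ring (BH K)"
proof -
 interpret ring "BH H" by (rule ring_H)
 have "cj \<in> ring_iso (BH H) (BH K)"
  unfolding ring_iso_def ring_hom_def
  by (auto simp: cj_bounded cj_add cj_mult cj_one intro!: bij_betwI[of _ _ _ cj'] cj'_bounded cj'_cj cj_cj')
 from ring_iso_imp_img_ring[OF this] have "ring ((BH K)\<lparr>ring.zero := \<zero>\<^bsub>BH K\<^esub>\<rparr>)" by (simp add: cj_zero)
 moreover have "(BH K)\<lparr>ring.zero := \<zero>\<^bsub>BH K\<^esub>\<rparr> = BH K" by (simp add: BH_def)
 ultimately show ?thesis by simp
qed

lemma adjoint_H: 
 assumes T: "T \<in> bounded_ops H"
 shows "adjoint_op H T \<in> bounded_ops H" 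
  "v \<in> carrier H \<Longrightarrow> w \<in> carrier H \<Longrightarrow> hip H (T v) w = hip H v (adjoint_op H T w)"
proof -
 have *: "\<exists>!S. S \<in> bounded_ops H \<and> (\<forall>v\<in>carrier H. \<forall>w\<in>carrier H. hip H (T v) w = hip H v (S w))"
 proof (rule ex_ex1I)
  show "\<exists>S. S \<in> bounded_ops H \<and> (\<forall>v\<in>carrier H. \<forall>w\<in>carrier H. hip H (T v) w = hip H v (S w))"
   using adjoint_ex[OF T] by blast
  fix S S' assume "S \<in> bounded_ops H \<and> (\<forall>v\<in>carrier H. \<forall>w\<in>carrier H. hip H (T v) w = hip H v (S w))"
   "S' \<in> bounded_ops H \<and> (\<forall>v\<in>carrier H. \<forall>w\<in>carrier H. hip H (T v) w = hip H v (S' w))"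
  thus "S = S'" using adjoint_uniq[of S S'] by simp
 qed
 from theI'[OF *]
 show "adjoint_op H T \<in> bounded_ops H" 
  "v \<in> carrier H \<Longrightarrow> w \<in> carrier H \<Longrightarrow> hip H (T v) w = hip H v (adjoint_op H T w)"
  by (auto simp: adjoint_op_def)
qed

lemma transport_sym: "hilbert_transport K H V U"
proof (intro hilbert_transport.intro hilbert_transport_axioms.intro)
 show "unitary_map K H V U" by (rule unitary_sym)
 show "ring (BH K)" by (rule ring_K)
 fix S assume S: "S \<in> bounded_ops K"
 note T = adjoint_H[OF cj'_bounded[OF S]]
 have "hip K (S v) w = hip K v (cj (adjoint_op H (cj' S)) w)" if vw: "v \<in> carrier K" "w \<in> carrier K" for v w
 proof -
  obtain a b where ab: "a \<in> carrier H" "v = U a" "b \<in> carrier H" "w = U b" using K_cases vw by metis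
  have Sa: "S (U a) = U (cj' S a)" using ab(1) by (simp add: cj'_apply UV U_in bounded_opsD(2)[OF S])
  show ?thesis unfolding ab(2,4) Sa
   by (simp add: cj_U ab U_hip T(2) bounded_opsD(2)[OF cj'_bounded[OF S]] bounded_opsD(2)[OF T(1)])
 qed
 thus "\<exists>S'\<in>bounded_ops K. \<forall>v\<in>carrier K. \<forall>w\<in>carrier K. hip K (S v) w = hip K v (S' w)"
  using cj_bounded[OF T(1)] by blast
 fix S' assume S': "S' \<in> bounded_ops K" and e: "\<And>v w. v \<in> carrier K \<Longrightarrow> w \<in> carrier K \<Longrightarrow> hip K v (S w) = hip K v (S' w)"
 have h: "hip H v (cj' R w) = hip K (U v) (R (U w))" if "v \<in> carrier H" "w \<in> carrier H" "R \<in> bounded_ops K" for v w R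
  using U_hip[OF that(1) bounded_opsD(2)[OF cj'_bounded[OF that(3)] that(2)]] that
  by (simp add: cj'_apply UV U_in bounded_opsD(2)[OF that(3)])
 have "cj' S = cj' S'"
  by (rule adjoint_uniq[OF cj'_bounded[OF S] cj'_bounded[OF S']]) (simp add: h S S' e U_in)
 thus "S = S'" using cj_cj' S S' by metis
qed

lemma cj_adjoint:
 assumes T: "T \<in> bounded_ops H"
 shows "adjoint_op K (cj T) = cj (adjoint_op H T)"
proof -
 interpret S: hilbert_transport K H V U by (rule transport_sym)
 note A = adjoint_H[OF T] and B = S.adjoint_H[OF cj_bounded[OF T]]
 show ?thesis
 proof (rule S.adjoint_uniq[OF B(1) cj_bounded[OF A(1)]])
  fix v w assume vw: "v \<in> carrier K" "w \<in> carrier K"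
  obtain a b where ab: "a \<in> carrier H" "v = U a" "b \<in> carrier H" "w = U b" using K_cases vw by metis
  have "hip K v (adjoint_op K (cj T) w) = hip H (T a) b"
   using B(2)[OF vw] ab by (simp add: cj_U U_hip bounded_opsD(2)[OF T])
  also have "\<dots> = hip K v (cj (adjoint_op H T) w)"
   using A(2)[OF ab(1,3)] ab by (simp add: cj_U U_hip bounded_opsD(2)[OF A(1)])
  finally show "hip K v (adjoint_op K (cj T) w) = hip K v (cj (adjoint_op H T) w)" .
 qed
qed

lemma cj_finsum:
 assumes "finite I" "\<And>i. i \<in> I \<Longrightarrow> f i \<in> bounded_ops H"
 shows "cj (\<Oplus>\<^bsub>BH H\<^esub>i\<in>I. f i) = (\<Oplus>\<^bsub>BH K\<^esub>i\<in>I. cj (f i))"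
 by (rule finsum_map[where h=cj, OF ring.is_abelian_group[OF ring_H] ring.is_abelian_group[OF ring_K]])
  (simp_all add: cj_bounded cj_add assms)

lemma cj_commutant:
 assumes "A \<subseteq> bounded_ops H"
 shows "commutant K (cj ` A) = cj ` commutant H A"
proof (rule subset_antisym)
 interpret S: hilbert_transport K H V U by (rule transport_sym)
 have cA: "cj ` A \<subseteq> bounded_ops K" using assms cj_bounded by blast
 have "cj' ` cj ` A = A" using assms cj'_cj by (auto simp: image_image subset_iff)
 hence 1: "cj' ` commutant K (cj ` A) \<subseteq> commutant H A" using S.cj_image_commutant[OF cA] by simp
 show "commutant K (cj ` A) \<subseteq> cj ` commutant H A"
 proof
  fix T assume T: "T \<in> commutant K (cj ` A)"
  hence "T = cj (cj' T)" using cj_cj' by (auto simp: commutant_def)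
  thus "T \<in> cj ` commutant H A" using 1 T by blast
 qed
 show "cj ` commutant H A \<subseteq> commutant K (cj ` A)" by (rule cj_image_commutant[OF assms])
qed

section \<open>Projections, spectral measures and Novikov-Shubin invariants\<close>

lemma projection_matrix_cj:
 assumes P: "projection_matrix H k E" and E': "\<And>i j. i < k \<Longrightarrow> j < k \<Longrightarrow> E' i j = cj (E i j)"
 shows "projection_matrix K k E'"
proof -
 interpret R: ring "BH H" by (rule ring_H)
 have E: "E i j \<in> bounded_ops H" "(\<Oplus>\<^bsub>BH H\<^esub>m\<in>{..<k}. E i m \<otimes>\<^bsub>BH H\<^esub> E m j) = E i j" "adjoint_op H (E i j) = E j i"
  if "i < k" "j < k" for i j
  using P that by (auto simp: projection_matrix_def matrix_over_def)
 interpret K: ring "BH K" by (rule ring_K)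
 have m: "E i m \<otimes>\<^bsub>BH H\<^esub> E m j \<in> bounded_ops H" if "i < k" "j < k" "m < k" for i j m
  using R.m_closed[of "E i m" "E m j"] E(1) that by simp
 have "(\<Oplus>\<^bsub>BH K\<^esub>m\<in>{..<k}. E' i m \<otimes>\<^bsub>BH K\<^esub> E' m j) = E' i j" if ij: "i < k" "j < k" for i j
 proof -
  have "(\<Oplus>\<^bsub>BH K\<^esub>m\<in>{..<k}. E' i m \<otimes>\<^bsub>BH K\<^esub> E' m j) = (\<Oplus>\<^bsub>BH K\<^esub>m\<in>{..<k}. cj (E i m \<otimes>\<^bsub>BH H\<^esub> E m j))"
   by (rule K.finsum_cong') (auto simp: ij E' cj_mult[symmetric] E(1) m cj_bounded)
  also have "\<dots> = cj (\<Oplus>\<^bsub>BH H\<^esub>m\<in>{..<k}. E i m \<otimes>\<^bsub>BH H\<^esub> E m j)"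
   by (rule cj_finsum[symmetric]) (simp_all add: m ij)
  finally show ?thesis using E(2)[OF ij] E'[OF ij] by simp
 qed
 thus ?thesis by (simp add: projection_matrix_def matrix_over_def E' E cj_bounded cj_adjoint)
qed

lemma gram_matrix_cj:
 assumes B: "\<And>m. m < k \<Longrightarrow> B m i \<in> bounded_ops H" "\<And>m. m < k \<Longrightarrow> B m j \<in> bounded_ops H"
 shows "gram_matrix K k (\<lambda>i j. cj (B i j)) i j = cj (gram_matrix H k B i j)" "gram_matrix H k B i j \<in> bounded_ops H"
proof -
 interpret R: ring "BH H" by (rule ring_H)
 interpret K: ring "BH K" by (rule ring_K)
 have m: "adjoint_op H (B m i) \<otimes>\<^bsub>BH H\<^esub> B m j \<in> bounded_ops H" if "m < k" for m
  using R.m_closed[of "adjoint_op H (B m i)" "B m j"] B that by (simp add: adjoint_H)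
 have "gram_matrix K k (\<lambda>i j. cj (B i j)) i j = (\<Oplus>\<^bsub>BH K\<^esub>m\<in>{..<k}. cj (adjoint_op H (B m i) \<otimes>\<^bsub>BH H\<^esub> B m j))"
  unfolding gram_matrix_def
  by (rule K.finsum_cong') (auto simp: B m cj_mult[symmetric] cj_adjoint cj_bounded adjoint_H)
 also have "\<dots> = cj (gram_matrix H k B i j)"
  unfolding gram_matrix_def by (rule cj_finsum[symmetric]) (simp_all add: m)
 finally show "gram_matrix K k (\<lambda>i j. cj (B i j)) i j = cj (gram_matrix H k B i j)" .
 show "gram_matrix H k B i j \<in> bounded_ops H"
  unfolding gram_matrix_def using R.finsum_closed[of "\<lambda>m. adjoint_op H (B m i) \<otimes>\<^bsub>BH H\<^esub> B m j" "{..<k}"] m by (simp add: Pi_iff)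
qed

lemma matrix_form_cj:
 assumes "\<And>i j. i < l \<Longrightarrow> j < l \<Longrightarrow> T i j \<in> bounded_ops H" "\<And>i j. i < l \<Longrightarrow> j < l \<Longrightarrow> T' i j = cj (T i j)"
  "\<And>i. i < l \<Longrightarrow> v i \<in> carrier K"
 shows "matrix_form K l T' v = matrix_form H l T (\<lambda>i. V (v i))"
proof -
 have "hip K (cj (T i j) (v j)) (v i) = hip H (T i j (V (v j))) (V (v i))" if "i < l" "j < l" for i j
 proof -
  have v: "V (v i) \<in> carrier H" "V (v j) \<in> carrier H" "U (V (v i)) = v i" "U (V (v j)) = v j" using assms(3) that V_in UV by auto
  show ?thesis using U_hip[OF bounded_opsD(2)[OF assms(1)[OF that] v(2)] v(1)] cj_U[OF v(2), of "T i j"] v by simp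
 qed
 thus ?thesis using assms(2) by (simp add: matrix_form_def)
qed

text \<open>A spectral measure is described by the scalar measures of its vectors, and a unitary
  does not change these: the measure of v over K is the one of V v over H.\<close>

lemma spectral_measure_cj:
 assumes P: "spectral_measure H l T P" and T: "\<And>i j. i < l \<Longrightarrow> j < l \<Longrightarrow> T i j \<in> bounded_ops H"
  "\<And>i j. i < l \<Longrightarrow> j < l \<Longrightarrow> T' i j = cj (T i j)"
 shows "spectral_measure K l T' (\<lambda>S i j. cj (P S i j))"
 unfolding spectral_measure_def
proof (intro conjI ballI allI impI)
 have pr: "projection_matrix H l (P S)" if "S \<in> sets borel" for S using P that by (simp add: spectral_measure_def)
 thus "projection_matrix K l (\<lambda>i j. cj (P S i j))" if "S \<in> sets borel" for S
  using that by (intro projection_matrix_cj) auto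
 have PS: "P S i j \<in> bounded_ops H" if "S \<in> sets borel" "i < l" "j < l" for S i j
  using pr[OF that(1)] that(2,3) by (auto simp: projection_matrix_def matrix_over_def)
 fix v assume "\<forall>i<l. v i \<in> carrier K"
 hence v: "\<And>i. i < l \<Longrightarrow> v i \<in> carrier K" by blast
 have Vv: "\<forall>i<l. V (v i) \<in> carrier H" using v V_in by blast
 obtain \<mu> :: "real measure" where \<mu>: "finite_measure \<mu>" "sets \<mu> = sets borel"
  "\<And>S. S \<in> sets borel \<Longrightarrow> matrix_form H l (P S) (\<lambda>i. V (v i)) = of_real (measure \<mu> S)"
  "measure \<mu> UNIV = (\<Sum>i<l. (hnorm H (V (v i)))\<^sup>2)" "integrable \<mu> (\<lambda>t. t)"
  "matrix_form H l T (\<lambda>i. V (v i)) = of_real (\<integral>t. t \<partial>\<mu>)"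
  using mp[OF spec[OF conjunct2[OF P[unfolded spectral_measure_def]], of "\<lambda>i. V (v i)"] Vv] by (elim exE conjE) blast
 have n: "hnorm H (V (v i)) = hnorm K (v i)" if "i < l" for i using U_hnorm[OF V_in[OF v[OF that]]] UV[OF v[OF that]] by simp
 have f: "matrix_form K l (\<lambda>i j. cj (P S i j)) v = matrix_form H l (P S) (\<lambda>i. V (v i))" if "S \<in> sets borel" for S
  by (rule matrix_form_cj) (simp_all add: PS that v)
 have g: "matrix_form K l T' v = matrix_form H l T (\<lambda>i. V (v i))"
  by (rule matrix_form_cj) (simp_all add: T v)
 show "\<exists>\<mu> :: real measure. finite_measure \<mu> \<and> sets \<mu> = sets borel \<and>
    (\<forall>S\<in>sets borel. matrix_form K l (\<lambda>i j. cj (P S i j)) v = of_real (measure \<mu> S)) \<and>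
    measure \<mu> UNIV = (\<Sum>i<l. (hnorm K (v i))\<^sup>2) \<and>
    integrable \<mu> (\<lambda>t. t) \<and> matrix_form K l T' v = of_real (\<integral>t. t \<partial>\<mu>)"
  using \<mu> f g n by (intro exI[of _ \<mu>]) simp
qed

lemma novikov_step:
 assumes "spectral_measure H l T P" and T: "\<And>i j. i < l \<Longrightarrow> j < l \<Longrightarrow> T i j \<in> bounded_ops H"
  "\<And>i j. i < l \<Longrightarrow> j < l \<Longrightarrow> T' i j = cj (T i j)"
  and tr: "\<And>x. x \<in> bounded_ops H \<Longrightarrow> tr' (cj x) = tr x"
 shows "\<exists>P'. spectral_measure K l T' P' \<and>
  ns_exponent (\<lambda>x. \<Sum>i<l. Re (tr (P {0..x\<^sup>2} i i))) = ns_exponent (\<lambda>x. \<Sum>i<l. Re (tr' (P' {0..x\<^sup>2} i i)))"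
proof -
 have "P S i j \<in> bounded_ops H" if "S \<in> sets borel" "i < l" "j < l" for S i j
  using assms(1) that by (auto simp: spectral_measure_def projection_matrix_def matrix_over_def)
 hence "(\<lambda>x. \<Sum>i<l. Re (tr (P {0..x\<^sup>2} i i))) = (\<lambda>x. \<Sum>i<l. Re (tr' (cj (P {0..x\<^sup>2} i i))))"
  by (simp add: tr)
 thus ?thesis using spectral_measure_cj[OF assms(1) T] by (intro exI[of _ "\<lambda>S i j. cj (P S i j)"]) simp
qed

text \<open>The two definite descriptions have equivalent defining predicates, because conjugation
  matches the spectral measures on both sides. Equality follows with no appeal to existence or
  uniqueness of a spectral measure.\<close>

lemma novikov_shubin_cj:
 assumes N: "vspace N = H" "vspace N' = K" and tr: "\<And>x. x \<in> bounded_ops H \<Longrightarrow> vtrace N' (cj x) = vtrace N x"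
  and B: "\<And>i j. i < k \<Longrightarrow> j < l \<Longrightarrow> B i j \<in> bounded_ops H"
 shows "novikov_shubin N' k l (\<lambda>i j. cj (B i j)) = novikov_shubin N k l B"
proof -
 interpret S: hilbert_transport K H V U by (rule transport_sym)
 let ?T = "gram_matrix H k B" and ?T' = "gram_matrix K k (\<lambda>i j. cj (B i j))"
 have T: "?T i j \<in> bounded_ops H" "?T' i j = cj (?T i j)" if "i < l" "j < l" for i j
  using gram_matrix_cj[of k B i j] B that by auto
 have T': "?T' i j \<in> bounded_ops K" "?T i j = cj' (?T' i j)" if "i < l" "j < l" for i j
  using T[OF that] cj'_cj cj_bounded by auto
 have tr': "vtrace N (cj' x) = vtrace N' x" if "x \<in> bounded_ops K" for x
  using tr[OF cj'_bounded[OF that]] cj_cj'[OF that] by simp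
 let ?e = "\<lambda>M P. ns_exponent (\<lambda>x. \<Sum>i<l. Re (vtrace M (P {0..x\<^sup>2} i i)))"
 have "(\<exists>P. spectral_measure K l ?T' P \<and> \<alpha> = ?e N' P) \<longleftrightarrow> (\<exists>P. spectral_measure H l ?T P \<and> \<alpha> = ?e N P)" for \<alpha>
 proof
  assume "\<exists>P. spectral_measure K l ?T' P \<and> \<alpha> = ?e N' P"
  then obtain P where P: "spectral_measure K l ?T' P" "\<alpha> = ?e N' P" by blast
  show "\<exists>P. spectral_measure H l ?T P \<and> \<alpha> = ?e N P"
   unfolding P(2) by (rule S.novikov_step[where T="?T'" and T'="?T" and tr="vtrace N'" and tr'="vtrace N"]) (rule P(1) T' tr' | assumption)+
 next
  assume "\<exists>P. spectral_measure H l ?T P \<and> \<alpha> = ?e N P"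
  then obtain P where P: "spectral_measure H l ?T P" "\<alpha> = ?e N P" by blast
  show "\<exists>P. spectral_measure K l ?T' P \<and> \<alpha> = ?e N' P"
   unfolding P(2) by (rule novikov_step[where T="?T" and T'="?T'" and tr="vtrace N" and tr'="vtrace N'"]) (rule P(1) T tr | assumption)+
 qed
 thus ?thesis unfolding novikov_shubin_def N by simp
qed

text \<open>Conjugation commutes with taking commutants, so twice over it carries the bicommutant of
  A onto that of its image; the remaining conditions of \<open>vna_iso\<close> are the transport
  lemmas and their converses.\<close>

lemma vna_iso_cj:
 assumes N: "vspace N = H" "velems N = commutant H (commutant H A)" and A: "A \<subseteq> bounded_ops H"
  and N': "vspace N' = K" "velems N' = commutant K (commutant K (cj ` A))"
  and tr: "\<And>x. x \<in> bounded_ops H \<Longrightarrow> vtrace N' (cj x) = vtrace N x"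
 shows "cj ` velems N = velems N'" "vna_iso N N' cj cj'"
proof -
 interpret S: hilbert_transport K H V U by (rule transport_sym)
 have c: "commutant H X \<subseteq> bounded_ops H" "commutant K Y \<subseteq> bounded_ops K" for X Y by (auto simp: commutant_def)
 show e: "cj ` velems N = velems N'" unfolding N N' cj_commutant[OF A] cj_commutant[OF c(1)] ..
 have b: "\<And>x. x \<in> velems N \<Longrightarrow> x \<in> bounded_ops H" "\<And>x. x \<in> velems N' \<Longrightarrow> x \<in> bounded_ops K"
  using N N' c by blast+
 have e1: "\<And>x. x \<in> velems N \<Longrightarrow> cj x \<in> velems N'" using e by blast
 have e2: "\<And>x. x \<in> velems N' \<Longrightarrow> cj' x \<in> velems N" unfolding e[symmetric] using cj'_cj b by auto
 have tr': "vtrace N (cj' x) = vtrace N' x" if "x \<in> bounded_ops K" for x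
  using tr[OF cj'_bounded[OF that]] cj_cj'[OF that] by simp
 have r: "ring (vring N)" "ring (vring N')"
  unfolding vring_def N N' by (rule commutant_ring(2)[OF ring_H c(1)] commutant_ring(2)[OF ring_K c(2)])+
 show "vna_iso N N' cj cj'"
 proof (rule vna_iso.intro)
  show "ring (vring N)" "ring (vring N')" by (rule r)+
  show "cj \<in> ring_hom (vring N) (vring N')"
   by (rule ring_hom_memI) (simp_all add: e1, simp_all add: vring_def N N' cj_mult cj_add cj_one b[unfolded N N'])
  show "cj' \<in> ring_hom (vring N') (vring N)"
   by (rule ring_hom_memI) (simp_all add: e2, simp_all add: vring_def N N' S.cj_mult S.cj_add S.cj_one b[unfolded N N'])
 qed (auto simp: b cj'_cj cj_cj' N N' tr tr' matrix_over_def intro: projection_matrix_cj S.projection_matrix_cj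
   novikov_shubin_cj S.novikov_shubin_cj)
qed

end

subsection \<open>Comparison of the two homologies\<close>

lemma regular_module_simps:
 "carrier (regular_module R) = carrier R" "x \<oplus>\<^bsub>regular_module R\<^esub> y = x \<oplus>\<^bsub>R\<^esub> y" "x \<odot>\<^bsub>regular_module R\<^esub> y = x \<otimes>\<^bsub>R\<^esub> y"
 by (simp_all add: regular_module_def)

lemma character_module_simps:
 "carrier (character_module e) = UNIV" "x \<oplus>\<^bsub>character_module e\<^esub> y = x + y" "r \<odot>\<^bsub>character_module e\<^esub> z = e r * z"
 "\<zero>\<^bsub>character_module e\<^esub> = 0"
 by (simp_all add: character_module_def)

lemma character_left_mod:
 assumes R: "ring R" and e: "\<And>r s. r \<in> carrier R \<Longrightarrow> s \<in> carrier R \<Longrightarrow> e (r \<oplus>\<^bsub>R\<^esub> s) = e r + e s"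
  "\<And>r s. r \<in> carrier R \<Longrightarrow> s \<in> carrier R \<Longrightarrow> e (r \<otimes>\<^bsub>R\<^esub> s) = e r * e s" "e \<one>\<^bsub>R\<^esub> = 1"
 shows "left_mod R (character_module e)"
proof -
 have "abelian_group (character_module e)"
  by (rule abelian_groupI) (auto simp: character_module_simps intro: exI[of _ "- _"])
 thus ?thesis using R
  by (intro left_mod.intro left_mod_axioms.intro) (simp_all add: character_module_simps e algebra_simps)
qed

lemma regular_bimodule:
 assumes S: "ring S" and \<rho>: "\<And>r. r \<in> carrier R \<Longrightarrow> \<rho> r \<in> carrier S"
 shows "bimodule S R (regular_module S) (\<lambda>x r. x \<otimes>\<^bsub>S\<^esub> \<rho> r)"
proof -
 interpret ring S by fact
 show ?thesis by (simp add: bimodule_def regular_module_simps \<rho> r_distr m_assoc)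
qed

lemma regular_bimodule_map:
 assumes \<sigma>: "\<sigma> \<in> ring_hom S S'" and \<rho>: "\<And>r. r \<in> carrier R \<Longrightarrow> \<rho> r \<in> carrier S" "\<And>r. r \<in> carrier R \<Longrightarrow> \<sigma> (\<rho> r) = \<rho>' (\<Phi> r)"
 shows "bimodule_map S R \<sigma> \<Phi> (regular_module S) (\<lambda>x r. x \<otimes>\<^bsub>S\<^esub> \<rho> r) (regular_module S') (\<lambda>x r. x \<otimes>\<^bsub>S'\<^esub> \<rho>' r) \<sigma>"
 using \<rho> by (simp add: bimodule_map_def regular_module_simps ring_hom_closed[OF \<sigma>] ring_hom_add[OF \<sigma>] ring_hom_mult[OF \<sigma>])

context group
begin

abbreviation "NG \<equiv> group_vna G"
abbreviation "NC \<equiv> cqg_vna (reduced_cqg G)"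
abbreviation "gns_inv \<equiv> inv_into l2G gns_map"

lemma NG_simps: "vspace NG = HG"
 "velems NG = commutant HG (commutant HG (lreg ` carrier G))"
 "vtrace NG x = ipG (x \<xi>) \<xi>"
 by (simp_all add: group_vna_def Let_def delta_one_eq)

lemma NC_simps: "vspace NC = gnsH"
 "velems NC = commutant gnsH (commutant gnsH (gns_rep HG cred haar ` cred))"
 "vtrace NC x = hip gnsH (x (gns_map \<xi>)) (gns_map \<xi>)"
 using gns_vec_map[OF cred_one] by (simp_all add: cqg_vna_def Let_def haar_state_eq)

sublocale gns: hilbert_transport "HG" gnsH gns_map gns_inv
proof (intro hilbert_transport.intro hilbert_transport_axioms.intro unitary_map.intro)
 show "hilbert_iso HG gnsH gns_map" by (rule gns_map_iso)
 show "gns_inv w \<in> l2G" "gns_map (gns_inv w) = w" if "w \<in> carrier gnsH" for w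
  using gns_map_bij that by (auto simp: bij_betw_def inv_into_into f_inv_into_f)
 show "gns_inv (gns_map v) = v" if "v \<in> l2G" for v
  using gns_map_bij that by (simp add: bij_betw_def)
 show "ring BG" by (rule ring_BH)
 show "\<exists>S\<in>bopG. \<forall>v\<in>l2G. \<forall>w\<in>l2G. ipG (T v) w = ipG v (S w)"
  if "T \<in> bopG" for T by (rule adjoint_exists[OF that])
qed (simp_all add: l2_add l2_scale gns_hzero adjoint_unique)

lemma gns_rep_cj: "a \<in> cred \<Longrightarrow> gns_rep HG cred haar a = gns.cj a"
 by (rule gns.cj_eqI[symmetric]) (simp_all add: gns_rep_map, simp add: gns_rep_def)

text \<open>The GNS representation is conjugation by the unitary, and the reduced algebra has the
  same commutant as the left translations. So the GNS bicommutant is generated by the conjugated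
  translations, which is the form \<open>vna_iso_cj\<close> expects.\<close>

lemma NC_velems: "velems NC = commutant gnsH (commutant gnsH (gns.cj ` lreg ` carrier G))"
proof -
 have "gns_rep HG cred haar ` cred = gns.cj ` cred" by (simp add: gns_rep_cj)
 thus ?thesis
  using gns.cj_commutant[OF cred_bop] gns.cj_commutant[OF lreg_range] by (simp only: NC_simps commutant_cred)
qed

lemma natural_map_eq: "natural_map G gns_map = gns.cj"
 by (simp add: natural_map_def NG_simps NC_simps)

lemma NC_trace: "x \<in> bopG \<Longrightarrow> vtrace NC (gns.cj x) = vtrace NG x"
 by (simp add: NG_simps NC_simps gns.cj_U gns_hip)

lemma velems_image: "gns.cj ` velems NG = velems NC" and vna_iso_reduced: "vna_iso NG NC gns.cj gns.cj'"
 using gns.vna_iso_cj[OF NG_simps(1,2) lreg_range NC_simps(1) NC_velems NC_trace] by blast+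

lemma gspan_velems: "gspan \<subseteq> velems NG"
proof
 fix a assume a: "a \<in> gspan"
 have "a \<otimes>\<^bsub>BG\<^esub> T = T \<otimes>\<^bsub>BG\<^esub> a" if "T \<in> commutant HG (lreg ` carrier G)" for T
  using that gspan_credD[OF a] unfolding commutant_cred[symmetric] by (simp add: commutant_def)
 thus "a \<in> velems NG" using gspan_credD[OF a] by (simp add: NG_simps commutant_def)
qed

abbreviation "HR \<equiv> hopf_ring (reduced_cqg G)"

lemma HR_eq: "HR = GS"
 by (simp add: hopf_ring_def hopf_alg_eq)

abbreviation "trivial_G \<equiv> character_module (\<lambda>f. \<Sum>x\<in>{x. f x \<noteq> 0}. f x)"
abbreviation "trivial_C \<equiv> character_module (counit (reduced_cqg G))"
abbreviation "act_G \<equiv> \<lambda>x f. x \<otimes>\<^bsub>vring NG\<^esub> rep f"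
abbreviation "act_C \<equiv> \<lambda>x a. x \<otimes>\<^bsub>vring NC\<^esub> gns_rep HG cred haar a"

text \<open>Multiplicativity of the coefficient sum on the group ring is read off from the counit by
  \<open>counit_rep\<close>, so it is checked on operators only.\<close>

lemma trivial_left_mod: "left_mod GR trivial_G" "left_mod HR trivial_C"
proof -
 have c: "counit (reduced_cqg G) (a \<oplus>\<^bsub>BG\<^esub> b) = counit (reduced_cqg G) a + counit (reduced_cqg G) b"
  "counit (reduced_cqg G) (a \<otimes>\<^bsub>BG\<^esub> b) = counit (reduced_cqg G) a * counit (reduced_cqg G) b"
  if "a \<in> gspan" "b \<in> gspan" for a b
  using that by (simp_all only: counit_eq augmentation_add augmentation_mult)
 have o: "counit (reduced_cqg G) \<one>\<^bsub>BG\<^esub> = 1"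
  using augmentation_lreg[OF one_closed] by (simp only: counit_eq lreg_one)
 show "left_mod HR trivial_C"
  unfolding HR_eq by (rule character_left_mod[OF ring_gspan]) (simp_all add: c o)
 show "left_mod GR trivial_G"
 proof (rule character_left_mod[OF ring_GR])
  fix f g assume fg: "f \<in> carrier GR" "g \<in> carrier GR"
  have s: "f \<oplus>\<^bsub>GR\<^esub> g \<in> carrier GR" "rep (f \<oplus>\<^bsub>GR\<^esub> g) = rep f \<oplus>\<^bsub>BG\<^esub> rep g" unfolding GR_plus by (rule GR_add[OF fg], rule rep_add[OF fg])
  show "(\<Sum>x\<in>{x. (f \<oplus>\<^bsub>GR\<^esub> g) x \<noteq> 0}. (f \<oplus>\<^bsub>GR\<^esub> g) x) = (\<Sum>x\<in>{x. f x \<noteq> 0}. f x) + (\<Sum>x\<in>{x. g x \<noteq> 0}. g x)"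
   unfolding counit_rep[OF s(1), symmetric] counit_rep[OF fg(1), symmetric] counit_rep[OF fg(2), symmetric] s(2)
   by (rule c(1)[OF rep_gspan rep_gspan, OF fg])
  note m = rep_mult[OF fg]
  show "(\<Sum>x\<in>{x. (f \<otimes>\<^bsub>GR\<^esub> g) x \<noteq> 0}. (f \<otimes>\<^bsub>GR\<^esub> g) x) = (\<Sum>x\<in>{x. f x \<noteq> 0}. f x) * (\<Sum>x\<in>{x. g x \<noteq> 0}. g x)"
   unfolding counit_rep[OF m(1), symmetric] counit_rep[OF fg(1), symmetric] counit_rep[OF fg(2), symmetric] m(2)
   by (rule c(2)[OF rep_gspan rep_gspan, OF fg])
 next
  show "(\<Sum>x\<in>{x. \<one>\<^bsub>GR\<^esub> x \<noteq> 0}. \<one>\<^bsub>GR\<^esub> x) = 1"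
   unfolding counit_rep[OF rep_one(1), symmetric] rep_one(2) by (rule o)
 qed
qed

lemma group_homology_eq: "group_L2_homology G n = Tor GR (regular_module (vring NG)) act_G trivial_G n"
 by (simp add: group_L2_homology_def)

lemma cqg_homology_eq: "cqg_L2_homology (reduced_cqg G) n = Tor HR (regular_module (vring NC)) act_C trivial_C n"
 by (simp add: cqg_L2_homology_def haar_state_eq)

lemma rep_velems: "f \<in> carrier GR \<Longrightarrow> rep f \<in> carrier (vring NG)"
 using gspan_velems rep_gspan by auto

lemma gns_rep_velems: "a \<in> carrier HR \<Longrightarrow> gns_rep HG cred haar a \<in> carrier (vring NC)"
 using gspan_velems velems_image by (auto simp: HR_eq gns_rep_cj gspan_credD)

lemma bimodules: "bimodule (vring NG) GR (regular_module (vring NG)) act_G" "bimodule (vring NC) HR (regular_module (vring NC)) act_C"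
proof -
 note r = vna_iso.rings[OF vna_iso_reduced]
 show "bimodule (vring NG) GR (regular_module (vring NG)) act_G"
  by (rule regular_bimodule[where \<rho>=rep, OF r(1)]) (rule rep_velems)
 show "bimodule (vring NC) HR (regular_module (vring NC)) act_C"
  by (rule regular_bimodule[where \<rho>="gns_rep HG cred haar", OF r(2)]) (rule gns_rep_velems)
qed

lemma homology_group: "abelian_group (group_L2_homology G n)" "abelian_group (cqg_L2_homology (reduced_cqg G) n)"
 unfolding group_homology_eq cqg_homology_eq
 using Tor_abelian_group[OF ring_GR trivial_left_mod(1) bimodules(1)]
  Tor_abelian_group[OF _ trivial_left_mod(2) bimodules(2)] ring_gspan by (simp_all add: HR_eq)

text \<open>All inputs of Tor correspond: \<open>rep\<close> and evaluation at the unit vector for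
  the rings, conjugation for the bimodules, and the identity of the complex numbers for the trivial
  modules, since the counit after \<open>rep\<close> is the augmentation. The converse exchanges the
  data rather than inverting the first isomorphism, which would require semilinearity of the
  inverse.\<close>

lemma homology_iso:
 "\<exists>f. left_module_iso_along (vring NG) gns.cj (group_L2_homology G n) (cqg_L2_homology (reduced_cqg G) n) f"
 "\<exists>f. left_module_iso_along (vring NC) gns.cj' (cqg_L2_homology (reduced_cqg G) n) (group_L2_homology G n) f"
proof -
 interpret I: vna_iso NG NC gns.cj gns.cj' by (rule vna_iso_reduced)
 let ?ev = "\<lambda>a. a \<xi>"
 have R: "ring GR" "ring HR" unfolding HR_eq by (rule ring_GR, rule ring_gspan)
 have h: "rep \<in> ring_hom GR HR" "?ev \<in> ring_hom HR GR"
  "\<And>f. f \<in> carrier GR \<Longrightarrow> ?ev (rep f) = f" "\<And>a. a \<in> carrier HR \<Longrightarrow> rep (?ev a) = a"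
  unfolding HR_eq by (rule rep_hom, rule ev_hom, rule rep_vec, assumption) (simp add: rep_ev)
 have ev: "?ev a \<in> carrier GR" if "a \<in> carrier HR" for a using that gspan_vec by (simp add: HR_eq)
 have \<theta>: "semilinear GR rep trivial_G trivial_C (\<lambda>z. z)"
  unfolding semilinear_def by (auto simp: character_module_simps counit_rep)
 have \<theta>': "semilinear HR ?ev trivial_C trivial_G (\<lambda>z. z)"
  unfolding semilinear_def using counit_rep[OF ev] h(4) by (auto simp: character_module_simps)
 have e: "gns.cj (rep f) = gns_rep HG cred haar (rep f)" if "f \<in> carrier GR" for f
  using gns_rep_cj[OF gspan_credD[OF rep_gspan[OF that]]] by simp
 have e': "gns.cj' (gns_rep HG cred haar a) = rep (?ev a)" if "a \<in> carrier HR" for a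
 proof -
  have a: "a \<in> gspan" using that by (simp add: HR_eq)
  show ?thesis using gns.cj'_cj[OF cred_bopD[OF gspan_credD[OF a]]] by (simp add: gns_rep_cj gspan_credD a rep_ev)
 qed
 have b: "bimodule_map (vring NG) GR gns.cj rep (regular_module (vring NG)) act_G (regular_module (vring NC)) act_C gns.cj"
  by (rule regular_bimodule_map[OF I.\<Phi>]) (simp_all only: rep_velems e)
 have b': "bimodule_map (vring NC) HR gns.cj' ?ev (regular_module (vring NC)) act_C (regular_module (vring NG)) act_G gns.cj'"
  by (rule regular_bimodule_map[OF I.\<Phi>']) (simp_all only: gns_rep_velems e')
 have s: "\<And>x. x \<in> carrier (vring NG) \<Longrightarrow> gns.cj x \<in> carrier (vring NC)" "\<And>x. x \<in> carrier (vring NC) \<Longrightarrow> gns.cj' x \<in> carrier (vring NG)"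
  using ring_hom_closed[OF I.\<Phi>] ring_hom_closed[OF I.\<Phi>'] by blast+
 have i: "\<And>m. m \<in> carrier (regular_module (vring NG)) \<Longrightarrow> gns.cj' (gns.cj m) = m" 
  "\<And>m. m \<in> carrier (regular_module (vring NC)) \<Longrightarrow> gns.cj (gns.cj' m) = m"
  by (simp_all add: regular_module_simps I.inv I.inv')
 show "\<exists>f. left_module_iso_along (vring NG) gns.cj (group_L2_homology G n) (cqg_L2_homology (reduced_cqg G) n) f"
  unfolding group_homology_eq cqg_homology_eq
  by (rule Tor_iso[where \<Phi>=rep and \<theta>="\<lambda>z. z" and \<theta>'="\<lambda>z. z" and \<Psi>=gns.cj, OF R trivial_left_mod bimodules h \<theta> \<theta>' refl refl s b b' i])
 show "\<exists>f. left_module_iso_along (vring NC) gns.cj' (cqg_L2_homology (reduced_cqg G) n) (group_L2_homology G n) f"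
  unfolding group_homology_eq cqg_homology_eq
  by (rule Tor_iso[where \<Phi>="?ev" and \<theta>="\<lambda>z. z" and \<theta>'="\<lambda>z. z" and \<Psi>="gns.cj'", OF R(2,1) trivial_left_mod(2,1) bimodules(2,1) h(2,1,4,3) \<theta>' \<theta> refl refl s(2,1) b' b i(2,1)])
qed

lemma invariants_eq:
 "cqg_L2_betti (reduced_cqg G) n = group_L2_betti G n" "cqg_capacity (reduced_cqg G) n = group_capacity G n"
proof -
 interpret I: vna_iso NG NC gns.cj gns.cj' by (rule vna_iso_reduced)
 interpret J: vna_iso NC NG gns.cj' gns.cj by (rule I.sym)
 obtain f where f: "left_module_iso_along (vring NG) gns.cj (group_L2_homology G n) (cqg_L2_homology (reduced_cqg G) n) f"
  using homology_iso(1) by blast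
 obtain g where g: "left_module_iso_along (vring NC) gns.cj' (cqg_L2_homology (reduced_cqg G) n) (group_L2_homology G n) g"
  using homology_iso(2) by blast
 show "cqg_L2_betti (reduced_cqg G) n = group_L2_betti G n"
  unfolding cqg_L2_betti_def group_L2_betti_def
  by (rule antisym[OF J.dim_le[OF homology_group(2,1) g] I.dim_le[OF homology_group f]])
 show "cqg_capacity (reduced_cqg G) n = group_capacity G n"
  unfolding cqg_capacity_def group_capacity_def
  by (rule antisym[OF J.capacity_le[OF homology_group(2,1) g] I.capacity_le[OF homology_group f]])
qed

lemma gns_identification_map: "gns_identification G gns_map"
 using gns_map_iso gns_vec_map by (simp add: gns_identification_def NG_simps NC_simps haar_state_eq delta_one_eq)

end

theorem proposition1p3:
 fixes \<Gamma> :: "('g, 'b) monoid_scheme"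
 assumes "group \<Gamma>" and "countable (carrier \<Gamma>)"
 shows "compact_quantum_group (reduced_cqg \<Gamma>) \<and>
  haar_state_on (reduced_cqg \<Gamma>) (haar_state (reduced_cqg \<Gamma>)) \<and>
  (\<forall>a\<in>reduced_alg \<Gamma>. \<forall>b\<in>reduced_alg \<Gamma>.
    haar_state (reduced_cqg \<Gamma>) (a \<otimes>\<^bsub>BH (ell2 (carrier \<Gamma>))\<^esub> b)
     = haar_state (reduced_cqg \<Gamma>) (b \<otimes>\<^bsub>BH (ell2 (carrier \<Gamma>))\<^esub> a)) \<and>
  (\<exists>U. gns_identification \<Gamma> U \<and>
    natural_map \<Gamma> U ` velems (group_vna \<Gamma>) = velems (cqg_vna (reduced_cqg \<Gamma>)) \<and>
    (\<forall>x\<in>velems (group_vna \<Gamma>).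
     vtrace (cqg_vna (reduced_cqg \<Gamma>)) (natural_map \<Gamma> U x) = vtrace (group_vna \<Gamma>) x) \<and>
    (\<forall>n. \<exists>f. left_module_iso_along (vring (group_vna \<Gamma>)) (natural_map \<Gamma> U)
     (group_L2_homology \<Gamma> n) (cqg_L2_homology (reduced_cqg \<Gamma>) n) f)) \<and>
  (\<forall>n. cqg_L2_betti (reduced_cqg \<Gamma>) n = group_L2_betti \<Gamma> n \<and>
     cqg_capacity (reduced_cqg \<Gamma>) n = group_capacity \<Gamma> n)"
proof -
 interpret group \<Gamma> by fact
 have tr: "vtrace NC (gns.cj x) = vtrace NG x" if "x \<in> velems NG" for x
  using that by (intro NC_trace) (simp add: NG_simps commutant_def)
 show ?thesis
 \<comment> \<open>The unitary does not depend on n: \<open>gns_map\<close> is the one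
   identification used in every degree.\<close>
 proof (intro conjI allI ballI exI[of _ gns_map])
  show "haar_state_on (reduced_cqg \<Gamma>) (haar_state (reduced_cqg \<Gamma>))"
   unfolding haar_state_eq by (rule haar_haar_state_on)
 qed (simp_all only: reduced_compact_quantum_group haar_state_eq haar_trace gns_identification_map natural_map_eq
   velems_image tr homology_iso(1) invariants_eq)
qed

end
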